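(* Let $\mu$ be a dominant weight and $\underline\lambda=(\lambda^{(1)},\dots,\lambda^{(\ell)})$ a sequence of dominant weights. For every $n\ge0$, $w\in SS_n$, $\mathbf i\in Q_0^n$ and weakly increasing functions $\kappa,\kappa':[1,\ell]\to[0,n]$ choose a reduced Stendhal diagram $D_{w,\kappa'}1_{\mathbf i,\kappa}$ from $(\mathbf i,\kappa,\underline\lambda)$ to $(w\mathbf i,\kappa',\underline\lambda)$. Then the set $$B=\bigcup_{\kappa,\kappa'}\{D_{w,\kappa'}\,y_1^{a_1}\cdots y_n^{a_n}1_{\mathbf i,\kappa}\mid w\in SS_n,\ \mathbf i\in Q_0^n,\ (a_1,\dots,a_n)\in\mathbb N^n\}$$ is a $k$-basis of the oKLRW algebra $\mathcal O_\mu^{\underline\lambda}$.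
   Context: $k$ is an algebraically closed field. $Q=(Q_0,Q_1,s,t)$ is a loop-free quiver with at most one arrow (both directions counted) between two distinct vertices; $\tau$ is an involution of $Q_0$ and $Q_1$ with $s(\tau h)=\tau(t(h))$, $t(\tau h)=\tau(s(h))$, with $\tau(s(h))=t(h)$ iff $\tau(h)=h$, and without fixed vertices. $i\to j$ means there is an arrow from $i$ to $j$. A dominant weight is $\theta=\sum_i\theta_i\varpi_i$ with $\theta_i\in\mathbb N$ ($\varpi_i$ fundamental weights). $X_{ij}(u,v)=u-v$ if $j\to i$, and $1$ otherwise; $f_{ij}(u,v)=X_{ij}(u,v)X_{ji}(v,u)$. **KLRW category $\mathcal K$:** the strict $k$-linear monoidal category with generating objects $i\in Q_0$ (black strands) and dominant weights $\theta$ (red strands), generating morphisms $x_i:i\to i$ (dot), $\sigma_{ij}:i\otimes j\to j\otimes i$, $\sigma_{i\theta}:i\otimes\theta\to\theta\otimes i$, $\sigma_{\theta i}:\theta\otimes i\to i\otimes\theta$ (crossings), and relations ($y_r$ = dot on the $r$-th black strand): $(x_j\otimes1)\sigma_{ij}=\sigma_{ij}(1\otimes x_j)+\delta_{ij}$, $\sigma_{ij}(x_i\otimes1)=(1\otimes x_i)\sigma_{ij}+\delta_{ij}$; $\sigma_{ii}^2=0$, $\sigma_{ji}\sigma_{ij}=f_{ij}(y_1,y_2)$ for $i\ne j$; $(\sigma_{jk}\otimes1)(1\otimes\sigma_{ik})(\sigma_{ij}\otimes1)-(1\otimes\sigma_{ij})(\sigma_{ik}\otimes1)(1\otimes\sigma_{jk})=\delta_{i=k\neq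 j}\frac{f_{ij}(y_3,y_2)-f_{ij}(y_1,y_2)}{y_3-y_1}$; $(\sigma_{\theta j}\otimes1)(1\otimes\sigma_{ij})(\sigma_{i\theta}\otimes1)-(1\otimes\sigma_{i\theta})(\sigma_{ij}\otimes1)(1\otimes\sigma_{\theta j})=\delta_{ij}\sum_{a+b+1=\theta_i}x_i^a\otimes1\otimes x_j^b$; $(\sigma_{j\theta}\otimes1)(1\otimes\sigma_{i\theta})(\sigma_{ij}\otimes1)=(1\otimes\sigma_{ij})(\sigma_{i\theta}\otimes1)(1\otimes\sigma_{j\theta})$, $(\sigma_{ji}\otimes1)(1\otimes\sigma_{\theta i})(\sigma_{\theta j}\otimes1)=(1\otimes\sigma_{\theta j})(\sigma_{\theta i}\otimes1)(1\otimes\sigma_{ji})$; $(x_i\otimes1)\sigma_{\theta i}=\sigma_{\theta i}(1\otimes x_i)$, $\sigma_{i\theta}(x_i\otimes1)=(1\otimes x_i)\sigma_{i\theta}$; $\sigma_{i\theta}\sigma_{\theta i}=1\otimes x_i^{\theta_i}$, $\sigma_{\theta i}\sigma_{i\theta}=x_i^{\theta_i}\otimes1$. **oKLRW category $\mathcal O_\mu$:** same objects as $\mathcal K$ (words); morphisms are linear combinations of composites of morphisms of $\mathcal K$ and morphisms $\rho_i\otimes\mathrm{id}_Z$ where $\rho_i:i\to\tau i$ (the leftmost strand meets a mirror at the left edge), modulo the consequences (closed under composition and $-\otimes\mathrm{id}_Z$) of the relations of $\mathcal K$ and, with $f^\mu_i(u)=(-u)^{\mu_i}u^{\mu_{\tau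 i}}$, $\rho_{\tau i}\rho_i=f^\mu_i(-x_i)$, $\rho_ix_i=-x_{\tau i}\rho_i$, and $\sigma_{\tau j,\tau i}(\rho_j\otimes1)\sigma_{\tau i,j}(\rho_i\otimes1)-(\rho_i\otimes1)\sigma_{\tau j,i}(\rho_j\otimes1)\sigma_{ij}=\delta_{\tau i,j}\frac{f^\mu_i(y_1)-f^\mu_j(y_2)}{y_1+y_2}\sigma_{ij}$. **oKLRW algebra.** An object with black letters $\mathbf i=(i_1,\dots,i_n)$ and red letters $\underline\lambda$ (left to right) is written $(\mathbf i,\kappa,\underline\lambda)$, where $\kappa:[1,\ell]\to[0,n]$ is weakly increasing and the $r$-th red letter lies between the $\kappa(r)$-th and $(\kappa(r)+1)$-st black letters; its identity is $1_{\mathbf i,\kappa}$. $\mathcal O^{\underline\lambda}_\mu$ is the direct sum of all Hom spaces of $\mathcal O_\mu$ between objects with red sequence $\underline\lambda$. **Signed permutations.** $SS_n$ is the group of permutations $w$ of $\{\pm1,\dots,\pm n\}$ with $w(-a)=-w(a)$, with Coxeter generators $s_0=(-1,1)$ and $s_a=(a,a+1)(-a,-a-1)$, $1\le a<n$. $w\mathbf i=(j_1,\dots,j_n)$ where $j_{w(a)}=i_a$ if $w(a)>0$ and $j_{-w(a)}=\tau(i_a)$ if $w(a)<0$. A mirror strand diagram of $w$ is a $2n$-strand diagram, symmetric about a central axis (the mirror), whose strands join $a$ to $w(a)$; one draws only its right half, so that a mirror pair of crossings of the $a$-th and $(a+1)$-st strands represents $s_a$ and a crossing on the mirror (a strand meeting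 the mirror) represents $s_0$. **Reduced Stendhal diagrams.** A dot-free diagram from $(\mathbf i,\kappa,\underline\lambda)$ to $(w\mathbf i,\kappa',\underline\lambda)$ (a composite of crossings and reflections; red strands never cross each other or the mirror) is *reduced for $w$* if: (1) the underlying diagram without red strands is a mirror strand diagram of $w$ such that no two black strands cross twice and each strand meets the mirror at most once; in other words, the crossings read from bottom to top form a reduced expression of $w$; (2) a red strand and a black strand which does not meet the mirror cross at most once; (3) a red strand and a black strand which meets the mirror cross at most twice.
   Formalization: Condition (3) is read as: a red strand crosses a black strand meeting the mirror at most once before and at most once after the mirror; with only "at most twice", D = ρ_i σ_{θi} σ_{iθ} = ρ_i x_i^{θ_i} (n=1, w=s_0, θ_i>0) is allowed and ρ_i is not in the span of B. *)

theory Defs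
  imports
    "Graph_Theory.Digraph"
    "Jordan_Normal_Form.VS_Connect"
    "HOL-Library.Poly_Mapping"
    "HOL-Library.FuncSet"
    "HOL-Combinatorics.Permutations"
begin

section \<open>Quivers with involution and weights\<close>

locale involutive_quiver = loopfree_digraph Q
  for Q :: "('v, 'a) pre_digraph" +
  fixes \<tau> :: "'v \<Rightarrow> 'v" and \<tau>\<^sub>1 :: "'a \<Rightarrow> 'a"
  assumes one_arrow: "\<lbrakk>e \<in> arcs Q; e' \<in> arcs Q; {tail Q e, head Q e} = {tail Q e', head Q e'}\<rbrakk> \<Longrightarrow> e = e'"
    and tau_closed: "i \<in> verts Q \<Longrightarrow> \<tau> i \<in> verts Q"
    and tau_invol: "i \<in> verts Q \<Longrightarrow> \<tau> (\<tau> i) = i"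
    and tau_no_fixed: "i \<in> verts Q \<Longrightarrow> \<tau> i \<noteq> i"
    and tau1_closed: "h \<in> arcs Q \<Longrightarrow> \<tau>\<^sub>1 h \<in> arcs Q"
    and tau1_invol: "h \<in> arcs Q \<Longrightarrow> \<tau>\<^sub>1 (\<tau>\<^sub>1 h) = h"
    and tail_tau1: "h \<in> arcs Q \<Longrightarrow> tail Q (\<tau>\<^sub>1 h) = \<tau> (head Q h)"
    and head_tau1: "h \<in> arcs Q \<Longrightarrow> head Q (\<tau>\<^sub>1 h) = \<tau> (tail Q h)"
    and tau1_fixed: "h \<in> arcs Q \<Longrightarrow> \<tau> (tail Q h) = head Q h \<longleftrightarrow> \<tau>\<^sub>1 h = h"

text \<open>A weight \<open>\<Sum>\<^sub>i \<theta>\<^sub>i \<varpi>\<^sub>i\<close> is given by its coefficients; the sum is finite, as there is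
  no assumption that the quiver is.\<close>

type_synonym 'v weight = "'v \<Rightarrow> nat"

definition dominant_weights :: "('v, 'a) pre_digraph \<Rightarrow> 'v weight set" where
  "dominant_weights Q = {\<theta>. finite {i. \<theta> i \<noteq> 0} \<and> {i. \<theta> i \<noteq> 0} \<subseteq> verts Q}"

definition X_poly :: "('v, 'a) pre_digraph \<Rightarrow> 'v \<Rightarrow> 'v \<Rightarrow> 'r :: comm_ring_1 \<Rightarrow> 'r \<Rightarrow> 'r" where
  "X_poly Q i j u v = (if j \<rightarrow>\<^bsub>Q\<^esub> i then u - v else 1)"

definition f_poly :: "('v, 'a) pre_digraph \<Rightarrow> 'v \<Rightarrow> 'v \<Rightarrow> 'r :: comm_ring_1 \<Rightarrow> 'r \<Rightarrow> 'r" where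
  "f_poly Q i j u v = X_poly Q i j u v * X_poly Q j i v u"

definition fmu_poly :: "('v \<Rightarrow> 'v) \<Rightarrow> 'v weight \<Rightarrow> 'v \<Rightarrow> 'r :: comm_ring_1 \<Rightarrow> 'r" where
  "fmu_poly \<tau> \<mu> i u = (- u) ^ \<mu> i * u ^ \<mu> (\<tau> i)"


section \<open>The KLRW and oKLRW categories\<close>

datatype 'v letter = Black 'v | Red "'v weight"

fun is_black :: "'v letter \<Rightarrow> bool" where
  "is_black (Black i) = True"
| "is_black (Red \<theta>) = False"

type_synonym 'v wrd = "'v letter list"

text \<open>Both categories are given by generators and relations: formal expressions of type
  \<open>mor\<close>, those which are well typed (\<open>is_mor\<close>), and the congruence \<open>mor_eq\<close> on the latter.
  \<open>g \<circ>\<^sub>k f\<close> is \<open>g\<close> after \<open>f\<close>.\<close>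

datatype ('v, 'k) mor =
    Ident "'v wrd"
  | Zero "'v wrd" "'v wrd"
  | Dot 'v
  | Cross "'v letter" "'v letter"
  | Reflect 'v
  | Compose "('v, 'k) mor" "('v, 'k) mor" (infixr \<open>\<circ>\<^sub>k\<close> 70)
  | Tensor "('v, 'k) mor" "('v, 'k) mor" (infixr \<open>\<otimes>\<^sub>k\<close> 75)
  | Plus "('v, 'k) mor" "('v, 'k) mor" (infixl \<open>+\<^sub>k\<close> 65)
  | Scale 'k "('v, 'k) mor" (infixr \<open>*\<^sub>k\<close> 72)

abbreviation Minus :: "('v, 'k :: field) mor \<Rightarrow> ('v, 'k) mor \<Rightarrow> ('v, 'k) mor" (infixl \<open>-\<^sub>k\<close> 65) where
  "f -\<^sub>k g \<equiv> f +\<^sub>k (- 1) *\<^sub>k g"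

abbreviation BCross :: "'v \<Rightarrow> 'v \<Rightarrow> ('v, 'k) mor" where
  "BCross i j \<equiv> Cross (Black i) (Black j)"

definition letters :: "('v, 'a) pre_digraph \<Rightarrow> 'v letter set" where
  "letters Q = Black ` verts Q \<union> Red ` dominant_weights Q"

abbreviation objects :: "('v, 'a) pre_digraph \<Rightarrow> 'v wrd set" where
  "objects Q \<equiv> lists (letters Q)"

datatype cat = KLRW | oKLRW

text \<open>The mirror is at the left edge, so a morphism of the oKLRW category can only be
  tensored on the right, by a morphism of the KLRW category: \<open>f \<otimes>\<^sub>k g\<close> is a morphism of the
  category \<open>c\<close> if \<open>f\<close> is one and \<open>g\<close> is a morphism of the KLRW category.
  (Then \<open>f \<otimes>\<^sub>k g = (1 \<otimes>\<^sub>k g) \<circ>\<^sub>k (f \<otimes>\<^sub>k 1)\<close>.)\<close>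

inductive is_mor :: "('v, 'a) pre_digraph \<Rightarrow> ('v \<Rightarrow> 'v) \<Rightarrow> cat \<Rightarrow> 'v wrd \<Rightarrow> 'v wrd \<Rightarrow> ('v, 'k) mor \<Rightarrow> bool"
  for Q \<tau> where
  ident: "X \<in> objects Q \<Longrightarrow> is_mor Q \<tau> c X X (Ident X)"
| zero: "X \<in> objects Q \<Longrightarrow> Y \<in> objects Q \<Longrightarrow> is_mor Q \<tau> c X Y (Zero X Y)"
| dot: "i \<in> verts Q \<Longrightarrow> is_mor Q \<tau> c [Black i] [Black i] (Dot i)"
| cross: "a \<in> letters Q \<Longrightarrow> b \<in> letters Q \<Longrightarrow> is_black a \<or> is_black b \<Longrightarrow> is_mor Q \<tau> c [a, b] [b, a] (Cross a b)"
| reflect: "i \<in> verts Q \<Longrightarrow> is_mor Q \<tau> oKLRW [Black i] [Black (\<tau> i)] (Reflect i)"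
| compose: "is_mor Q \<tau> c X Y f \<Longrightarrow> is_mor Q \<tau> c Y Z g \<Longrightarrow> is_mor Q \<tau> c X Z (g \<circ>\<^sub>k f)"
| tensor: "is_mor Q \<tau> c X Y f \<Longrightarrow> is_mor Q \<tau> KLRW X' Y' g \<Longrightarrow> is_mor Q \<tau> c (X @ X') (Y @ Y') (f \<otimes>\<^sub>k g)"
| plus: "is_mor Q \<tau> c X Y f \<Longrightarrow> is_mor Q \<tau> c X Y g \<Longrightarrow> is_mor Q \<tau> c X Y (f +\<^sub>k g)"
| scale: "is_mor Q \<tau> c X Y f \<Longrightarrow> is_mor Q \<tau> c X Y (a *\<^sub>k f)"

text \<open>The axioms of a strict \<open>k\<close>-linear monoidal category; for the oKLRW category, with the
  restriction on \<open>\<otimes>\<^sub>k\<close> above, those of a strict right module category. These and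
  the relations below apply to any two well-typed expressions with the same source and target.\<close>

inductive linear_monoidal_rel :: "('v, 'k :: field) mor \<Rightarrow> ('v, 'k) mor \<Rightarrow> bool" where
  plus_assoc: "linear_monoidal_rel ((f +\<^sub>k g) +\<^sub>k h) (f +\<^sub>k (g +\<^sub>k h))"
| plus_comm: "linear_monoidal_rel (f +\<^sub>k g) (g +\<^sub>k f)"
| plus_zero: "linear_monoidal_rel (f +\<^sub>k Zero X Y) f"
| plus_neg: "linear_monoidal_rel (f -\<^sub>k f) (Zero X Y)"
| scale_plus: "linear_monoidal_rel (a *\<^sub>k (f +\<^sub>k g)) (a *\<^sub>k f +\<^sub>k a *\<^sub>k g)"
| plus_scale: "linear_monoidal_rel ((a + b) *\<^sub>k f) (a *\<^sub>k f +\<^sub>k b *\<^sub>k f)"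
| scale_scale: "linear_monoidal_rel (a *\<^sub>k b *\<^sub>k f) ((a * b) *\<^sub>k f)"
| scale_one: "linear_monoidal_rel (1 *\<^sub>k f) f"
| comp_assoc: "linear_monoidal_rel ((h \<circ>\<^sub>k g) \<circ>\<^sub>k f) (h \<circ>\<^sub>k (g \<circ>\<^sub>k f))"
| comp_ident_right: "linear_monoidal_rel (f \<circ>\<^sub>k Ident X) f"
| comp_ident_left: "linear_monoidal_rel (Ident Y \<circ>\<^sub>k f) f"
| comp_plus_left: "linear_monoidal_rel ((g +\<^sub>k g') \<circ>\<^sub>k f) (g \<circ>\<^sub>k f +\<^sub>k g' \<circ>\<^sub>k f)"
| comp_plus_right: "linear_monoidal_rel (g \<circ>\<^sub>k (f +\<^sub>k f')) (g \<circ>\<^sub>k f +\<^sub>k g \<circ>\<^sub>k f')"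
| comp_scale_left: "linear_monoidal_rel ((a *\<^sub>k g) \<circ>\<^sub>k f) (a *\<^sub>k (g \<circ>\<^sub>k f))"
| comp_scale_right: "linear_monoidal_rel (g \<circ>\<^sub>k (a *\<^sub>k f)) (a *\<^sub>k (g \<circ>\<^sub>k f))"
| tensor_assoc: "linear_monoidal_rel ((f \<otimes>\<^sub>k g) \<otimes>\<^sub>k h) (f \<otimes>\<^sub>k (g \<otimes>\<^sub>k h))"
| tensor_unit_right: "linear_monoidal_rel (f \<otimes>\<^sub>k Ident []) f"
| tensor_unit_left: "linear_monoidal_rel (Ident [] \<otimes>\<^sub>k f) f"
| tensor_ident: "linear_monoidal_rel (Ident X \<otimes>\<^sub>k Ident Y) (Ident (X @ Y))"
| interchange: "linear_monoidal_rel ((g \<otimes>\<^sub>k g') \<circ>\<^sub>k (f \<otimes>\<^sub>k f')) ((g \<circ>\<^sub>k f) \<otimes>\<^sub>k (g' \<circ>\<^sub>k f'))"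
| tensor_plus_left: "linear_monoidal_rel ((f +\<^sub>k f') \<otimes>\<^sub>k g) (f \<otimes>\<^sub>k g +\<^sub>k f' \<otimes>\<^sub>k g)"
| tensor_plus_right: "linear_monoidal_rel (f \<otimes>\<^sub>k (g +\<^sub>k g')) (f \<otimes>\<^sub>k g +\<^sub>k f \<otimes>\<^sub>k g')"
| tensor_scale_left: "linear_monoidal_rel ((a *\<^sub>k f) \<otimes>\<^sub>k g) (a *\<^sub>k (f \<otimes>\<^sub>k g))"
| tensor_scale_right: "linear_monoidal_rel (f \<otimes>\<^sub>k (a *\<^sub>k g)) (a *\<^sub>k (f \<otimes>\<^sub>k g))"

subsection \<open>Polynomials in dots\<close>

definition black_positions :: "'v wrd \<Rightarrow> nat list" where
  "black_positions X = filter (\<lambda>p. is_black (X ! p)) [0..<length X]"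

fun dot_on :: "'v letter \<Rightarrow> ('v, 'k) mor" where
  "dot_on (Black i) = Dot i"
| "dot_on (Red \<theta>) = Ident [Red \<theta>]"

text \<open>\<open>black_dot X r\<close> is the dot on the \<open>r\<close>-th black strand of \<open>X\<close>, where \<open>r\<close> counts from 1.\<close>

definition black_dot :: "'v wrd \<Rightarrow> nat \<Rightarrow> ('v, 'k) mor" where
  "black_dot X r = (let p = black_positions X ! (r - 1)
            in Ident (take p X) \<otimes>\<^sub>k dot_on (X ! p) \<otimes>\<^sub>k Ident (drop (Suc p) X))"

type_synonym 'k mpolynomial = "(nat \<Rightarrow>\<^sub>0 nat) \<Rightarrow>\<^sub>0 'k"

definition Cst :: "'k :: field \<Rightarrow> 'k mpolynomial" where
  "Cst a = Poly_Mapping.single 0 a"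

definition Var :: "nat \<Rightarrow> 'k :: field mpolynomial" where
  "Var r = Poly_Mapping.single (Poly_Mapping.single r 1) 1"

text \<open>\<open>dot_poly X p t\<close>: the endomorphism \<open>t\<close> of \<open>X\<close> is obtained by substituting the dots
  \<open>black_dot X r\<close> for the variables \<open>Var r\<close> of the polynomial \<open>p\<close>. The expression \<open>t\<close> is not
  unique, but all choices are equal by the interchange law.\<close>

inductive dot_poly :: "'v wrd \<Rightarrow> 'k :: field mpolynomial \<Rightarrow> ('v, 'k) mor \<Rightarrow> bool" for X where
  "dot_poly X (Cst a) (a *\<^sub>k Ident X)"
| "1 \<le> r \<Longrightarrow> r \<le> length (black_positions X) \<Longrightarrow> dot_poly X (Var r) (black_dot X r)"
| "dot_poly X p f \<Longrightarrow> dot_poly X q g \<Longrightarrow> dot_poly X (p + q) (f +\<^sub>k g)"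
| "dot_poly X p f \<Longrightarrow> dot_poly X q g \<Longrightarrow> dot_poly X (p * q) (f \<circ>\<^sub>k g)"

subsection \<open>Relations\<close>

definition delta_mor :: "bool \<Rightarrow> 'v wrd \<Rightarrow> 'v wrd \<Rightarrow> ('v, 'k) mor \<Rightarrow> ('v, 'k) mor" where
  "delta_mor P X Y t = (if P then t else Zero X Y)"

text \<open>A quotient of polynomials is the polynomial \<open>q\<close> whose product with the denominator is
  the numerator.\<close>

inductive klrw_rel :: "('v, 'a) pre_digraph \<Rightarrow> ('v, 'k :: field) mor \<Rightarrow> ('v, 'k) mor \<Rightarrow> bool"
  for Q where
  dot_cross_left: "klrw_rel Q
     ((Dot j \<otimes>\<^sub>k Ident [Black i]) \<circ>\<^sub>k BCross i j)
     (BCross i j \<circ>\<^sub>k (Ident [Black i] \<otimes>\<^sub>k Dot j)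
       +\<^sub>k delta_mor (i = j) [Black i, Black j] [Black j, Black i] (Ident [Black i, Black j]))"
| dot_cross_right: "klrw_rel Q
     (BCross i j \<circ>\<^sub>k (Dot i \<otimes>\<^sub>k Ident [Black j]))
     ((Ident [Black j] \<otimes>\<^sub>k Dot i) \<circ>\<^sub>k BCross i j
       +\<^sub>k delta_mor (i = j) [Black i, Black j] [Black j, Black i] (Ident [Black i, Black j]))"
| cross_cross_same: "klrw_rel Q (BCross i i \<circ>\<^sub>k BCross i i) (Zero [Black i, Black i] [Black i, Black i])"
| cross_cross: "i \<noteq> j \<Longrightarrow> dot_poly [Black i, Black j] (f_poly Q i j (Var 1) (Var 2)) t \<Longrightarrow>
     klrw_rel Q (BCross j i \<circ>\<^sub>k BCross i j) t"
| braid: "(i = k \<and> k \<noteq> j \<Longrightarrow>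
        dot_poly [Black i, Black j, Black k] q t \<and>
        q * (Var 3 - Var 1) = f_poly Q i j (Var 3) (Var 2) - f_poly Q i j (Var 1) (Var 2)) \<Longrightarrow>
     klrw_rel Q
     ((BCross j k \<otimes>\<^sub>k Ident [Black i]) \<circ>\<^sub>k (Ident [Black j] \<otimes>\<^sub>k BCross i k) \<circ>\<^sub>k (BCross i j \<otimes>\<^sub>k Ident [Black k])
      -\<^sub>k (Ident [Black k] \<otimes>\<^sub>k BCross i j) \<circ>\<^sub>k (BCross i k \<otimes>\<^sub>k Ident [Black j]) \<circ>\<^sub>k (Ident [Black i] \<otimes>\<^sub>k BCross j k))
     (delta_mor (i = k \<and> k \<noteq> j) [Black i, Black j, Black k] [Black k, Black j, Black i] t)"
| braid_red_middle: "(i = j \<Longrightarrow>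
        dot_poly [Black i, Red \<theta>, Black j] (\<Sum>(a, b) | a + b + 1 = \<theta> i. Var 1 ^ a * Var 2 ^ b) t) \<Longrightarrow>
     klrw_rel Q
     ((Cross (Red \<theta>) (Black j) \<otimes>\<^sub>k Ident [Black i]) \<circ>\<^sub>k (Ident [Red \<theta>] \<otimes>\<^sub>k BCross i j) \<circ>\<^sub>k (Cross (Black i) (Red \<theta>) \<otimes>\<^sub>k Ident [Black j])
      -\<^sub>k (Ident [Black j] \<otimes>\<^sub>k Cross (Black i) (Red \<theta>)) \<circ>\<^sub>k (BCross i j \<otimes>\<^sub>k Ident [Red \<theta>]) \<circ>\<^sub>k (Ident [Black i] \<otimes>\<^sub>k Cross (Red \<theta>) (Black j)))
     (delta_mor (i = j) [Black i, Red \<theta>, Black j] [Black j, Red \<theta>, Black i] t)"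
| braid_red_right: "klrw_rel Q
     ((Cross (Black j) (Red \<theta>) \<otimes>\<^sub>k Ident [Black i]) \<circ>\<^sub>k (Ident [Black j] \<otimes>\<^sub>k Cross (Black i) (Red \<theta>)) \<circ>\<^sub>k (BCross i j \<otimes>\<^sub>k Ident [Red \<theta>]))
     ((Ident [Red \<theta>] \<otimes>\<^sub>k BCross i j) \<circ>\<^sub>k (Cross (Black i) (Red \<theta>) \<otimes>\<^sub>k Ident [Black j]) \<circ>\<^sub>k (Ident [Black i] \<otimes>\<^sub>k Cross (Black j) (Red \<theta>)))"
| braid_red_left: "klrw_rel Q
     ((BCross j i \<otimes>\<^sub>k Ident [Red \<theta>]) \<circ>\<^sub>k (Ident [Black j] \<otimes>\<^sub>k Cross (Red \<theta>) (Black i)) \<circ>\<^sub>k (Cross (Red \<theta>) (Black j) \<otimes>\<^sub>k Ident [Black i]))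
     ((Ident [Black i] \<otimes>\<^sub>k Cross (Red \<theta>) (Black j)) \<circ>\<^sub>k (Cross (Red \<theta>) (Black i) \<otimes>\<^sub>k Ident [Black j]) \<circ>\<^sub>k (Ident [Red \<theta>] \<otimes>\<^sub>k BCross j i))"
| dot_cross_red_left: "klrw_rel Q
     ((Dot i \<otimes>\<^sub>k Ident [Red \<theta>]) \<circ>\<^sub>k Cross (Red \<theta>) (Black i))
     (Cross (Red \<theta>) (Black i) \<circ>\<^sub>k (Ident [Red \<theta>] \<otimes>\<^sub>k Dot i))"
| dot_cross_red_right: "klrw_rel Q
     (Cross (Black i) (Red \<theta>) \<circ>\<^sub>k (Dot i \<otimes>\<^sub>k Ident [Red \<theta>]))
     ((Ident [Red \<theta>] \<otimes>\<^sub>k Dot i) \<circ>\<^sub>k Cross (Black i) (Red \<theta>))"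
| cross_cross_red_left: "dot_poly [Red \<theta>, Black i] (Var 1 ^ \<theta> i) t \<Longrightarrow>
     klrw_rel Q (Cross (Black i) (Red \<theta>) \<circ>\<^sub>k Cross (Red \<theta>) (Black i)) t"
| cross_cross_red_right: "dot_poly [Black i, Red \<theta>] (Var 1 ^ \<theta> i) t \<Longrightarrow>
     klrw_rel Q (Cross (Red \<theta>) (Black i) \<circ>\<^sub>k Cross (Black i) (Red \<theta>)) t"

inductive mirror_rel :: "('v \<Rightarrow> 'v) \<Rightarrow> 'v weight \<Rightarrow> ('v, 'k :: field) mor \<Rightarrow> ('v, 'k) mor \<Rightarrow> bool"
  for \<tau> \<mu> where
  reflect_reflect: "dot_poly [Black i] (fmu_poly \<tau> \<mu> i (- Var 1)) t \<Longrightarrow>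
     mirror_rel \<tau> \<mu> (Reflect (\<tau> i) \<circ>\<^sub>k Reflect i) t"
| reflect_dot: "mirror_rel \<tau> \<mu> (Reflect i \<circ>\<^sub>k Dot i) ((- 1) *\<^sub>k (Dot (\<tau> i) \<circ>\<^sub>k Reflect i))"
| reflect_braid: "(\<tau> i = j \<Longrightarrow>
        dot_poly [Black j, Black i] q t \<and>
        q * (Var 1 + Var 2) = fmu_poly \<tau> \<mu> i (Var 1) - fmu_poly \<tau> \<mu> j (Var 2)) \<Longrightarrow>
     mirror_rel \<tau> \<mu>
     (BCross (\<tau> j) (\<tau> i) \<circ>\<^sub>k (Reflect j \<otimes>\<^sub>k Ident [Black (\<tau> i)]) \<circ>\<^sub>k BCross (\<tau> i) j \<circ>\<^sub>k (Reflect i \<otimes>\<^sub>k Ident [Black j])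
      -\<^sub>k (Reflect i \<otimes>\<^sub>k Ident [Black (\<tau> j)]) \<circ>\<^sub>k BCross (\<tau> j) i \<circ>\<^sub>k (Reflect j \<otimes>\<^sub>k Ident [Black i]) \<circ>\<^sub>k BCross i j)
     (delta_mor (\<tau> i = j) [Black i, Black j] [Black (\<tau> i), Black (\<tau> j)] (t \<circ>\<^sub>k BCross i j))"

inductive mor_eq :: "('v, 'a) pre_digraph \<Rightarrow> ('v \<Rightarrow> 'v) \<Rightarrow> 'v weight \<Rightarrow> cat \<Rightarrow> 'v wrd \<Rightarrow> 'v wrd \<Rightarrow>
    ('v, 'k :: field) mor \<Rightarrow> ('v, 'k) mor \<Rightarrow> bool"
  for Q \<tau> \<mu> where
  refl: "is_mor Q \<tau> c X Y f \<Longrightarrow> mor_eq Q \<tau> \<mu> c X Y f f"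
| sym: "mor_eq Q \<tau> \<mu> c X Y f g \<Longrightarrow> mor_eq Q \<tau> \<mu> c X Y g f"
| trans: "mor_eq Q \<tau> \<mu> c X Y f g \<Longrightarrow> mor_eq Q \<tau> \<mu> c X Y g h \<Longrightarrow> mor_eq Q \<tau> \<mu> c X Y f h"
| compose: "mor_eq Q \<tau> \<mu> c X Y f f' \<Longrightarrow> mor_eq Q \<tau> \<mu> c Y Z g g' \<Longrightarrow> mor_eq Q \<tau> \<mu> c X Z (g \<circ>\<^sub>k f) (g' \<circ>\<^sub>k f')"
| tensor: "mor_eq Q \<tau> \<mu> c X Y f f' \<Longrightarrow> mor_eq Q \<tau> \<mu> KLRW X' Y' g g' \<Longrightarrow>
    mor_eq Q \<tau> \<mu> c (X @ X') (Y @ Y') (f \<otimes>\<^sub>k g) (f' \<otimes>\<^sub>k g')"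
| plus: "mor_eq Q \<tau> \<mu> c X Y f f' \<Longrightarrow> mor_eq Q \<tau> \<mu> c X Y g g' \<Longrightarrow> mor_eq Q \<tau> \<mu> c X Y (f +\<^sub>k g) (f' +\<^sub>k g')"
| scale: "mor_eq Q \<tau> \<mu> c X Y f f' \<Longrightarrow> mor_eq Q \<tau> \<mu> c X Y (a *\<^sub>k f) (a *\<^sub>k f')"
| linear_monoidal: "linear_monoidal_rel f g \<Longrightarrow> is_mor Q \<tau> c X Y f \<Longrightarrow> is_mor Q \<tau> c X Y g \<Longrightarrow> mor_eq Q \<tau> \<mu> c X Y f g"
| klrw: "klrw_rel Q f g \<Longrightarrow> is_mor Q \<tau> c X Y f \<Longrightarrow> is_mor Q \<tau> c X Y g \<Longrightarrow> mor_eq Q \<tau> \<mu> c X Y f g"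
| mirror: "mirror_rel \<tau> \<mu> f g \<Longrightarrow> is_mor Q \<tau> oKLRW X Y f \<Longrightarrow> is_mor Q \<tau> oKLRW X Y g \<Longrightarrow> mor_eq Q \<tau> \<mu> oKLRW X Y f g"

lemma mor_eq_is_mor:
  assumes "mor_eq Q \<tau> \<mu> c X Y f g"
  shows "is_mor Q \<tau> c X Y f" "is_mor Q \<tau> c X Y g"
  using assms by (induction rule: mor_eq.induct) (auto intro: is_mor.intros)


section \<open>The oKLRW algebra\<close>

text \<open>As for \<open>module_vec\<close> in the Jordan normal form library, the ring operations of the
  \<open>module\<close> record are left undefined where only the module structure is meant.\<close>

definition mor_rel :: "('v, 'a) pre_digraph \<Rightarrow> ('v \<Rightarrow> 'v) \<Rightarrow> 'v weight \<Rightarrow> 'v wrd \<Rightarrow> 'v wrd \<Rightarrow>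
    (('v, 'k :: field) mor \<times> ('v, 'k) mor) set" where
  "mor_rel Q \<tau> \<mu> X Y = {(f, g). mor_eq Q \<tau> \<mu> oKLRW X Y f g}"

definition mor_class :: "('v, 'a) pre_digraph \<Rightarrow> ('v \<Rightarrow> 'v) \<Rightarrow> 'v weight \<Rightarrow> 'v wrd \<Rightarrow> 'v wrd \<Rightarrow>
    ('v, 'k :: field) mor \<Rightarrow> ('v, 'k) mor set" where
  "mor_class Q \<tau> \<mu> X Y f = mor_rel Q \<tau> \<mu> X Y `` {f}"

definition Hom :: "('v, 'a) pre_digraph \<Rightarrow> ('v \<Rightarrow> 'v) \<Rightarrow> 'v weight \<Rightarrow> 'v wrd \<Rightarrow> 'v wrd \<Rightarrow>
    ('k :: field, ('v, 'k) mor set) module" where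
  "Hom Q \<tau> \<mu> X Y =
    \<lparr> carrier = {f. is_mor Q \<tau> oKLRW X Y f} // mor_rel Q \<tau> \<mu> X Y,
      mult = undefined, one = undefined,
      zero = mor_class Q \<tau> \<mu> X Y (Zero X Y),
      add = (\<lambda>C C'. \<Union>f\<in>C. \<Union>g\<in>C'. mor_class Q \<tau> \<mu> X Y (f +\<^sub>k g)),
      smult = (\<lambda>a C. \<Union>f\<in>C. mor_class Q \<tau> \<mu> X Y (a *\<^sub>k f)) \<rparr>"

definition comp_class :: "('v, 'a) pre_digraph \<Rightarrow> ('v \<Rightarrow> 'v) \<Rightarrow> 'v weight \<Rightarrow> 'v wrd \<Rightarrow> 'v wrd \<Rightarrow>
    ('v, 'k :: field) mor set \<Rightarrow> ('v, 'k) mor set \<Rightarrow> ('v, 'k) mor set" where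
  "comp_class Q \<tau> \<mu> X Z C' C = (\<Union>g\<in>C'. \<Union>f\<in>C. mor_class Q \<tau> \<mu> X Z (g \<circ>\<^sub>k f))"

definition module_direct_sum :: "'i set \<Rightarrow> ('i \<Rightarrow> ('k, 'm) module) \<Rightarrow> ('k, 'i \<Rightarrow> 'm) module" where
  "module_direct_sum I M =
    \<lparr> carrier = {F \<in> (\<Pi>\<^sub>E i\<in>I. carrier (M i)). finite {i \<in> I. F i \<noteq> \<zero>\<^bsub>M i\<^esub>}},
      mult = undefined, one = undefined,
      zero = (\<lambda>i\<in>I. \<zero>\<^bsub>M i\<^esub>),
      add = (\<lambda>F G. \<lambda>i\<in>I. F i \<oplus>\<^bsub>M i\<^esub> G i),
      smult = (\<lambda>a F. \<lambda>i\<in>I. a \<odot>\<^bsub>M i\<^esub> F i) \<rparr>"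

definition direct_sum_incl :: "'i set \<Rightarrow> ('i \<Rightarrow> ('k, 'm) module) \<Rightarrow> 'i \<Rightarrow> 'm \<Rightarrow> 'i \<Rightarrow> 'm" where
  "direct_sum_incl I M j m = (\<lambda>i\<in>I. if i = j then m else \<zero>\<^bsub>M i\<^esub>)"

fun red_letters :: "'v wrd \<Rightarrow> 'v weight list" where
  "red_letters [] = []"
| "red_letters (Black i # X) = red_letters X"
| "red_letters (Red \<theta> # X) = \<theta> # red_letters X"

definition objects_over :: "('v, 'a) pre_digraph \<Rightarrow> 'v weight list \<Rightarrow> 'v wrd set" where
  "objects_over Q \<Lambda> = {X \<in> objects Q. red_letters X = \<Lambda>}"

text \<open>The product of two elements is composition where this is defined and 0 otherwise, i.e. the
  product of block matrices. There are infinitely many objects as soon as the quiver is not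
  empty, so that there is no unit.\<close>

definition oKLRW_algebra :: "('v, 'a) pre_digraph \<Rightarrow> ('v \<Rightarrow> 'v) \<Rightarrow> 'v weight \<Rightarrow> 'v weight list \<Rightarrow>
    ('k :: field, 'v wrd \<times> 'v wrd \<Rightarrow> ('v, 'k) mor set) module" where
  "oKLRW_algebra Q \<tau> \<mu> \<Lambda> =
    (module_direct_sum (objects_over Q \<Lambda> \<times> objects_over Q \<Lambda>) (\<lambda>(X, Y). Hom Q \<tau> \<mu> X Y))
    \<lparr> mult := (\<lambda>F G. \<lambda>(X, Z)\<in>objects_over Q \<Lambda> \<times> objects_over Q \<Lambda>.
        finsum (Hom Q \<tau> \<mu> X Z) (\<lambda>Y. comp_class Q \<tau> \<mu> X Z (F (Y, Z)) (G (X, Y)))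
          {Y \<in> objects_over Q \<Lambda>. F (Y, Z) \<noteq> \<zero>\<^bsub>Hom Q \<tau> \<mu> Y Z\<^esub> \<and> G (X, Y) \<noteq> \<zero>\<^bsub>Hom Q \<tau> \<mu> X Y\<^esub>}) \<rparr>"

definition algebra_element :: "('v, 'a) pre_digraph \<Rightarrow> ('v \<Rightarrow> 'v) \<Rightarrow> 'v weight \<Rightarrow> 'v weight list \<Rightarrow>
    'v wrd \<Rightarrow> 'v wrd \<Rightarrow> ('v, 'k :: field) mor \<Rightarrow> 'v wrd \<times> 'v wrd \<Rightarrow> ('v, 'k) mor set" where
  "algebra_element Q \<tau> \<mu> \<Lambda> X Y f =
    direct_sum_incl (objects_over Q \<Lambda> \<times> objects_over Q \<Lambda>) (\<lambda>(X, Y). Hom Q \<tau> \<mu> X Y) (X, Y)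
      (mor_class Q \<tau> \<mu> X Y f)"

lemma equiv_mor_rel:
  "equiv {f. is_mor Q \<tau> oKLRW X Y f} (mor_rel Q \<tau> \<mu> X Y :: (('v, 'k :: field) mor \<times> _) set)"
  by (rule equivI)
    (auto simp: mor_rel_def refl_on_def sym_def trans_def
          intro: mor_eq.refl mor_eq.sym mor_eq.trans dest: mor_eq_is_mor)

lemma Hom_carrierE:
  assumes "C \<in> carrier (Hom Q \<tau> \<mu> X Y)"
  obtains f where "is_mor Q \<tau> oKLRW X Y f" "C = mor_class Q \<tau> \<mu> X Y f"
  using assms unfolding Hom_def by (auto elim!: quotientE simp: mor_class_def)

lemma mor_class_carrier:
  "is_mor Q \<tau> oKLRW X Y f \<Longrightarrow> mor_class Q \<tau> \<mu> X Y f \<in> carrier (Hom Q \<tau> \<mu> X Y)"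
  unfolding Hom_def mor_class_def by (auto intro: quotientI)

lemma mor_class_eqI: "mor_eq Q \<tau> \<mu> oKLRW X Y f g \<Longrightarrow> mor_class Q \<tau> \<mu> X Y f = mor_class Q \<tau> \<mu> X Y g"
  unfolding mor_class_def by (rule equiv_class_eq[OF equiv_mor_rel]) (simp add: mor_rel_def)

lemma mor_class_relI:
  "linear_monoidal_rel f g \<Longrightarrow> is_mor Q \<tau> oKLRW X Y f \<Longrightarrow> is_mor Q \<tau> oKLRW X Y g \<Longrightarrow>
    mor_class Q \<tau> \<mu> X Y f = mor_class Q \<tau> \<mu> X Y g"
  by (intro mor_class_eqI mor_eq.linear_monoidal)

lemma add_mor_class:
  fixes f g :: "('v, 'k :: field) mor"
  assumes "is_mor Q \<tau> oKLRW X Y f" "is_mor Q \<tau> oKLRW X Y g"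
  shows "mor_class Q \<tau> \<mu> X Y f \<oplus>\<^bsub>Hom Q \<tau> \<mu> X Y\<^esub> mor_class Q \<tau> \<mu> X Y g = mor_class Q \<tau> \<mu> X Y (f +\<^sub>k g)"
proof -
  let ?r = "mor_rel Q \<tau> \<mu> X Y :: (('v, 'k) mor \<times> _) set"
  have "congruent2 ?r ?r (\<lambda>f g. mor_class Q \<tau> \<mu> X Y (f +\<^sub>k g))"
    by (auto simp: congruent2_def mor_rel_def intro!: mor_class_eqI mor_eq.plus)
  from UN_equiv_class2[OF equiv_mor_rel equiv_mor_rel this] assms show ?thesis
    by (simp add: Hom_def mor_class_def)
qed

lemma smult_mor_class:
  fixes f :: "('v, 'k :: field) mor"
  assumes "is_mor Q \<tau> oKLRW X Y f"
  shows "a \<odot>\<^bsub>Hom Q \<tau> \<mu> X Y\<^esub> mor_class Q \<tau> \<mu> X Y f = mor_class Q \<tau> \<mu> X Y (a *\<^sub>k f)"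
proof -
  let ?r = "mor_rel Q \<tau> \<mu> X Y :: (('v, 'k) mor \<times> _) set"
  have "congruent ?r (\<lambda>f. mor_class Q \<tau> \<mu> X Y (a *\<^sub>k f))"
    by (auto simp: congruent_def mor_rel_def intro!: mor_class_eqI mor_eq.scale)
  from UN_equiv_class[OF equiv_mor_rel this] assms show ?thesis
    by (simp add: Hom_def mor_class_def)
qed

lemma zero_Hom: "\<zero>\<^bsub>Hom Q \<tau> \<mu> X Y\<^esub> = mor_class Q \<tau> \<mu> X Y (Zero X Y)"
  by (simp add: Hom_def)

lemma comp_mor_class:
  fixes f g :: "('v, 'k :: field) mor"
  assumes "is_mor Q \<tau> oKLRW X Y f" "is_mor Q \<tau> oKLRW Y Z g"
  shows "comp_class Q \<tau> \<mu> X Z (mor_class Q \<tau> \<mu> Y Z g) (mor_class Q \<tau> \<mu> X Y f) = mor_class Q \<tau> \<mu> X Z (g \<circ>\<^sub>k f)"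
proof -
  let ?r = "mor_rel Q \<tau> \<mu> X Y :: (('v, 'k) mor \<times> _) set"
  let ?s = "mor_rel Q \<tau> \<mu> Y Z :: (('v, 'k) mor \<times> _) set"
  have "congruent2 ?s ?r (\<lambda>g f. mor_class Q \<tau> \<mu> X Z (g \<circ>\<^sub>k f))"
    by (auto simp: congruent2_def mor_rel_def intro!: mor_class_eqI mor_eq.compose)
  from UN_equiv_class2[OF equiv_mor_rel equiv_mor_rel this] assms show ?thesis
    by (simp add: comp_class_def mor_class_def)
qed

lemma vectorspace_Hom:
  assumes X: "X \<in> objects Q" "Y \<in> objects Q"
  shows "vectorspace (class_ring :: 'k :: field ring) (Hom Q \<tau> \<mu> X Y :: ('k, ('v, 'k) mor set) module)"
    (is "vectorspace ?K ?M")
proof -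
  note [intro] = is_mor.intros(2,8,9) mor_class_carrier
  note [simp] = add_mor_class smult_mor_class zero_Hom
  have typed: "is_mor Q \<tau> oKLRW X Y f \<Longrightarrow> is_mor Q \<tau> oKLRW X Y g \<Longrightarrow> is_mor Q \<tau> oKLRW X Y (f +\<^sub>k g)"
      "is_mor Q \<tau> oKLRW X Y f \<Longrightarrow> is_mor Q \<tau> oKLRW X Y (a *\<^sub>k f)" for f g :: "('v, 'k) mor" and a
    by auto
  have z: "is_mor Q \<tau> oKLRW X Y (Zero X Y :: ('v, 'k) mor)" using X by auto
  have ab: "abelian_group ?M"
  proof (rule abelian_groupI)
    fix C D assume "C \<in> carrier ?M" "D \<in> carrier ?M"
    then show "C \<oplus>\<^bsub>?M\<^esub> D \<in> carrier ?M"
      by (elim Hom_carrierE) (simp add: typed mor_class_carrier)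
  next
    show "\<zero>\<^bsub>?M\<^esub> \<in> carrier ?M" using z by (simp add: mor_class_carrier)
  next
    fix C D E assume "C \<in> carrier ?M" "D \<in> carrier ?M" "E \<in> carrier ?M"
    then show "C \<oplus>\<^bsub>?M\<^esub> D \<oplus>\<^bsub>?M\<^esub> E = C \<oplus>\<^bsub>?M\<^esub> (D \<oplus>\<^bsub>?M\<^esub> E)"
      by (elim Hom_carrierE) (simp add: typed, intro mor_class_relI plus_assoc typed, assumption+)
  next
    fix C D assume "C \<in> carrier ?M" "D \<in> carrier ?M"
    then show "C \<oplus>\<^bsub>?M\<^esub> D = D \<oplus>\<^bsub>?M\<^esub> C"
      by (elim Hom_carrierE) (simp add: typed, intro mor_class_relI plus_comm typed, assumption+)
  next
    fix C assume "C \<in> carrier ?M"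
    then obtain f where f: "is_mor Q \<tau> oKLRW X Y f" "C = mor_class Q \<tau> \<mu> X Y f" by (elim Hom_carrierE)
    have "mor_class Q \<tau> \<mu> X Y (Zero X Y +\<^sub>k f) = mor_class Q \<tau> \<mu> X Y (f +\<^sub>k Zero X Y)"
      by (intro mor_class_relI plus_comm typed f z)
    also have "\<dots> = C"
      unfolding f(2) by (intro mor_class_relI plus_zero typed f z)
    finally show "\<zero>\<^bsub>?M\<^esub> \<oplus>\<^bsub>?M\<^esub> C = C" using f z by simp
  next
    fix C assume "C \<in> carrier ?M"
    then obtain f where f: "is_mor Q \<tau> oKLRW X Y f" "C = mor_class Q \<tau> \<mu> X Y f" by (elim Hom_carrierE)
    have f': "is_mor Q \<tau> oKLRW X Y ((- 1) *\<^sub>k f)" using f by auto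
    have "mor_class Q \<tau> \<mu> X Y ((- 1) *\<^sub>k f) \<oplus>\<^bsub>?M\<^esub> C = mor_class Q \<tau> \<mu> X Y ((- 1) *\<^sub>k f +\<^sub>k f)"
      using f f' by simp
    also have "\<dots> = mor_class Q \<tau> \<mu> X Y (f -\<^sub>k f)"
      by (intro mor_class_relI plus_comm typed f f')
    also have "\<dots> = \<zero>\<^bsub>?M\<^esub>"
      unfolding zero_Hom by (intro mor_class_relI plus_neg typed f f' z)
    finally show "\<exists>D\<in>carrier ?M. D \<oplus>\<^bsub>?M\<^esub> C = \<zero>\<^bsub>?M\<^esub>" using f' mor_class_carrier by blast
  qed
  have fld: "field ?K" by (rule class_field.field_axioms)
  have cr: "cring ?K" using fld by (simp add: field_def domain_def)
  have "module ?K ?M"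
  proof (rule moduleI[OF cr ab], goal_cases)
    case (1 a C) then show ?case by (elim Hom_carrierE) (simp add: typed mor_class_carrier)
  next
    case (2 a b C)
    then obtain f where f: "is_mor Q \<tau> oKLRW X Y f" "C = mor_class Q \<tau> \<mu> X Y f" by (elim Hom_carrierE)
    have "mor_class Q \<tau> \<mu> X Y ((a + b) *\<^sub>k f) = mor_class Q \<tau> \<mu> X Y (a *\<^sub>k f +\<^sub>k b *\<^sub>k f)"
      by (intro mor_class_relI plus_scale typed f)
    then show ?case using f by (simp add: typed)
  next
    case (3 a C D)
    then obtain f g where f: "is_mor Q \<tau> oKLRW X Y f" "C = mor_class Q \<tau> \<mu> X Y f"
      and g: "is_mor Q \<tau> oKLRW X Y g" "D = mor_class Q \<tau> \<mu> X Y g" by (elim Hom_carrierE)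
    have "mor_class Q \<tau> \<mu> X Y (a *\<^sub>k (f +\<^sub>k g)) = mor_class Q \<tau> \<mu> X Y (a *\<^sub>k f +\<^sub>k a *\<^sub>k g)"
      by (intro mor_class_relI scale_plus typed f g)
    then show ?case using f g by (simp add: typed)
  next
    case (4 a b C)
    then obtain f where f: "is_mor Q \<tau> oKLRW X Y f" "C = mor_class Q \<tau> \<mu> X Y f" by (elim Hom_carrierE)
    have "mor_class Q \<tau> \<mu> X Y (a *\<^sub>k b *\<^sub>k f) = mor_class Q \<tau> \<mu> X Y ((a * b) *\<^sub>k f)"
      by (intro mor_class_relI scale_scale typed f)
    then show ?case using f by (simp add: typed)
  next
    case (5 C)
    then obtain f where f: "is_mor Q \<tau> oKLRW X Y f" "C = mor_class Q \<tau> \<mu> X Y f" by (elim Hom_carrierE)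
    have "mor_class Q \<tau> \<mu> X Y (1 *\<^sub>k f) = mor_class Q \<tau> \<mu> X Y f"
      by (intro mor_class_relI scale_one typed f)
    then show ?case using f by (simp add: typed)
  qed
  then show ?thesis using fld by (simp add: vectorspace_def)
qed

lemma vectorspace_direct_sum:
  assumes M: "\<And>i. i \<in> I \<Longrightarrow> vectorspace K (M i)" and K: "field K"
  shows "vectorspace K (module_direct_sum I M)" (is "vectorspace K ?S")
proof -
  note [simp] = module_direct_sum_def
  have m: "module K (M i)" if "i \<in> I" for i using M[OF that] by (simp add: vectorspace_def)
  then have ab: "abelian_group (M i)" if "i \<in> I" for i using that by (simp add: module_def)
  note am = abelian_groupE[OF ab]
  have cr: "cring K" using K by (simp add: field_def domain_def)
  have fin_add: "finite {i \<in> I. F i \<oplus>\<^bsub>M i\<^esub> G i \<noteq> \<zero>\<^bsub>M i\<^esub>}"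
    if "finite {i \<in> I. F i \<noteq> \<zero>\<^bsub>M i\<^esub>}" "finite {i \<in> I. G i \<noteq> \<zero>\<^bsub>M i\<^esub>}" for F G
  proof (rule finite_subset)
    show "{i \<in> I. F i \<oplus>\<^bsub>M i\<^esub> G i \<noteq> \<zero>\<^bsub>M i\<^esub>} \<subseteq> {i \<in> I. F i \<noteq> \<zero>\<^bsub>M i\<^esub>} \<union> {i \<in> I. G i \<noteq> \<zero>\<^bsub>M i\<^esub>}"
      using am by auto
  qed (use that in auto)
  have smult_zero: "a \<odot>\<^bsub>M i\<^esub> \<zero>\<^bsub>M i\<^esub> = \<zero>\<^bsub>M i\<^esub>" if "i \<in> I" "a \<in> carrier K" for a i
    using module.smult_r_null[OF m] that by auto
  have fin_smult: "finite {i \<in> I. a \<odot>\<^bsub>M i\<^esub> F i \<noteq> \<zero>\<^bsub>M i\<^esub>}"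
    if "finite {i \<in> I. F i \<noteq> \<zero>\<^bsub>M i\<^esub>}" "a \<in> carrier K" for F a
    by (rule finite_subset[OF _ that(1)]) (use that(2) smult_zero in auto)
  have closed: "(\<lambda>i\<in>I. F i \<oplus>\<^bsub>M i\<^esub> G i) \<in> carrier ?S" if "F \<in> carrier ?S" "G \<in> carrier ?S" for F G
    using that am(1) fin_add[of F G] by (auto simp: PiE_def Pi_def cong: conj_cong)
  have closed': "(\<lambda>i\<in>I. a \<odot>\<^bsub>M i\<^esub> F i) \<in> carrier ?S" if "F \<in> carrier ?S" "a \<in> carrier K" for F a
    using that module.smult_closed[OF m] fin_smult[of F a] by (auto simp: PiE_def Pi_def cong: conj_cong)
  have ab': "abelian_group ?S"
  proof (rule abelian_groupI)
    fix F G assume "F \<in> carrier ?S" "G \<in> carrier ?S"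
    then show "F \<oplus>\<^bsub>?S\<^esub> G \<in> carrier ?S" using closed[of F G] by simp
  next
    show "\<zero>\<^bsub>?S\<^esub> \<in> carrier ?S" using am(2) by (auto cong: conj_cong)
  next
    fix F G H assume "F \<in> carrier ?S" "G \<in> carrier ?S" "H \<in> carrier ?S"
    then show "F \<oplus>\<^bsub>?S\<^esub> G \<oplus>\<^bsub>?S\<^esub> H = F \<oplus>\<^bsub>?S\<^esub> (G \<oplus>\<^bsub>?S\<^esub> H)"
      using am(3) by (auto simp: fun_eq_iff PiE_def Pi_def)
  next
    fix F G assume "F \<in> carrier ?S" "G \<in> carrier ?S"
    then show "F \<oplus>\<^bsub>?S\<^esub> G = G \<oplus>\<^bsub>?S\<^esub> F"
      using am(4) by (auto simp: fun_eq_iff PiE_def Pi_def)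
  next
    fix F assume "F \<in> carrier ?S"
    then show "\<zero>\<^bsub>?S\<^esub> \<oplus>\<^bsub>?S\<^esub> F = F"
      using am(5) by (auto simp: fun_eq_iff PiE_def Pi_def extensional_def)
  next
    fix F assume F: "F \<in> carrier ?S"
    have one: "\<ominus>\<^bsub>K\<^esub> \<one>\<^bsub>K\<^esub> \<in> carrier K" using cr by (simp add: cring.cring_simprules)
    let ?G = "\<lambda>i\<in>I. (\<ominus>\<^bsub>K\<^esub> \<one>\<^bsub>K\<^esub>) \<odot>\<^bsub>M i\<^esub> F i"
    have "(\<ominus>\<^bsub>K\<^esub> \<one>\<^bsub>K\<^esub>) \<odot>\<^bsub>M i\<^esub> F i \<oplus>\<^bsub>M i\<^esub> F i = \<zero>\<^bsub>M i\<^esub>" if i: "i \<in> I" for i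
    proof -
      interpret module K "M i" by (rule m[OF i])
      have Fi: "F i \<in> carrier (M i)" using F i by auto
      show ?thesis using Fi smult_l_minus[of "\<one>\<^bsub>K\<^esub>" "F i"] by (simp add: M.l_neg)
    qed
    then have "?G \<oplus>\<^bsub>?S\<^esub> F = \<zero>\<^bsub>?S\<^esub>" by (auto simp: fun_eq_iff)
    then show "\<exists>G\<in>carrier ?S. G \<oplus>\<^bsub>?S\<^esub> F = \<zero>\<^bsub>?S\<^esub>" using closed'[OF F one] by blast
  qed
  have "module K ?S"
  proof (rule moduleI[OF cr ab'], goal_cases)
    case (1 a F) then show ?case using closed'[of F a] by simp
  next
    case (2 a b F)
    then show ?case using module.smult_l_distr[OF m] by (auto simp: fun_eq_iff PiE_def Pi_def)
  next
    case (3 a F G)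
    then show ?case using module.smult_r_distr[OF m] by (auto simp: fun_eq_iff PiE_def Pi_def)
  next
    case (4 a b F)
    then show ?case using module.smult_assoc1[OF m] by (auto simp: fun_eq_iff PiE_def Pi_def)
  next
    case (5 F)
    then show ?case using module.smult_one[OF m] by (auto simp: fun_eq_iff PiE_def Pi_def extensional_def)
  qed
  then show ?thesis using K by (simp add: vectorspace_def)
qed

lemma vectorspace_oKLRW_algebra:
  "vectorspace (class_ring :: 'k :: field ring)
    (oKLRW_algebra Q \<tau> \<mu> \<Lambda> :: ('k, 'v wrd \<times> 'v wrd \<Rightarrow> ('v, 'k) mor set) module)"
proof -
  let ?S = "module_direct_sum (objects_over Q \<Lambda> \<times> objects_over Q \<Lambda>) (\<lambda>(X, Y). Hom Q \<tau> \<mu> X Y)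
    :: ('k, 'v wrd \<times> 'v wrd \<Rightarrow> ('v, 'k) mor set) module"
  have "vectorspace (class_ring :: 'k ring) ?S"
    by (rule vectorspace_direct_sum)
      (auto simp: objects_over_def intro: vectorspace_Hom class_field.field_axioms)
  moreover have "vectorspace K V \<Longrightarrow> vectorspace K (V\<lparr>mult := m\<rparr>)" for K :: "'k ring" and V :: "('k, 'x) module" and m
    by (simp add: vectorspace_def module_def module_axioms_def abelian_group_def
        abelian_monoid_def abelian_group_axioms_def)
  ultimately show ?thesis unfolding oKLRW_algebra_def by blast
qed


section \<open>Signed permutations\<close>

definition signed_perms :: "nat \<Rightarrow> (int \<Rightarrow> int) set" where
  "signed_perms n = {w. w permutes ({- int n..int n} - {0}) \<and> (\<forall>a. w (- a) = - w a)}"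

definition signed_gen :: "nat \<Rightarrow> int \<Rightarrow> int" where
  "signed_gen a = (if a = 0 then Transposition.transpose (- 1) 1
     else Transposition.transpose (int a) (int a + 1) \<circ> Transposition.transpose (- int a) (- int a - 1))"

text \<open>Words in the generators are read from bottom to top: \<open>[c\<^sub>1, \<dots>, c\<^sub>m]\<close> stands for
  \<open>s\<^sub>c\<^sub>m \<circ> \<dots> \<circ> s\<^sub>c\<^sub>1\<close>.\<close>

definition gens_perm :: "nat list \<Rightarrow> int \<Rightarrow> int" where
  "gens_perm cs = fold (\<lambda>c v. signed_gen c \<circ> v) cs id"

definition reduced_expression :: "nat \<Rightarrow> nat list \<Rightarrow> (int \<Rightarrow> int) \<Rightarrow> bool" where
  "reduced_expression n cs w \<longleftrightarrow> set cs \<subseteq> {..<n} \<and> gens_perm cs = w \<and>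
     (\<forall>cs'. set cs' \<subseteq> {..<n} \<and> gens_perm cs' = w \<longrightarrow> length cs \<le> length cs')"

definition signed_act :: "('v \<Rightarrow> 'v) \<Rightarrow> (int \<Rightarrow> int) \<Rightarrow> 'v list \<Rightarrow> 'v list" where
  "signed_act \<tau> w is = map (\<lambda>b. let a = inv_into UNIV w (int b) in
      if a > 0 then is ! (nat a - 1) else \<tau> (is ! (nat (- a) - 1))) [1..<Suc (length is)]"

lemma signed_act_nth:
  assumes w: "w \<in> signed_perms (length is)" and a: "1 \<le> a" "a \<le> length is"
  shows "w (int a) > 0 \<Longrightarrow> signed_act \<tau> w is ! (nat (w (int a)) - 1) = is ! (a - 1)"
    and "w (int a) < 0 \<Longrightarrow> signed_act \<tau> w is ! (nat (- w (int a)) - 1) = \<tau> (is ! (a - 1))"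
proof -
  let ?n = "length is"
  from w have p: "w permutes ({- int ?n..int ?n} - {0})" and odd: "\<And>a. w (- a) = - w a"
    by (auto simp: signed_perms_def)
  have "int a \<in> {- int ?n..int ?n} - {0}" using a by auto
  then have wa: "w (int a) \<in> {- int ?n..int ?n} - {0}" using permutes_in_image[OF p] by blast
  have inv1: "inv_into UNIV w (w (int a)) = int a" using permutes_inverses(2)[OF p] .
  have inv2: "inv_into UNIV w (- w (int a)) = - int a" using permutes_inverses(2)[OF p] odd[of "int a"] by metis
  {
    assume pos: "w (int a) > 0"
    define b where "b = nat (w (int a))"
    have b: "int b = w (int a)" "1 \<le> b" "b \<le> ?n" using pos wa by (auto simp: b_def)
    have "signed_act \<tau> w is ! (b - 1) = is ! (a - 1)"
      using b a inv1 by (simp add: signed_act_def Let_def del: upt_Suc)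
    then show "signed_act \<tau> w is ! (nat (w (int a)) - 1) = is ! (a - 1)" by (simp add: b_def)
  }
  {
    assume neg: "w (int a) < 0"
    define b where "b = nat (- w (int a))"
    have b: "int b = - w (int a)" "1 \<le> b" "b \<le> ?n" using neg wa by (auto simp: b_def)
    have "signed_act \<tau> w is ! (b - 1) = \<tau> (is ! (a - 1))"
      using b a inv2 by (simp add: signed_act_def Let_def del: upt_Suc)
    then show "signed_act \<tau> w is ! (nat (- w (int a)) - 1) = \<tau> (is ! (a - 1))" by (simp add: b_def)
  }
qed


section \<open>Stendhal diagrams\<close>

text \<open>\<open>red_placements l n\<close> is the set of the functions \<open>\<kappa>\<close>, for \<open>l\<close> red and \<open>n\<close> black letters.\<close>

definition red_placements :: "nat \<Rightarrow> nat \<Rightarrow> (nat \<Rightarrow> nat) set" where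
  "red_placements l n = {\<kappa> \<in> {1..l} \<rightarrow>\<^sub>E {0..n}. mono_on {1..l} \<kappa>}"

definition stendhal_word :: "'v list \<Rightarrow> (nat \<Rightarrow> nat) \<Rightarrow> 'v weight list \<Rightarrow> 'v wrd" where
  "stendhal_word is \<kappa> \<Lambda> = concat (map (\<lambda>p.
      map (\<lambda>r. Red (\<Lambda> ! (r - 1))) (filter (\<lambda>r. \<kappa> r = p) [1..<Suc (length \<Lambda>)])
      @ (if p < length is then [Black (is ! p)] else [])) [0..<Suc (length is)])"

text \<open>A dot-free diagram is the list of its crossings and reflections from bottom to top.
  \<open>Crossing p\<close> crosses the strands at the positions \<open>p\<close> and \<open>p + 1\<close> of a word, black and red
  letters being counted from 0; \<open>Mirror\<close> is a reflection of the leftmost strand.\<close>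

datatype piece = Crossing nat | Mirror

type_synonym diagram = "piece list"

definition swap_at :: "nat \<Rightarrow> 'x list \<Rightarrow> 'x list" where
  "swap_at p xs = xs[p := xs ! (p + 1), p + 1 := xs ! p]"

fun piece_ok :: "'v wrd \<Rightarrow> piece \<Rightarrow> bool" where
  "piece_ok X (Crossing p) \<longleftrightarrow> p + 1 < length X \<and> (is_black (X ! p) \<or> is_black (X ! (p + 1)))"
| "piece_ok X Mirror \<longleftrightarrow> X \<noteq> [] \<and> is_black (hd X)"

fun reflect_letter :: "('v \<Rightarrow> 'v) \<Rightarrow> 'v letter \<Rightarrow> 'v letter" where
  "reflect_letter \<tau> (Black i) = Black (\<tau> i)"
| "reflect_letter \<tau> (Red \<theta>) = Red \<theta>"

fun piece_target :: "('v \<Rightarrow> 'v) \<Rightarrow> 'v wrd \<Rightarrow> piece \<Rightarrow> 'v wrd" where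
  "piece_target \<tau> X (Crossing p) = swap_at p X"
| "piece_target \<tau> X Mirror = reflect_letter \<tau> (hd X) # tl X"

fun reflect_on :: "'v letter \<Rightarrow> ('v, 'k) mor" where
  "reflect_on (Black i) = Reflect i"
| "reflect_on (Red \<theta>) = Ident [Red \<theta>]"

fun piece_mor :: "'v wrd \<Rightarrow> piece \<Rightarrow> ('v, 'k) mor" where
  "piece_mor X (Crossing p) = Ident (take p X) \<otimes>\<^sub>k Cross (X ! p) (X ! (p + 1)) \<otimes>\<^sub>k Ident (drop (p + 2) X)"
| "piece_mor X Mirror = reflect_on (hd X) \<otimes>\<^sub>k Ident (tl X)"

fun is_diagram :: "('v \<Rightarrow> 'v) \<Rightarrow> 'v wrd \<Rightarrow> 'v wrd \<Rightarrow> diagram \<Rightarrow> bool" where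
  "is_diagram \<tau> X Y [] \<longleftrightarrow> X = Y"
| "is_diagram \<tau> X Y (d # ds) \<longleftrightarrow> piece_ok X d \<and> is_diagram \<tau> (piece_target \<tau> X d) Y ds"

fun diagram_mor :: "('v \<Rightarrow> 'v) \<Rightarrow> 'v wrd \<Rightarrow> diagram \<Rightarrow> ('v, 'k) mor" where
  "diagram_mor \<tau> X [] = Ident X"
| "diagram_mor \<tau> X (d # ds) = diagram_mor \<tau> (piece_target \<tau> X d) ds \<circ>\<^sub>k piece_mor X d"

text \<open>The word in the generators of the signed permutations that is read off from the diagram
  without its red strands.\<close>

fun black_gens :: "'v wrd \<Rightarrow> piece \<Rightarrow> nat list" where
  "black_gens X (Crossing p) =
     (if is_black (X ! p) \<and> is_black (X ! (p + 1)) then [length (filter is_black (take (p + 1) X))] else [])"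
| "black_gens X Mirror = [0]"

fun black_expression :: "('v \<Rightarrow> 'v) \<Rightarrow> 'v wrd \<Rightarrow> diagram \<Rightarrow> nat list" where
  "black_expression \<tau> X [] = []"
| "black_expression \<tau> X (d # ds) = black_gens X d @ black_expression \<tau> (piece_target \<tau> X d) ds"

text \<open>Strands are named by their position in the bottom word, of length \<open>m\<close>. \<open>strands m ds\<close> lists
  the strands from left to right at the top of \<open>ds\<close>.\<close>

definition strands :: "nat \<Rightarrow> diagram \<Rightarrow> nat list" where
  "strands m ds = fold (\<lambda>d xs. case d of Crossing p \<Rightarrow> swap_at p xs | Mirror \<Rightarrow> xs) ds [0..<m]"

definition crossing_times :: "nat \<Rightarrow> diagram \<Rightarrow> nat \<Rightarrow> nat \<Rightarrow> nat set" where
  "crossing_times m ds a b = {t. t < length ds \<and> (\<exists>p. ds ! t = Crossing p \<and>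
     {strands m (take t ds) ! p, strands m (take t ds) ! (p + 1)} = {a, b})}"

definition mirror_times :: "nat \<Rightarrow> diagram \<Rightarrow> nat \<Rightarrow> nat set" where
  "mirror_times m ds b = {t. t < length ds \<and> ds ! t = Mirror \<and> strands m (take t ds) ! 0 = b}"

text \<open>A black strand which meets the mirror may cross a red strand twice, but only once on its way
  to the mirror and once on its way back. (Without this restriction, \<open>Mirror\<close> preceded by a
  double crossing of the black with a red strand of weight \<open>\<theta>\<close> to its right would count as reduced,
  although it is equal to the reflection composed with \<open>\<theta>\<^sub>i\<close> dots, and basis elements built on
  it could not span.) In the symmetric
  picture with \<open>2n\<close> black strands, in which the red strands also have mirror images, it says
  that no red and black strand cross twice.\<close>

definition reduced_diagram :: "('v \<Rightarrow> 'v) \<Rightarrow> 'v weight list \<Rightarrow> (int \<Rightarrow> int) \<Rightarrow> 'v list \<Rightarrow>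
    (nat \<Rightarrow> nat) \<Rightarrow> (nat \<Rightarrow> nat) \<Rightarrow> diagram \<Rightarrow> bool" where
  "reduced_diagram \<tau> \<Lambda> w is \<kappa> \<kappa>' ds \<longleftrightarrow>
     (let X = stendhal_word is \<kappa> \<Lambda>; m = length X in
       is_diagram \<tau> X (stendhal_word (signed_act \<tau> w is) \<kappa>' \<Lambda>) ds \<and>
       reduced_expression (length is) (black_expression \<tau> X ds) w \<and>
       (\<forall>r<m. \<forall>b<m. \<not> is_black (X ! r) \<and> is_black (X ! b) \<longrightarrow>
          (mirror_times m ds b = {} \<longrightarrow> card (crossing_times m ds r b) \<le> 1) \<and>
          (\<forall>t\<in>mirror_times m ds b.
             card {s \<in> crossing_times m ds r b. s < t} \<le> 1 \<and>
             card {s \<in> crossing_times m ds r b. t < s} \<le> 1)))"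

fun mor_power :: "'v wrd \<Rightarrow> ('v, 'k) mor \<Rightarrow> nat \<Rightarrow> ('v, 'k) mor" where
  "mor_power X f 0 = Ident X"
| "mor_power X f (Suc a) = f \<circ>\<^sub>k mor_power X f a"

definition dot_monomial :: "'v wrd \<Rightarrow> nat list \<Rightarrow> ('v, 'k) mor" where
  "dot_monomial X as =
     foldr (\<lambda>r g. mor_power X (black_dot X r) (as ! (r - 1)) \<circ>\<^sub>k g) [1..<Suc (length as)] (Ident X)"

definition basis_element :: "('v, 'a) pre_digraph \<Rightarrow> ('v \<Rightarrow> 'v) \<Rightarrow> 'v weight \<Rightarrow> 'v weight list \<Rightarrow> diagram \<Rightarrow>
    (int \<Rightarrow> int) \<Rightarrow> 'v list \<Rightarrow> (nat \<Rightarrow> nat) \<Rightarrow> (nat \<Rightarrow> nat) \<Rightarrow> nat list \<Rightarrow>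
    'v wrd \<times> 'v wrd \<Rightarrow> ('v, 'k :: field) mor set" where
  "basis_element Q \<tau> \<mu> \<Lambda> ds w is \<kappa> \<kappa>' as =
     (let X = stendhal_word is \<kappa> \<Lambda> in
       algebra_element Q \<tau> \<mu> \<Lambda> X (stendhal_word (signed_act \<tau> w is) \<kappa>' \<Lambda>)
         (diagram_mor \<tau> X ds \<circ>\<^sub>k dot_monomial X as))"

definition basis_index :: "('v, 'a) pre_digraph \<Rightarrow> nat \<Rightarrow>
    ((int \<Rightarrow> int) \<times> 'v list \<times> (nat \<Rightarrow> nat) \<times> (nat \<Rightarrow> nat) \<times> nat list) set" where
  "basis_index Q l = {(w, is, \<kappa>, \<kappa>', as). set is \<subseteq> verts Q \<and> w \<in> signed_perms (length is) \<and>
     \<kappa> \<in> red_placements l (length is) \<and> \<kappa>' \<in> red_placements l (length is) \<and> length as = length is}"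

end

(*
The diagrams span: a composite of crossings, reflections and dots can be rewritten with all dots at
the bottom, and modulo diagrams with fewer pieces it depends only on the underlying signed
permutation of all strands, black and red. Here a red strand is a strand of the signed permutation
which never becomes negative; a diagram on N strands is then a word in the generators of the
hyperoctahedral group on N letters, and by Matsumoto's theorem it suffices to treat nonreduced words
and braid moves, where the defining relations produce only shorter diagrams.

Independence comes from a representation on functions of points: crossings of two equal labels act
by divided differences, all other pieces by substitutions times polynomials. To avoid quotients of
polynomials, functions are evaluated only at generic points, whose coordinates are nonzero with
distinct squares. There the diagram of a reduced word of w acts as a nonvanishing multiple of the
substitution w plus substitutions of shorter words, and substitutions that take the bottom labels to
the same top labels move a generic point to different points, as there are no fixed vertices. So a
relation can be tested on functions supported at one point, longest w first.
*)
theory Submission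
  imports Defs
begin

text \<open>The two halves of the proof need different notions of reducedness. Independence uses
  only that the black word is a reduced expression; spanning needs a reduced word in all N letters,
  red ones included. The bridge is that red entries stay positive and increasing: a descent then
  always involves a black entry, and a red-black descent would be a second crossing of the same two
  strands on the same side of the mirror. This invariant survives the removal of a descent, so the
  induction in Matsumoto's theorem never needs a diagram in which red strands cross each other or
  the mirror. The filtration counts pieces and ignores dots: each defining relation then holds up to
  strictly fewer pieces, as its correction consists of dots, or of dots above one crossing in place
  of four pieces. Arbitrary functions can replace polynomials because each morphism evaluates a
  function at finitely many points of one orbit. In characteristic 2 a point does not see signs; the
  labels must then tell whether a strand has met the mirror. Algebraic closure supplies the
  infinitely many generic points that separate dot monomials.\<close>

section \<open>Signed lists\<close>

text \<open>The entry \<open>x\<close> at a position of a signed list stands for the strand \<open>\<bar>x\<bar>\<close>, black or red and counted from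
  1, at this position of a diagram; it is negative after the strand has met the mirror.
  \<open>signed_inv\<close> is the Coxeter length.\<close>

fun piece_act :: "int list \<Rightarrow> piece \<Rightarrow> int list" where
  "piece_act xs (Crossing p) = swap_at p xs"
| "piece_act xs Mirror = (- hd xs) # tl xs"

fun in_range :: "nat \<Rightarrow> piece \<Rightarrow> bool" where
  "in_range N (Crossing p) \<longleftrightarrow> p + 1 < N"
| "in_range N Mirror \<longleftrightarrow> 0 < N"

text \<open>The descent condition of type B in one-line notation: by
  \<open>signed_inv_piece_act\<close> these are exactly the pieces that lower
  \<open>signed_inv\<close>.\<close>

fun descends :: "int list \<Rightarrow> piece \<Rightarrow> bool" where
  "descends xs (Crossing p) \<longleftrightarrow> xs ! (p + 1) < xs ! p"
| "descends xs Mirror \<longleftrightarrow> hd xs < 0"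

definition ident_list :: "nat \<Rightarrow> int list" where
  "ident_list N = map int [1..<Suc N]"

definition state :: "nat \<Rightarrow> diagram \<Rightarrow> int list" where
  "state N ds = foldl piece_act (ident_list N) ds"

definition signed_list :: "nat \<Rightarrow> int list \<Rightarrow> bool" where
  "signed_list N xs \<longleftrightarrow> length xs = N \<and> distinct (map abs xs) \<and> abs ` set xs = {1..int N}"

text \<open>Each summand tests one positive root of type B: the entry \<open>x\<close> itself, and
  for a later entry \<open>y\<close> the difference and the sum of the two.\<close>

fun signed_inv :: "int list \<Rightarrow> nat" where
  "signed_inv [] = 0"
| "signed_inv (x # xs) =
     of_bool (x < 0) + (\<Sum>y\<leftarrow>xs. of_bool (y < x) + of_bool (x + y < 0)) + signed_inv xs"

text \<open>Measured by \<open>signed_inv\<close> rather than by minimality among words, so that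
  reducedness can be checked piece by piece (\<open>reduced_snoc\<close>).\<close>

definition reduced :: "nat \<Rightarrow> diagram \<Rightarrow> bool" where
  "reduced N ds \<longleftrightarrow> list_all (in_range N) ds \<and> signed_inv (state N ds) = length ds"

lemma swap_at_append: "swap_at (length A) (A @ x # y # B) = A @ y # x # B"
  by (simp add: swap_at_def nth_append list_update_append)

lemma length_swap_at [simp]: "length (swap_at p xs) = length xs"
  by (simp add: swap_at_def)

lemma map_swap_at: "p + 1 < length xs \<Longrightarrow> map f (swap_at p xs) = swap_at p (map f xs)"
  by (simp add: swap_at_def map_update)

lemma split_at_crossing:
  assumes "p + 1 < length xs"
  obtains A x y B where "xs = A @ x # y # B" "length A = p"
proof -
  have "xs = take p xs @ xs ! p # xs ! (p + 1) # drop (p + 2) xs"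
    using assms by (metis Cons_nth_drop_Suc Suc_eq_plus1 add_2_eq_Suc' append_take_drop_id Suc_lessD)
  moreover have "length (take p xs) = p" using assms by simp
  ultimately show ?thesis using that by blast
qed

lemma mset_swap_at: "p + 1 < length xs \<Longrightarrow> mset (swap_at p xs) = mset xs"
  by (elim split_at_crossing) (clarsimp simp: swap_at_append)

lemma length_piece_act [simp]: "xs \<noteq> [] \<Longrightarrow> length (piece_act xs d) = length xs"
  by (cases d) auto

lemma mset_abs_piece_act:
  "in_range (length xs) d \<Longrightarrow> mset (map abs (piece_act xs d)) = mset (map abs xs)"
proof (cases d)
  case (Crossing p)
  then show "in_range (length xs) d \<Longrightarrow> ?thesis" using mset_swap_at[of p xs] Crossing by simp
next
  case Mirror
  then show "in_range (length xs) d \<Longrightarrow> ?thesis" by (cases xs) auto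
qed

lemma signed_list_piece_act:
  assumes "signed_list N xs" "in_range N d"
  shows "signed_list N (piece_act xs d)"
proof -
  have m: "mset (map abs (piece_act xs d)) = mset (map abs xs)"
    using assms mset_abs_piece_act by (auto simp: signed_list_def)
  have "length (piece_act xs d) = length xs" using arg_cong[OF m, of size] by simp
  moreover have "set (map abs (piece_act xs d)) = set (map abs xs)" using mset_eq_setD[OF m] .
  ultimately show ?thesis using assms mset_eq_imp_distinct_iff[OF m] by (auto simp: signed_list_def)
qed

lemma piece_act_invol: "in_range (length xs) d \<Longrightarrow> piece_act (piece_act xs d) d = xs"
proof (cases d)
  case (Crossing p)
  assume "in_range (length xs) d"
  then have "p + 1 < length xs" using Crossing by simp
  then show ?thesis unfolding Crossing by (elim split_at_crossing) (clarsimp simp: swap_at_append)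
next
  case Mirror
  then show "in_range (length xs) d \<Longrightarrow> ?thesis" by (cases xs) auto
qed

text \<open>Entries are nonzero with distinct absolute values, so no comparison is an equality and
  each piece reverses its own.\<close>

lemma descends_piece_act:
  assumes "signed_list N xs" "in_range N d"
  shows "descends (piece_act xs d) d \<longleftrightarrow> \<not> descends xs d"
proof (cases d)
  case (Crossing p)
  have "p + 1 < length xs" using Crossing assms by (simp add: signed_list_def)
  then obtain A x y B where xs: "xs = A @ x # y # B" "length A = p" by (rule split_at_crossing)
  have "x \<noteq> y" using assms xs by (auto simp: signed_list_def)
  then show ?thesis using xs Crossing swap_at_append[of A x y B] by (auto simp: nth_append)
next
  case Mirror
  then have "xs \<noteq> []" "hd xs \<noteq> 0" using assms by (cases xs; force simp: signed_list_def)+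
  then show ?thesis using Mirror by (cases xs) auto
qed

text \<open>Pairs with only one member among \<open>x\<close>, \<open>y\<close> do not see the order
  of these two, and \<open>x + y < 0\<close> is symmetric; only the comparison of \<open>x\<close>
  with \<open>y\<close> changes.\<close>

lemma signed_inv_append_swap:
  "x \<noteq> y \<Longrightarrow> signed_inv (A @ x # y # B) + of_bool (x < y) = signed_inv (A @ y # x # B) + of_bool (y < x)"
  by (induction A) (auto simp: sum_list_addf add.commute[of x y])

text \<open>Replacing \<open>x\<close> by \<open>- x\<close> exchanges the two indicators of each
  pair, so only the sign of \<open>x\<close> itself counts.\<close>

lemma signed_inv_neg:
  "x \<noteq> 0 \<Longrightarrow> signed_inv (x # B) + of_bool (0 < x) = signed_inv (- x # B) + of_bool (x < 0)"
proof -
  have "(\<Sum>y\<leftarrow>B. of_bool (y < x) + of_bool (x + y < 0)) =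
      (\<Sum>y\<leftarrow>B. of_bool (y < - x) + of_bool (- x + y < 0) :: nat)"
    by (rule arg_cong[of _ _ sum_list], rule map_cong) (auto simp: of_bool_def)
  then show "x \<noteq> 0 \<Longrightarrow> ?thesis" by simp
qed

lemma signed_inv_piece_act:
  assumes "signed_list N xs" "in_range N d"
  shows "signed_inv (piece_act xs d) + of_bool (descends xs d) = signed_inv xs + of_bool (\<not> descends xs d)"
proof (cases d)
  case (Crossing p)
  have "p + 1 < length xs" using Crossing assms by (simp add: signed_list_def)
  then obtain A x y B where xs: "xs = A @ x # y # B" "length A = p" by (rule split_at_crossing)
  have "x \<noteq> y" using assms xs by (auto simp: signed_list_def)
  then show ?thesis using xs Crossing swap_at_append[of A x y B] signed_inv_append_swap[of x y A B]
    by (auto simp: nth_append split: if_splits)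
next
  case Mirror
  then obtain x B where xs: "xs = x # B" "x \<noteq> 0" using assms by (cases xs; force simp: signed_list_def)+
  then show ?thesis using Mirror signed_inv_neg[of x B] by (auto simp: of_bool_def split: if_splits)
qed

lemma signed_list_initial: "signed_list N (ident_list N)"
proof -
  have "int ` {1..N} = {1..int N}" by (simp add: image_int_atLeastAtMost)
  then show ?thesis by (auto simp: signed_list_def ident_list_def distinct_map inj_on_def image_image
        atLeastLessThanSuc_atLeastAtMost simp del: upt_Suc)
qed

lemma state_Nil [simp]: "state N [] = ident_list N"
  by (simp add: state_def)

lemma state_snoc [simp]: "state N (ds @ [d]) = piece_act (state N ds) d"
  by (simp add: state_def)

lemma signed_list_state: "list_all (in_range N) ds \<Longrightarrow> signed_list N (state N ds)"
  by (induction ds rule: rev_induct) (auto simp: signed_list_initial signed_list_piece_act)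

lemma signed_inv_nonneg_sorted:
  "sorted_wrt (<) xs \<Longrightarrow> (\<forall>x\<in>set xs. 0 < x) \<Longrightarrow> signed_inv xs = 0"
  by (induction xs) (fastforce simp: sum_list_eq_0_iff of_bool_def)+

lemma signed_inv_initial: "signed_inv (ident_list N) = 0"
  by (rule signed_inv_nonneg_sorted) (auto simp: sorted_wrt_map ident_list_def simp del: upt_Suc)

lemma signed_inv_state_le: "list_all (in_range N) ds \<Longrightarrow> signed_inv (state N ds) \<le> length ds"
proof (induction ds rule: rev_induct)
  case Nil
  then show ?case by (simp add: signed_inv_initial)
next
  case (snoc d ds)
  then show ?case using signed_inv_piece_act[OF signed_list_state, of N ds d]
    by (auto simp: of_bool_def split: if_splits)
qed

text \<open>One piece raises \<open>signed_inv\<close> by at most one, so the bound by the length is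
  attained only if no piece is applied at a descent.\<close>

lemma reduced_snoc:
  "reduced N (ds @ [d]) \<longleftrightarrow> reduced N ds \<and> in_range N d \<and> \<not> descends (state N ds) d"
  using signed_inv_piece_act[OF signed_list_state, of N ds d] signed_inv_state_le[of N ds]
  by (auto simp: reduced_def of_bool_def split: if_splits)

lemma reduced_Nil: "reduced N []"
  by (simp add: reduced_def signed_inv_initial)

lemma reduced_append: "reduced N (ds @ es) \<Longrightarrow> reduced N ds"
  by (induction es rule: rev_induct) (auto simp: reduced_snoc simp flip: append_assoc)

text \<open>Without descents at crossings the list increases strictly, and without a descent at the
  mirror its first entry is positive; the absolute values leave only one such list.\<close>

lemma no_descents:
  assumes xs: "signed_list N xs" and nd: "\<And>d. in_range N d \<Longrightarrow> \<not> descends xs d"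
  shows "xs = ident_list N"
proof -
  have len: "length xs = N" and dist: "distinct (map abs xs)" and im: "abs ` set xs = {1..int N}"
    using xs by (auto simp: signed_list_def)
  have step: "xs ! p < xs ! Suc p" if "Suc p < N" for p
  proof -
    have "xs ! p \<noteq> xs ! Suc p" using dist len that
      by (metis Suc_lessD distinct_map n_not_Suc_n nth_eq_iff_index_eq)
    then show ?thesis using nd[of "Crossing p"] that by simp
  qed
  have srt: "sorted_wrt (<) xs"
    using step len by (simp add: sorted_wrt_iff_nth_Suc_transp)
  have pos: "\<forall>x\<in>set xs. 0 < x"
  proof (cases xs)
    case (Cons a ys)
    have "a \<noteq> 0" using im Cons by force
    then have "0 < a" using nd[of Mirror] Cons len by fastforce
    then show ?thesis using srt Cons by auto
  qed simp
  have "set xs = {1..int N}" using im pos by (force simp: image_def)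
  moreover have "set (ident_list N) = {1..int N}"
    by (simp add: image_int_atLeastAtMost ident_list_def atLeastLessThanSuc_atLeastAtMost del: upt_Suc)
  moreover have "sorted_wrt (<) (ident_list N)" by (simp add: sorted_wrt_map ident_list_def del: upt_Suc)
  ultimately show ?thesis using srt strict_sorted_equal by metis
qed

lemma exists_reduced:
  "signed_list N xs \<Longrightarrow> \<exists>ds. reduced N ds \<and> state N ds = xs"
proof (induction "signed_inv xs" arbitrary: xs rule: less_induct)
  case less
  show ?case
  proof (cases "\<exists>d. in_range N d \<and> descends xs d")
    case True
    then obtain d where d: "in_range N d" "descends xs d" by blast
    have "signed_inv (piece_act xs d) < signed_inv xs"
      using signed_inv_piece_act[OF less.prems d(1)] d by auto
    then obtain ds where ds: "reduced N ds" "state N ds = piece_act xs d"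
      using less signed_list_piece_act d by blast
    have "reduced N (ds @ [d])" using ds d descends_piece_act[OF less.prems] by (simp add: reduced_snoc)
    moreover have "state N (ds @ [d]) = xs"
      using ds piece_act_invol d less.prems by (simp add: signed_list_def)
    ultimately show ?thesis by blast
  next
    case False
    then have "xs = state N []" using no_descents less.prems by auto
    then show ?thesis using reduced_Nil by blast
  qed
qed

text \<open>The exchange condition; in \<open>filt_nonreduced\<close> it produces a repeated
  piece.\<close>

lemma exists_reduced_snoc:
  assumes "signed_list N xs" "in_range N d" "descends xs d"
  obtains ds where "reduced N (ds @ [d])" "state N (ds @ [d]) = xs" "state N ds = piece_act xs d"
proof -
  obtain ds where ds: "reduced N ds" "state N ds = piece_act xs d"
    using exists_reduced signed_list_piece_act assms by blast
  show ?thesis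
  proof (rule that[of ds])
    show "reduced N (ds @ [d])" using ds assms descends_piece_act by (simp add: reduced_snoc)
    show "state N (ds @ [d]) = xs" using ds piece_act_invol assms by (simp add: signed_list_def)
  qed (use ds in simp)
qed

subsection \<open>Matsumoto's theorem\<close>

text \<open>The rank-two relations of type B, each in one orientation; the other orientation comes
  from the symmetry of \<open>R\<close> in \<open>matsumoto\<close>.\<close>

inductive braid_move :: "diagram \<Rightarrow> diagram \<Rightarrow> bool" where
  far: "p + 1 < q \<Longrightarrow> braid_move [Crossing p, Crossing q] [Crossing q, Crossing p]"
| far_mirror: "0 < p \<Longrightarrow> braid_move [Mirror, Crossing p] [Crossing p, Mirror]"
| braid: "braid_move [Crossing (Suc p), Crossing p, Crossing (Suc p)] [Crossing p, Crossing (Suc p), Crossing p]"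
| mirror_braid: "braid_move [Crossing 0, Mirror, Crossing 0, Mirror] [Mirror, Crossing 0, Mirror, Crossing 0]"

text \<open>Reducedness of a suffix, read from the state \<open>xs\<close> at which it starts
  (\<open>reduced_append_iff\<close>).\<close>

fun ascending :: "int list \<Rightarrow> diagram \<Rightarrow> bool" where
  "ascending xs [] \<longleftrightarrow> True"
| "ascending xs (d # ds) \<longleftrightarrow> in_range (length xs) d \<and> \<not> descends xs d \<and> ascending (piece_act xs d) ds"

lemma state_append: "state N (ds @ es) = foldl piece_act (state N ds) es"
  by (simp add: state_def)

lemma length_state: "list_all (in_range N) ds \<Longrightarrow> length (state N ds) = N"
  using signed_list_state by (simp add: signed_list_def)

lemma reduced_append_iff: "reduced N (ds @ es) \<longleftrightarrow> reduced N ds \<and> ascending (state N ds) es"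
proof (induction es arbitrary: ds)
  case (Cons d es)
  have "length (state N ds) = N" if "reduced N ds" using that by (simp add: reduced_def length_state)
  then show ?case using Cons[of "ds @ [d]"] by (auto simp: reduced_snoc)
qed simp

lemma swap_at_Suc_append: "swap_at (Suc (length A)) (A @ x # y # z # B) = A @ x # z # y # B"
  using swap_at_append[of "A @ [x]" y z B] by simp

text \<open>When \<open>s\<close> and \<open>t\<close> are both descents, \<open>xs\<close> is the
  top of its coset of the rank-two group that they generate. Both alternating words lead up to it
  from the bottom \<open>?ys\<close> of that coset, and together they are the two sides of one braid
  move. The condition \<open>ori\<close> orders the pair, to halve the cases.\<close>

lemma oriented_descents:
  assumes xs: "signed_list N xs" and st: "in_range N s" "descends xs s" "in_range N t" "descends xs t"
    and ori: "(\<exists>p q. s = Crossing p \<and> t = Crossing q \<and> p < q) \<or> (s = Mirror \<and> (\<exists>p. t = Crossing p))"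
  shows "\<exists>e b b'. (braid_move (b @ [s]) (b' @ [t]) \<or> braid_move (b' @ [t]) (b @ [s])) \<and>
    reduced N (e @ b @ [s]) \<and> state N (e @ b @ [s]) = xs \<and> reduced N (e @ b' @ [t]) \<and> state N (e @ b' @ [t]) = xs"
proof -
  have len: "length xs = N" and dist: "distinct (map abs xs)" using xs by (auto simp: signed_list_def)
  \<comment> \<open>A reduced word \<open>e\<close> for the bottom \<open>ys\<close> of the coset
    exists, so it suffices to name \<open>ys\<close> and to follow both words upwards.\<close>
  have conclude: ?thesis
    if sl: "signed_list N ys" and bm: "braid_move (b @ [s]) (b' @ [t]) \<or> braid_move (b' @ [t]) (b @ [s])"
      and asc: "ascending ys (b @ [s])" "ascending ys (b' @ [t])"
      and fold: "foldl piece_act ys (b @ [s]) = xs" "foldl piece_act ys (b' @ [t]) = xs" for ys b b'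
  proof -
    obtain e where e: "reduced N e" "state N e = ys" using exists_reduced[OF sl] by blast
    have "reduced N (e @ b @ [s])" "reduced N (e @ b' @ [t])"
      using e asc by (simp_all only: reduced_append_iff)
    moreover have "state N (e @ b @ [s]) = xs" "state N (e @ b' @ [t]) = xs"
      using e fold by (simp_all only: state_append)
    ultimately show ?thesis using bm by blast
  qed
  have sl: "signed_list N ys" if "mset (map abs ys) = mset (map abs xs)" for ys
  proof -
    have "length ys = N" using arg_cong[OF that, of size] len by simp
    moreover have "distinct (map abs ys)" using mset_eq_imp_distinct_iff[OF that] dist by simp
    moreover have "abs ` set ys = {1..int N}" using mset_eq_setD[OF that] xs by (simp add: signed_list_def)
    ultimately show ?thesis by (simp add: signed_list_def)
  qed
  consider (far) p q where "s = Crossing p" "t = Crossing q" "p + 1 < q"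
    | (near) p where "s = Crossing p" "t = Crossing (Suc p)"
    | (mfar) p where "s = Mirror" "t = Crossing p" "0 < p"
    | (mnear) "s = Mirror" "t = Crossing 0"
  proof -
    assume a: "\<And>p q. s = Crossing p \<Longrightarrow> t = Crossing q \<Longrightarrow> p + 1 < q \<Longrightarrow> thesis"
      "\<And>p. s = Crossing p \<Longrightarrow> t = Crossing (Suc p) \<Longrightarrow> thesis"
      "\<And>p. s = Mirror \<Longrightarrow> t = Crossing p \<Longrightarrow> 0 < p \<Longrightarrow> thesis"
      "s = Mirror \<Longrightarrow> t = Crossing 0 \<Longrightarrow> thesis"
    from ori show thesis
    proof (elim disjE conjE exE)
      fix p q assume pq: "s = Crossing p" "t = Crossing q" "p < q"
      then consider "q = Suc p" | "p + 1 < q" by linarith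
      then show thesis using a pq by cases auto
    next
      fix p assume pq: "s = Mirror" "t = Crossing p"
      then show thesis using a by (cases p) auto
    qed
  qed
  then show ?thesis
  proof cases
    case far
    have "q + 1 < length xs" using far st len by simp
    then obtain A z w C where A: "xs = A @ z # w # C" "length A = q" by (rule split_at_crossing)
    have "p + 1 < length A" using far A by simp
    then obtain A' x y B where A': "A = A' @ x # y # B" "length A' = p" by (rule split_at_crossing)
    let ?ys = "A' @ y # x # B @ w # z # C"
    have eq: "xs = A' @ x # y # B @ z # w # C" using A A' by simp
    have q: "q = length (A' @ x # y # B)" using A A' by simp
    have sw: "swap_at q (A' @ a # b # B @ c # d # C) = A' @ a # b # B @ d # c # C" for a b c d
      using swap_at_append[of "A' @ a # b # B" c d C] q by simp
    have sp: "swap_at p (A' @ a # b # Z) = A' @ b # a # Z" for a b Z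
      using swap_at_append[of A' a b Z] A' by simp
    have nq: "(A' @ a # b # B @ c # d # C) ! q = c" "(A' @ a # b # B @ c # d # C) ! (Suc q) = d" for a b c d
      unfolding q by (simp_all add: nth_append)
    have np: "(A' @ a # b # Z) ! p = a" "(A' @ a # b # Z) ! Suc p = b" for a b Z
      using A' by (simp_all add: nth_append)
    have lt: "y < x" "w < z" using st eq far by (simp_all add: np nq)
    have ranges: "p + 1 < length ?ys" "q + 1 < length ?ys" using A' q by simp_all
    show ?thesis
    proof (rule conclude[of ?ys "[Crossing q]" "[Crossing p]"])
      show "signed_list N ?ys" by (rule sl) (simp add: eq)
      show "ascending ?ys ([Crossing q] @ [s])" "ascending ?ys ([Crossing p] @ [t])"
        using far lt ranges by (simp_all add: sw sp np nq)
      show "foldl piece_act ?ys ([Crossing q] @ [s]) = xs" "foldl piece_act ?ys ([Crossing p] @ [t]) = xs"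
        using far eq by (simp_all add: sw sp)
    qed (use far in \<open>auto intro: braid_move.far\<close>)
  next
    case near
    have "p + 1 < length xs" using near st len by simp
    then obtain A x y B where A: "xs = A @ x # y # B" "length A = p" by (rule split_at_crossing)
    then obtain z C where B: "B = z # C" using near st len by (cases B) auto
    let ?ys = "A @ z # y # x # C"
    have lt: "y < x" "z < y" using st A B near by (auto simp: nth_append)
    note sw = swap_at_append[of A, unfolded A(2)] swap_at_Suc_append[of A, unfolded A(2)]
    have n: "(A @ a # b # Z) ! p = a" "(A @ a # b # Z) ! Suc p = b"
        "(A @ a # b # c # Z') ! Suc (Suc p) = c" for a b c Z Z'
      using A by (simp_all add: nth_append)
    show ?thesis
    proof (rule conclude[of ?ys "[Crossing p, Crossing (Suc p)]" "[Crossing (Suc p), Crossing p]"])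
      show "signed_list N ?ys" by (rule sl) (simp add: A B)
      show "ascending ?ys ([Crossing p, Crossing (Suc p)] @ [s])" "ascending ?ys ([Crossing (Suc p), Crossing p] @ [t])"
        using near lt A B by (simp_all add: sw n)
      show "foldl piece_act ?ys ([Crossing p, Crossing (Suc p)] @ [s]) = xs"
        "foldl piece_act ?ys ([Crossing (Suc p), Crossing p] @ [t]) = xs"
        using near A B by (simp_all add: sw)
    qed (use near in \<open>auto intro: braid_move.braid\<close>)
  next
    case mfar
    obtain p' where p': "p = Suc p'" using mfar by (cases p) auto
    obtain x Z where Z: "xs = x # Z" using st len by (cases xs) (auto simp: mfar)
    have "p' + 1 < length Z" using mfar st len Z p' by simp
    then obtain A y z B where A: "Z = A @ y # z # B" "length A = p'" by (rule split_at_crossing)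
    let ?ys = "(- x) # A @ z # y # B"
    have sw: "swap_at (Suc p') (a # A @ b # c # B) = a # A @ c # b # B" for a b c
      using swap_at_append[of "a # A" b c B] A p' by simp
    have n: "(A @ b # c # B) ! p' = b" "(A @ b # c # B) ! Suc p' = c" for b c
      using A p' by (simp_all add: nth_append)
    have lt: "x < 0" "z < y" using st A Z mfar p' by (auto simp: nth_append)
    show ?thesis
    proof (rule conclude[of ?ys "[Crossing p]" "[Mirror]"])
      show "signed_list N ?ys" by (rule sl) (simp add: A Z)
      show "ascending ?ys ([Crossing p] @ [s])" "ascending ?ys ([Mirror] @ [t])"
        using mfar lt A Z p' by (simp_all add: sw n)
      show "foldl piece_act ?ys ([Crossing p] @ [s]) = xs" "foldl piece_act ?ys ([Mirror] @ [t]) = xs"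
        using mfar A Z p' by (simp_all add: sw)
    qed (use mfar in \<open>auto intro: braid_move.far_mirror\<close>)
  next
    case mnear
    obtain x y B where B: "xs = x # y # B" using st len mnear by (cases xs; cases "tl xs") auto
    let ?ys = "(- x) # (- y) # B"
    have sw: "swap_at 0 (a # b # Z) = b # a # Z" for a b :: int and Z
      using swap_at_append[of "[]" a b Z] by simp
    have lt: "x < 0" "y < x" using st B mnear by auto
    show ?thesis
    proof (rule conclude[of ?ys "[Crossing 0, Mirror, Crossing 0]" "[Mirror, Crossing 0, Mirror]"])
      show "signed_list N ?ys" by (rule sl) (simp add: B)
      show "ascending ?ys ([Crossing 0, Mirror, Crossing 0] @ [s])" "ascending ?ys ([Mirror, Crossing 0, Mirror] @ [t])"
        using mnear lt B by (simp_all add: sw)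
      show "foldl piece_act ?ys ([Crossing 0, Mirror, Crossing 0] @ [s]) = xs"
        "foldl piece_act ?ys ([Mirror, Crossing 0, Mirror] @ [t]) = xs"
        using mnear B by (simp_all add: sw)
    qed (use mnear in \<open>auto intro: braid_move.mirror_braid\<close>)
  qed
qed

lemma two_descents:
  assumes "signed_list N xs" "in_range N s" "descends xs s" "in_range N t" "descends xs t" "s \<noteq> t"
  shows "\<exists>e b b'. (braid_move (b @ [s]) (b' @ [t]) \<or> braid_move (b' @ [t]) (b @ [s])) \<and>
    reduced N (e @ b @ [s]) \<and> state N (e @ b @ [s]) = xs \<and> reduced N (e @ b' @ [t]) \<and> state N (e @ b' @ [t]) = xs"
proof (cases "(\<exists>p q. s = Crossing p \<and> t = Crossing q \<and> p < q) \<or> (s = Mirror \<and> (\<exists>p. t = Crossing p))")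
  case True
  then show ?thesis using oriented_descents assms by blast
next
  case False
  then have "(\<exists>p q. t = Crossing p \<and> s = Crossing q \<and> p < q) \<or> (t = Mirror \<and> (\<exists>p. s = Crossing p))"
    using assms(6) by (cases s; cases t) auto
  then show ?thesis using oriented_descents[OF assms(1,4,5,2,3)] by blast
qed

text \<open>Pieces are involutions on signed lists, so the state below the last piece is recovered
  by applying it once more.\<close>

lemma state_init:
  assumes "reduced N (ds @ [d])"
  shows "state N ds = piece_act (state N (ds @ [d])) d" "descends (state N (ds @ [d])) d"
proof -
  have r: "reduced N ds" "in_range N d" "\<not> descends (state N ds) d" using assms by (auto simp: reduced_snoc)
  have sl: "signed_list N (state N ds)" using r by (simp add: signed_list_state reduced_def)
  show "state N ds = piece_act (state N (ds @ [d])) d"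
    using piece_act_invol[of "state N ds" d] r sl by (simp add: signed_list_def)
  show "descends (state N (ds @ [d])) d" using descends_piece_act[OF sl] r by simp
qed

text \<open>\<open>C\<close> and \<open>R\<close> are abstract because the result is applied modulo
  lower terms and only to states that diagrams can reach: extension and braid moves are required
  only where \<open>C\<close> holds. Two words ending in \<open>s\<close> and \<open>t\<close> are
  joined through two words that also end in \<open>s\<close> and \<open>t\<close> and differ by one
  braid move after a common prefix.\<close>

lemma matsumoto:
  assumes C: "\<And>xs d. C xs \<Longrightarrow> signed_list N xs \<Longrightarrow> in_range N d \<Longrightarrow> descends xs d \<Longrightarrow> C (piece_act xs d)"
    and sym: "\<And>ds es. R ds es \<Longrightarrow> R es ds"
    and trans: "\<And>ds es fs. R ds es \<Longrightarrow> R es fs \<Longrightarrow> R ds fs"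
    and Nil: "R [] []"
    and extend: "\<And>ds es d. R ds es \<Longrightarrow> reduced N (ds @ [d]) \<Longrightarrow> reduced N (es @ [d]) \<Longrightarrow> state N es = state N ds \<Longrightarrow>
        C (state N (ds @ [d])) \<Longrightarrow> R (ds @ [d]) (es @ [d])"
    and braid: "\<And>e b b'. braid_move b b' \<Longrightarrow> reduced N (e @ b) \<Longrightarrow> reduced N (e @ b') \<Longrightarrow>
        state N (e @ b) = state N (e @ b') \<Longrightarrow> C (state N (e @ b)) \<Longrightarrow> R (e @ b) (e @ b')"
  shows "\<lbrakk>reduced N ds; reduced N es; state N ds = state N es; C (state N ds)\<rbrakk> \<Longrightarrow> R ds es"
proof (induction "length ds" arbitrary: ds es rule: less_induct)
  case less
  have len: "length ds = length es" using less.prems by (simp add: reduced_def)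
  show ?case
  proof (cases ds rule: rev_cases)
    case [simp]: (snoc c s)
    obtain c' t where [simp]: "es = c' @ [t]" using len by (cases es rule: rev_cases) auto
    let ?xs = "state N ds"
    have eqs: "state N (c' @ [t]) = ?xs" "state N (c @ [s]) = ?xs" using less.prems(3) by simp_all
    have rd: "reduced N (c @ [s])" "reduced N (c' @ [t])" using less.prems by simp_all
    have s: "in_range N s" "descends ?xs s" "state N c = piece_act ?xs s"
      using state_init[OF rd(1)] rd(1) eqs unfolding reduced_snoc by metis+
    have t: "in_range N t" "descends ?xs t" "state N c' = piece_act ?xs t"
      using state_init[OF rd(2)] rd(2) eqs unfolding reduced_snoc by metis+
    have sl: "signed_list N ?xs" using less.prems by (simp only: reduced_def signed_list_state)
    \<comment> \<open>For two words with the same state and the same last piece, both prefixes reach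
      the state with this descent removed, where \<open>C\<close> still holds.\<close>
    have IH: "R (f @ [d]) (g @ [d])"
      if "reduced N (f @ [d])" "reduced N (g @ [d])" "state N (f @ [d]) = ?xs" "state N (g @ [d]) = ?xs" for f g d
    proof -
      have fg: "reduced N f" "reduced N g" "in_range N d" using that by (auto simp: reduced_snoc)
      have st: "state N f = piece_act ?xs d" "state N g = piece_act ?xs d" "descends ?xs d"
        using state_init[OF that(1)] state_init[OF that(2)] that(3,4) by auto
      have "length f + 1 = length ds" using that(1,3) less.prems(1) unfolding reduced_def by (metis length_append_singleton Suc_eq_plus1)
      then have "R f g" using less.hyps[of f g] fg st C[OF less.prems(4) sl, of d] by simp
      then show ?thesis using extend[of f g d] that st less.prems(4) by simp
    qed
    show ?thesis
    proof (cases "s = t")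
      case True
      then show ?thesis using IH[of c s c'] rd eqs by (simp only: \<open>ds = c @ [s]\<close> \<open>es = c' @ [t]\<close>)
    next
      case False
      \<comment> \<open>The words from \<open>two_descents\<close> share a last piece with one given
        word each, so the induction hypothesis applies on both sides of the braid move.\<close>
      obtain e b b' where bm: "braid_move (b @ [s]) (b' @ [t]) \<or> braid_move (b' @ [t]) (b @ [s])"
        and r: "reduced N (e @ b @ [s])" "state N (e @ b @ [s]) = ?xs"
          "reduced N (e @ b' @ [t])" "state N (e @ b' @ [t]) = ?xs"
        using two_descents[OF sl s(1,2) t(1,2) False] by blast
      have 1: "R (c @ [s]) (e @ b @ [s])"
        using IH[of c s "e @ b"] r rd eqs by (simp only: append_assoc)
      have 2: "R (e @ b' @ [t]) (c' @ [t])"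
        using IH[of "e @ b'" t c'] r rd eqs by (simp only: append_assoc)
      have "R (e @ b @ [s]) (e @ b' @ [t])"
        using bm
      proof
        assume "braid_move (b @ [s]) (b' @ [t])"
        then show ?thesis using braid r less.prems(4) by metis
      next
        assume "braid_move (b' @ [t]) (b @ [s])"
        then show ?thesis using braid r less.prems(4) sym by metis
      qed
      then show ?thesis using 1 2 trans by (metis \<open>es = c' @ [t]\<close> snoc)
    qed
  qed (use Nil len in simp)
qed

section \<open>Words at the top of a diagram\<close>

definition strand_black :: "'v wrd \<Rightarrow> int \<Rightarrow> bool" where
  "strand_black X x \<longleftrightarrow> is_black (X ! (nat \<bar>x\<bar> - 1))"

definition strand_letter :: "('v \<Rightarrow> 'v) \<Rightarrow> 'v wrd \<Rightarrow> int \<Rightarrow> 'v letter" where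
  "strand_letter \<tau> X x = (if x < 0 then reflect_letter \<tau> (X ! (nat (- x) - 1)) else X ! (nat x - 1))"

text \<open>The invariant of all states reached by diagrams: red strands meet neither the mirror nor
  each other.\<close>

definition compatible :: "'v wrd \<Rightarrow> int list \<Rightarrow> bool" where
  "compatible X xs \<longleftrightarrow> (\<forall>x\<in>set xs. \<not> strand_black X x \<longrightarrow> 0 < x) \<and>
     sorted_wrt (<) (filter (\<lambda>x. \<not> strand_black X x) xs)"

lemma is_black_reflect [simp]: "is_black (reflect_letter \<tau> a) = is_black a"
  by (cases a) auto

lemma is_black_strand_letter [simp]: "is_black (strand_letter \<tau> X x) = strand_black X x"
  by (auto simp: strand_letter_def strand_black_def)

lemma strand_black_neg [simp]: "strand_black X (- x) = strand_black X x"
  by (simp add: strand_black_def)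

lemma is_diagram_snoc:
  "is_diagram \<tau> X Y (ds @ [d]) \<longleftrightarrow> (\<exists>Z. is_diagram \<tau> X Z ds \<and> piece_ok Z d \<and> Y = piece_target \<tau> Z d)"
  by (induction ds arbitrary: X) auto

lemma is_diagram_unique: "is_diagram \<tau> X Y ds \<Longrightarrow> is_diagram \<tau> X Z ds \<Longrightarrow> Y = Z"
  by (induction ds arbitrary: X) auto

lemma length_piece_target: "piece_ok X d \<Longrightarrow> length (piece_target \<tau> X d) = length X"
  by (cases d) auto

text \<open>Red entries are positive and increasing, so two of them never form a descent and none is
  negative. The piece that removes a descent therefore involves a black strand and is legal.\<close>

lemma compatible_descent:
  assumes "compatible X xs" "signed_list N xs" "in_range N d" "descends xs d"
  shows "compatible X (piece_act xs d)" "piece_ok (map (strand_letter \<tau> X) (piece_act xs d)) d"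
proof -
  have "compatible X (piece_act xs d) \<and> piece_ok (map (strand_letter \<tau> X) (piece_act xs d)) d"
  proof (cases d)
    case (Crossing p)
    have "p + 1 < length xs" using Crossing assms by (simp add: signed_list_def)
    then obtain A x y B where xs: "xs = A @ x # y # B" "length A = p" by (rule split_at_crossing)
    have "y < x" using assms xs Crossing by (auto simp: nth_append)
    then have "strand_black X x \<or> strand_black X y"
      using assms(1) xs by (auto simp: compatible_def sorted_wrt_append)
    then show ?thesis using assms(1) xs Crossing swap_at_append[of A x y B]
      by (auto simp: compatible_def sorted_wrt_append nth_append)
  next
    case Mirror
    then obtain x B where xs: "xs = x # B" "x < 0" using assms by (cases xs) (auto simp: signed_list_def)
    then have "strand_black X x" using assms(1) by (auto simp: compatible_def)
    then show ?thesis using assms(1) xs Mirror by (auto simp: compatible_def)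
  qed
  then show "compatible X (piece_act xs d)" "piece_ok (map (strand_letter \<tau> X) (piece_act xs d)) d" by auto
qed

lemma compatible_ident_list: "compatible X (ident_list N)"
proof -
  have "sorted_wrt (<) (ident_list N)" by (simp add: ident_list_def sorted_wrt_map del: upt_Suc)
  then have "sorted_wrt (<) (filter P (ident_list N))" for P by (rule sorted_wrt_filter)
  then show ?thesis by (simp add: compatible_def) (auto simp: ident_list_def simp del: upt_Suc)
qed

lemma map_strand_letter_ident: "map (strand_letter \<tau> X) (ident_list (length X)) = X"
  by (rule nth_equalityI) (auto simp: ident_list_def strand_letter_def nat_add_distrib simp del: upt_Suc)

text \<open>Only letters of \<open>X\<close> are tested, since \<open>\<tau>\<close> is an arbitrary
  function outside the vertices.\<close>

definition involutive_on :: "('v \<Rightarrow> 'v) \<Rightarrow> 'v wrd \<Rightarrow> bool" where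
  "involutive_on \<tau> X \<longleftrightarrow> (\<forall>i. Black i \<in> set X \<longrightarrow> \<tau> (\<tau> i) = i)"

lemma reflect_strand_letter:
  assumes "involutive_on \<tau> X" "x \<noteq> 0" "\<bar>x\<bar> \<le> int (length X)"
  shows "reflect_letter \<tau> (strand_letter \<tau> X x) = strand_letter \<tau> X (- x)"
proof -
  have "reflect_letter \<tau> (reflect_letter \<tau> (X ! p)) = X ! p" if "p < length X" for p
    using that assms(1) nth_mem[OF that] by (cases "X ! p") (auto simp: involutive_on_def)
  from this[of "nat (- x) - 1"] show ?thesis using assms(2,3) by (auto simp: strand_letter_def)
qed

lemma piece_target_strands:
  assumes X: "involutive_on \<tau> X" and sl: "signed_list (length X) xs" and d: "in_range (length X) d"
  shows "piece_target \<tau> (map (strand_letter \<tau> X) xs) d = map (strand_letter \<tau> X) (piece_act xs d)"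
proof (cases d)
  case (Crossing p)
  then show ?thesis using sl d by (simp add: map_swap_at signed_list_def)
next
  case Mirror
  then obtain x B where xs: "xs = x # B" using sl d by (cases xs) (auto simp: signed_list_def)
  have "\<bar>x\<bar> \<in> {1..int (length X)}" using sl xs by (auto simp: signed_list_def)
  then have "x \<noteq> 0" "\<bar>x\<bar> \<le> int (length X)" by auto
  then show ?thesis using Mirror xs reflect_strand_letter[OF X] by simp
qed

text \<open>Each legal piece keeps the red entries positive and in order, and the letter of a strand
  changes only with its sign; so the signed list determines the word at the top.\<close>

lemma is_diagram_state:
  assumes X: "involutive_on \<tau> X"
  shows "is_diagram \<tau> X Y ds \<Longrightarrow> list_all (in_range (length X)) ds \<and>
    compatible X (state (length X) ds) \<and> Y = map (strand_letter \<tau> X) (state (length X) ds)"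
proof (induction ds arbitrary: Y rule: rev_induct)
  case Nil
  then show ?case by (simp add: compatible_ident_list map_strand_letter_ident)
next
  case (snoc d ds)
  then obtain Z where Z: "is_diagram \<tau> X Z ds" "piece_ok Z d" "Y = piece_target \<tau> Z d"
    by (auto simp: is_diagram_snoc)
  let ?xs = "state (length X) ds"
  from snoc.IH[OF Z(1)] have IH: "list_all (in_range (length X)) ds" "compatible X ?xs"
      "Z = map (strand_letter \<tau> X) ?xs" by auto
  have sl: "signed_list (length X) ?xs" using IH(1) by (rule signed_list_state)
  have len: "length Z = length X" using IH(3) sl by (simp add: signed_list_def)
  have rng: "in_range (length X) d" using Z(2) len by (cases d) auto
  have "compatible X (piece_act ?xs d)"
  proof (cases d)
    case (Crossing p)
    have "p + 1 < length ?xs" using Crossing rng sl by (simp add: signed_list_def)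
    then obtain A x y B where xs: "?xs = A @ x # y # B" "length A = p" by (rule split_at_crossing)
    have "strand_black X x \<or> strand_black X y" using Z(2) IH(3) xs Crossing by (auto simp: nth_append)
    then show ?thesis using IH(2) xs Crossing swap_at_append[of A x y B]
      by (auto simp: compatible_def sorted_wrt_append)
  next
    case Mirror
    obtain x B where xs: "?xs = x # B" using Z(2) IH(3) Mirror by (cases ?xs) auto
    have "strand_black X x" using Z(2) IH(3) xs Mirror by auto
    then show ?thesis using IH(2) xs Mirror by (auto simp: compatible_def)
  qed
  then show ?case using piece_target_strands[OF X sl rng] IH Z(3) rng by simp
qed

text \<open>In a reduced word every last piece is a descent of the state above it, so compatibility
  of the final state passes down to all prefixes and makes every piece legal.\<close>

lemma reduced_is_diagram:
  assumes X: "involutive_on \<tau> X"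
  shows "reduced (length X) ds \<Longrightarrow> compatible X (state (length X) ds) \<Longrightarrow>
    is_diagram \<tau> X (map (strand_letter \<tau> X) (state (length X) ds)) ds"
proof (induction ds rule: rev_induct)
  case Nil
  then show ?case by (simp add: map_strand_letter_ident)
next
  case (snoc d ds)
  let ?xs = "state (length X) (ds @ [d])"
  have r: "reduced (length X) ds" "in_range (length X) d" using snoc.prems(1) by (auto simp: reduced_snoc)
  note i = state_init[OF snoc.prems(1)]
  have sl: "signed_list (length X) ?xs" using snoc.prems(1) unfolding reduced_def by (blast intro: signed_list_state)
  have c: "compatible X (state (length X) ds)"
    using compatible_descent(1)[OF snoc.prems(2) sl r(2) i(2)] unfolding i(1) .
  have ok: "piece_ok (map (strand_letter \<tau> X) (state (length X) ds)) d"
    using compatible_descent(2)[OF snoc.prems(2) sl r(2) i(2)] unfolding i(1) .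
  have sl': "signed_list (length X) (state (length X) ds)" using r(1) unfolding reduced_def by (blast intro: signed_list_state)
  show ?case unfolding is_diagram_snoc
    by (intro exI[of _ "map (strand_letter \<tau> X) (state (length X) ds)"] conjI)
      (simp_all only: snoc.IH[OF r(1) c] ok piece_target_strands[OF X sl' r(2)] state_snoc)
qed

section \<open>Calculus in the oKLRW category\<close>

declare mor_eq.trans [trans]

text \<open>Bracketed like the right-hand sides of \<open>piece_mor\<close> and
  \<open>black_dot\<close>.\<close>

definition ctx :: "'v wrd \<Rightarrow> ('v, 'k) mor \<Rightarrow> 'v wrd \<Rightarrow> ('v, 'k) mor" where
  "ctx A f B = Ident A \<otimes>\<^sub>k f \<otimes>\<^sub>k Ident B"

text \<open>The dot is indexed by its position in the word rather than by its black strand. At a red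
  position it is an identity, which avoids a case distinction when dots move through pieces.\<close>

definition dot_at :: "'v wrd \<Rightarrow> nat \<Rightarrow> ('v, 'k) mor" where
  "dot_at X p = ctx (take p X) (dot_on (X ! p)) (drop (Suc p) X)"

lemma dot_at_append': "p = length A \<Longrightarrow> dot_at (A @ a # B) p = ctx A (dot_on a) B"
  by (simp add: dot_at_def)

lemma piece_mor_append: "piece_mor (A @ a # b # B) (Crossing (length A)) = ctx A (Cross a b) B"
  by (simp add: ctx_def nth_append)

lemma split_at:
  assumes "p < length xs"
  obtains A x B where "xs = A @ x # B" "length A = p"
proof -
  have "xs = take p xs @ xs ! p # drop (Suc p) xs" "length (take p xs) = p"
    using assms by (simp_all add: id_take_nth_drop)
  then show ?thesis using that by blast
qed

lemma black_dot_eq_dot_at: "black_dot X r = dot_at X (black_positions X ! (r - 1))"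
  by (simp add: black_dot_def dot_at_def ctx_def Let_def)

text \<open>\<open>scalars\<close> carries no data; it makes the field type \<open>'k\<close> part
  of the context.\<close>

locale oklrw = involutive_quiver Q \<tau> \<tau>\<^sub>1
  for Q :: "('v, 'a) pre_digraph" and \<tau> :: "'v \<Rightarrow> 'v" and \<tau>\<^sub>1 :: "'a \<Rightarrow> 'a" +
  fixes \<mu> :: "'v weight" and scalars :: "'k :: field itself"
begin

abbreviation arrow :: "cat \<Rightarrow> 'v wrd \<Rightarrow> 'v wrd \<Rightarrow> ('v, 'k) mor \<Rightarrow> bool" where
  "arrow \<equiv> is_mor Q \<tau>"

abbreviation eqv :: "cat \<Rightarrow> 'v wrd \<Rightarrow> 'v wrd \<Rightarrow> ('v, 'k) mor \<Rightarrow> ('v, 'k) mor \<Rightarrow> bool" where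
  "eqv \<equiv> mor_eq Q \<tau> \<mu>"

lemma arrow_objects: "arrow c X Y f \<Longrightarrow> X \<in> objects Q \<and> Y \<in> objects Q"
  by (induction rule: is_mor.induct) (auto simp: letters_def tau_closed)

lemma arrow_mono: "arrow KLRW X Y f \<Longrightarrow> arrow c X Y f"
proof (induction KLRW X Y f rule: is_mor.induct)
  case (compose X Y f Z g)
  show ?case by (rule is_mor.compose; fact)
next
  case (tensor X Y f X' Y' g)
  show ?case by (rule is_mor.tensor; fact)
next
  case (plus X Y f g)
  show ?case by (rule is_mor.plus; fact)
next
  case (scale X Y f a)
  show ?case by (rule is_mor.scale; fact)
qed (simp_all add: is_mor.ident is_mor.zero is_mor.dot is_mor.cross)

lemmas eqv_arrow = mor_eq_is_mor

lemma lm: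
  "linear_monoidal_rel f g \<Longrightarrow> arrow c X Y f \<Longrightarrow> arrow c X Y g \<Longrightarrow> eqv c X Y f g"
  "linear_monoidal_rel f g \<Longrightarrow> arrow c X Y f \<Longrightarrow> arrow c X Y g \<Longrightarrow> eqv c X Y g f"
  by (blast intro: mor_eq.linear_monoidal mor_eq.sym)+

lemma comp_cong_left: "eqv c Y Z g g' \<Longrightarrow> arrow c X Y f \<Longrightarrow> eqv c X Z (g \<circ>\<^sub>k f) (g' \<circ>\<^sub>k f)"
  by (intro mor_eq.compose mor_eq.refl)

lemma comp_cong_right: "eqv c X Y f f' \<Longrightarrow> arrow c Y Z g \<Longrightarrow> eqv c X Z (g \<circ>\<^sub>k f) (g \<circ>\<^sub>k f')"
  by (intro mor_eq.compose mor_eq.refl)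

lemma comp_assoc_eqv:
  "arrow c X Y f \<Longrightarrow> arrow c Y Z g \<Longrightarrow> arrow c Z W h \<Longrightarrow> eqv c X W ((h \<circ>\<^sub>k g) \<circ>\<^sub>k f) (h \<circ>\<^sub>k (g \<circ>\<^sub>k f))"
  by (intro lm(1)[OF linear_monoidal_rel.comp_assoc]) (rule is_mor.compose, assumption?, (rule is_mor.compose)?, assumption+)+

lemma ident_left: "arrow c X Y f \<Longrightarrow> eqv c X Y (Ident Y \<circ>\<^sub>k f) f"
  using arrow_objects[of c X Y f] by (intro lm(1)[OF linear_monoidal_rel.comp_ident_left] is_mor.compose[where Y = Y] is_mor.ident) simp_all

lemma ident_right: "arrow c X Y f \<Longrightarrow> eqv c X Y (f \<circ>\<^sub>k Ident X) f"
  using arrow_objects[of c X Y f] by (intro lm(1)[OF linear_monoidal_rel.comp_ident_right] is_mor.compose[where Y = X] is_mor.ident) simp_all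

text \<open>The scalar 0 does not occur in the axioms; it is split as 1 + (-1).\<close>

lemma scale_0: assumes f: "arrow c X Y f" shows "eqv c X Y (0 *\<^sub>k f) (Zero X Y)"
proof -
  note ob = arrow_objects[OF f]
  note ty = is_mor.plus is_mor.scale f is_mor.zero
  have "eqv c X Y ((1 + - 1) *\<^sub>k f) (1 *\<^sub>k f +\<^sub>k (- 1) *\<^sub>k f)"
    by (intro lm linear_monoidal_rel.plus_scale ty)
  also have "eqv c X Y (1 *\<^sub>k f +\<^sub>k (- 1) *\<^sub>k f) (f -\<^sub>k f)"
    by (intro mor_eq.plus lm(1)[OF linear_monoidal_rel.scale_one] mor_eq.refl ty)
  also have "eqv c X Y (f -\<^sub>k f) (Zero X Y)"
    using ob by (intro lm linear_monoidal_rel.plus_neg ty) auto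
  finally show ?thesis by simp
qed

lemma zero_scale: "X \<in> objects Q \<Longrightarrow> Y \<in> objects Q \<Longrightarrow> eqv c X Y (Zero X Y) (0 *\<^sub>k Zero X Y)"
  by (intro mor_eq.sym[OF scale_0] is_mor.zero)

lemma scale_Zero:
  assumes ob: "X \<in> objects Q" "Y \<in> objects Q" shows "eqv c X Y (a *\<^sub>k Zero X Y) (Zero X Y)"
proof -
  note ty = is_mor.scale is_mor.zero ob
  have "eqv c X Y (a *\<^sub>k Zero X Y) (a *\<^sub>k 0 *\<^sub>k Zero X Y)"
    by (intro mor_eq.scale zero_scale ob)
  also have "eqv c X Y (a *\<^sub>k 0 *\<^sub>k Zero X Y) ((a * 0) *\<^sub>k Zero X Y)"
    by (intro lm linear_monoidal_rel.scale_scale ty)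
  also have "eqv c X Y ((a * 0) *\<^sub>k Zero X Y) (Zero X Y)"
    using scale_0[OF is_mor.zero, OF ob] by simp
  finally show ?thesis .
qed

text \<open>\<open>Zero\<close> is 0 times itself, and scalars can be taken out of a
  composition.\<close>

lemma comp_Zero_left:
  assumes f: "arrow c X Y f" and Z: "Z \<in> objects Q" shows "eqv c X Z (Zero Y Z \<circ>\<^sub>k f) (Zero X Z)"
proof -
  note ob = arrow_objects[OF f]
  note ty = is_mor.scale is_mor.zero is_mor.compose[where Y = Y] f Z conjunct1[OF ob] conjunct2[OF ob]
  have "eqv c X Z (Zero Y Z \<circ>\<^sub>k f) ((0 *\<^sub>k Zero Y Z) \<circ>\<^sub>k f)"
    by (intro comp_cong_left[where Y = Y] zero_scale f ty)
  also have "eqv c X Z ((0 *\<^sub>k Zero Y Z) \<circ>\<^sub>k f) (0 *\<^sub>k (Zero Y Z \<circ>\<^sub>k f))"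
    by (intro lm linear_monoidal_rel.comp_scale_left ty)
  also have "eqv c X Z (0 *\<^sub>k (Zero Y Z \<circ>\<^sub>k f)) (Zero X Z)"
    by (intro scale_0 ty)
  finally show ?thesis .
qed

lemma comp_Zero_right:
  assumes f: "arrow c Y Z f" and X: "X \<in> objects Q" shows "eqv c X Z (f \<circ>\<^sub>k Zero X Y) (Zero X Z)"
proof -
  note ob = arrow_objects[OF f]
  note ty = is_mor.scale is_mor.zero is_mor.compose[where Y = Y] f X conjunct1[OF ob] conjunct2[OF ob]
  have "eqv c X Z (f \<circ>\<^sub>k Zero X Y) (f \<circ>\<^sub>k (0 *\<^sub>k Zero X Y))"
    by (intro comp_cong_right[where Y = Y] zero_scale f ty)
  also have "eqv c X Z (f \<circ>\<^sub>k (0 *\<^sub>k Zero X Y)) (0 *\<^sub>k (f \<circ>\<^sub>k Zero X Y))"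
    by (intro lm linear_monoidal_rel.comp_scale_right ty)
  also have "eqv c X Z (0 *\<^sub>k (f \<circ>\<^sub>k Zero X Y)) (Zero X Z)"
    by (intro scale_0 ty)
  finally show ?thesis .
qed

lemma plus_Zero: "arrow c X Y f \<Longrightarrow> eqv c X Y (f +\<^sub>k Zero X Y) f"
  using arrow_objects[of c X Y f] by (intro lm linear_monoidal_rel.plus_zero is_mor.intros) auto

text \<open>The braid relations are stated as differences; this form exposes the correction
  \<open>h\<close>.\<close>

lemma eqv_of_diff:
  assumes fg: "eqv c X Y (f -\<^sub>k g) h" and f: "arrow c X Y f" and g: "arrow c X Y g"
  shows "eqv c X Y f (h +\<^sub>k g)"
proof -
  note ob = arrow_objects[OF f]
  note ty = is_mor.plus is_mor.scale is_mor.zero f g conjunct1[OF ob] conjunct2[OF ob]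
  have "eqv c X Y f (f +\<^sub>k Zero X Y)"
    by (intro mor_eq.sym[OF plus_Zero] f)
  also have "eqv c X Y (f +\<^sub>k Zero X Y) (f +\<^sub>k (g -\<^sub>k g))"
    by (intro mor_eq.plus mor_eq.refl lm(2)[OF linear_monoidal_rel.plus_neg] ty)
  also have "eqv c X Y (f +\<^sub>k (g -\<^sub>k g)) (f +\<^sub>k ((- 1) *\<^sub>k g +\<^sub>k g))"
    by (intro mor_eq.plus mor_eq.refl lm(1)[OF linear_monoidal_rel.plus_comm] ty)
  also have "eqv c X Y (f +\<^sub>k ((- 1) *\<^sub>k g +\<^sub>k g)) ((f -\<^sub>k g) +\<^sub>k g)"
    by (intro lm(2)[OF linear_monoidal_rel.plus_assoc] ty)
  also have "eqv c X Y ((f -\<^sub>k g) +\<^sub>k g) (h +\<^sub>k g)"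
    by (intro mor_eq.plus fg mor_eq.refl ty)
  finally show ?thesis .
qed

subsection \<open>Morphisms in context\<close>

lemma arrow_ctx:
  "arrow KLRW X Y f \<Longrightarrow> A \<in> objects Q \<Longrightarrow> B \<in> objects Q \<Longrightarrow> arrow c (A @ X @ B) (A @ Y @ B) (ctx A f B)"
  unfolding ctx_def by (intro is_mor.tensor is_mor.ident)

lemma ctx_cong:
  "eqv KLRW X Y f g \<Longrightarrow> A \<in> objects Q \<Longrightarrow> B \<in> objects Q \<Longrightarrow> eqv c (A @ X @ B) (A @ Y @ B) (ctx A f B) (ctx A g B)"
  unfolding ctx_def by (intro mor_eq.tensor mor_eq.refl is_mor.ident)

lemma tensor_ident_comp:
  assumes f: "arrow c X Y f" and g: "arrow c Y Z g" and B: "B \<in> objects Q"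
  shows "eqv c (X @ B) (Z @ B) ((g \<circ>\<^sub>k f) \<otimes>\<^sub>k Ident B) ((g \<otimes>\<^sub>k Ident B) \<circ>\<^sub>k (f \<otimes>\<^sub>k Ident B))"
proof -
  note ty = is_mor.tensor is_mor.ident is_mor.compose[OF f g] B
  have I: "arrow KLRW B B (Ident B \<circ>\<^sub>k Ident B)" by (rule is_mor.compose; rule is_mor.ident, rule B)
  have "eqv c (X @ B) (Z @ B) ((g \<circ>\<^sub>k f) \<otimes>\<^sub>k Ident B) ((g \<circ>\<^sub>k f) \<otimes>\<^sub>k (Ident B \<circ>\<^sub>k Ident B))"
    by (intro mor_eq.tensor mor_eq.refl mor_eq.sym[OF ident_left] ty)
  also have "eqv c (X @ B) (Z @ B) ((g \<circ>\<^sub>k f) \<otimes>\<^sub>k (Ident B \<circ>\<^sub>k Ident B)) ((g \<otimes>\<^sub>k Ident B) \<circ>\<^sub>k (f \<otimes>\<^sub>k Ident B))"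
    by (intro lm(2)[OF linear_monoidal_rel.interchange] is_mor.tensor is_mor.compose[where Y = "Y @ B"] f g ty I)
  finally show ?thesis .
qed

lemma ident_tensor_comp:
  assumes f: "arrow KLRW X Y f" and g: "arrow KLRW Y Z g" and A: "A \<in> objects Q"
  shows "eqv c (A @ X) (A @ Z) (Ident A \<otimes>\<^sub>k (g \<circ>\<^sub>k f)) ((Ident A \<otimes>\<^sub>k g) \<circ>\<^sub>k (Ident A \<otimes>\<^sub>k f))"
proof -
  have I0: "arrow c A A (Ident A)" by (rule is_mor.ident, rule A)
  note I = I0 is_mor.compose[OF I0 I0]
  have "eqv c (A @ X) (A @ Z) (Ident A \<otimes>\<^sub>k (g \<circ>\<^sub>k f)) ((Ident A \<circ>\<^sub>k Ident A) \<otimes>\<^sub>k (g \<circ>\<^sub>k f))"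
    by (intro mor_eq.tensor mor_eq.refl mor_eq.sym[OF ident_left] I is_mor.compose[OF f g])
  also have "eqv c (A @ X) (A @ Z) ((Ident A \<circ>\<^sub>k Ident A) \<otimes>\<^sub>k (g \<circ>\<^sub>k f)) ((Ident A \<otimes>\<^sub>k g) \<circ>\<^sub>k (Ident A \<otimes>\<^sub>k f))"
    by (intro lm(2)[OF linear_monoidal_rel.interchange] is_mor.tensor is_mor.compose[where Y = "A @ Y"] f g I is_mor.compose[OF f g])
  finally show ?thesis .
qed

lemma ctx_comp:
  assumes f: "arrow KLRW X Y f" and g: "arrow KLRW Y Z g" and A: "A \<in> objects Q" and B: "B \<in> objects Q"
  shows "eqv c (A @ X @ B) (A @ Z @ B) (ctx A (g \<circ>\<^sub>k f) B) (ctx A g B \<circ>\<^sub>k ctx A f B)"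
proof -
  have "eqv c (A @ X @ B) (A @ Z @ B) (ctx A (g \<circ>\<^sub>k f) B) (Ident A \<otimes>\<^sub>k ((g \<otimes>\<^sub>k Ident B) \<circ>\<^sub>k (f \<otimes>\<^sub>k Ident B)))"
    unfolding ctx_def by (intro mor_eq.tensor mor_eq.refl tensor_ident_comp[OF f g B] is_mor.ident A)
  also have "eqv c (A @ X @ B) (A @ Z @ B) \<dots> (ctx A g B \<circ>\<^sub>k ctx A f B)"
    unfolding ctx_def
    by (rule ident_tensor_comp[OF is_mor.tensor[OF f is_mor.ident[OF B]] is_mor.tensor[OF g is_mor.ident[OF B]] A])
  finally show ?thesis .
qed

lemma ctx_plus:
  assumes f: "arrow KLRW X Y f" and g: "arrow KLRW X Y g" and A: "A \<in> objects Q" and B: "B \<in> objects Q"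
  shows "eqv c (A @ X @ B) (A @ Y @ B) (ctx A (f +\<^sub>k g) B) (ctx A f B +\<^sub>k ctx A g B)"
proof -
  note ty = is_mor.tensor is_mor.plus is_mor.ident f g A B
  have "eqv c (A @ X @ B) (A @ Y @ B) (ctx A (f +\<^sub>k g) B) (Ident A \<otimes>\<^sub>k (f \<otimes>\<^sub>k Ident B +\<^sub>k g \<otimes>\<^sub>k Ident B))"
    unfolding ctx_def by (intro mor_eq.tensor mor_eq.refl lm(1)[OF linear_monoidal_rel.tensor_plus_left] ty)
  also have "eqv c (A @ X @ B) (A @ Y @ B) \<dots> (ctx A f B +\<^sub>k ctx A g B)"
    unfolding ctx_def by (intro lm(1)[OF linear_monoidal_rel.tensor_plus_right] ty)
  finally show ?thesis .
qed

lemma ctx_scale: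
  assumes f: "arrow KLRW X Y f" and A: "A \<in> objects Q" and B: "B \<in> objects Q"
  shows "eqv c (A @ X @ B) (A @ Y @ B) (ctx A (a *\<^sub>k f) B) (a *\<^sub>k ctx A f B)"
proof -
  note ty = is_mor.tensor is_mor.scale is_mor.ident f A B
  have "eqv c (A @ X @ B) (A @ Y @ B) (ctx A (a *\<^sub>k f) B) (Ident A \<otimes>\<^sub>k (a *\<^sub>k (f \<otimes>\<^sub>k Ident B)))"
    unfolding ctx_def by (intro mor_eq.tensor mor_eq.refl lm(1)[OF linear_monoidal_rel.tensor_scale_left] ty)
  also have "eqv c (A @ X @ B) (A @ Y @ B) \<dots> (a *\<^sub>k ctx A f B)"
    unfolding ctx_def by (intro lm(1)[OF linear_monoidal_rel.tensor_scale_right] ty)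
  finally show ?thesis .
qed

lemma ctx_Zero:
  assumes "X \<in> objects Q" "Y \<in> objects Q" and A: "A \<in> objects Q" and B: "B \<in> objects Q"
  shows "eqv c (A @ X @ B) (A @ Y @ B) (ctx A (Zero X Y) B) (Zero (A @ X @ B) (A @ Y @ B))"
proof -
  have z: "arrow KLRW X Y (Zero X Y)" using assms by (intro is_mor.zero)
  have "eqv c (A @ X @ B) (A @ Y @ B) (ctx A (Zero X Y) B) (ctx A (0 *\<^sub>k Zero X Y) B)"
    by (intro ctx_cong zero_scale assms)
  also have "eqv c (A @ X @ B) (A @ Y @ B) \<dots> (0 *\<^sub>k ctx A (Zero X Y) B)"
    by (intro ctx_scale z A B)
  also have "eqv c (A @ X @ B) (A @ Y @ B) \<dots> (Zero (A @ X @ B) (A @ Y @ B))"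
    by (intro scale_0 arrow_ctx z A B)
  finally show ?thesis .
qed

lemma ctx_Ident:
  assumes "X \<in> objects Q" "A \<in> objects Q" "B \<in> objects Q"
  shows "eqv c (A @ X @ B) (A @ X @ B) (ctx A (Ident X) B) (Ident (A @ X @ B))"
proof -
  have [simp]: "X @ B \<in> objects Q" "A @ X @ B \<in> objects Q" using assms by simp_all
  have "eqv c (A @ X @ B) (A @ X @ B) (ctx A (Ident X) B) (Ident A \<otimes>\<^sub>k Ident (X @ B))"
    unfolding ctx_def using assms
    by (intro mor_eq.tensor mor_eq.refl lm(1)[OF linear_monoidal_rel.tensor_ident] is_mor.tensor is_mor.ident) auto
  also have "eqv c (A @ X @ B) (A @ X @ B) \<dots> (Ident (A @ X @ B))"
    using assms by (intro lm(1)[OF linear_monoidal_rel.tensor_ident] is_mor.tensor is_mor.ident) auto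
  finally show ?thesis .
qed

lemma ident_append_tensor:
  assumes g: "arrow KLRW Y Y' g" and "A \<in> objects Q" "B \<in> objects Q"
  shows "eqv c (A @ B @ Y) (A @ B @ Y') (Ident (A @ B) \<otimes>\<^sub>k g) (Ident A \<otimes>\<^sub>k Ident B \<otimes>\<^sub>k g)"
proof -
  have I: "A @ B \<in> objects Q" "arrow c' A A (Ident A)" "arrow c' B B (Ident B)" for c'
    using assms by (auto intro: is_mor.ident)
  have t1: "arrow c (A @ B @ Y) (A @ B @ Y') (Ident (A @ B) \<otimes>\<^sub>k g)"
    using is_mor.tensor[OF is_mor.ident[OF I(1)] g] by simp
  have t2: "arrow c (A @ B @ Y) (A @ B @ Y') ((Ident A \<otimes>\<^sub>k Ident B) \<otimes>\<^sub>k g)"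
    using is_mor.tensor[OF is_mor.tensor[OF I(2,3)] g] by simp
  have t3: "arrow c (A @ B @ Y) (A @ B @ Y') (Ident A \<otimes>\<^sub>k Ident B \<otimes>\<^sub>k g)"
    by (intro is_mor.tensor I g)
  have "eqv c (A @ B) (A @ B) (Ident (A @ B)) (Ident A \<otimes>\<^sub>k Ident B)"
    by (intro lm(2)[OF linear_monoidal_rel.tensor_ident] is_mor.tensor is_mor.ident I assms)
  from mor_eq.tensor[OF this mor_eq.refl[OF g]]
  have "eqv c (A @ B @ Y) (A @ B @ Y') (Ident (A @ B) \<otimes>\<^sub>k g) ((Ident A \<otimes>\<^sub>k Ident B) \<otimes>\<^sub>k g)" by simp
  also have "eqv c (A @ B @ Y) (A @ B @ Y') \<dots> (Ident A \<otimes>\<^sub>k Ident B \<otimes>\<^sub>k g)"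
    by (intro lm(1)[OF linear_monoidal_rel.tensor_assoc] t2 t3)
  finally show ?thesis .
qed

lemma ctx_append_left:
  assumes g: "arrow KLRW Y Y' g" and "A \<in> objects Q" "B \<in> objects Q" "C \<in> objects Q"
  shows "eqv c (A @ B @ Y @ C) (A @ B @ Y' @ C) (ctx (A @ B) g C) (Ident A \<otimes>\<^sub>k ctx B g C)"
  unfolding ctx_def by (intro ident_append_tensor is_mor.tensor assms is_mor.ident)

lemma tensor_ident_append:
  assumes f: "arrow c X X' f" and "A \<in> objects Q" "B \<in> objects Q"
  shows "eqv c (X @ A @ B) (X' @ A @ B) ((f \<otimes>\<^sub>k Ident A) \<otimes>\<^sub>k Ident B) (f \<otimes>\<^sub>k Ident (A @ B))"
proof -
  have AB: "A @ B \<in> objects Q" using assms by simp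
  have t1: "arrow c (X @ A @ B) (X' @ A @ B) ((f \<otimes>\<^sub>k Ident A) \<otimes>\<^sub>k Ident B)"
    using is_mor.tensor[OF is_mor.tensor[OF f] is_mor.ident[OF assms(3)], OF is_mor.ident[OF assms(2)]] by simp
  have t2: "arrow c (X @ A @ B) (X' @ A @ B) (f \<otimes>\<^sub>k Ident A \<otimes>\<^sub>k Ident B)"
    by (intro is_mor.tensor f is_mor.ident assms)
  have "eqv c (X @ A @ B) (X' @ A @ B) ((f \<otimes>\<^sub>k Ident A) \<otimes>\<^sub>k Ident B) (f \<otimes>\<^sub>k Ident A \<otimes>\<^sub>k Ident B)"
    by (intro lm(1)[OF linear_monoidal_rel.tensor_assoc] t1 t2)
  also have "eqv c (X @ A @ B) (X' @ A @ B) \<dots> (f \<otimes>\<^sub>k Ident (A @ B))"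
    using AB assms by (intro mor_eq.tensor mor_eq.refl lm(1)[OF linear_monoidal_rel.tensor_ident] f is_mor.tensor is_mor.ident)
  finally show ?thesis .
qed

lemma ctx_tensor_ident:
  assumes f: "arrow KLRW X X' f" and "A \<in> objects Q" "B \<in> objects Q" "C \<in> objects Q"
  shows "eqv c (A @ X @ B @ C) (A @ X' @ B @ C) (ctx A f B \<otimes>\<^sub>k Ident C) (ctx A f (B @ C))"
proof -
  note I = is_mor.ident[OF assms(2)]
  have t1: "arrow c (A @ X @ B @ C) (A @ X' @ B @ C) (ctx A f B \<otimes>\<^sub>k Ident C)"
    using is_mor.tensor[OF arrow_ctx[OF f assms(2,3)] is_mor.ident[OF assms(4)]] by simp
  have t0: "arrow KLRW (X @ B @ C) (X' @ B @ C) ((f \<otimes>\<^sub>k Ident B) \<otimes>\<^sub>k Ident C)"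
    using is_mor.tensor[OF is_mor.tensor[OF f is_mor.ident[OF assms(3)]] is_mor.ident[OF assms(4)]] by simp
  have "eqv c (A @ X @ B @ C) (A @ X' @ B @ C) (ctx A f B \<otimes>\<^sub>k Ident C) (Ident A \<otimes>\<^sub>k (f \<otimes>\<^sub>k Ident B) \<otimes>\<^sub>k Ident C)"
    using t1 is_mor.tensor[OF I(1) t0] unfolding ctx_def by (rule lm(1)[OF linear_monoidal_rel.tensor_assoc])
  also have "eqv c (A @ X @ B @ C) (A @ X' @ B @ C) \<dots> (ctx A f (B @ C))"
    unfolding ctx_def by (intro mor_eq.tensor mor_eq.refl tensor_ident_append I f assms)
  finally show ?thesis .
qed

lemma ctx_ctx:
  assumes f: "arrow KLRW X X' f" and ob: "A \<in> objects Q" "B \<in> objects Q" "A' \<in> objects Q" "B' \<in> objects Q"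
  shows "eqv c (A @ A' @ X @ B' @ B) (A @ A' @ X' @ B' @ B) (ctx A (ctx A' f B') B) (ctx (A @ A') f (B' @ B))"
proof -
  have BB: "B' @ B \<in> objects Q" using ob by simp
  have "eqv c (A @ A' @ X @ B' @ B) (A @ A' @ X' @ B' @ B) (Ident A \<otimes>\<^sub>k ctx A' f B' \<otimes>\<^sub>k Ident B)
      (Ident A \<otimes>\<^sub>k ctx A' f (B' @ B))"
    by (intro mor_eq.tensor mor_eq.refl ctx_tensor_ident is_mor.ident ob f)
  also have "eqv c (A @ A' @ X @ B' @ B) (A @ A' @ X' @ B' @ B) \<dots> (ctx (A @ A') f (B' @ B))"
    using BB by (intro mor_eq.sym[OF ctx_append_left, of X X' f A A' "B' @ B", simplified] f ob) simp_all
  finally show ?thesis by (simp add: ctx_def)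
qed

lemma tensor_exchange:
  assumes f: "arrow c X X' f" and g: "arrow KLRW Y Y' g"
  shows "eqv c (X @ Y) (X' @ Y') (f \<otimes>\<^sub>k g) ((Ident X' \<otimes>\<^sub>k g) \<circ>\<^sub>k (f \<otimes>\<^sub>k Ident Y))"
    and "eqv c (X @ Y) (X' @ Y') (f \<otimes>\<^sub>k g) ((f \<otimes>\<^sub>k Ident Y') \<circ>\<^sub>k (Ident X \<otimes>\<^sub>k g))"
proof -
  note ob = arrow_objects[OF f] arrow_objects[OF g]
  have I: "arrow c X X (Ident X)" "arrow c X' X' (Ident X')" "arrow KLRW Y Y (Ident Y)" "arrow KLRW Y' Y' (Ident Y')"
    using ob by (auto intro: is_mor.ident)
  have "eqv c (X @ Y) (X' @ Y') (f \<otimes>\<^sub>k g) ((Ident X' \<circ>\<^sub>k f) \<otimes>\<^sub>k (g \<circ>\<^sub>k Ident Y))"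
    by (intro mor_eq.tensor mor_eq.sym[OF ident_left] mor_eq.sym[OF ident_right] f g)
  also have "eqv c (X @ Y) (X' @ Y') \<dots> ((Ident X' \<otimes>\<^sub>k g) \<circ>\<^sub>k (f \<otimes>\<^sub>k Ident Y))"
    by (intro lm(2)[OF linear_monoidal_rel.interchange] is_mor.tensor is_mor.compose[where Y = "X' @ Y"] f g I is_mor.compose[OF f I(2)] is_mor.compose[OF I(3) g])
  finally show "eqv c (X @ Y) (X' @ Y') (f \<otimes>\<^sub>k g) ((Ident X' \<otimes>\<^sub>k g) \<circ>\<^sub>k (f \<otimes>\<^sub>k Ident Y))" .
  have "eqv c (X @ Y) (X' @ Y') (f \<otimes>\<^sub>k g) ((f \<circ>\<^sub>k Ident X) \<otimes>\<^sub>k (Ident Y' \<circ>\<^sub>k g))"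
    by (intro mor_eq.tensor mor_eq.sym[OF ident_left] mor_eq.sym[OF ident_right] f g)
  also have "eqv c (X @ Y) (X' @ Y') \<dots> ((f \<otimes>\<^sub>k Ident Y') \<circ>\<^sub>k (Ident X \<otimes>\<^sub>k g))"
    by (intro lm(2)[OF linear_monoidal_rel.interchange] is_mor.tensor is_mor.compose[where Y = "X @ Y'"] f g I is_mor.compose[OF I(1) f] is_mor.compose[OF g I(4)])
  finally show "eqv c (X @ Y) (X' @ Y') (f \<otimes>\<^sub>k g) ((f \<otimes>\<^sub>k Ident Y') \<circ>\<^sub>k (Ident X \<otimes>\<^sub>k g))" .
qed

text \<open>Disjoint morphisms commute by the interchange law. The left factor may contain
  reflections, since nothing stands to its left.\<close>

lemma far_exchange:
  assumes f: "arrow c X X' f" and g: "arrow KLRW Y Y' g" and ob: "B \<in> objects Q" "C \<in> objects Q"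
  shows "eqv c (X @ B @ Y @ C) (X' @ B @ Y' @ C)
    (ctx (X' @ B) g C \<circ>\<^sub>k (f \<otimes>\<^sub>k Ident (B @ Y @ C))) ((f \<otimes>\<^sub>k Ident (B @ Y' @ C)) \<circ>\<^sub>k ctx (X @ B) g C)"
proof -
  let ?g = "ctx B g C"
  have g': "arrow KLRW (B @ Y @ C) (B @ Y' @ C) ?g" by (intro arrow_ctx g ob)
  have XX: "X \<in> objects Q" "X' \<in> objects Q" "Y \<in> objects Q" "Y' \<in> objects Q"
    using arrow_objects[OF f] arrow_objects[OF g] by auto
  have tf: "arrow c (X @ B @ Z @ C) (X' @ B @ Z @ C) (f \<otimes>\<^sub>k Ident (B @ Z @ C))" if "Z \<in> objects Q" for Z
    using that ob f by (intro is_mor.tensor is_mor.ident) simp_all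
  have "eqv c (X @ B @ Y @ C) (X' @ B @ Y' @ C) (ctx (X' @ B) g C \<circ>\<^sub>k (f \<otimes>\<^sub>k Ident (B @ Y @ C)))
     ((Ident X' \<otimes>\<^sub>k ?g) \<circ>\<^sub>k (f \<otimes>\<^sub>k Ident (B @ Y @ C)))"
    by (intro comp_cong_left[where Y = "X' @ B @ Y @ C"] ctx_append_left tf g ob XX)
  also have "eqv c (X @ B @ Y @ C) (X' @ B @ Y' @ C) \<dots> (f \<otimes>\<^sub>k ?g)"
    by (intro mor_eq.sym[OF tensor_exchange(1)] f g')
  also have "eqv c (X @ B @ Y @ C) (X' @ B @ Y' @ C) \<dots> ((f \<otimes>\<^sub>k Ident (B @ Y' @ C)) \<circ>\<^sub>k (Ident X \<otimes>\<^sub>k ?g))"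
    by (intro tensor_exchange(2) f g')
  also have "eqv c (X @ B @ Y @ C) (X' @ B @ Y' @ C) \<dots> ((f \<otimes>\<^sub>k Ident (B @ Y' @ C)) \<circ>\<^sub>k ctx (X @ B) g C)"
    by (intro comp_cong_right[where Y = "X @ B @ Y' @ C"] mor_eq.sym[OF ctx_append_left] tf g ob XX)
  finally show ?thesis .
qed

lemma ident_tensor_tensor_ident:
  assumes f: "arrow KLRW X X' f" and ob: "A \<in> objects Q" "B \<in> objects Q"
  shows "eqv c (A @ X @ B) (A @ X' @ B) ((Ident A \<otimes>\<^sub>k f) \<otimes>\<^sub>k Ident B) (ctx A f B)"
proof -
  have "arrow c (A @ X @ B) (A @ X' @ B) ((Ident A \<otimes>\<^sub>k f) \<otimes>\<^sub>k Ident B)"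
    using is_mor.tensor[OF is_mor.tensor[OF is_mor.ident[OF ob(1)] f] is_mor.ident[OF ob(2)]] by simp
  moreover have "arrow c (A @ X @ B) (A @ X' @ B) (ctx A f B)" by (rule arrow_ctx[OF f ob])
  ultimately show ?thesis unfolding ctx_def by (rule lm(1)[OF linear_monoidal_rel.tensor_assoc])
qed

lemma ctx_far:
  assumes f: "arrow KLRW X X' f" and g: "arrow KLRW Y Y' g" and ob: "A \<in> objects Q" "B \<in> objects Q" "C \<in> objects Q"
  shows "eqv c (A @ X @ B @ Y @ C) (A @ X' @ B @ Y' @ C)
    (ctx (A @ X' @ B) g C \<circ>\<^sub>k ctx A f (B @ Y @ C)) (ctx A f (B @ Y' @ C) \<circ>\<^sub>k ctx (A @ X @ B) g C)"
proof -
  let ?f = "Ident A \<otimes>\<^sub>k f"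
  have XX: "X \<in> objects Q" "X' \<in> objects Q" "Y \<in> objects Q" "Y' \<in> objects Q"
    using arrow_objects[OF f] arrow_objects[OF g] by auto
  have f': "arrow c (A @ X) (A @ X') ?f" by (intro is_mor.tensor is_mor.ident ob f)
  have e: "eqv c (A @ X @ B @ Z @ C) (A @ X' @ B @ Z @ C) (?f \<otimes>\<^sub>k Ident (B @ Z @ C)) (ctx A f (B @ Z @ C))"
    if "Z \<in> objects Q" for Z using that ob by (intro ident_tensor_tensor_ident f) simp_all
  have tg: "arrow c (A @ Z @ B @ Y @ C) (A @ Z @ B @ Y' @ C) (ctx (A @ Z @ B) g C)" if "Z \<in> objects Q" for Z
    using arrow_ctx[OF g, of "A @ Z @ B" C c] ob that by simp
  have "eqv c (A @ X @ B @ Y @ C) (A @ X' @ B @ Y' @ C) (ctx (A @ X' @ B) g C \<circ>\<^sub>k ctx A f (B @ Y @ C))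
     (ctx (A @ X' @ B) g C \<circ>\<^sub>k (?f \<otimes>\<^sub>k Ident (B @ Y @ C)))"
    by (intro comp_cong_right[where Y = "A @ X' @ B @ Y @ C"] mor_eq.sym[OF e] tg XX)
  also have "eqv c (A @ X @ B @ Y @ C) (A @ X' @ B @ Y' @ C) \<dots> ((?f \<otimes>\<^sub>k Ident (B @ Y' @ C)) \<circ>\<^sub>k ctx (A @ X @ B) g C)"
    using far_exchange[OF f' g ob(2,3)] by simp
  also have "eqv c (A @ X @ B @ Y @ C) (A @ X' @ B @ Y' @ C) \<dots> (ctx A f (B @ Y' @ C) \<circ>\<^sub>k ctx (A @ X @ B) g C)"
    by (intro comp_cong_left[where Y = "A @ X @ B @ Y' @ C"] e tg XX)
  finally show ?thesis .
qed

end

declare piece_mor.simps [simp del]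

lemma piece_mor_append': "p = length A \<Longrightarrow> piece_mor (A @ a # b # B) (Crossing p) = ctx A (Cross a b) B"
  by (simp only: piece_mor_append)

lemma swap_at_append': "p = length A \<Longrightarrow> swap_at p (A @ x # y # B) = A @ y # x # B"
  by (simp only: swap_at_append)

context oklrw
begin

lemma ctx_tensor_right:
  assumes f: "arrow KLRW X X' f" and ob: "A \<in> objects Q" "C \<in> objects Q" "B \<in> objects Q"
  shows "eqv c (A @ X @ C @ B) (A @ X' @ C @ B) (ctx A (f \<otimes>\<^sub>k Ident C) B) (ctx A f (C @ B))"
  unfolding ctx_def by (intro mor_eq.tensor mor_eq.refl is_mor.ident tensor_ident_append f ob)

lemma ctx_tensor_left:
  assumes f: "arrow KLRW X X' f" and ob: "A \<in> objects Q" "C \<in> objects Q" "B \<in> objects Q"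
  shows "eqv c (A @ C @ X @ B) (A @ C @ X' @ B) (ctx A (Ident C \<otimes>\<^sub>k f) B) (ctx (A @ C) f B)"
proof -
  have "eqv c (A @ C @ X @ B) (A @ C @ X' @ B) (ctx A (Ident C \<otimes>\<^sub>k f) B) (Ident A \<otimes>\<^sub>k ctx C f B)"
    unfolding ctx_def[of A] by (intro mor_eq.tensor mor_eq.refl is_mor.ident ident_tensor_tensor_ident f ob)
  also have "eqv c (A @ C @ X @ B) (A @ C @ X' @ B) \<dots> (ctx (A @ C) f B)"
    by (rule mor_eq.sym[OF ctx_append_left[OF f ob]])
  finally show ?thesis .
qed

lemma ctx_Nil:
  assumes f: "arrow KLRW X X' f" and ob: "B \<in> objects Q"
  shows "eqv c (X @ B) (X' @ B) (ctx [] f B) (f \<otimes>\<^sub>k Ident B)"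
proof -
  have t: "arrow c (X @ B) (X' @ B) (f \<otimes>\<^sub>k Ident B)" by (intro is_mor.tensor arrow_mono[OF f] is_mor.ident ob)
  have "arrow c (X @ B) (X' @ B) (ctx [] f B)" using arrow_ctx[OF f _ ob, of "[]" c] by simp
  then show ?thesis using t unfolding ctx_def by (rule lm(1)[OF linear_monoidal_rel.tensor_unit_left])
qed

lemma eqv_move:
  assumes fg: "eqv c X Y f (g +\<^sub>k h)" and g: "arrow c X Y g" and h: "arrow c X Y h"
  shows "eqv c X Y g (f +\<^sub>k (- 1) *\<^sub>k h)"
proof -
  note f = eqv_arrow(1)[OF fg]
  note ob = arrow_objects[OF f]
  note ty = is_mor.plus is_mor.scale is_mor.zero f g h conjunct1[OF ob] conjunct2[OF ob]
  have "eqv c X Y (f +\<^sub>k (- 1) *\<^sub>k h) ((g +\<^sub>k h) +\<^sub>k (- 1) *\<^sub>k h)"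
    by (intro mor_eq.plus fg mor_eq.refl ty)
  also have "eqv c X Y \<dots> (g +\<^sub>k (h -\<^sub>k h))"
    by (intro lm(1)[OF linear_monoidal_rel.plus_assoc] ty)
  also have "eqv c X Y \<dots> (g +\<^sub>k Zero X Y)"
    by (intro mor_eq.plus mor_eq.refl lm(1)[OF linear_monoidal_rel.plus_neg] ty)
  also have "eqv c X Y \<dots> g" by (rule plus_Zero[OF g])
  finally show ?thesis by (rule mor_eq.sym)
qed

lemma scale_one_eqv: "arrow c X Y f \<Longrightarrow> eqv c X Y (1 *\<^sub>k f) f"
  by (rule lm(1)[OF linear_monoidal_rel.scale_one is_mor.scale])

lemma comp_plus_left_eqv:
  assumes "arrow c X Y f" "arrow c Y Z g" "arrow c Y Z g'"
  shows "eqv c X Z ((g +\<^sub>k g') \<circ>\<^sub>k f) (g \<circ>\<^sub>k f +\<^sub>k g' \<circ>\<^sub>k f)"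
  by (rule lm(1)[OF linear_monoidal_rel.comp_plus_left is_mor.compose[OF assms(1) is_mor.plus[OF assms(2,3)]]
        is_mor.plus[OF is_mor.compose[OF assms(1,2)] is_mor.compose[OF assms(1,3)]]])

lemma comp_plus_right_eqv:
  assumes "arrow c Y Z g" "arrow c X Y f" "arrow c X Y f'"
  shows "eqv c X Z (g \<circ>\<^sub>k (f +\<^sub>k f')) (g \<circ>\<^sub>k f +\<^sub>k g \<circ>\<^sub>k f')"
  by (rule lm(1)[OF linear_monoidal_rel.comp_plus_right is_mor.compose[OF is_mor.plus[OF assms(2,3)] assms(1)]
        is_mor.plus[OF is_mor.compose[OF assms(2,1)] is_mor.compose[OF assms(3,1)]]])

lemma comp_scale_left_eqv:
  assumes "arrow c X Y f" "arrow c Y Z g"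
  shows "eqv c X Z ((a *\<^sub>k g) \<circ>\<^sub>k f) (a *\<^sub>k (g \<circ>\<^sub>k f))"
  by (rule lm(1)[OF linear_monoidal_rel.comp_scale_left is_mor.compose[OF assms(1) is_mor.scale[OF assms(2)]]
        is_mor.scale[OF is_mor.compose[OF assms]]])

lemma comp_scale_right_eqv:
  assumes "arrow c X Y f" "arrow c Y Z g"
  shows "eqv c X Z (g \<circ>\<^sub>k (a *\<^sub>k f)) (a *\<^sub>k (g \<circ>\<^sub>k f))"
  by (rule lm(1)[OF linear_monoidal_rel.comp_scale_right is_mor.compose[OF is_mor.scale[OF assms(1)] assms(2)]
        is_mor.scale[OF is_mor.compose[OF assms]]])

subsection \<open>Typing of diagrams and dots\<close>

lemma arrow_dot_on: "a \<in> letters Q \<Longrightarrow> arrow c [a] [a] (dot_on a)"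
  by (cases a) (auto simp: letters_def intro!: is_mor.dot is_mor.ident)

lemma arrow_dot_at:
  assumes "p < length X" "X \<in> objects Q"
  shows "arrow c X X (dot_at X p)"
proof -
  obtain A a B where X: "X = A @ a # B" "length A = p" using assms(1) by (rule split_at)
  then have "arrow KLRW [a] [a] (dot_on a)" "A \<in> objects Q" "B \<in> objects Q"
    using assms(2) by (auto intro: arrow_dot_on)
  from arrow_ctx[OF this, of c] X show ?thesis by (simp add: dot_at_append')
qed

lemma black_positions_nth:
  assumes "1 \<le> r" "r \<le> length (black_positions X)"
  shows "black_positions X ! (r - 1) < length X" "is_black (X ! (black_positions X ! (r - 1)))"
proof -
  have "black_positions X ! (r - 1) \<in> set (black_positions X)" using assms by (intro nth_mem) simp
  then show "black_positions X ! (r - 1) < length X" "is_black (X ! (black_positions X ! (r - 1)))"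
    by (auto simp: black_positions_def)
qed

lemma black_position_index:
  assumes "p < length X" "is_black (X ! p)"
  obtains r where "1 \<le> r" "r \<le> length (black_positions X)" "black_positions X ! (r - 1) = p"
proof -
  have "p \<in> set (black_positions X)" using assms by (simp add: black_positions_def)
  then obtain i where "i < length (black_positions X)" "black_positions X ! i = p" by (auto simp: in_set_conv_nth)
  then show ?thesis using that[of "Suc i"] by simp
qed

lemma arrow_black_dot:
  "1 \<le> r \<Longrightarrow> r \<le> length (black_positions X) \<Longrightarrow> X \<in> objects Q \<Longrightarrow> arrow c X X (black_dot X r)"
  unfolding black_dot_eq_dot_at by (intro arrow_dot_at black_positions_nth)

lemma arrow_mor_power: "arrow c X X f \<Longrightarrow> arrow c X X (mor_power X f n)"
proof (induction n)
  case 0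
  then show ?case using arrow_objects[OF 0] by (simp add: is_mor.ident)
next
  case (Suc n)
  then show ?case by (auto intro: is_mor.compose[OF Suc.IH])
qed

lemma arrow_dot_foldr:
  assumes "X \<in> objects Q" "\<And>r. r \<in> set rs \<Longrightarrow> arrow c X X (h r)"
  shows "arrow c X X (foldr (\<lambda>r g. h r \<circ>\<^sub>k g) rs (Ident X))"
  using assms(2)
proof (induction rs)
  case Nil
  then show ?case by (simp add: is_mor.ident[OF assms(1)])
next
  case (Cons r rs)
  have "arrow c X X (h r)" "arrow c X X (foldr (\<lambda>r g. h r \<circ>\<^sub>k g) rs (Ident X))" using Cons by simp_all
  then show ?case by (simp add: is_mor.compose)
qed

lemma arrow_dot_monomial:
  "X \<in> objects Q \<Longrightarrow> length as = length (black_positions X) \<Longrightarrow> arrow c X X (dot_monomial X as)"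
  unfolding dot_monomial_def by (rule arrow_dot_foldr) (auto intro!: arrow_mor_power arrow_black_dot)

lemma crossing_okE:
  assumes "piece_ok X (Crossing p)"
  obtains A a b B where "X = A @ a # b # B" "length A = p" "is_black a \<or> is_black b"
proof -
  have "p + 1 < length X" using assms by simp
  then obtain A a b B where X: "X = A @ a # b # B" "length A = p" by (rule split_at_crossing)
  then show ?thesis using that[of A a b B] assms by (auto simp: nth_append)
qed

lemma mirror_okE:
  assumes "piece_ok X Mirror"
  obtains i B where "X = Black i # B"
  using assms by (cases X; cases "hd X") auto

lemma arrow_piece:
  assumes ok: "piece_ok X d" and X: "X \<in> objects Q"
  shows "arrow oKLRW X (piece_target \<tau> X d) (piece_mor X d)"
proof (cases d)
  case (Crossing p)
  then obtain A a b B where X': "X = A @ a # b # B" "length A = p" "is_black a \<or> is_black b"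
    using ok crossing_okE by metis
  have "arrow KLRW [a, b] [b, a] (Cross a b)" using X X' by (intro is_mor.cross) auto
  then have "arrow oKLRW (A @ [a, b] @ B) (A @ [b, a] @ B) (ctx A (Cross a b) B)" using X X' by (intro arrow_ctx) auto
  then show ?thesis using X' Crossing by (simp add: piece_mor_append' swap_at_append')
next
  case Mirror
  then obtain i B where X': "X = Black i # B" using ok mirror_okE by metis
  have "arrow oKLRW ([Black i] @ B) ([Black (\<tau> i)] @ B) (Reflect i \<otimes>\<^sub>k Ident B)"
    using X X' by (intro is_mor.tensor is_mor.reflect is_mor.ident) (auto simp: letters_def)
  then show ?thesis using X' Mirror by (simp add: piece_mor.simps)
qed

lemma objects_piece_target: "piece_ok X d \<Longrightarrow> X \<in> objects Q \<Longrightarrow> piece_target \<tau> X d \<in> objects Q"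
  using arrow_objects[OF arrow_piece] by blast

lemma arrow_diagram:
  "is_diagram \<tau> X Y ds \<Longrightarrow> X \<in> objects Q \<Longrightarrow> arrow oKLRW X Y (diagram_mor \<tau> X ds)"
proof (induction ds arbitrary: X)
  case Nil
  then show ?case by (simp add: is_mor.ident)
next
  case (Cons d ds)
  then have ok: "piece_ok X d" by simp
  have "arrow oKLRW (piece_target \<tau> X d) Y (diagram_mor \<tau> (piece_target \<tau> X d) ds)"
    using Cons objects_piece_target by simp
  then show ?case using is_mor.compose[OF arrow_piece[OF ok Cons.prems(2)]] by simp
qed

lemma diagram_append:
  assumes "is_diagram \<tau> X Z ds" "is_diagram \<tau> Z Y es" "X \<in> objects Q"
  shows "eqv oKLRW X Y (diagram_mor \<tau> X (ds @ es)) (diagram_mor \<tau> Z es \<circ>\<^sub>k diagram_mor \<tau> X ds)"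
  using assms
proof (induction ds arbitrary: X)
  case Nil
  then show ?case using mor_eq.sym[OF ident_right[OF arrow_diagram[OF Nil(2)]]] by simp
next
  case (Cons d ds)
  let ?W = "piece_target \<tau> X d"
  have ok: "piece_ok X d" and ds: "is_diagram \<tau> ?W Z ds" using Cons.prems by simp_all
  have W: "?W \<in> objects Q" by (rule objects_piece_target[OF ok Cons.prems(3)])
  have Z: "Z \<in> objects Q" using arrow_objects[OF arrow_diagram[OF ds W]] by simp
  note p = arrow_piece[OF ok Cons.prems(3)]
  have "eqv oKLRW X Y (diagram_mor \<tau> ?W (ds @ es) \<circ>\<^sub>k piece_mor X d)
      ((diagram_mor \<tau> Z es \<circ>\<^sub>k diagram_mor \<tau> ?W ds) \<circ>\<^sub>k piece_mor X d)"
    by (rule comp_cong_left[OF Cons.IH[OF ds Cons.prems(2) W] p])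
  also have "eqv oKLRW X Y \<dots> (diagram_mor \<tau> Z es \<circ>\<^sub>k (diagram_mor \<tau> ?W ds \<circ>\<^sub>k piece_mor X d))"
    by (rule comp_assoc_eqv[OF p arrow_diagram[OF ds W] arrow_diagram[OF Cons.prems(2) Z]])
  finally show ?case by simp
qed

lemma diagram_snoc:
  assumes "is_diagram \<tau> X Z ds" "piece_ok Z d" "X \<in> objects Q"
  shows "eqv oKLRW X (piece_target \<tau> Z d) (diagram_mor \<tau> X (ds @ [d])) (piece_mor Z d \<circ>\<^sub>k diagram_mor \<tau> X ds)"
proof -
  have Z: "Z \<in> objects Q" using arrow_objects[OF arrow_diagram[OF assms(1,3)]] by simp
  have "eqv oKLRW X (piece_target \<tau> Z d) (diagram_mor \<tau> X (ds @ [d])) (diagram_mor \<tau> Z [d] \<circ>\<^sub>k diagram_mor \<tau> X ds)"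
    using assms by (intro diagram_append) simp_all
  also have "eqv oKLRW X (piece_target \<tau> Z d) (diagram_mor \<tau> Z [d] \<circ>\<^sub>k diagram_mor \<tau> X ds) (piece_mor Z d \<circ>\<^sub>k diagram_mor \<tau> X ds)"
    using comp_cong_left[OF ident_left[OF arrow_piece[OF assms(2) Z]] arrow_diagram[OF assms(1,3)]] by simp
  finally show ?thesis .
qed

subsection \<open>Linear spans and the filtration by the number of crossings\<close>

text \<open>Spans are formed among expressions with fixed source and target and closed under
  \<open>eqv\<close>, so that classes enter only in the basis theorem. Ill-typed members of
  \<open>S\<close> are ignored.\<close>

inductive lin_span :: "('v, 'k) mor set \<Rightarrow> 'v wrd \<Rightarrow> 'v wrd \<Rightarrow> ('v, 'k) mor \<Rightarrow> bool"
  for S X Y where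
  gen: "f \<in> S \<Longrightarrow> arrow oKLRW X Y f \<Longrightarrow> lin_span S X Y f"
| zero: "X \<in> objects Q \<Longrightarrow> Y \<in> objects Q \<Longrightarrow> lin_span S X Y (Zero X Y)"
| plus: "lin_span S X Y f \<Longrightarrow> lin_span S X Y g \<Longrightarrow> lin_span S X Y (f +\<^sub>k g)"
| scale: "lin_span S X Y f \<Longrightarrow> lin_span S X Y (a *\<^sub>k f)"
| equiv: "lin_span S X Y f \<Longrightarrow> eqv oKLRW X Y f g \<Longrightarrow> lin_span S X Y g"

lemma lin_span_equiv': "lin_span S X Y g \<Longrightarrow> eqv oKLRW X Y f g \<Longrightarrow> lin_span S X Y f"
  by (rule lin_span.equiv[OF _ mor_eq.sym])

lemma lin_span_arrow: "lin_span S X Y f \<Longrightarrow> arrow oKLRW X Y f"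
  by (induction rule: lin_span.induct) (auto intro: is_mor.zero is_mor.plus is_mor.scale eqv_arrow)

lemma lin_span_trans:
  assumes "\<And>f. f \<in> S \<Longrightarrow> arrow oKLRW X Y f \<Longrightarrow> lin_span T X Y f"
  shows "lin_span S X Y f \<Longrightarrow> lin_span T X Y f"
proof (induction rule: lin_span.induct)
  case (equiv f g)
  show ?case by (rule lin_span.equiv[OF equiv.IH equiv.hyps(2)])
next
  case (gen f)
  then show ?case by (rule assms)
next
  case zero
  then show ?case by (rule lin_span.zero)
next
  case (plus f g)
  show ?case by (rule lin_span.plus[OF plus.IH])
next
  case (scale f a)
  show ?case by (rule lin_span.scale[OF scale.IH])
qed

lemma lin_span_left:
  assumes S: "\<And>f. f \<in> S \<Longrightarrow> arrow oKLRW X Y f \<Longrightarrow> lin_span T X Z (g \<circ>\<^sub>k f)" and g: "arrow oKLRW Y Z g"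
  shows "lin_span S X Y f \<Longrightarrow> lin_span T X Z (g \<circ>\<^sub>k f)"
proof (induction rule: lin_span.induct)
  case (gen f)
  then show ?case by (rule S)
next
  case zero
  then show ?case using arrow_objects[OF g] lin_span_equiv'[OF lin_span.zero comp_Zero_right[OF g]] by blast
next
  case (plus f f')
  show ?case by (rule lin_span_equiv'[OF lin_span.plus[OF plus.IH] comp_plus_right_eqv[OF g lin_span_arrow[OF plus.hyps(1)] lin_span_arrow[OF plus.hyps(2)]]])
next
  case (scale f a)
  show ?case by (rule lin_span_equiv'[OF lin_span.scale[OF scale.IH] comp_scale_right_eqv[OF lin_span_arrow[OF scale.hyps] g]])
next
  case (equiv f f')
  show ?case by (rule lin_span.equiv[OF equiv.IH comp_cong_right[OF equiv.hyps(2) g]])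
qed

lemma lin_span_right:
  assumes S: "\<And>f. f \<in> S \<Longrightarrow> arrow oKLRW X Y f \<Longrightarrow> lin_span T W Y (f \<circ>\<^sub>k g)" and g: "arrow oKLRW W X g"
  shows "lin_span S X Y f \<Longrightarrow> lin_span T W Y (f \<circ>\<^sub>k g)"
proof (induction rule: lin_span.induct)
  case (gen f)
  then show ?case by (rule S)
next
  case zero
  then show ?case using arrow_objects[OF g] lin_span_equiv'[OF lin_span.zero comp_Zero_left[OF g]] by blast
next
  case (plus f f')
  show ?case by (rule lin_span_equiv'[OF lin_span.plus[OF plus.IH] comp_plus_left_eqv[OF g lin_span_arrow[OF plus.hyps(1)] lin_span_arrow[OF plus.hyps(2)]]])
next
  case (scale f a)
  show ?case by (rule lin_span_equiv'[OF lin_span.scale[OF scale.IH] comp_scale_left_eqv[OF g lin_span_arrow[OF scale.hyps]]])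
next
  case (equiv f f')
  show ?case by (rule lin_span.equiv[OF equiv.IH comp_cong_left[OF equiv.hyps(2) g]])
qed

text \<open>The bound is strict, so \<open>filt (length ds)\<close> is spanned by diagrams with
  fewer pieces than \<open>ds\<close>; the dots, all at the bottom, are not counted.\<close>

definition diagram_gens :: "nat \<Rightarrow> 'v wrd \<Rightarrow> 'v wrd \<Rightarrow> ('v, 'k) mor set" where
  "diagram_gens m X Y = {diagram_mor \<tau> X ds \<circ>\<^sub>k dot_monomial X as | ds as.
     is_diagram \<tau> X Y ds \<and> length as = length (black_positions X) \<and> length ds < m}"

abbreviation "filt m X Y \<equiv> lin_span (diagram_gens m X Y) X Y"

lemma diagram_gens_mono: "m \<le> m' \<Longrightarrow> diagram_gens m X Y \<subseteq> diagram_gens m' X Y"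
  unfolding diagram_gens_def by force

lemma filt_mono:
  assumes "filt m X Y f" "m \<le> m'"
  shows "filt m' X Y f"
proof (rule lin_span_trans[OF _ assms(1)])
  fix g assume "g \<in> diagram_gens m X Y" "arrow oKLRW X Y g"
  then show "filt m' X Y g" using diagram_gens_mono[OF assms(2)] lin_span.gen by blast
qed

lemma filt_gen:
  "is_diagram \<tau> X Y ds \<Longrightarrow> X \<in> objects Q \<Longrightarrow> length as = length (black_positions X) \<Longrightarrow> length ds < m \<Longrightarrow>
    filt m X Y (diagram_mor \<tau> X ds \<circ>\<^sub>k dot_monomial X as)"
  by (rule lin_span.gen) (auto simp: diagram_gens_def intro!: is_mor.compose[OF arrow_dot_monomial arrow_diagram])

lemma filt_piece:
  assumes f: "filt m X Z f" and ok: "piece_ok Z d" and X: "X \<in> objects Q"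
  shows "filt (Suc m) X (piece_target \<tau> Z d) (piece_mor Z d \<circ>\<^sub>k f)"
proof -
  have Z: "Z \<in> objects Q" using arrow_objects[OF lin_span_arrow[OF f]] by simp
  note p = arrow_piece[OF ok Z]
  show ?thesis
  proof (rule lin_span_left[OF _ p f])
    fix g assume "g \<in> diagram_gens m X Z" "arrow oKLRW X Z g"
    then obtain ds as where g: "g = diagram_mor \<tau> X ds \<circ>\<^sub>k dot_monomial X as" "is_diagram \<tau> X Z ds"
       "length as = length (black_positions X)" "length ds < m" by (auto simp: diagram_gens_def)
    note td = arrow_diagram[OF g(2) X] and tm = arrow_dot_monomial[OF X g(3)]
    have gen: "filt (Suc m) X (piece_target \<tau> Z d) (diagram_mor \<tau> X (ds @ [d]) \<circ>\<^sub>k dot_monomial X as)"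
      using g ok by (intro filt_gen X) (auto simp: is_diagram_snoc)
    have "eqv oKLRW X (piece_target \<tau> Z d) (diagram_mor \<tau> X (ds @ [d]) \<circ>\<^sub>k dot_monomial X as)
        ((piece_mor Z d \<circ>\<^sub>k diagram_mor \<tau> X ds) \<circ>\<^sub>k dot_monomial X as)"
      by (rule comp_cong_left[OF diagram_snoc[OF g(2) ok X] tm])
    also have "eqv oKLRW X (piece_target \<tau> Z d) \<dots> (piece_mor Z d \<circ>\<^sub>k g)"
      unfolding g(1) by (rule comp_assoc_eqv[OF tm td p])
    finally show "filt (Suc m) X (piece_target \<tau> Z d) (piece_mor Z d \<circ>\<^sub>k g)"
      by (rule lin_span.equiv[OF gen])
  qed
qed

subsection \<open>Moving dots\<close>

lemma dot_at_commute:
  assumes "p < length X" "q < length X" "X \<in> objects Q"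
  shows "eqv c X X (dot_at X p \<circ>\<^sub>k dot_at X q) (dot_at X q \<circ>\<^sub>k dot_at X p)"
proof -
  have less: "eqv c X X (dot_at X q \<circ>\<^sub>k dot_at X p) (dot_at X p \<circ>\<^sub>k dot_at X q)"
    if "p < q" "q < length X" for p q
  proof -
    note pq = that
    obtain A' b C where X: "X = A' @ b # C" "length A' = q" using pq(2) by (rule split_at)
    have "p < length A'" using pq X by simp
    then obtain A a B where A': "A' = A @ a # B" "length A = p" by (rule split_at)
    have ob: "A \<in> objects Q" "B \<in> objects Q" "C \<in> objects Q" "a \<in> letters Q" "b \<in> letters Q"
      using assms(3) X A' by auto
    have e: "dot_at X p = ctx A (dot_on a) (B @ [b] @ C)" "dot_at X q = ctx (A @ [a] @ B) (dot_on b) C"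
      unfolding X(1) dot_at_append'[OF X(2)[symmetric]] unfolding A'(1) by (simp_all add: dot_at_append' A'(2))
    show ?thesis
      using ctx_far[OF arrow_dot_on[OF ob(4)] arrow_dot_on[OF ob(5)] ob(1-3), of c] unfolding e using X A' by simp
  qed
  consider "p = q" | "p < q" | "q < p" by linarith
  then show ?thesis
  proof cases
    case 1
    then show ?thesis using assms by (auto intro!: mor_eq.refl is_mor.compose[OF arrow_dot_at arrow_dot_at])
  next
    case 2
    then show ?thesis using less[of p q] assms by (intro mor_eq.sym[OF less])
  next
    case 3
    then show ?thesis using less[of q p] assms by simp
  qed
qed

lemma commute_power:
  assumes f: "arrow c X X f" and g: "arrow c X X g" and fg: "eqv c X X (f \<circ>\<^sub>k g) (g \<circ>\<^sub>k f)"
  shows "eqv c X X (f \<circ>\<^sub>k mor_power X g n) (mor_power X g n \<circ>\<^sub>k f)"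
proof (induction n)
  case 0
  show ?case using mor_eq.trans[OF ident_right[OF f] mor_eq.sym[OF ident_left[OF f]]] by simp
next
  case (Suc n)
  note tp = arrow_mor_power[OF g, of n]
  have "eqv c X X (f \<circ>\<^sub>k (g \<circ>\<^sub>k mor_power X g n)) ((f \<circ>\<^sub>k g) \<circ>\<^sub>k mor_power X g n)"
    by (rule mor_eq.sym[OF comp_assoc_eqv[OF tp g f]])
  also have "eqv c X X \<dots> ((g \<circ>\<^sub>k f) \<circ>\<^sub>k mor_power X g n)" by (rule comp_cong_left[OF fg tp])
  also have "eqv c X X \<dots> (g \<circ>\<^sub>k (f \<circ>\<^sub>k mor_power X g n))" by (rule comp_assoc_eqv[OF tp f g])
  also have "eqv c X X \<dots> (g \<circ>\<^sub>k (mor_power X g n \<circ>\<^sub>k f))" by (rule comp_cong_right[OF Suc g])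
  also have "eqv c X X \<dots> ((g \<circ>\<^sub>k mor_power X g n) \<circ>\<^sub>k f)" by (rule mor_eq.sym[OF comp_assoc_eqv[OF f tp g]])
  finally show ?case by simp
qed

text \<open>\<open>D r\<close> passes the powers of the other endomorphisms, with which it commutes,
  until it meets its own power.\<close>

lemma dot_foldr:
  assumes X: "X \<in> objects Q" and t: "\<And>s. s \<in> set rs \<Longrightarrow> arrow c X X (D s)"
    and comm: "\<And>s. s \<in> set rs \<Longrightarrow> eqv c X X (D r \<circ>\<^sub>k D s) (D s \<circ>\<^sub>k D r)"
    and r: "r \<in> set rs" "distinct rs"
  shows "eqv c X X (D r \<circ>\<^sub>k foldr (\<lambda>s g. mor_power X (D s) (a s) \<circ>\<^sub>k g) rs (Ident X))
     (foldr (\<lambda>s g. mor_power X (D s) ((a(r := Suc (a r))) s) \<circ>\<^sub>k g) rs (Ident X))"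
proof -
  have tr: "arrow c X X (D r)" using r t by blast
  from t comm r show ?thesis
  proof (induction rs)
    case (Cons s rs)
    let ?F = "\<lambda>a. foldr (\<lambda>s g. mor_power X (D s) (a s) \<circ>\<^sub>k g) rs (Ident X)"
    let ?a = "a(r := Suc (a r))"
    have tF: "arrow c X X (?F b)" for b by (rule arrow_dot_foldr[OF X]) (auto intro!: arrow_mor_power Cons.prems)
    have ts: "arrow c X X (D s)" using Cons.prems by simp
    note tp = arrow_mor_power[OF ts, of "a s"]
    show ?case
    proof (cases "s = r")
      case True
      then have "?F ?a = ?F a" using Cons.prems(4) by (intro foldr_cong) auto
      then show ?thesis using True mor_eq.sym[OF comp_assoc_eqv[OF tF tp tr]] by simp
    next
      case False
      have IH: "eqv c X X (D r \<circ>\<^sub>k ?F a) (?F ?a)"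
        using Cons.prems False by (intro Cons.IH) auto
      have "eqv c X X (D r \<circ>\<^sub>k (mor_power X (D s) (a s) \<circ>\<^sub>k ?F a)) ((D r \<circ>\<^sub>k mor_power X (D s) (a s)) \<circ>\<^sub>k ?F a)"
        by (rule mor_eq.sym[OF comp_assoc_eqv[OF tF tp tr]])
      also have "eqv c X X \<dots> ((mor_power X (D s) (a s) \<circ>\<^sub>k D r) \<circ>\<^sub>k ?F a)"
        by (rule comp_cong_left[OF commute_power[OF tr ts Cons.prems(2)[of s, simplified]] tF])
      also have "eqv c X X \<dots> (mor_power X (D s) (a s) \<circ>\<^sub>k (D r \<circ>\<^sub>k ?F a))"
        by (rule comp_assoc_eqv[OF tF tr tp])
      also have "eqv c X X \<dots> (mor_power X (D s) (a s) \<circ>\<^sub>k ?F ?a)"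
        by (rule comp_cong_right[OF IH tp])
      finally show ?thesis using False by simp
    qed
  qed simp
qed

lemma black_dot_monomial:
  assumes X: "X \<in> objects Q" and as: "length as = length (black_positions X)"
    and r: "1 \<le> r" "r \<le> length (black_positions X)"
  shows "eqv c X X (black_dot X r \<circ>\<^sub>k dot_monomial X as) (dot_monomial X (as[r - 1 := Suc (as ! (r - 1))]))"
proof -
  let ?rs = "[1..<Suc (length as)]"
  have "eqv c X X (black_dot X r \<circ>\<^sub>k foldr (\<lambda>s g. mor_power X (black_dot X s) (as ! (s - 1)) \<circ>\<^sub>k g) ?rs (Ident X))
     (foldr (\<lambda>s g. mor_power X (black_dot X s) (((\<lambda>s. as ! (s - 1))(r := Suc (as ! (r - 1)))) s) \<circ>\<^sub>k g) ?rs (Ident X))"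
  proof (rule dot_foldr[OF X])
    fix s assume "s \<in> set ?rs"
    then have s: "1 \<le> s" "s \<le> length (black_positions X)" using as by auto
    then show "arrow c X X (black_dot X s)" by (rule arrow_black_dot) (rule X)
    show "eqv c X X (black_dot X r \<circ>\<^sub>k black_dot X s) (black_dot X s \<circ>\<^sub>k black_dot X r)"
      unfolding black_dot_eq_dot_at using s r by (intro dot_at_commute black_positions_nth X)
  qed (use r as in auto)
  moreover have "foldr (\<lambda>s g. mor_power X (black_dot X s) (((\<lambda>s. as ! (s - 1))(r := Suc (as ! (r - 1)))) s) \<circ>\<^sub>k g) ?rs (Ident X)
      = foldr (\<lambda>s g. mor_power X (black_dot X s) (as[r - 1 := Suc (as ! (r - 1))] ! (s - 1)) \<circ>\<^sub>k g) ?rs (Ident X :: ('v, 'k) mor)"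
    using r as by (intro foldr_cong) (auto simp: nth_list_update)
  ultimately show ?thesis by (simp only: dot_monomial_def length_list_update)
qed

lemma dot_at_red:
  assumes "p < length X" "\<not> is_black (X ! p)" "X \<in> objects Q"
  shows "eqv c X X (dot_at X p) (Ident X)"
proof -
  obtain A a B where X: "X = A @ a # B" "length A = p" using assms(1) by (rule split_at)
  then obtain \<theta> where a: "a = Red \<theta>" using assms(2) by (cases a) (auto simp: nth_append)
  have "eqv c (A @ [a] @ B) (A @ [a] @ B) (ctx A (Ident [a]) B) (Ident (A @ [a] @ B))"
    using assms(3) X by (intro ctx_Ident) auto
  then show ?thesis using X a by (simp add: dot_at_append')
qed

lemma dot_monomial_zero:
  assumes X: "X \<in> objects Q"
  shows "eqv c X X (dot_monomial X (replicate n 0)) (Ident X)"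
proof -
  have "eqv c X X (foldr (\<lambda>r g. mor_power X (black_dot X r) (replicate n 0 ! (r - 1)) \<circ>\<^sub>k g) rs (Ident X)) (Ident X)"
    if "set rs \<subseteq> {1..n}" for rs
    using that
  proof (induction rs)
    case Nil
    then show ?case by (auto intro!: mor_eq.refl is_mor.ident X)
  next
    case (Cons r rs)
    then have IH: "eqv c X X (foldr (\<lambda>r g. mor_power X (black_dot X r) (replicate n 0 ! (r - 1)) \<circ>\<^sub>k g) rs (Ident X)) (Ident X)"
      by simp
    have "r - 1 < n" using Cons.prems by auto
    then have [simp]: "replicate n 0 ! (r - Suc 0) = (0::nat)" by simp
    show ?case using mor_eq.trans[OF ident_left[OF eqv_arrow(1)[OF IH]] IH] by simp
  qed
  from this[of "[1..<Suc n]"] show ?thesis by (simp add: dot_monomial_def atLeastLessThanSuc_atLeastAtMost del: upt_Suc)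
qed

lemma filt_diagram:
  assumes "is_diagram \<tau> X Y ds" "X \<in> objects Q" "length ds < m"
  shows "filt m X Y (diagram_mor \<tau> X ds)"
proof -
  let ?as = "replicate (length (black_positions X)) 0"
  note t = arrow_diagram[OF assms(1,2)]
  have "eqv oKLRW X Y (diagram_mor \<tau> X ds) (diagram_mor \<tau> X ds \<circ>\<^sub>k Ident X)"
    by (rule mor_eq.sym[OF ident_right[OF t]])
  also have "eqv oKLRW X Y \<dots> (diagram_mor \<tau> X ds \<circ>\<^sub>k dot_monomial X ?as)"
    by (rule comp_cong_right[OF mor_eq.sym[OF dot_monomial_zero[OF assms(2)]] t])
  finally show ?thesis using filt_gen[OF assms(1,2) _ assms(3), of ?as]
    by (auto intro: lin_span_equiv'[rotated])
qed

text \<open>Stated for letters of either colour; for a dot at a red letter both sides reduce to the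
  crossing by unit laws.\<close>

lemma cross_dot_left:
  assumes "a \<in> letters Q" "b \<in> letters Q" "is_black a \<or> is_black b"
  shows "\<exists>h. (h = Zero [a, b] [b, a] \<or> a = b \<and> h = Ident [a, b]) \<and>
    eqv KLRW [a, b] [b, a] ((dot_on b \<otimes>\<^sub>k Ident [a]) \<circ>\<^sub>k Cross a b) (Cross a b \<circ>\<^sub>k (Ident [a] \<otimes>\<^sub>k dot_on b) +\<^sub>k h)"
proof -
  have I: "arrow KLRW [a] [a] (Ident [a])" by (rule is_mor.ident) (use assms in simp)
  have tc: "arrow KLRW [a, b] [b, a] (Cross a b)" by (rule is_mor.cross) (use assms in auto)
  have z: "arrow KLRW [a, b] [b, a] (Zero [a, b] [b, a])" by (rule is_mor.zero) (use assms in auto)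
  have i2: "arrow KLRW [a, b] [a, b] (Ident [a, b])" by (rule is_mor.ident) (use assms in auto)
  note td = arrow_dot_on[OF assms(2), of KLRW]
  have t1: "arrow KLRW [a, b] [b, a] ((dot_on b \<otimes>\<^sub>k Ident [a]) \<circ>\<^sub>k Cross a b)"
    using is_mor.compose[OF tc] is_mor.tensor[OF td I] by simp
  have t2: "arrow KLRW [a, b] [b, a] (Cross a b \<circ>\<^sub>k (Ident [a] \<otimes>\<^sub>k dot_on b))"
    using is_mor.compose[OF _ tc] is_mor.tensor[OF I td] by simp
  show ?thesis
  proof (cases b)
    case b: (Black j)
    show ?thesis
    proof (cases a)
      case a: (Black i)
      show ?thesis
      proof (cases "i = j")
        case True
        have "eqv KLRW [a, b] [b, a] ((dot_on b \<otimes>\<^sub>k Ident [a]) \<circ>\<^sub>k Cross a b) (Cross a b \<circ>\<^sub>k (Ident [a] \<otimes>\<^sub>k dot_on b) +\<^sub>k Ident [a, b])"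
          using klrw_rel.dot_cross_left[of Q j i] t1 is_mor.plus[OF t2, of "Ident [a, b]"] i2 True unfolding a b
          by (intro mor_eq.klrw) (simp_all add: delta_mor_def)
        then show ?thesis using True a b by blast
      next
        case False
        have "eqv KLRW [a, b] [b, a] ((dot_on b \<otimes>\<^sub>k Ident [a]) \<circ>\<^sub>k Cross a b) (Cross a b \<circ>\<^sub>k (Ident [a] \<otimes>\<^sub>k dot_on b) +\<^sub>k Zero [a, b] [b, a])"
          using klrw_rel.dot_cross_left[of Q j i] t1 is_mor.plus[OF t2 z] False unfolding a b
          by (intro mor_eq.klrw) (simp_all add: delta_mor_def)
        then show ?thesis by blast
      qed
    next
      case a: (Red \<theta>)
      have "eqv KLRW [a, b] [b, a] ((dot_on b \<otimes>\<^sub>k Ident [a]) \<circ>\<^sub>k Cross a b) (Cross a b \<circ>\<^sub>k (Ident [a] \<otimes>\<^sub>k dot_on b))"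
        using klrw_rel.dot_cross_red_left[of Q j \<theta>] t1 t2 unfolding a b by (intro mor_eq.klrw) simp_all
      then show ?thesis using mor_eq.trans[OF _ mor_eq.sym[OF plus_Zero[OF t2]]] by blast
    qed
  next
    case b: (Red \<theta>)
    have J: "arrow KLRW [b] [b] (Ident [b])" by (rule is_mor.ident) (use assms in simp)
    have e1: "eqv KLRW [b, a] [b, a] (dot_on b \<otimes>\<^sub>k Ident [a]) (Ident [b, a])"
      using lm(1)[OF linear_monoidal_rel.tensor_ident is_mor.tensor[OF J I] is_mor.ident] assms by (simp add: b)
    have e2: "eqv KLRW [a, b] [a, b] (Ident [a] \<otimes>\<^sub>k dot_on b) (Ident [a, b])"
      using lm(1)[OF linear_monoidal_rel.tensor_ident is_mor.tensor[OF I J] is_mor.ident] assms by (simp add: b)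
    have "eqv KLRW [a, b] [b, a] ((dot_on b \<otimes>\<^sub>k Ident [a]) \<circ>\<^sub>k Cross a b) (Cross a b)"
      by (rule mor_eq.trans[OF comp_cong_left[OF e1 tc] ident_left[OF tc]])
    also have "eqv KLRW [a, b] [b, a] (Cross a b) (Cross a b \<circ>\<^sub>k (Ident [a] \<otimes>\<^sub>k dot_on b))"
      by (rule mor_eq.sym[OF mor_eq.trans[OF comp_cong_right[OF e2 tc] ident_right[OF tc]]])
    finally show ?thesis using mor_eq.trans[OF _ mor_eq.sym[OF plus_Zero[OF t2]]] by blast
  qed
qed

lemma cross_dot_right:
  assumes "a \<in> letters Q" "b \<in> letters Q" "is_black a \<or> is_black b"
  shows "\<exists>h. (h = Zero [a, b] [b, a] \<or> a = b \<and> h = Ident [a, b]) \<and>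
    eqv KLRW [a, b] [b, a] (Cross a b \<circ>\<^sub>k (dot_on a \<otimes>\<^sub>k Ident [b])) ((Ident [b] \<otimes>\<^sub>k dot_on a) \<circ>\<^sub>k Cross a b +\<^sub>k h)"
proof -
  have I: "arrow KLRW [b] [b] (Ident [b])" by (rule is_mor.ident) (use assms in simp)
  have tc: "arrow KLRW [a, b] [b, a] (Cross a b)" by (rule is_mor.cross) (use assms in auto)
  have z: "arrow KLRW [a, b] [b, a] (Zero [a, b] [b, a])" by (rule is_mor.zero) (use assms in auto)
  have i2: "arrow KLRW [a, b] [a, b] (Ident [a, b])" by (rule is_mor.ident) (use assms in auto)
  note td = arrow_dot_on[OF assms(1), of KLRW]
  have t1: "arrow KLRW [a, b] [b, a] ((Ident [b] \<otimes>\<^sub>k dot_on a) \<circ>\<^sub>k Cross a b)"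
    using is_mor.compose[OF tc] is_mor.tensor[OF I td] by simp
  have t2: "arrow KLRW [a, b] [b, a] (Cross a b \<circ>\<^sub>k (dot_on a \<otimes>\<^sub>k Ident [b]))"
    using is_mor.compose[OF _ tc] is_mor.tensor[OF td I] by simp
  show ?thesis
  proof (cases a)
    case a: (Black i)
    show ?thesis
    proof (cases b)
      case b: (Black j)
      show ?thesis
      proof (cases "i = j")
        case True
        have "eqv KLRW [a, b] [b, a] (Cross a b \<circ>\<^sub>k (dot_on a \<otimes>\<^sub>k Ident [b])) ((Ident [b] \<otimes>\<^sub>k dot_on a) \<circ>\<^sub>k Cross a b +\<^sub>k Ident [a, b])"
          using klrw_rel.dot_cross_right[of Q i j] t2 is_mor.plus[OF t1, of "Ident [a, b]"] i2 True unfolding a b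
          by (intro mor_eq.klrw) (simp_all add: delta_mor_def)
        then show ?thesis using True a b by blast
      next
        case False
        have "eqv KLRW [a, b] [b, a] (Cross a b \<circ>\<^sub>k (dot_on a \<otimes>\<^sub>k Ident [b])) ((Ident [b] \<otimes>\<^sub>k dot_on a) \<circ>\<^sub>k Cross a b +\<^sub>k Zero [a, b] [b, a])"
          using klrw_rel.dot_cross_right[of Q i j] t2 is_mor.plus[OF t1 z] False unfolding a b
          by (intro mor_eq.klrw) (simp_all add: delta_mor_def)
        then show ?thesis by blast
      qed
    next
      case b: (Red \<theta>)
      have "eqv KLRW [a, b] [b, a] (Cross a b \<circ>\<^sub>k (dot_on a \<otimes>\<^sub>k Ident [b])) ((Ident [b] \<otimes>\<^sub>k dot_on a) \<circ>\<^sub>k Cross a b)"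
        using klrw_rel.dot_cross_red_right[of Q i \<theta>] t1 t2 unfolding a b by (intro mor_eq.klrw) simp_all
      then show ?thesis using mor_eq.trans[OF _ mor_eq.sym[OF plus_Zero[OF t1]]] by blast
    qed
  next
    case a: (Red \<theta>)
    have J: "arrow KLRW [a] [a] (Ident [a])" by (rule is_mor.ident) (use assms in simp)
    have e1: "eqv KLRW [b, a] [b, a] (Ident [b] \<otimes>\<^sub>k dot_on a) (Ident [b, a])"
      using lm(1)[OF linear_monoidal_rel.tensor_ident is_mor.tensor[OF I J] is_mor.ident] assms by (simp add: a)
    have e2: "eqv KLRW [a, b] [a, b] (dot_on a \<otimes>\<^sub>k Ident [b]) (Ident [a, b])"
      using lm(1)[OF linear_monoidal_rel.tensor_ident is_mor.tensor[OF J I] is_mor.ident] assms by (simp add: a)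
    have "eqv KLRW [a, b] [b, a] (Cross a b \<circ>\<^sub>k (dot_on a \<otimes>\<^sub>k Ident [b])) (Cross a b)"
      by (rule mor_eq.trans[OF comp_cong_right[OF e2 tc] ident_right[OF tc]])
    also have "eqv KLRW [a, b] [b, a] (Cross a b) ((Ident [b] \<otimes>\<^sub>k dot_on a) \<circ>\<^sub>k Cross a b)"
      by (rule mor_eq.sym[OF mor_eq.trans[OF comp_cong_left[OF e1 tc] ident_left[OF tc]]])
    finally show ?thesis using mor_eq.trans[OF _ mor_eq.sym[OF plus_Zero[OF t1]]] by blast
  qed
qed

end

lemma length_black_positions: "length (black_positions X) = length (filter is_black X)"
proof -
  have "filter is_black X = map ((!) X) (filter (\<lambda>p. is_black (X ! p)) [0..<length X])"
    using filter_map[of is_black "(!) X" "[0..<length X]"] by (simp add: map_nth comp_def)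
  then show ?thesis by (simp add: black_positions_def)
qed

lemma dot_at_eq: "X = A @ a # B \<Longrightarrow> p = length A \<Longrightarrow> dot_at X p = ctx A (dot_on a) B"
  by (simp add: dot_at_append')

context oklrw
begin

lemma dot_piece_local:
  assumes u: "arrow KLRW Y Y u" and v: "arrow KLRW X X v" and s: "arrow KLRW X Y s" and k: "arrow KLRW X Y k"
    and eq: "eqv KLRW X Y (u \<circ>\<^sub>k s) (s \<circ>\<^sub>k v +\<^sub>k k)" and ob: "A \<in> objects Q" "B \<in> objects Q"
  shows "eqv c (A @ X @ B) (A @ Y @ B) (ctx A u B \<circ>\<^sub>k ctx A s B) (ctx A s B \<circ>\<^sub>k ctx A v B +\<^sub>k ctx A k B)"
proof -
  have "eqv c (A @ X @ B) (A @ Y @ B) (ctx A u B \<circ>\<^sub>k ctx A s B) (ctx A (u \<circ>\<^sub>k s) B)"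
    by (rule mor_eq.sym[OF ctx_comp[OF s u ob]])
  also have "eqv c (A @ X @ B) (A @ Y @ B) \<dots> (ctx A (s \<circ>\<^sub>k v +\<^sub>k k) B)" by (rule ctx_cong[OF eq ob])
  also have "eqv c (A @ X @ B) (A @ Y @ B) \<dots> (ctx A (s \<circ>\<^sub>k v) B +\<^sub>k ctx A k B)"
    by (rule ctx_plus[OF is_mor.compose[OF v s] k ob])
  also have "eqv c (A @ X @ B) (A @ Y @ B) \<dots> (ctx A s B \<circ>\<^sub>k ctx A v B +\<^sub>k ctx A k B)"
    by (rule mor_eq.plus[OF ctx_comp[OF v s ob] mor_eq.refl[OF arrow_ctx[OF k ob]]])
  finally show ?thesis .
qed

text \<open>The coefficient \<open>a\<close> is -1 for the dot on the strand that meets the mirror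
  and 1 otherwise. A nonzero correction \<open>h\<close> arises only at a crossing of two equal
  letters; it has lost the crossing, which is why its source and target agree.\<close>

lemma dot_piece:
  assumes ok: "piece_ok Z d" and Z: "Z \<in> objects Q" and p: "p < length Z"
  shows "\<exists>q a h. q < length Z \<and>
    (h = Zero Z (piece_target \<tau> Z d) \<or> piece_target \<tau> Z d = Z \<and> (h = Ident Z \<or> h = (- 1) *\<^sub>k Ident Z)) \<and>
    eqv oKLRW Z (piece_target \<tau> Z d) (dot_at (piece_target \<tau> Z d) p \<circ>\<^sub>k piece_mor Z d)
      (a *\<^sub>k (piece_mor Z d \<circ>\<^sub>k dot_at Z q) +\<^sub>k h)"
proof -
  let ?Z = "piece_target \<tau> Z d"
  have Z': "?Z \<in> objects Q" by (rule objects_piece_target[OF ok Z])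
  note tp = arrow_piece[OF ok Z]
  have plain: ?thesis if "q < length Z" "eqv oKLRW Z ?Z (dot_at ?Z p \<circ>\<^sub>k piece_mor Z d) (a *\<^sub>k (piece_mor Z d \<circ>\<^sub>k dot_at Z q))" for q a
    using that mor_eq.trans[OF that(2) mor_eq.sym[OF plus_Zero[OF eqv_arrow(2)[OF that(2)]]]] by blast
  have scaled: "eqv oKLRW Z ?Z (piece_mor Z d \<circ>\<^sub>k dot_at Z q) (1 *\<^sub>k (piece_mor Z d \<circ>\<^sub>k dot_at Z q))" if "q < length Z" for q
    by (rule mor_eq.sym[OF scale_one_eqv[OF is_mor.compose[OF arrow_dot_at[OF that Z] tp]]])
  have plain1: ?thesis if "q < length Z" "eqv oKLRW Z ?Z (dot_at ?Z p \<circ>\<^sub>k piece_mor Z d) (piece_mor Z d \<circ>\<^sub>k dot_at Z q)" for q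
    using plain[OF that(1)] mor_eq.trans[OF that(2) scaled[OF that(1)]] .
  show ?thesis
  proof (cases d)
    case (Crossing pc)
    obtain A a b B where ZA: "Z = A @ a # b # B" and lA: "length A = pc" and bl: "is_black a \<or> is_black b"
      using ok Crossing crossing_okE by metis
    have ob: "A \<in> objects Q" "B \<in> objects Q" "a \<in> letters Q" "b \<in> letters Q" using Z ZA by auto
    have tc: "arrow KLRW [a, b] [b, a] (Cross a b)" by (rule is_mor.cross[OF ob(3,4) bl])
    have tgt: "?Z = A @ b # a # B" using Crossing ZA lA by (simp add: swap_at_append')
    have pm: "piece_mor Z d = ctx A (Cross a b) B" using Crossing ZA lA by (simp add: piece_mor_append')
    have Ia: "arrow KLRW [a] [a] (Ident [a])" and Ib: "arrow KLRW [b] [b] (Ident [b])"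
      using ob by (auto intro!: is_mor.ident)
    \<comment> \<open>Shared by the dots on the two crossing strands: \<open>u\<close> is the dot
      above the crossing, \<open>v\<close> the same dot below it.\<close>
    have near: ?thesis
      if q: "q < length Z" and du: "eqv oKLRW (A @ [b, a] @ B) (A @ [b, a] @ B) (dot_at ?Z p) (ctx A u B)"
        and dv: "eqv oKLRW (A @ [a, b] @ B) (A @ [a, b] @ B) (ctx A v B) (dot_at Z q)"
        and u: "arrow KLRW [b, a] [b, a] u" and v: "arrow KLRW [a, b] [a, b] v"
        and h: "h = Zero [a, b] [b, a] \<or> a = b \<and> (h = Ident [a, b] \<or> h = (- 1) *\<^sub>k Ident [a, b])"
        and eq: "eqv KLRW [a, b] [b, a] (u \<circ>\<^sub>k Cross a b) (Cross a b \<circ>\<^sub>k v +\<^sub>k h)" for q u v h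
    proof -
      have ab: "[a, b] \<in> objects Q" "[b, a] \<in> objects Q" using ob by auto
      have th: "arrow KLRW [a, b] [b, a] h" using h ab by (auto intro!: is_mor.zero is_mor.scale is_mor.ident)
      have "\<exists>h'. (h' = Zero Z ?Z \<or> ?Z = Z \<and> (h' = Ident Z \<or> h' = (- 1) *\<^sub>k Ident Z)) \<and>
          eqv oKLRW (A @ [a, b] @ B) (A @ [b, a] @ B) (ctx A h B) h'"
        using h
      proof (elim disjE conjE)
        assume "h = Zero [a, b] [b, a]"
        then show ?thesis using ctx_Zero[OF ab ob(1,2), of oKLRW] ZA tgt by auto
      next
        assume "a = b" "h = Ident [a, b]"
        then show ?thesis using ctx_Ident[OF ab(1) ob(1,2), of oKLRW] ZA tgt by auto
      next
        assume h: "a = b" "h = (- 1) *\<^sub>k Ident [a, b]"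
        have "eqv oKLRW (A @ [a, b] @ B) (A @ [a, b] @ B) (ctx A ((- 1) *\<^sub>k Ident [a, b]) B) ((- 1) *\<^sub>k ctx A (Ident [a, b]) B)"
          by (rule ctx_scale[OF is_mor.ident[OF ab(1)] ob(1,2)])
        also have "eqv oKLRW (A @ [a, b] @ B) (A @ [a, b] @ B) \<dots> ((- 1) *\<^sub>k Ident (A @ [a, b] @ B))"
          by (rule mor_eq.scale[OF ctx_Ident[OF ab(1) ob(1,2)]])
        finally show ?thesis using h ZA tgt by auto
      qed
      then obtain h' where h': "h' = Zero Z ?Z \<or> ?Z = Z \<and> (h' = Ident Z \<or> h' = (- 1) *\<^sub>k Ident Z)"
          "eqv oKLRW (A @ [a, b] @ B) (A @ [b, a] @ B) (ctx A h B) h'" by blast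
      note tc' = arrow_ctx[OF tc ob(1,2)] and tv' = arrow_ctx[OF v ob(1,2)]
      have "eqv oKLRW (A @ [a, b] @ B) (A @ [b, a] @ B) (dot_at ?Z p \<circ>\<^sub>k ctx A (Cross a b) B) (ctx A u B \<circ>\<^sub>k ctx A (Cross a b) B)"
        by (rule comp_cong_left[OF du tc'])
      also have "eqv oKLRW (A @ [a, b] @ B) (A @ [b, a] @ B) \<dots> (ctx A (Cross a b) B \<circ>\<^sub>k ctx A v B +\<^sub>k ctx A h B)"
        by (rule dot_piece_local[OF u v tc th eq ob(1,2)])
      also have "eqv oKLRW (A @ [a, b] @ B) (A @ [b, a] @ B) \<dots> (1 *\<^sub>k (ctx A (Cross a b) B \<circ>\<^sub>k dot_at Z q) +\<^sub>k h')"
        by (rule mor_eq.plus[OF mor_eq.trans[OF comp_cong_right[OF dv tc'] mor_eq.sym[OF scale_one_eqv[OF is_mor.compose[OF eqv_arrow(2)[OF dv] tc']]]] h'(2)])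
      finally have "eqv oKLRW Z ?Z (dot_at ?Z p \<circ>\<^sub>k piece_mor Z d) (1 *\<^sub>k (piece_mor Z d \<circ>\<^sub>k dot_at Z q) +\<^sub>k h')"
        unfolding pm tgt using ZA by simp
      then show ?thesis using q h'(1) by blast
    qed
    consider "p < pc" | "p = pc" | "p = Suc pc" | "Suc pc < p" by linarith
    then show ?thesis
    proof cases
      case 1
      then obtain A1 e A2 where A: "A = A1 @ e # A2" "length A1 = p" using lA split_at[of p A] by metis
      have ob': "A1 \<in> objects Q" "A2 \<in> objects Q" "e \<in> letters Q" using ob A by auto
      have e: "dot_at ?Z p = ctx A1 (dot_on e) (A2 @ [b, a] @ B)" "dot_at Z p = ctx A1 (dot_on e) (A2 @ [a, b] @ B)"
        unfolding tgt using ZA A by (simp_all add: dot_at_append')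
      have "eqv oKLRW Z ?Z (dot_at ?Z p \<circ>\<^sub>k piece_mor Z d) (piece_mor Z d \<circ>\<^sub>k dot_at Z p)"
        unfolding e pm using mor_eq.sym[OF ctx_far[OF arrow_dot_on[OF ob'(3)] tc ob'(1,2) ob(2), of oKLRW]] tgt ZA A by simp
      then show ?thesis by (rule plain1[OF p])
    next
      case 2
      obtain h where h: "h = Zero [a, b] [b, a] \<or> a = b \<and> h = Ident [a, b]"
        "eqv KLRW [a, b] [b, a] ((dot_on b \<otimes>\<^sub>k Ident [a]) \<circ>\<^sub>k Cross a b) (Cross a b \<circ>\<^sub>k (Ident [a] \<otimes>\<^sub>k dot_on b) +\<^sub>k h)"
        using cross_dot_left[OF ob(3,4) bl] by blast
      show ?thesis
      proof (rule near[OF _ _ _ _ _ _ h(2)])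
        show "Suc p < length Z" using ZA lA 2 by simp
        have "dot_at ?Z p = (ctx A (dot_on b) ([a] @ B) :: ('v, 'k) mor)" using tgt lA 2 by (simp add: dot_at_append')
        then show "eqv oKLRW (A @ [b, a] @ B) (A @ [b, a] @ B) (dot_at ?Z p) (ctx A (dot_on b \<otimes>\<^sub>k Ident [a]) B)"
          using mor_eq.sym[OF ctx_tensor_right[OF arrow_dot_on[OF ob(4)] ob(1) _ ob(2), of "[a]" oKLRW]] ob by simp
        have "dot_at Z (Suc p) = (ctx (A @ [a]) (dot_on b) B :: ('v, 'k) mor)"
          by (rule dot_at_eq) (use ZA lA 2 in simp_all)
        then show "eqv oKLRW (A @ [a, b] @ B) (A @ [a, b] @ B) (ctx A (Ident [a] \<otimes>\<^sub>k dot_on b) B) (dot_at Z (Suc p))"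
          using ctx_tensor_left[OF arrow_dot_on[OF ob(4)] ob(1) _ ob(2), of "[a]" oKLRW] ob by simp
        show "arrow KLRW [b, a] [b, a] (dot_on b \<otimes>\<^sub>k Ident [a])" using is_mor.tensor[OF arrow_dot_on[OF ob(4)] Ia] by simp
        show "arrow KLRW [a, b] [a, b] (Ident [a] \<otimes>\<^sub>k dot_on b)" using is_mor.tensor[OF Ia arrow_dot_on[OF ob(4)]] by simp
      qed (use h in blast)
    next
      case 3
      obtain h where h: "h = Zero [a, b] [b, a] \<or> a = b \<and> h = Ident [a, b]"
        "eqv KLRW [a, b] [b, a] (Cross a b \<circ>\<^sub>k (dot_on a \<otimes>\<^sub>k Ident [b])) ((Ident [b] \<otimes>\<^sub>k dot_on a) \<circ>\<^sub>k Cross a b +\<^sub>k h)"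
        using cross_dot_right[OF ob(3,4) bl] by blast
      have ab: "[a, b] \<in> objects Q" "[b, a] \<in> objects Q" using ob by auto
      have th: "arrow KLRW [a, b] [b, a] h" using h(1) ab by (auto intro!: is_mor.zero is_mor.ident)
      have t1: "arrow KLRW [b, a] [b, a] (Ident [b] \<otimes>\<^sub>k dot_on a)" using is_mor.tensor[OF Ib arrow_dot_on[OF ob(3)]] by simp
      have t2: "arrow KLRW [a, b] [a, b] (dot_on a \<otimes>\<^sub>k Ident [b])" using is_mor.tensor[OF arrow_dot_on[OF ob(3)] Ib] by simp
      \<comment> \<open>The relation expresses the dot below the crossing through the dot above;
        solved for the latter, it changes the sign of the correction.\<close>
      have mv: "eqv KLRW [a, b] [b, a] ((Ident [b] \<otimes>\<^sub>k dot_on a) \<circ>\<^sub>k Cross a b) (Cross a b \<circ>\<^sub>k (dot_on a \<otimes>\<^sub>k Ident [b]) +\<^sub>k (- 1) *\<^sub>k h)"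
        by (rule eqv_move[OF h(2) is_mor.compose[OF tc t1] th])
      have "\<exists>h'. (h' = Zero [a, b] [b, a] \<or> a = b \<and> (h' = Ident [a, b] \<or> h' = (- 1) *\<^sub>k Ident [a, b])) \<and>
          eqv KLRW [a, b] [b, a] ((- 1) *\<^sub>k h) h'"
        using h(1)
      proof (elim disjE conjE)
        assume "h = Zero [a, b] [b, a]"
        then show ?thesis using scale_Zero[OF ab, of KLRW "- 1"] by blast
      next
        assume "a = b" "h = Ident [a, b]"
        then show ?thesis using mor_eq.refl[OF is_mor.scale[OF th, of "- 1"]] by blast
      qed
      then obtain h' where h': "h' = Zero [a, b] [b, a] \<or> a = b \<and> (h' = Ident [a, b] \<or> h' = (- 1) *\<^sub>k Ident [a, b])"
          "eqv KLRW [a, b] [b, a] ((- 1) *\<^sub>k h) h'" by blast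
      show ?thesis
      proof (rule near[OF _ _ _ t1 t2 h'(1)])
        show "eqv KLRW [a, b] [b, a] ((Ident [b] \<otimes>\<^sub>k dot_on a) \<circ>\<^sub>k Cross a b) (Cross a b \<circ>\<^sub>k (dot_on a \<otimes>\<^sub>k Ident [b]) +\<^sub>k h')"
          by (rule mor_eq.trans[OF mv mor_eq.plus[OF mor_eq.refl[OF is_mor.compose[OF t2 tc]] h'(2)]])
        show "pc < length Z" using ZA lA by simp
        have "dot_at ?Z p = (ctx (A @ [b]) (dot_on a) B :: ('v, 'k) mor)"
          by (rule dot_at_eq) (use tgt lA 3 in simp_all)
        then show "eqv oKLRW (A @ [b, a] @ B) (A @ [b, a] @ B) (dot_at ?Z p) (ctx A (Ident [b] \<otimes>\<^sub>k dot_on a) B)"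
          using mor_eq.sym[OF ctx_tensor_left[OF arrow_dot_on[OF ob(3)] ob(1) _ ob(2), of "[b]" oKLRW]] ob by simp
        have "dot_at Z pc = (ctx A (dot_on a) ([b] @ B) :: ('v, 'k) mor)"
          using ZA lA by (simp add: dot_at_append')
        then show "eqv oKLRW (A @ [a, b] @ B) (A @ [a, b] @ B) (ctx A (dot_on a \<otimes>\<^sub>k Ident [b]) B) (dot_at Z pc)"
          using ctx_tensor_right[OF arrow_dot_on[OF ob(3)] ob(1) _ ob(2), of "[b]" oKLRW] ob by simp
      qed
    next
      case 4
      then have "p - Suc (Suc pc) < length B" using p ZA lA by simp
      then obtain B1 e B2 where B: "B = B1 @ e # B2" "length B1 = p - Suc (Suc pc)" by (rule split_at)
      have ob': "B1 \<in> objects Q" "B2 \<in> objects Q" "e \<in> letters Q" using ob B by auto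
      have e: "dot_at ?Z p = ctx (A @ [b, a] @ B1) (dot_on e) B2" "dot_at Z p = ctx (A @ [a, b] @ B1) (dot_on e) B2"
        by (rule dot_at_eq; use ZA B lA 4 tgt in simp)+
      have "eqv oKLRW Z ?Z (dot_at ?Z p \<circ>\<^sub>k piece_mor Z d) (piece_mor Z d \<circ>\<^sub>k dot_at Z p)"
        unfolding e pm using ctx_far[OF tc arrow_dot_on[OF ob'(3)] ob(1) ob'(1,2), of oKLRW] tgt ZA B by simp
      then show ?thesis by (rule plain1[OF p])
    qed
  next
    case Mirror
    obtain i B where ZB: "Z = Black i # B" using ok Mirror mirror_okE by metis
    have i: "i \<in> verts Q" and B: "B \<in> objects Q" using Z ZB by (auto simp: letters_def)
    have tgt: "?Z = Black (\<tau> i) # B" and pm: "piece_mor Z d = Reflect i \<otimes>\<^sub>k Ident B"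
      using Mirror ZB by (simp_all add: piece_mor.simps)
    have tr: "arrow oKLRW [Black i] [Black (\<tau> i)] (Reflect i)" by (rule is_mor.reflect[OF i])
    show ?thesis
    proof (cases p)
      case 0
      have td: "arrow c [Black i] [Black i] (Dot i)" "arrow c [Black (\<tau> i)] [Black (\<tau> i)] (Dot (\<tau> i))" for c
        using i tau_closed by (auto intro!: is_mor.dot)
      have "eqv oKLRW [Black i] [Black (\<tau> i)] (Reflect i \<circ>\<^sub>k Dot i) ((- 1) *\<^sub>k (Dot (\<tau> i) \<circ>\<^sub>k Reflect i))"
        by (rule mor_eq.mirror[OF mirror_rel.reflect_dot is_mor.compose[OF td(1) tr] is_mor.scale[OF is_mor.compose[OF tr td(2)]]])
      \<comment> \<open>The relation carries its sign on the side of the upper dot; multiplying by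
        -1 moves it to the lower one.\<close>
      from mor_eq.scale[OF this, of "- 1"]
      have "eqv oKLRW [Black i] [Black (\<tau> i)] ((- 1) *\<^sub>k (Reflect i \<circ>\<^sub>k Dot i)) ((- 1) *\<^sub>k (- 1) *\<^sub>k (Dot (\<tau> i) \<circ>\<^sub>k Reflect i))" .
      also have "eqv oKLRW [Black i] [Black (\<tau> i)] \<dots> ((- 1 * - 1) *\<^sub>k (Dot (\<tau> i) \<circ>\<^sub>k Reflect i))"
        using is_mor.compose[OF tr td(2)] by (intro lm(1)[OF linear_monoidal_rel.scale_scale] is_mor.scale)
      also have "eqv oKLRW [Black i] [Black (\<tau> i)] \<dots> (Dot (\<tau> i) \<circ>\<^sub>k Reflect i)"
        using scale_one_eqv[OF is_mor.compose[OF tr td(2)]] by simp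
      finally have *: "eqv oKLRW [Black i] [Black (\<tau> i)] (Dot (\<tau> i) \<circ>\<^sub>k Reflect i) ((- 1) *\<^sub>k (Reflect i \<circ>\<^sub>k Dot i))"
        by (rule mor_eq.sym)
      let ?X = "[Black i] @ B" and ?Y = "[Black (\<tau> i)] @ B"
      note tIB = is_mor.ident[OF B]
      have e: "dot_at ?Z 0 = ctx [] (Dot (\<tau> i)) B" "dot_at Z 0 = ctx [] (Dot i) B"
        using tgt ZB by (simp_all add: dot_at_eq[of _ "[]"])
      have d2: "eqv oKLRW ?Y ?Y (ctx [] (Dot (\<tau> i)) B) (Dot (\<tau> i) \<otimes>\<^sub>k Ident B)" by (rule ctx_Nil[OF td(2) B])
      have d1: "eqv oKLRW ?X ?X (ctx [] (Dot i) B) (Dot i \<otimes>\<^sub>k Ident B)" by (rule ctx_Nil[OF td(1) B])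
      have tR: "arrow oKLRW ?X ?Y (Reflect i \<otimes>\<^sub>k Ident B)" by (rule is_mor.tensor[OF tr tIB])
      have "eqv oKLRW ?X ?Y (ctx [] (Dot (\<tau> i)) B \<circ>\<^sub>k (Reflect i \<otimes>\<^sub>k Ident B)) ((Dot (\<tau> i) \<otimes>\<^sub>k Ident B) \<circ>\<^sub>k (Reflect i \<otimes>\<^sub>k Ident B))"
        by (rule comp_cong_left[OF d2 tR])
      also have "eqv oKLRW ?X ?Y \<dots> ((Dot (\<tau> i) \<circ>\<^sub>k Reflect i) \<otimes>\<^sub>k Ident B)"
        by (rule mor_eq.sym[OF tensor_ident_comp[OF tr td(2) B]])
      also have "eqv oKLRW ?X ?Y \<dots> (((- 1) *\<^sub>k (Reflect i \<circ>\<^sub>k Dot i)) \<otimes>\<^sub>k Ident B)"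
        by (rule mor_eq.tensor[OF * mor_eq.refl[OF tIB]])
      also have "eqv oKLRW ?X ?Y \<dots> ((- 1) *\<^sub>k ((Reflect i \<circ>\<^sub>k Dot i) \<otimes>\<^sub>k Ident B))"
        by (rule lm(1)[OF linear_monoidal_rel.tensor_scale_left is_mor.tensor[OF is_mor.scale[OF is_mor.compose[OF td(1) tr]] tIB]
              is_mor.scale[OF is_mor.tensor[OF is_mor.compose[OF td(1) tr] tIB]]])
      also have "eqv oKLRW ?X ?Y \<dots> ((- 1) *\<^sub>k ((Reflect i \<otimes>\<^sub>k Ident B) \<circ>\<^sub>k (Dot i \<otimes>\<^sub>k Ident B)))"
        by (rule mor_eq.scale[OF tensor_ident_comp[OF td(1) tr B]])
      also have "eqv oKLRW ?X ?Y \<dots> ((- 1) *\<^sub>k ((Reflect i \<otimes>\<^sub>k Ident B) \<circ>\<^sub>k ctx [] (Dot i) B))"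
        by (rule mor_eq.scale[OF comp_cong_right[OF mor_eq.sym[OF d1] tR]])
      finally have "eqv oKLRW Z ?Z (dot_at ?Z 0 \<circ>\<^sub>k piece_mor Z d) ((- 1) *\<^sub>k (piece_mor Z d \<circ>\<^sub>k dot_at Z 0))"
        unfolding e pm using tgt ZB by simp
      then show ?thesis using p 0 by (intro plain[of 0 "- 1"]) simp_all
    next
      case (Suc p')
      then have "p' < length B" using p ZB by simp
      then obtain B1 e B2 where B12: "B = B1 @ e # B2" "length B1 = p'" by (rule split_at)
      have ob': "B1 \<in> objects Q" "B2 \<in> objects Q" "e \<in> letters Q" using B B12 by auto
      have e: "dot_at ?Z p = ctx ([Black (\<tau> i)] @ B1) (dot_on e) B2" "dot_at Z p = ctx ([Black i] @ B1) (dot_on e) B2"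
        by (rule dot_at_eq; use ZB B12 tgt Suc in simp)+
      have "eqv oKLRW Z ?Z (dot_at ?Z p \<circ>\<^sub>k piece_mor Z d) (piece_mor Z d \<circ>\<^sub>k dot_at Z p)"
        unfolding e pm using far_exchange[OF tr arrow_dot_on[OF ob'(3)] ob'(1,2)] tgt ZB B12 by simp
      then show ?thesis by (rule plain1[OF p])
    qed
  qed
qed

text \<open>The dot sinks piece by piece until the monomial at the bottom absorbs it, and each
  correction has one piece fewer. So a dot does not raise the filtration.\<close>

lemma filt_dot:
  assumes f: "filt m X Y f" and p: "p < length Y" and X: "X \<in> objects Q"
  shows "filt m X Y (dot_at Y p \<circ>\<^sub>k f)"
proof -
  have Y: "Y \<in> objects Q" using arrow_objects[OF lin_span_arrow[OF f]] by simp
  have base: "filt (Suc (length ds)) X Y (dot_at Y p \<circ>\<^sub>k (diagram_mor \<tau> X ds \<circ>\<^sub>k dot_monomial X as))"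
    if "is_diagram \<tau> X Y ds" "length as = length (black_positions X)" "p < length Y" for ds Y p as
    using that
  proof (induction ds arbitrary: Y p rule: rev_induct)
    case Nil
    then have YX [simp]: "Y = X" by simp
    note tm = arrow_dot_monomial[OF X Nil(2)]
    have p: "p < length X" using Nil by simp
    \<comment> \<open>A dot on a black strand raises one exponent; at a red position it is the
      identity.\<close>
    have "\<exists>bs. length bs = length (black_positions X) \<and> eqv oKLRW X X (dot_at X p \<circ>\<^sub>k dot_monomial X as) (dot_monomial X bs)"
    proof (cases "is_black (X ! p)")
      case True
      then obtain r where r: "1 \<le> r" "r \<le> length (black_positions X)" "black_positions X ! (r - 1) = p"
        using black_position_index p by metis
      have "eqv oKLRW X X (black_dot X r \<circ>\<^sub>k dot_monomial X as) (dot_monomial X (as[r - 1 := Suc (as ! (r - 1))]))"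
        by (rule black_dot_monomial[OF X Nil(2) r(1,2)])
      then show ?thesis using Nil(2) r(3) black_dot_eq_dot_at[of X r] unfolding black_dot_eq_dot_at r(3)
        by (intro exI[of _ "as[r - 1 := Suc (as ! (r - 1))]"]) simp
    next
      case False
      have "eqv oKLRW X X (dot_at X p \<circ>\<^sub>k dot_monomial X as) (Ident X \<circ>\<^sub>k dot_monomial X as)"
        by (rule comp_cong_left[OF dot_at_red[OF p False X] tm])
      then show ?thesis using mor_eq.trans[OF _ ident_left[OF tm]] Nil(2) by blast
    qed
    then obtain bs where bs: "length bs = length (black_positions X)"
      "eqv oKLRW X X (dot_at X p \<circ>\<^sub>k dot_monomial X as) (dot_monomial X bs)" by blast
    have "eqv oKLRW X X (dot_at X p \<circ>\<^sub>k (Ident X \<circ>\<^sub>k dot_monomial X as)) (dot_at X p \<circ>\<^sub>k dot_monomial X as)"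
      by (rule comp_cong_right[OF ident_left[OF tm] arrow_dot_at[OF p X]])
    also note bs(2)
    also have "eqv oKLRW X X (dot_monomial X bs) (diagram_mor \<tau> X [] \<circ>\<^sub>k dot_monomial X bs)"
      using mor_eq.sym[OF ident_left[OF arrow_dot_monomial[OF X bs(1)]]] by simp
    finally show ?case using lin_span_equiv'[OF filt_gen[OF _ X bs(1), of X "[]" 1]] by simp
  next
    case (snoc d ds)
    then obtain Z where Z: "is_diagram \<tau> X Z ds" "piece_ok Z d" "Y = piece_target \<tau> Z d" by (auto simp: is_diagram_snoc)
    note tm = arrow_dot_monomial[OF X snoc.prems(2)] and td = arrow_diagram[OF Z(1) X]
    have ZQ: "Z \<in> objects Q" using arrow_objects[OF td] by simp
    have YQ: "Y \<in> objects Q" using objects_piece_target[OF Z(2) ZQ] Z(3) by simp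
    have pZ: "p < length Z" using snoc.prems(3) Z length_piece_target by metis
    let ?g = "diagram_mor \<tau> X ds \<circ>\<^sub>k dot_monomial X as" and ?P = "piece_mor Z d"
    note tg = is_mor.compose[OF tm td]
    have tP: "arrow oKLRW Z Y ?P" using arrow_piece[OF Z(2) ZQ] Z(3) by simp
    have tD: "arrow oKLRW Y Y (dot_at Y p)" by (rule arrow_dot_at[OF snoc.prems(3) YQ])
    obtain q a h where q: "q < length Z" and h: "h = Zero Z Y \<or> Y = Z \<and> (h = Ident Z \<or> h = (- 1) *\<^sub>k Ident Z)"
      and eq: "eqv oKLRW Z Y (dot_at Y p \<circ>\<^sub>k ?P) (a *\<^sub>k (?P \<circ>\<^sub>k dot_at Z q) +\<^sub>k h)"
      using dot_piece[OF Z(2) ZQ pZ] Z(3) by blast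
    note tDq = arrow_dot_at[OF q ZQ]
    note tPD = is_mor.compose[OF tDq tP]
    have th: "arrow oKLRW Z Y h" using h ZQ YQ by (auto intro!: is_mor.zero is_mor.scale is_mor.ident)
    have "eqv oKLRW X Y (dot_at Y p \<circ>\<^sub>k (diagram_mor \<tau> X (ds @ [d]) \<circ>\<^sub>k dot_monomial X as))
        (dot_at Y p \<circ>\<^sub>k ((?P \<circ>\<^sub>k diagram_mor \<tau> X ds) \<circ>\<^sub>k dot_monomial X as))"
      using comp_cong_right[OF comp_cong_left[OF diagram_snoc[OF Z(1,2) X] tm]] tD Z(3) by simp
    also have "eqv oKLRW X Y \<dots> (dot_at Y p \<circ>\<^sub>k (?P \<circ>\<^sub>k ?g))"
      by (rule comp_cong_right[OF comp_assoc_eqv[OF tm td tP] tD])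
    also have "eqv oKLRW X Y \<dots> ((dot_at Y p \<circ>\<^sub>k ?P) \<circ>\<^sub>k ?g)"
      by (rule mor_eq.sym[OF comp_assoc_eqv[OF tg tP tD]])
    also have "eqv oKLRW X Y \<dots> ((a *\<^sub>k (?P \<circ>\<^sub>k dot_at Z q) +\<^sub>k h) \<circ>\<^sub>k ?g)" by (rule comp_cong_left[OF eq tg])
    also have "eqv oKLRW X Y \<dots> ((a *\<^sub>k (?P \<circ>\<^sub>k dot_at Z q)) \<circ>\<^sub>k ?g +\<^sub>k h \<circ>\<^sub>k ?g)"
      by (rule comp_plus_left_eqv[OF tg is_mor.scale[OF tPD] th])
    also have "eqv oKLRW X Y \<dots> (a *\<^sub>k (?P \<circ>\<^sub>k (dot_at Z q \<circ>\<^sub>k ?g)) +\<^sub>k h \<circ>\<^sub>k ?g)"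
      by (rule mor_eq.plus[OF mor_eq.trans[OF comp_scale_left_eqv[OF tg tPD] mor_eq.scale[OF comp_assoc_eqv[OF tg tDq tP]]]
            mor_eq.refl[OF is_mor.compose[OF tg th]]])
    finally have E: "eqv oKLRW X Y (dot_at Y p \<circ>\<^sub>k (diagram_mor \<tau> X (ds @ [d]) \<circ>\<^sub>k dot_monomial X as))
        (a *\<^sub>k (?P \<circ>\<^sub>k (dot_at Z q \<circ>\<^sub>k ?g)) +\<^sub>k h \<circ>\<^sub>k ?g)" .
    have F1: "filt (Suc (Suc (length ds))) X Y (?P \<circ>\<^sub>k (dot_at Z q \<circ>\<^sub>k ?g))"
      using filt_piece[OF snoc.IH[OF Z(1) snoc.prems(2) q] Z(2) X] Z(3) by simp
    have G: "filt (Suc (Suc (length ds))) X Z ?g" by (rule filt_gen[OF Z(1) X snoc.prems(2)]) simp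
    \<comment> \<open>The correction is a multiple of an identity or zero, so at most the pieces of
      \<open>ds\<close> remain.\<close>
    have F2: "filt (Suc (Suc (length ds))) X Y (h \<circ>\<^sub>k ?g)"
      using h
    proof (elim disjE conjE)
      assume "h = Zero Z Y"
      then show ?thesis using lin_span_equiv'[OF lin_span.zero[OF X YQ] comp_Zero_left[OF tg YQ]] by simp
    next
      assume "Y = Z" "h = Ident Z"
      then show ?thesis using lin_span_equiv'[OF G ident_left[OF tg]] by simp
    next
      assume *: "Y = Z" "h = (- 1) *\<^sub>k Ident Z"
      have "eqv oKLRW X Z (((- 1) *\<^sub>k Ident Z) \<circ>\<^sub>k ?g) ((- 1) *\<^sub>k ?g)"
        by (rule mor_eq.trans[OF comp_scale_left_eqv[OF tg is_mor.ident[OF ZQ]] mor_eq.scale[OF ident_left[OF tg]]])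
      then show ?thesis using lin_span_equiv'[OF lin_span.scale[OF G]] * by simp
    qed
    show ?case using lin_span_equiv'[OF lin_span.plus[OF lin_span.scale[OF F1] F2] E] by simp
  qed
  show ?thesis
  proof (rule lin_span_left[OF _ arrow_dot_at[OF p Y] f])
    fix g assume "g \<in> diagram_gens m X Y" "arrow oKLRW X Y g"
    then obtain ds as where g: "g = diagram_mor \<tau> X ds \<circ>\<^sub>k dot_monomial X as" "is_diagram \<tau> X Y ds"
       "length as = length (black_positions X)" "length ds < m" by (auto simp: diagram_gens_def)
    show "filt m X Y (dot_at Y p \<circ>\<^sub>k g)"
      unfolding g(1) by (rule filt_mono[OF base[OF g(2,3) p]]) (use g(4) in simp)
  qed
qed

lemma arrow_dot_poly: "dot_poly W P t \<Longrightarrow> W \<in> objects Q \<Longrightarrow> arrow c W W t"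
  by (induction rule: dot_poly.induct)
    (auto intro: is_mor.plus is_mor.compose intro!: is_mor.scale is_mor.ident arrow_black_dot)

lemma filt_dot_poly:
  assumes t: "dot_poly W P t" and ob: "A \<in> objects Q" "W \<in> objects Q" "B \<in> objects Q" "X \<in> objects Q"
  shows "filt m X (A @ W @ B) f \<Longrightarrow> filt m X (A @ W @ B) (ctx A t B \<circ>\<^sub>k f)"
  using t
proof (induction arbitrary: f rule: dot_poly.induct)
  case (1 a)
  note tf = lin_span_arrow[OF 1]
  note I = is_mor.ident[OF ob(2)]
  have "eqv oKLRW X (A @ W @ B) (ctx A (a *\<^sub>k Ident W) B \<circ>\<^sub>k f) ((a *\<^sub>k Ident (A @ W @ B)) \<circ>\<^sub>k f)"
    by (rule comp_cong_left[OF mor_eq.trans[OF ctx_scale[OF I ob(1,3)] mor_eq.scale[OF ctx_Ident[OF ob(2,1,3)]]] tf])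
  also have "eqv oKLRW X (A @ W @ B) \<dots> (a *\<^sub>k (Ident (A @ W @ B) \<circ>\<^sub>k f))"
    using ob by (intro comp_scale_left_eqv[OF tf] is_mor.ident) simp
  also have "eqv oKLRW X (A @ W @ B) \<dots> (a *\<^sub>k f)" by (rule mor_eq.scale[OF ident_left[OF tf]])
  finally show ?case by (rule lin_span_equiv'[OF lin_span.scale[OF 1]])
next
  case (2 r)
  note tf = lin_span_arrow[OF 2(3)]
  let ?p = "black_positions W ! (r - 1)"
  have p: "?p < length W" by (rule black_positions_nth[OF 2(1,2)])
  then obtain W1 a W2 where W: "W = W1 @ a # W2" "length W1 = ?p" by (rule split_at)
  have ob': "W1 \<in> objects Q" "W2 \<in> objects Q" "a \<in> letters Q" using ob W by auto
  have "black_dot W r = dot_at W ?p" by (rule black_dot_eq_dot_at)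
  also have "\<dots> = ctx W1 (dot_on a) W2" by (subst W(1), rule dot_at_append'[OF W(2)[symmetric]])
  finally have e1: "black_dot W r = (ctx W1 (dot_on a) W2 :: ('v, 'k) mor)" .
  have e2: "dot_at (A @ W @ B) (length A + ?p) = (ctx (A @ W1) (dot_on a) (W2 @ B) :: ('v, 'k) mor)"
    by (rule dot_at_eq) (subst W(1), use W(2) in simp_all)
  have *: "eqv oKLRW (A @ W @ B) (A @ W @ B) (ctx A (black_dot W r) B) (dot_at (A @ W @ B) (length A + ?p))"
    unfolding e1 e2 using ctx_ctx[OF arrow_dot_on[OF ob'(3)] ob(1,3) ob'(1,2)] W(1) by simp
  show ?case
    by (rule lin_span_equiv'[OF filt_dot[OF 2(3) _ ob(4)] comp_cong_left[OF * tf]]) (use p in simp)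
next
  case (3 p f1 q f2)
  note tf = lin_span_arrow[OF 3(5)]
  note t = arrow_dot_poly[OF 3(1) ob(2)] arrow_dot_poly[OF 3(2) ob(2)]
  have "eqv oKLRW X (A @ W @ B) (ctx A (f1 +\<^sub>k f2) B \<circ>\<^sub>k f) ((ctx A f1 B +\<^sub>k ctx A f2 B) \<circ>\<^sub>k f)"
    by (rule comp_cong_left[OF ctx_plus[OF t ob(1,3)] tf])
  also have "eqv oKLRW X (A @ W @ B) \<dots> (ctx A f1 B \<circ>\<^sub>k f +\<^sub>k ctx A f2 B \<circ>\<^sub>k f)"
    by (rule comp_plus_left_eqv[OF tf arrow_ctx[OF t(1) ob(1,3)] arrow_ctx[OF t(2) ob(1,3)]])
  finally show ?case by (rule lin_span_equiv'[OF lin_span.plus[OF 3(3)[OF 3(5)] 3(4)[OF 3(5)]]])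
next
  case (4 p f1 q f2)
  note tf = lin_span_arrow[OF 4(5)]
  note t = arrow_dot_poly[OF 4(1) ob(2)] arrow_dot_poly[OF 4(2) ob(2)]
  have "eqv oKLRW X (A @ W @ B) (ctx A (f1 \<circ>\<^sub>k f2) B \<circ>\<^sub>k f) ((ctx A f1 B \<circ>\<^sub>k ctx A f2 B) \<circ>\<^sub>k f)"
    by (rule comp_cong_left[OF ctx_comp[OF t(2,1) ob(1,3)] tf])
  also have "eqv oKLRW X (A @ W @ B) \<dots> (ctx A f1 B \<circ>\<^sub>k (ctx A f2 B \<circ>\<^sub>k f))"
    by (rule comp_assoc_eqv[OF tf arrow_ctx[OF t(2) ob(1,3)] arrow_ctx[OF t(1) ob(1,3)]])
  finally show ?case by (rule lin_span_equiv'[OF 4(3)[OF 4(4)[OF 4(5)]]])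
qed

end

section \<open>Local relations whose corrections are polynomials in dots\<close>

lemma Cst_1: "Cst 1 = 1"
  by (simp add: Cst_def)

lemma Cst_minus_1: "Cst (- 1) = - 1"
  by (simp add: Cst_def single_uminus)

text \<open>The relations take a morphism \<open>t\<close> with \<open>dot_poly X P t\<close> as a
  parameter, so applying one of them requires that a representing morphism exists. The type argument
  fixes the field.\<close>

definition dot_expressible :: "'k :: field itself \<Rightarrow> 'v wrd \<Rightarrow> 'k mpolynomial \<Rightarrow> bool" where
  "dot_expressible K X P \<longleftrightarrow> (\<exists>t :: ('v, 'k) mor. dot_poly X P t)"

lemma dot_expressible_Cst: "dot_expressible K X (Cst a)"
  and dot_expressible_plus: "dot_expressible K X P \<Longrightarrow> dot_expressible K X R \<Longrightarrow> dot_expressible K X (P + R)"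
  and dot_expressible_times: "dot_expressible K X P \<Longrightarrow> dot_expressible K X R \<Longrightarrow> dot_expressible K X (P * R)"
  and dot_expressible_Var: "1 \<le> r \<Longrightarrow> r \<le> length (black_positions X) \<Longrightarrow> dot_expressible K X (Var r)"
  unfolding dot_expressible_def by (blast intro: dot_poly.intros)+

lemma dot_expressible_1: "dot_expressible K X 1"
  using dot_expressible_Cst[of K X 1] by (simp add: Cst_1)

lemma dot_expressible_0: "dot_expressible K X 0"
  using dot_expressible_Cst[of K X 0] by (simp add: Cst_def)

lemma dot_expressible_uminus: "dot_expressible K X P \<Longrightarrow> dot_expressible K X (- P)"
  using dot_expressible_times[OF dot_expressible_Cst[of K X "- 1"]] by (force simp: Cst_minus_1)

lemma dot_expressible_minus:
  "dot_expressible K X P \<Longrightarrow> dot_expressible K X R \<Longrightarrow> dot_expressible K X (P - R)"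
  using dot_expressible_plus[OF _ dot_expressible_uminus] by (force simp: diff_conv_add_uminus simp del: add_uminus_conv_diff)

lemma dot_expressible_power: "dot_expressible K X P \<Longrightarrow> dot_expressible K X (P ^ n)"
  by (induction n) (simp_all add: dot_expressible_1 dot_expressible_times)

lemma dot_expressible_sum: "(\<And>a. a \<in> S \<Longrightarrow> dot_expressible K X (h a)) \<Longrightarrow> dot_expressible K X (sum h S)"
  by (induction S rule: infinite_finite_induct) (simp_all add: dot_expressible_0 dot_expressible_plus)

lemmas dot_expressible = dot_expressible_1 dot_expressible_0 dot_expressible_Cst dot_expressible_plus
  dot_expressible_times dot_expressible_uminus dot_expressible_minus dot_expressible_power dot_expressible_Var dot_expressible_sum

lemma dot_expressible_f_poly:
  "dot_expressible K X P \<Longrightarrow> dot_expressible K X R \<Longrightarrow> dot_expressible K X (f_poly Q i j P R)"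
  unfolding f_poly_def X_poly_def by (auto intro!: dot_expressible)

lemma dot_expressible_fmu_poly:
  "dot_expressible K X P \<Longrightarrow> dot_expressible K X (fmu_poly \<tau> \<mu> i P)"
  unfolding fmu_poly_def by (intro dot_expressible)

context oklrw
begin

text \<open>At most one of the two possible arrows exists, so \<open>f_poly\<close> is 1 or a
  difference of its arguments up to sign, and its divided difference is one of the constants 1, -1
  and 0.\<close>

lemma f_poly_quotient:
  assumes "i \<noteq> j"
  shows "\<exists>q. dot_expressible (TYPE('k)) X q \<and>
    q * (Var 3 - Var 1) = f_poly Q i j (Var 3) (Var 2) - f_poly Q i j (Var 1) (Var 2)"
proof -
  have not_both: "\<not> (j \<rightarrow>\<^bsub>Q\<^esub> i \<and> i \<rightarrow>\<^bsub>Q\<^esub> j)"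
  proof
    assume "j \<rightarrow>\<^bsub>Q\<^esub> i \<and> i \<rightarrow>\<^bsub>Q\<^esub> j"
    then obtain e e' where "e \<in> arcs Q" "tail Q e = j" "head Q e = i" "e' \<in> arcs Q" "tail Q e' = i" "head Q e' = j"
      by (auto simp: arcs_ends_def arc_to_ends_def)
    then show False using one_arrow[of e e'] assms by auto
  qed
  show ?thesis
  proof (cases "j \<rightarrow>\<^bsub>Q\<^esub> i")
    case True
    then show ?thesis using not_both by (intro exI[of _ 1]) (simp add: f_poly_def X_poly_def dot_expressible_1)
  next
    case False
    show ?thesis
    proof (cases "i \<rightarrow>\<^bsub>Q\<^esub> j")
      case True
      then show ?thesis using False
        by (intro exI[of _ "- 1"] conjI dot_expressible) (simp add: f_poly_def X_poly_def)
    next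
      case False
      then show ?thesis using \<open>\<not> j \<rightarrow>\<^bsub>Q\<^esub> i\<close>
        by (intro exI[of _ 0] conjI dot_expressible) (simp add: f_poly_def X_poly_def)
    qed
  qed
qed

text \<open>With n = \<open>\<mu> i + \<mu> (\<tau> i)\<close> and e = \<open>\<mu> i\<close>, the
  two values are (-1)^e x^n and (-1)^e (-y)^n. The quotient is (-1)^e times the geometric sum for
  x^n - (-y)^n, whose divisor is x - (-y).\<close>

lemma fmu_poly_quotient:
  assumes "\<tau> (\<tau> i) = i" "2 \<le> length (black_positions X)"
  shows "\<exists>q. dot_expressible (TYPE('k)) X q \<and>
    q * (Var 1 + Var 2) = fmu_poly \<tau> \<mu> i (Var 1) - fmu_poly \<tau> \<mu> (\<tau> i) (Var 2)"
proof -
  let ?n = "\<mu> i + \<mu> (\<tau> i)" and ?x = "Var 1 :: 'k mpolynomial" and ?y = "Var 2 :: 'k mpolynomial"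
  let ?q = "(- 1) ^ \<mu> i * (\<Sum>a<?n. (- ?y) ^ (?n - Suc a) * ?x ^ a)"
  have f1: "fmu_poly \<tau> \<mu> i ?x = (- 1) ^ \<mu> i * ?x ^ ?n"
    unfolding fmu_poly_def by (subst power_minus) (simp add: power_add algebra_simps)
  have f2: "fmu_poly \<tau> \<mu> (\<tau> i) ?y = (- 1) ^ \<mu> i * (- ?y) ^ ?n"
  proof -
    have "(- 1) ^ \<mu> i * (- ?y) ^ ?n = ((- 1) ^ \<mu> i * (- ?y) ^ \<mu> i) * (- ?y) ^ \<mu> (\<tau> i)"
      by (simp add: power_add algebra_simps)
    also have "(- 1) ^ \<mu> i * (- ?y) ^ \<mu> i = ?y ^ \<mu> i"
      by (simp flip: power_mult_distrib)
    finally show ?thesis using assms(1) by (simp add: fmu_poly_def)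
  qed
  have "?q * (?x + ?y) = (- 1) ^ \<mu> i * ((?x - (- ?y)) * (\<Sum>a<?n. (- ?y) ^ (?n - Suc a) * ?x ^ a))"
    by (simp add: algebra_simps)
  also have "\<dots> = (- 1) ^ \<mu> i * (?x ^ ?n - (- ?y) ^ ?n)"
    by (subst power_diff_sumr2) simp
  also have "\<dots> = fmu_poly \<tau> \<mu> i ?x - fmu_poly \<tau> \<mu> (\<tau> i) ?y"
    unfolding f1 f2 by (simp add: algebra_simps)
  finally have "?q * (?x + ?y) = fmu_poly \<tau> \<mu> i ?x - fmu_poly \<tau> \<mu> (\<tau> i) ?y" .
  moreover have "dot_expressible TYPE('k) X ?q"
    using assms(2) by (intro dot_expressible) simp_all
  ultimately show ?thesis by blast
qed

text \<open>The zero obtained for two equal black letters is written as 0 times the identity, so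
  that every double crossing is a polynomial in dots.\<close>

lemma cross_twice:
  assumes ob: "a \<in> letters Q" "b \<in> letters Q" and bl: "is_black a \<or> is_black b"
  shows "\<exists>P t. dot_poly [a, b] P t \<and> eqv KLRW [a, b] [a, b] (Cross b a \<circ>\<^sub>k Cross a b) t"
proof -
  have ab: "[a, b] \<in> objects Q" using ob by simp
  have tc: "arrow KLRW [a, b] [b, a] (Cross a b)" "arrow KLRW [b, a] [a, b] (Cross b a)"
    using ob bl by (auto intro!: is_mor.cross)
  note tcc = is_mor.compose[OF tc]
  have by_rel: ?thesis if "dot_expressible TYPE('k) [a, b] P"
      "\<And>t :: ('v, 'k) mor. dot_poly [a, b] P t \<Longrightarrow> klrw_rel Q (Cross b a \<circ>\<^sub>k Cross a b) t" for P
  proof -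
    note expr = that
    obtain t :: "('v, 'k) mor" where t: "dot_poly [a, b] P t" using expr(1) by (auto simp: dot_expressible_def)
    have "eqv KLRW [a, b] [a, b] (Cross b a \<circ>\<^sub>k Cross a b) t"
      by (rule mor_eq.klrw[OF expr(2)[OF t] tcc arrow_dot_poly[OF t ab]])
    then show ?thesis using t by blast
  qed
  show ?thesis
  proof (cases a)
    case a: (Black i)
    show ?thesis
    proof (cases b)
      case b: (Black j)
      show ?thesis
      proof (cases "i = j")
        case True
        have "eqv KLRW [a, b] [a, b] (Cross b a \<circ>\<^sub>k Cross a b) (Zero [a, b] [a, b])"
          using mor_eq.klrw[OF klrw_rel.cross_cross_same, of Q \<tau> KLRW "[a, b]" "[a, b]" i \<mu>] tcc is_mor.zero[OF ab ab, of \<tau> KLRW] a b True by simp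
        then have "eqv KLRW [a, b] [a, b] (Cross b a \<circ>\<^sub>k Cross a b) (0 *\<^sub>k Ident [a, b])"
          by (rule mor_eq.trans[OF _ mor_eq.sym[OF scale_0[OF is_mor.ident[OF ab]]]])
        then show ?thesis using dot_poly.intros(1) by blast
      next
        case False
        show ?thesis
        proof (rule by_rel)
          show "dot_expressible TYPE('k) [a, b] (f_poly Q i j (Var 1) (Var 2))"
            by (intro dot_expressible_f_poly dot_expressible) (simp_all add: length_black_positions a b)
        qed (use False klrw_rel.cross_cross[of i j Q] a b in simp)
      qed
    next
      case b: (Red \<theta>)
      show ?thesis
      proof (rule by_rel)
        show "dot_expressible TYPE('k) [a, b] (Var 1 ^ \<theta> i)"
          by (intro dot_expressible) (simp_all add: length_black_positions a b)
      qed (use klrw_rel.cross_cross_red_right[of i \<theta>] a b in simp)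
    qed
  next
    case a: (Red \<theta>)
    then obtain i where b: "b = Black i" using bl by (cases b) auto
    show ?thesis
    proof (rule by_rel)
      show "dot_expressible TYPE('k) [a, b] (Var 1 ^ \<theta> i)"
        by (intro dot_expressible) (simp_all add: length_black_positions a b)
    qed (use klrw_rel.cross_cross_red_left[of \<theta> i] a b in simp)
  qed
qed

lemma reflect_twice:
  assumes "i \<in> verts Q"
  shows "\<exists>P t. dot_poly [Black i] P t \<and> eqv oKLRW [Black i] [Black i] (Reflect (\<tau> i) \<circ>\<^sub>k Reflect i) t"
proof -
  have ob: "[Black i] \<in> objects Q" using assms by (auto simp: letters_def)
  have "dot_expressible TYPE('k) [Black i] (fmu_poly \<tau> \<mu> i (- Var 1))"
    by (intro dot_expressible_fmu_poly dot_expressible) (simp_all add: length_black_positions)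
  then obtain t :: "('v, 'k) mor" where t: "dot_poly [Black i] (fmu_poly \<tau> \<mu> i (- Var 1)) t"
    by (auto simp: dot_expressible_def)
  have "arrow oKLRW [Black i] [Black (\<tau> i)] (Reflect i)" "arrow oKLRW [Black (\<tau> i)] [Black i] (Reflect (\<tau> i))"
    using is_mor.reflect[OF assms, of \<tau>] is_mor.reflect[OF tau_closed[OF assms], of \<tau>] tau_invol[OF assms] by simp_all
  then have "eqv oKLRW [Black i] [Black i] (Reflect (\<tau> i) \<circ>\<^sub>k Reflect i) t"
    by (intro mor_eq.mirror[OF mirror_rel.reflect_reflect[OF t]] arrow_dot_poly[OF t ob] is_mor.compose)
  then show ?thesis using t by blast
qed

lemma involutive_on_objects: "X \<in> objects Q \<Longrightarrow> involutive_on \<tau> X"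
  by (fastforce simp: involutive_on_def letters_def tau_invol)

lemma piece_target_invol:
  assumes ok: "piece_ok Z d" and Z: "Z \<in> objects Q"
  shows "piece_target \<tau> (piece_target \<tau> Z d) d = Z"
proof (cases d)
  case (Crossing p)
  then obtain A a b B where "Z = A @ a # b # B" "length A = p" using ok crossing_okE by metis
  then show ?thesis using Crossing by (simp add: swap_at_append')
next
  case Mirror
  then obtain i B where "Z = Black i # B" using ok mirror_okE by metis
  then show ?thesis using Mirror Z by (auto simp: letters_def tau_invol)
qed

text \<open>The same piece twice in a row is a double crossing or a double reflection, hence a
  polynomial in dots; so \<open>m\<close> does not grow.\<close>

lemma filt_piece_twice:
  assumes f: "filt m X Z f" and ok: "piece_ok Z d" and X: "X \<in> objects Q"
  shows "filt m X Z (piece_mor (piece_target \<tau> Z d) d \<circ>\<^sub>k (piece_mor Z d \<circ>\<^sub>k f))"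
proof -
  note tf = lin_span_arrow[OF f]
  have Z: "Z \<in> objects Q" using arrow_objects[OF tf] by simp
  show ?thesis
  proof (cases d)
    case (Crossing p)
    obtain A a b B where ZA: "Z = A @ a # b # B" and lA: "length A = p" and bl: "is_black a \<or> is_black b"
      using ok Crossing crossing_okE by metis
    have ob: "A \<in> objects Q" "B \<in> objects Q" "a \<in> letters Q" "b \<in> letters Q" using Z ZA by auto
    have tgt: "piece_target \<tau> Z d = A @ b # a # B" using Crossing ZA lA by (simp add: swap_at_append')
    have pm: "piece_mor Z d = ctx A (Cross a b) B" "piece_mor (piece_target \<tau> Z d) d = ctx A (Cross b a) B"
      unfolding tgt using Crossing ZA lA by (simp_all add: piece_mor_append')
    have tc: "arrow KLRW [a, b] [b, a] (Cross a b)" "arrow KLRW [b, a] [a, b] (Cross b a)"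
      using ob bl by (auto intro!: is_mor.cross)
    obtain P t where t: "dot_poly [a, b] P t" "eqv KLRW [a, b] [a, b] (Cross b a \<circ>\<^sub>k Cross a b) t"
      using cross_twice[OF ob(3,4) bl] by blast
    let ?Z = "A @ [a, b] @ B"
    have f': "filt m X ?Z f" using f ZA by simp
    note tf' = lin_span_arrow[OF f']
    note tca = arrow_ctx[OF tc(1) ob(1,2)] and tcb = arrow_ctx[OF tc(2) ob(1,2)]
    have "eqv oKLRW X ?Z (ctx A (Cross b a) B \<circ>\<^sub>k (ctx A (Cross a b) B \<circ>\<^sub>k f)) ((ctx A (Cross b a) B \<circ>\<^sub>k ctx A (Cross a b) B) \<circ>\<^sub>k f)"
      by (rule mor_eq.sym[OF comp_assoc_eqv[OF tf' tca tcb]])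
    also have "eqv oKLRW X ?Z \<dots> (ctx A (Cross b a \<circ>\<^sub>k Cross a b) B \<circ>\<^sub>k f)"
      by (rule comp_cong_left[OF mor_eq.sym[OF ctx_comp[OF tc ob(1,2)]] tf'])
    also have "eqv oKLRW X ?Z \<dots> (ctx A t B \<circ>\<^sub>k f)" by (rule comp_cong_left[OF ctx_cong[OF t(2) ob(1,2)] tf'])
    finally have "filt m X ?Z (ctx A (Cross b a) B \<circ>\<^sub>k (ctx A (Cross a b) B \<circ>\<^sub>k f))"
      using filt_dot_poly[OF t(1) ob(1) _ ob(2) X f'] ob lin_span_equiv' by auto
    then show ?thesis unfolding pm using ZA by simp
  next
    case Mirror
    obtain i B where ZB: "Z = Black i # B" using ok Mirror mirror_okE by metis
    have i: "i \<in> verts Q" and B: "B \<in> objects Q" using Z ZB by (auto simp: letters_def)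
    have pm: "piece_mor Z d = Reflect i \<otimes>\<^sub>k Ident B" "piece_mor (piece_target \<tau> Z d) d = Reflect (\<tau> i) \<otimes>\<^sub>k Ident B"
      using Mirror ZB by (simp_all add: piece_mor.simps)
    have tr: "arrow oKLRW [Black i] [Black (\<tau> i)] (Reflect i)" "arrow oKLRW [Black (\<tau> i)] [Black i] (Reflect (\<tau> i))"
      using is_mor.reflect[OF i, of \<tau>] is_mor.reflect[OF tau_closed[OF i], of \<tau>] tau_invol[OF i] by simp_all
    obtain P t where t: "dot_poly [Black i] P t" "eqv oKLRW [Black i] [Black i] (Reflect (\<tau> i) \<circ>\<^sub>k Reflect i) t"
      using reflect_twice[OF i] by blast
    have bi: "[Black i] \<in> objects Q" using i by (auto simp: letters_def)
    have f': "filt m X ([Black i] @ B) f" using f ZB by simp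
    let ?Z = "[Black i] @ B"
    note tf' = lin_span_arrow[OF f'] and tI = is_mor.ident[OF B]
    have "eqv oKLRW X ?Z ((Reflect (\<tau> i) \<otimes>\<^sub>k Ident B) \<circ>\<^sub>k ((Reflect i \<otimes>\<^sub>k Ident B) \<circ>\<^sub>k f))
       (((Reflect (\<tau> i) \<otimes>\<^sub>k Ident B) \<circ>\<^sub>k (Reflect i \<otimes>\<^sub>k Ident B)) \<circ>\<^sub>k f)"
      by (rule mor_eq.sym[OF comp_assoc_eqv[OF tf' is_mor.tensor[OF tr(1) tI] is_mor.tensor[OF tr(2) tI]]])
    also have "eqv oKLRW X ?Z \<dots> (((Reflect (\<tau> i) \<circ>\<^sub>k Reflect i) \<otimes>\<^sub>k Ident B) \<circ>\<^sub>k f)"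
      by (rule comp_cong_left[OF mor_eq.sym[OF tensor_ident_comp[OF tr B]] tf'])
    also have "eqv oKLRW X ?Z \<dots> ((t \<otimes>\<^sub>k Ident B) \<circ>\<^sub>k f)"
      by (rule comp_cong_left[OF mor_eq.tensor[OF t(2) mor_eq.refl[OF tI]] tf'])
    also have "eqv oKLRW X ?Z \<dots> (ctx [] t B \<circ>\<^sub>k f)"
      by (rule comp_cong_left[OF mor_eq.sym[OF ctx_Nil[OF arrow_dot_poly[OF t(1) bi] B]] tf'])
    finally show ?thesis unfolding pm
      using filt_dot_poly[OF t(1) _ bi B X, of "[]" m f] f' lin_span_equiv' ZB by auto
  qed
qed

text \<open>All colour patterns at once: a nonzero correction needs equal outer letters, and then it
  is a polynomial in dots on the source word, which is also the target.\<close>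

lemma braid_local:
  assumes ob: "a \<in> letters Q" "b \<in> letters Q" "c \<in> letters Q"
    and bl: "is_black a \<or> is_black b" "is_black a \<or> is_black c" "is_black b \<or> is_black c"
  shows "\<exists>h. (h = Zero [a, b, c] [c, b, a] \<or> c = a \<and> (\<exists>P. dot_poly [a, b, c] P h)) \<and>
    eqv KLRW [a, b, c] [c, b, a]
     ((Cross b c \<otimes>\<^sub>k Ident [a]) \<circ>\<^sub>k (Ident [b] \<otimes>\<^sub>k Cross a c) \<circ>\<^sub>k (Cross a b \<otimes>\<^sub>k Ident [c]))
     (h +\<^sub>k (Ident [c] \<otimes>\<^sub>k Cross a b) \<circ>\<^sub>k (Cross a c \<otimes>\<^sub>k Ident [b]) \<circ>\<^sub>k (Ident [a] \<otimes>\<^sub>k Cross b c))"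
    (is "\<exists>h. _ \<and> eqv _ _ _ ?L1 (h +\<^sub>k ?L2)")
proof -
  have I: "arrow KLRW [x] [x] (Ident [x])" if "x \<in> {a, b, c}" for x using that ob by (auto intro!: is_mor.ident)
  have tc: "arrow KLRW [x, y] [y, x] (Cross x y)" if "x \<in> letters Q" "y \<in> letters Q" "is_black x \<or> is_black y" for x y
    by (rule is_mor.cross[OF that])
  have abc: "[a, b, c] \<in> objects Q" "[c, b, a] \<in> objects Q" using ob by auto
  have r: "arrow KLRW [x, y, z] [y, x, z] (Cross x y \<otimes>\<^sub>k Ident [z])" "arrow KLRW [z, x, y] [z, y, x] (Ident [z] \<otimes>\<^sub>k Cross x y)"
    if "x \<in> letters Q" "y \<in> letters Q" "is_black x \<or> is_black y" "z \<in> {a, b, c}" for x y z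
    using is_mor.tensor[OF tc[OF that(1-3)] I[OF that(4)]] is_mor.tensor[OF I[OF that(4)] tc[OF that(1-3)]] by simp_all
  have t1: "arrow KLRW [a, b, c] [c, b, a] ?L1"
    using is_mor.compose[OF is_mor.compose[OF r(1)[OF ob(1,2) bl(1), of c] r(2)[OF ob(1,3) bl(2), of b]] r(1)[OF ob(2,3) bl(3), of a]] by simp
  have t2: "arrow KLRW [a, b, c] [c, b, a] ?L2"
    using is_mor.compose[OF is_mor.compose[OF r(2)[OF ob(2,3) bl(3), of a] r(1)[OF ob(1,3) bl(2), of b]] r(2)[OF ob(1,2) bl(1), of c]] by simp
  note tm = is_mor.plus[OF t1 is_mor.scale[OF t2, of "- 1"]]
  have zero_case: ?thesis if "eqv KLRW [a, b, c] [c, b, a] (?L1 -\<^sub>k ?L2) (Zero [a, b, c] [c, b, a])"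
    using eqv_of_diff[OF that t1 t2] by blast
  have poly_case: ?thesis if "eqv KLRW [a, b, c] [c, b, a] (?L1 -\<^sub>k ?L2) t" "c = a" "dot_poly [a, b, c] P t" for t P
    using eqv_of_diff[OF that(1) t1 t2] that(2,3) by blast
  have eq_case: ?thesis if "eqv KLRW [a, b, c] [c, b, a] ?L1 ?L2"
  proof (rule zero_case)
    have "eqv KLRW [a, b, c] [c, b, a] (?L1 -\<^sub>k ?L2) (?L2 -\<^sub>k ?L2)"
      by (rule mor_eq.plus[OF that mor_eq.refl[OF is_mor.scale[OF t2]]])
    also have "eqv KLRW [a, b, c] [c, b, a] (?L2 -\<^sub>k ?L2) (Zero [a, b, c] [c, b, a])"
      by (rule lm(1)[OF linear_monoidal_rel.plus_neg is_mor.plus[OF t2 is_mor.scale[OF t2]] is_mor.zero[OF abc]])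
    finally show "eqv KLRW [a, b, c] [c, b, a] (?L1 -\<^sub>k ?L2) (Zero [a, b, c] [c, b, a])" .
  qed
  note tz = is_mor.zero[OF abc, of \<tau> KLRW]
  consider (bbb) i j k where "a = Black i" "b = Black j" "c = Black k"
    | (left) \<theta> j i where "a = Red \<theta>" "b = Black j" "c = Black i"
    | (middle) \<theta> i j where "a = Black i" "b = Red \<theta>" "c = Black j"
    | (right) \<theta> i j where "a = Black i" "b = Black j" "c = Red \<theta>"
    using bl by (cases a; cases b; cases c) auto
  then show ?thesis
  proof cases
    case bbb
    show ?thesis
    proof (cases "i = k \<and> k \<noteq> j")
      case True
      then have "i \<noteq> j" by simp
      then obtain q where q: "dot_expressible (TYPE('k)) [a, b, c] q"
        "q * (Var 3 - Var 1) = f_poly Q i j (Var 3) (Var 2) - f_poly Q i j (Var 1) (Var 2)"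
        using f_poly_quotient[of i j "[a, b, c]"] by blast
      then obtain t :: "('v, 'k) mor" where t: "dot_poly [a, b, c] q t" by (auto simp: dot_expressible_def)
      have "klrw_rel Q (?L1 -\<^sub>k ?L2) t"
        using klrw_rel.braid[of i k j q t Q] t q(2) True bbb by (simp add: delta_mor_def)
      from mor_eq.klrw[OF this tm] have "eqv KLRW [a, b, c] [c, b, a] (?L1 -\<^sub>k ?L2) t"
        using arrow_dot_poly[OF t abc(1), of KLRW] True bbb by simp
      then show ?thesis by (rule poly_case[OF _ _ t]) (use True bbb in simp)
    next
      case False
      have "klrw_rel Q (?L1 -\<^sub>k ?L2) (Zero [a, b, c] [c, b, a])"
        using klrw_rel.braid[of i k j undefined undefined Q] False bbb by (auto simp: delta_mor_def)
      then show ?thesis by (rule zero_case[OF mor_eq.klrw[OF _ tm tz]])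
    qed
  next
    case left
    have "klrw_rel Q ?L1 ?L2" using klrw_rel.braid_red_left[of Q j i \<theta>] left by simp
    then show ?thesis by (rule eq_case[OF mor_eq.klrw[OF _ t1 t2]])
  next
    case right
    have "klrw_rel Q ?L1 ?L2" using klrw_rel.braid_red_right[of Q j \<theta> i] right by simp
    then show ?thesis by (rule eq_case[OF mor_eq.klrw[OF _ t1 t2]])
  next
    case middle
    show ?thesis
    proof (cases "i = j")
      case True
      have "dot_expressible (TYPE('k)) [a, b, c] (\<Sum>(x, y) | x + y + 1 = \<theta> i. Var 1 ^ x * Var 2 ^ y)"
        unfolding case_prod_unfold by (intro dot_expressible) (simp_all add: length_black_positions middle)
      then obtain t :: "('v, 'k) mor" where t: "dot_poly [a, b, c] (\<Sum>(x, y) | x + y + 1 = \<theta> i. Var 1 ^ x * Var 2 ^ y) t"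
        by (auto simp: dot_expressible_def)
      have "klrw_rel Q (?L1 -\<^sub>k ?L2) t"
        using klrw_rel.braid_red_middle[of i j \<theta> t Q] t True middle by (simp add: delta_mor_def)
      from mor_eq.klrw[OF this tm] have "eqv KLRW [a, b, c] [c, b, a] (?L1 -\<^sub>k ?L2) t"
        using arrow_dot_poly[OF t abc(1), of KLRW] True middle by simp
      then show ?thesis by (rule poly_case[OF _ _ t]) (use True middle in simp)
    next
      case False
      have "klrw_rel Q (?L1 -\<^sub>k ?L2) (Zero [a, b, c] [c, b, a])"
        using klrw_rel.braid_red_middle[of i j \<theta> undefined Q] False middle by (auto simp: delta_mor_def)
      then show ?thesis by (rule zero_case[OF mor_eq.klrw[OF _ tm tz]])
    qed
  qed
qed

end

section \<open>Braid moves up to diagrams with fewer pieces\<close>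

lemma is_diagram_append:
  "is_diagram \<tau> X Y (ds @ es) \<longleftrightarrow> (\<exists>Z. is_diagram \<tau> X Z ds \<and> is_diagram \<tau> Z Y es)"
  by (induction ds arbitrary: X) auto

lemma swap_at_Suc_append': "p = length A \<Longrightarrow> swap_at (Suc p) (A @ x # y # z # B) = A @ x # z # y # B"
  by (simp only: swap_at_Suc_append)

lemma piece_mor_Suc_append': "p = length A \<Longrightarrow> piece_mor (A @ x # y # z # B) (Crossing (Suc p)) = ctx (A @ [x]) (Cross y z) B"
  using piece_mor_append'[of "Suc p" "A @ [x]" y z B] by simp

context oklrw
begin

lemma diagram_1:
  assumes "piece_ok Z d" "Z \<in> objects Q"
  shows "eqv oKLRW Z (piece_target \<tau> Z d) (diagram_mor \<tau> Z [d]) (piece_mor Z d)"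
  using ident_left[OF arrow_piece[OF assms]] by simp

lemma diagram_2:
  assumes "is_diagram \<tau> Z Y [d1, d2]" "Z \<in> objects Q"
  shows "eqv oKLRW Z Y (diagram_mor \<tau> Z [d1, d2]) (piece_mor (piece_target \<tau> Z d1) d2 \<circ>\<^sub>k piece_mor Z d1)"
proof -
  let ?Z1 = "piece_target \<tau> Z d1"
  have ok: "piece_ok Z d1" "piece_ok ?Z1 d2" "Y = piece_target \<tau> ?Z1 d2" using assms(1) by auto
  have "eqv oKLRW Z Y (diagram_mor \<tau> Z ([d1] @ [d2])) (piece_mor ?Z1 d2 \<circ>\<^sub>k diagram_mor \<tau> Z [d1])"
    using diagram_snoc[of Z ?Z1 "[d1]" d2] ok assms(2) by simp
  also have "eqv oKLRW Z Y \<dots> (piece_mor ?Z1 d2 \<circ>\<^sub>k piece_mor Z d1)"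
    using comp_cong_right[OF diagram_1[OF ok(1) assms(2)] arrow_piece[OF ok(2) objects_piece_target[OF ok(1) assms(2)]]] ok(3) by simp
  finally show ?thesis by simp
qed

lemma diagram_3:
  assumes "is_diagram \<tau> Z Y [d1, d2, d3]" "Z \<in> objects Q"
  shows "eqv oKLRW Z Y (diagram_mor \<tau> Z [d1, d2, d3])
    (piece_mor (piece_target \<tau> (piece_target \<tau> Z d1) d2) d3 \<circ>\<^sub>k (piece_mor (piece_target \<tau> Z d1) d2 \<circ>\<^sub>k piece_mor Z d1))"
proof -
  let ?Z2 = "piece_target \<tau> (piece_target \<tau> Z d1) d2"
  have d: "is_diagram \<tau> Z ?Z2 [d1, d2]" and ok: "piece_ok ?Z2 d3" "Y = piece_target \<tau> ?Z2 d3" using assms(1) by auto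
  have Z2: "?Z2 \<in> objects Q" using arrow_objects[OF arrow_diagram[OF d assms(2)]] by simp
  have "eqv oKLRW Z Y (diagram_mor \<tau> Z ([d1, d2] @ [d3])) (piece_mor ?Z2 d3 \<circ>\<^sub>k diagram_mor \<tau> Z [d1, d2])"
    using diagram_snoc[OF d ok(1) assms(2)] ok(2) by simp
  also have "eqv oKLRW Z Y \<dots> (piece_mor ?Z2 d3 \<circ>\<^sub>k (piece_mor (piece_target \<tau> Z d1) d2 \<circ>\<^sub>k piece_mor Z d1))"
    using comp_cong_right[OF diagram_2[OF d assms(2)] arrow_piece[OF ok(1) Z2]] ok(2) by simp
  finally show ?thesis by simp
qed

lemma diagram_4:
  assumes "is_diagram \<tau> Z Y [d1, d2, d3, d4]" "Z \<in> objects Q"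
  shows "eqv oKLRW Z Y (diagram_mor \<tau> Z [d1, d2, d3, d4])
    (piece_mor (piece_target \<tau> (piece_target \<tau> (piece_target \<tau> Z d1) d2) d3) d4 \<circ>\<^sub>k
      (piece_mor (piece_target \<tau> (piece_target \<tau> Z d1) d2) d3 \<circ>\<^sub>k (piece_mor (piece_target \<tau> Z d1) d2 \<circ>\<^sub>k piece_mor Z d1)))"
proof -
  let ?Z3 = "piece_target \<tau> (piece_target \<tau> (piece_target \<tau> Z d1) d2) d3"
  have d: "is_diagram \<tau> Z ?Z3 [d1, d2, d3]" and ok: "piece_ok ?Z3 d4" "Y = piece_target \<tau> ?Z3 d4" using assms(1) by auto
  have Z3: "?Z3 \<in> objects Q" using arrow_objects[OF arrow_diagram[OF d assms(2)]] by simp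
  have "eqv oKLRW Z Y (diagram_mor \<tau> Z ([d1, d2, d3] @ [d4])) (piece_mor ?Z3 d4 \<circ>\<^sub>k diagram_mor \<tau> Z [d1, d2, d3])"
    using diagram_snoc[OF d ok(1) assms(2)] ok(2) by simp
  also have "eqv oKLRW Z Y \<dots> (piece_mor ?Z3 d4 \<circ>\<^sub>k (piece_mor (piece_target \<tau> (piece_target \<tau> Z d1) d2) d3 \<circ>\<^sub>k
       (piece_mor (piece_target \<tau> Z d1) d2 \<circ>\<^sub>k piece_mor Z d1)))"
    using comp_cong_right[OF diagram_3[OF d assms(2)] arrow_piece[OF ok(1) Z3]] ok(2) by simp
  finally show ?thesis by simp
qed

lemma ctx_comp3:
  assumes "arrow KLRW X Y f" "arrow KLRW Y Z g" "arrow KLRW Z W h" and ob: "A \<in> objects Q" "B \<in> objects Q"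
  shows "eqv c (A @ X @ B) (A @ W @ B) (ctx A (h \<circ>\<^sub>k g \<circ>\<^sub>k f) B) (ctx A h B \<circ>\<^sub>k (ctx A g B \<circ>\<^sub>k ctx A f B))"
  by (rule mor_eq.trans[OF ctx_comp[OF is_mor.compose[OF assms(1,2)] assms(3) ob]
        comp_cong_right[OF ctx_comp[OF assms(1,2) ob] arrow_ctx[OF assms(3) ob]]])

lemma tensor_ident_comp4:
  assumes "arrow c X1 X2 f1" "arrow c X2 X3 f2" "arrow c X3 X4 f3" "arrow c X4 X5 f4" and B: "B \<in> objects Q"
  shows "eqv c (X1 @ B) (X5 @ B) ((f4 \<circ>\<^sub>k f3 \<circ>\<^sub>k f2 \<circ>\<^sub>k f1) \<otimes>\<^sub>k Ident B)
    ((f4 \<otimes>\<^sub>k Ident B) \<circ>\<^sub>k ((f3 \<otimes>\<^sub>k Ident B) \<circ>\<^sub>k ((f2 \<otimes>\<^sub>k Ident B) \<circ>\<^sub>k (f1 \<otimes>\<^sub>k Ident B))))"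
proof -
  note t = is_mor.tensor[OF assms(3) is_mor.ident[OF B]] is_mor.tensor[OF assms(4) is_mor.ident[OF B]]
  note c12 = is_mor.compose[OF assms(1,2)]
  note c123 = is_mor.compose[OF c12 assms(3)]
  show ?thesis
    by (rule mor_eq.trans[OF tensor_ident_comp[OF c123 assms(4) B]
          comp_cong_right[OF mor_eq.trans[OF tensor_ident_comp[OF c12 assms(3) B]
          comp_cong_right[OF tensor_ident_comp[OF assms(1,2) B] t(1)]] t(2)]])
qed

lemma plus_commute_eqv:
  assumes "arrow c X Y f" "arrow c X Y g"
  shows "eqv c X Y (f +\<^sub>k g) (g +\<^sub>k f)"
  by (rule lm(1)[OF linear_monoidal_rel.plus_comm is_mor.plus[OF assms] is_mor.plus[OF assms(2,1)]])

text \<open>\<open>k\<close> behaves like a combination of diagrams with at most \<open>l\<close>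
  pieces, whatever stands below it. This is all that is used of the corrections to braid
  moves.\<close>

definition lowering :: "nat \<Rightarrow> 'v wrd \<Rightarrow> 'v wrd \<Rightarrow> ('v, 'k) mor \<Rightarrow> bool" where
  "lowering l Z Y k \<longleftrightarrow> arrow oKLRW Z Y k \<and>
     (\<forall>m X f. X \<in> objects Q \<longrightarrow> filt m X Z f \<longrightarrow> filt (m + l) X Y (k \<circ>\<^sub>k f))"

lemma lowering_Zero:
  assumes "Z \<in> objects Q" "Y \<in> objects Q"
  shows "lowering l Z Y (Zero Z Y)"
  unfolding lowering_def
proof (intro conjI allI impI)
  fix m X f assume "X \<in> objects Q" "filt m X Z f"
  then show "filt (m + l) X Y (Zero Z Y \<circ>\<^sub>k f)"
    using lin_span_equiv'[OF lin_span.zero comp_Zero_left[OF lin_span_arrow]] assms by blast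
qed (rule is_mor.zero[OF assms])

lemma lowering_scale:
  assumes "lowering l Z Y k"
  shows "lowering l Z Y (a *\<^sub>k k)"
  unfolding lowering_def
proof (intro conjI allI impI)
  fix m X f assume "X \<in> objects Q" and f: "filt m X Z f"
  then have 1: "filt (m + l) X Y (k \<circ>\<^sub>k f)" and k: "arrow oKLRW Z Y k" using assms by (auto simp: lowering_def)
  show "filt (m + l) X Y ((a *\<^sub>k k) \<circ>\<^sub>k f)"
    by (rule lin_span_equiv'[OF lin_span.scale[OF 1] comp_scale_left_eqv[OF lin_span_arrow[OF f] k]])
qed (use assms is_mor.scale in \<open>auto simp: lowering_def\<close>)

lemma lowering_eqv:
  assumes "lowering l Z Y k" "eqv oKLRW Z Y k' k"
  shows "lowering l Z Y k'"
  unfolding lowering_def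
proof (intro conjI allI impI)
  fix m X f assume "X \<in> objects Q" and f: "filt m X Z f"
  then have 1: "filt (m + l) X Y (k \<circ>\<^sub>k f)" using assms by (auto simp: lowering_def)
  show "filt (m + l) X Y (k' \<circ>\<^sub>k f)"
    by (rule lin_span_equiv'[OF 1 comp_cong_left[OF assms(2) lin_span_arrow[OF f]]])
qed (use eqv_arrow(1)[OF assms(2)] in simp)

lemma lowering_mono: "lowering l Z Y k \<Longrightarrow> l \<le> l' \<Longrightarrow> lowering l' Z Y k"
  unfolding lowering_def using filt_mono by (metis add_le_cancel_left)

lemma lowering_compose:
  assumes "lowering l Z Y k" "lowering l' Y W k'"
  shows "lowering (l + l') Z W (k' \<circ>\<^sub>k k)"
  unfolding lowering_def
proof (intro conjI allI impI)
  have k: "arrow oKLRW Z Y k" "arrow oKLRW Y W k'" using assms by (auto simp: lowering_def)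
  show "arrow oKLRW Z W (k' \<circ>\<^sub>k k)" by (rule is_mor.compose[OF k])
  fix m X f assume X: "X \<in> objects Q" and f: "filt m X Z f"
  then have 1: "filt (m + l + l') X W (k' \<circ>\<^sub>k (k \<circ>\<^sub>k f))" using assms by (auto simp: lowering_def)
  show "filt (m + (l + l')) X W ((k' \<circ>\<^sub>k k) \<circ>\<^sub>k f)"
    using lin_span_equiv'[OF 1 comp_assoc_eqv[OF lin_span_arrow[OF f] k]] by (simp add: add.assoc)
qed

lemma lowering_dot_poly:
  assumes "dot_poly W P t" "A \<in> objects Q" "W \<in> objects Q" "B \<in> objects Q"
  shows "lowering 0 (A @ W @ B) (A @ W @ B) (ctx A t B)"
  unfolding lowering_def using filt_dot_poly[OF assms] arrow_ctx[OF arrow_dot_poly[OF assms(1,3)] assms(2,4)] by auto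

lemma lowering_piece:
  assumes "piece_ok Z d" "Z \<in> objects Q"
  shows "lowering 1 Z (piece_target \<tau> Z d) (piece_mor Z d)"
  unfolding lowering_def using filt_piece[OF _ assms(1)] arrow_piece[OF assms] by auto

text \<open>The correction is zero or a polynomial in dots and adds no piece; 2 is the bound
  \<open>length b - 1\<close> demanded by \<open>braid_move_filt\<close>.\<close>

lemma braid_filt:
  assumes Z: "Z \<in> objects Q" and ZA: "Z = A @ x # y # z # B" and p: "p = length A"
    and d: "is_diagram \<tau> Z Y [Crossing (Suc p), Crossing p, Crossing (Suc p)]"
    and d': "is_diagram \<tau> Z Y [Crossing p, Crossing (Suc p), Crossing p]"
  shows "\<exists>k. eqv oKLRW Z Y (diagram_mor \<tau> Z [Crossing (Suc p), Crossing p, Crossing (Suc p)])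
      (diagram_mor \<tau> Z [Crossing p, Crossing (Suc p), Crossing p] +\<^sub>k k) \<and> lowering 2 Z Y k"
proof -
  have ob: "x \<in> letters Q" "y \<in> letters Q" "z \<in> letters Q" "A \<in> objects Q" "B \<in> objects Q" using Z ZA by auto
  note sw = swap_at_append'[OF p] swap_at_Suc_append'[OF p]
  note pm = piece_mor_append'[OF p] piece_mor_Suc_append'[OF p]
  have Y: "Y = A @ [z, y, x] @ B" using d' ZA by (simp add: sw)
  have nth: "(A @ a # Z') ! p = a" "(A @ a # b # Z') ! Suc p = b" "(A @ a # b # c # Z') ! Suc (Suc p) = c" for a b c :: "'v letter" and Z'
    using p by (simp_all add: nth_append)
  have bl: "is_black x \<or> is_black y" "is_black x \<or> is_black z" "is_black y \<or> is_black z"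
    using d' ZA by (simp_all add: sw nth)
  have bl': "is_black y \<or> is_black x" "is_black z \<or> is_black x" "is_black z \<or> is_black y" using bl by auto
  let ?L1 = "(Cross y z \<otimes>\<^sub>k Ident [x]) \<circ>\<^sub>k (Ident [y] \<otimes>\<^sub>k Cross x z) \<circ>\<^sub>k (Cross x y \<otimes>\<^sub>k Ident [z])"
  let ?L2 = "(Ident [z] \<otimes>\<^sub>k Cross x y) \<circ>\<^sub>k (Cross x z \<otimes>\<^sub>k Ident [y]) \<circ>\<^sub>k (Ident [x] \<otimes>\<^sub>k Cross y z)"
  obtain h where h: "h = Zero [x, y, z] [z, y, x] \<or> z = x \<and> (\<exists>P. dot_poly [x, y, z] P h)"
    "eqv KLRW [x, y, z] [z, y, x] ?L1 (h +\<^sub>k ?L2)"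
    using braid_local[OF ob(1-3) bl] by blast
  have I: "arrow KLRW [u] [u] (Ident [u])" if "u \<in> {x, y, z}" for u using that ob by (auto intro!: is_mor.ident)
  have tc: "arrow KLRW [u, v] [v, u] (Cross u v)" if "u \<in> letters Q" "v \<in> letters Q" "is_black u \<or> is_black v" for u v
    by (rule is_mor.cross[OF that])
  have r: "arrow KLRW [u, v, w] [v, u, w] (Cross u v \<otimes>\<^sub>k Ident [w])" "arrow KLRW [w, u, v] [w, v, u] (Ident [w] \<otimes>\<^sub>k Cross u v)"
    if "u \<in> letters Q" "v \<in> letters Q" "is_black u \<or> is_black v" "w \<in> {x, y, z}" for u v w
    using is_mor.tensor[OF tc[OF that(1-3)] I[OF that(4)]] is_mor.tensor[OF I[OF that(4)] tc[OF that(1-3)]] by simp_all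
  have cr: "eqv oKLRW (A @ [u, v, w] @ B) (A @ [v, u, w] @ B) (ctx A (Cross u v \<otimes>\<^sub>k Ident [w]) B) (ctx A (Cross u v) (w # B))"
    if "u \<in> letters Q" "v \<in> letters Q" "is_black u \<or> is_black v" "w \<in> letters Q" for u v w
    using ctx_tensor_right[OF tc[OF that(1-3)] ob(4) _ ob(5), of "[w]" oKLRW] that by simp
  have cl: "eqv oKLRW (A @ [w, u, v] @ B) (A @ [w, v, u] @ B) (ctx A (Ident [w] \<otimes>\<^sub>k Cross u v) B) (ctx (A @ [w]) (Cross u v) B)"
    if "u \<in> letters Q" "v \<in> letters Q" "is_black u \<or> is_black v" "w \<in> letters Q" for u v w
    using ctx_tensor_left[OF tc[OF that(1-3)] ob(4) _ ob(5), of "[w]" oKLRW] that by simp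
  let ?Z = "A @ [x, y, z] @ B" and ?Y = "A @ [z, y, x] @ B"
  have "eqv oKLRW ?Z ?Y (ctx A ?L1 B) (ctx A (Cross y z \<otimes>\<^sub>k Ident [x]) B \<circ>\<^sub>k (ctx A (Ident [y] \<otimes>\<^sub>k Cross x z) B \<circ>\<^sub>k ctx A (Cross x y \<otimes>\<^sub>k Ident [z]) B))"
    by (rule ctx_comp3[OF r(1)[OF ob(1,2) bl(1)] r(2)[OF ob(1,3) bl(2)] r(1)[OF ob(2,3) bl(3)] ob(4,5)]) simp_all
  also have "eqv oKLRW ?Z ?Y \<dots> (ctx A (Cross y z) (x # B) \<circ>\<^sub>k (ctx (A @ [y]) (Cross x z) B \<circ>\<^sub>k ctx A (Cross x y) (z # B)))"
    by (rule mor_eq.compose[OF mor_eq.compose[OF cr[OF ob(1,2) bl(1) ob(3)] cl[OF ob(1,3) bl(2) ob(2)]] cr[OF ob(2,3) bl(3) ob(1)]])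
  also have "eqv oKLRW ?Z ?Y \<dots> (diagram_mor \<tau> Z [Crossing p, Crossing (Suc p), Crossing p])"
    using mor_eq.sym[OF diagram_3[OF d' Z]] ZA Y by (simp add: sw pm del: diagram_mor.simps)
  finally have E1: "eqv oKLRW ?Z ?Y (ctx A ?L1 B) (diagram_mor \<tau> Z [Crossing p, Crossing (Suc p), Crossing p])" .
  have "eqv oKLRW ?Z ?Y (ctx A ?L2 B) (ctx A (Ident [z] \<otimes>\<^sub>k Cross x y) B \<circ>\<^sub>k (ctx A (Cross x z \<otimes>\<^sub>k Ident [y]) B \<circ>\<^sub>k ctx A (Ident [x] \<otimes>\<^sub>k Cross y z) B))"
    by (rule ctx_comp3[OF r(2)[OF ob(2,3) bl(3)] r(1)[OF ob(1,3) bl(2)] r(2)[OF ob(1,2) bl(1)] ob(4,5)]) simp_all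
  also have "eqv oKLRW ?Z ?Y \<dots> (ctx (A @ [z]) (Cross x y) B \<circ>\<^sub>k (ctx A (Cross x z) (y # B) \<circ>\<^sub>k ctx (A @ [x]) (Cross y z) B))"
    by (rule mor_eq.compose[OF mor_eq.compose[OF cl[OF ob(2,3) bl(3) ob(1)] cr[OF ob(1,3) bl(2) ob(2)]] cl[OF ob(1,2) bl(1) ob(3)]])
  also have "eqv oKLRW ?Z ?Y \<dots> (diagram_mor \<tau> Z [Crossing (Suc p), Crossing p, Crossing (Suc p)])"
    using mor_eq.sym[OF diagram_3[OF d Z]] ZA Y by (simp add: sw pm del: diagram_mor.simps)
  finally have E2: "eqv oKLRW ?Z ?Y (ctx A ?L2 B) (diagram_mor \<tau> Z [Crossing (Suc p), Crossing p, Crossing (Suc p)])" .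
  have th: "arrow KLRW [x, y, z] [z, y, x] h"
    using h(1) ob arrow_dot_poly[of "[x, y, z]" _ h KLRW] by (auto intro!: is_mor.zero)
  have t1: "arrow KLRW [x, y, z] [z, y, x] ?L1" by (rule eqv_arrow(1)[OF h(2)])
  have t2: "arrow KLRW [x, y, z] [z, y, x] ?L2"
    by (rule is_mor.compose[OF is_mor.compose[OF r(2)[OF ob(2,3) bl(3)] r(1)[OF ob(1,3) bl(2)]] r(2)[OF ob(1,2) bl(1)]]) simp_all
  note tsh = is_mor.scale[OF th, of "- 1"]
  let ?k = "ctx A ((- 1) *\<^sub>k h) B"
  have "eqv KLRW [x, y, z] [z, y, x] ?L2 (?L1 +\<^sub>k (- 1) *\<^sub>k h)"
    by (rule eqv_move[OF mor_eq.trans[OF h(2) plus_commute_eqv[OF th t2]] t2 th])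
  then have "eqv oKLRW ?Z ?Y (ctx A ?L2 B) (ctx A ?L1 B +\<^sub>k ?k)"
    by (rule mor_eq.trans[OF ctx_cong[OF _ ob(4,5)] ctx_plus[OF t1 tsh ob(4,5)]])
  then have "eqv oKLRW ?Z ?Y (diagram_mor \<tau> Z [Crossing (Suc p), Crossing p, Crossing (Suc p)])
      (diagram_mor \<tau> Z [Crossing p, Crossing (Suc p), Crossing p] +\<^sub>k ?k)"
    by (rule mor_eq.trans[OF mor_eq.trans[OF mor_eq.sym[OF E2]] mor_eq.plus[OF E1 mor_eq.refl[OF arrow_ctx[OF tsh ob(4,5)]]]])
  moreover have "lowering 2 ?Z ?Y ?k"
  proof (rule lowering_eqv[OF lowering_scale ctx_scale[OF th ob(4,5)]])
    have xyz: "[x, y, z] \<in> objects Q" "[z, y, x] \<in> objects Q" using ob by auto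
    show "lowering 2 ?Z ?Y (ctx A h B)"
      using h(1)
    proof (elim disjE conjE exE)
      assume "h = Zero [x, y, z] [z, y, x]"
      then show ?thesis
        using lowering_eqv[OF lowering_Zero ctx_Zero[OF xyz ob(4,5)], of 2] ob by simp
    next
      fix P assume "z = x" "dot_poly [x, y, z] P h"
      then show ?thesis using lowering_mono[OF lowering_dot_poly[OF _ ob(4) xyz(1) ob(5)], of P h 2] by simp
    qed
  qed
  ultimately show ?thesis using ZA Y by auto
qed

text \<open>For \<open>\<tau> i = j\<close> the correction is a polynomial in dots above the single
  crossing \<open>BCross i j\<close>; otherwise it is zero. Again 3 is one less than the number of
  pieces.\<close>

lemma mirror_braid_filt:
  assumes Z: "Z \<in> objects Q" and d: "is_diagram \<tau> Z Y [Crossing 0, Mirror, Crossing 0, Mirror]"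
    and d': "is_diagram \<tau> Z Y [Mirror, Crossing 0, Mirror, Crossing 0]"
  shows "\<exists>k. eqv oKLRW Z Y (diagram_mor \<tau> Z [Crossing 0, Mirror, Crossing 0, Mirror])
      (diagram_mor \<tau> Z [Mirror, Crossing 0, Mirror, Crossing 0] +\<^sub>k k) \<and> lowering 3 Z Y k"
proof -
  have "piece_ok Z (Crossing 0)" using d by simp
  then obtain a b C where Zab: "Z = a # b # C" using crossing_okE by (metis append_Nil length_0_conv)
  have sw: "swap_at 0 (u # v # W) = v # u # W" for u v :: "'v letter" and W
    using swap_at_append'[of 0 "[]" u v W] by simp
  obtain i where a: "a = Black i" using d' Zab by (cases a) auto
  obtain j where b: "b = Black j" using d' Zab a by (cases b) (auto simp: sw)
  have ob: "i \<in> verts Q" "j \<in> verts Q" "C \<in> objects Q" using Z Zab a b by (auto simp: letters_def)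
  have obt: "\<tau> i \<in> verts Q" "\<tau> j \<in> verts Q" using ob tau_closed by auto
  have Y: "Y = [Black (\<tau> i), Black (\<tau> j)] @ C" using d' Zab a b by (simp add: sw)
  have Zij: "Z = [Black i, Black j] @ C" using Zab a b by simp
  have pmc: "piece_mor (u # v # W) (Crossing 0) = (ctx [] (Cross u v) W :: ('v, 'k) mor)" for u v W
    using piece_mor_append'[of 0 "[]" u v W] by simp
  have pmm: "piece_mor (Black u # W) Mirror = (Reflect u \<otimes>\<^sub>k Ident W :: ('v, 'k) mor)" for u W
    by (simp add: piece_mor.simps)
  have ob1: "[Black u] \<in> objects Q" if "u \<in> verts Q" for u using that by (auto simp: letters_def)
  have tc: "arrow c [Black u, Black v] [Black v, Black u] (BCross u v)" if "u \<in> verts Q" "v \<in> verts Q" for u v c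
    using that by (intro is_mor.cross) (auto simp: letters_def)
  have tr: "arrow oKLRW [Black u, Black v] [Black (\<tau> u), Black v] (Reflect u \<otimes>\<^sub>k Ident [Black v])"
    if "u \<in> verts Q" "v \<in> verts Q" for u v
    using is_mor.tensor[OF is_mor.reflect[OF that(1), of \<tau>] is_mor.ident[OF ob1[OF that(2)]]] by simp
  have cc: "eqv oKLRW ([Black u, Black v] @ C) ([Black v, Black u] @ C) (BCross u v \<otimes>\<^sub>k Ident C) (ctx [] (BCross u v) C)"
    if "u \<in> verts Q" "v \<in> verts Q" for u v
    by (rule mor_eq.sym[OF ctx_Nil[OF tc[OF that] ob(3)]])
  have cm: "eqv oKLRW ([Black u, Black v] @ C) ([Black (\<tau> u), Black v] @ C) ((Reflect u \<otimes>\<^sub>k Ident [Black v]) \<otimes>\<^sub>k Ident C)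
      (Reflect u \<otimes>\<^sub>k Ident (Black v # C))" if "u \<in> verts Q" "v \<in> verts Q" for u v
    using tensor_ident_append[OF is_mor.reflect[OF that(1), of \<tau>] ob1[OF that(2)] ob(3)] by simp
  let ?L1 = "BCross (\<tau> j) (\<tau> i) \<circ>\<^sub>k (Reflect j \<otimes>\<^sub>k Ident [Black (\<tau> i)]) \<circ>\<^sub>k BCross (\<tau> i) j \<circ>\<^sub>k (Reflect i \<otimes>\<^sub>k Ident [Black j])"
  let ?L2 = "(Reflect i \<otimes>\<^sub>k Ident [Black (\<tau> j)]) \<circ>\<^sub>k BCross (\<tau> j) i \<circ>\<^sub>k (Reflect j \<otimes>\<^sub>k Ident [Black i]) \<circ>\<^sub>k BCross i j"
  let ?X = "[Black i, Black j]" and ?W = "[Black (\<tau> i), Black (\<tau> j)]"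
  let ?D = "diagram_mor \<tau> Z [Crossing 0, Mirror, Crossing 0, Mirror]" and ?D' = "diagram_mor \<tau> Z [Mirror, Crossing 0, Mirror, Crossing 0]"
  have XW: "?X \<in> objects Q" "?W \<in> objects Q" using ob obt by (auto simp: letters_def)
  have "eqv oKLRW (?X @ C) (?W @ C) (?L1 \<otimes>\<^sub>k Ident C)
     ((BCross (\<tau> j) (\<tau> i) \<otimes>\<^sub>k Ident C) \<circ>\<^sub>k (((Reflect j \<otimes>\<^sub>k Ident [Black (\<tau> i)]) \<otimes>\<^sub>k Ident C) \<circ>\<^sub>k
       ((BCross (\<tau> i) j \<otimes>\<^sub>k Ident C) \<circ>\<^sub>k ((Reflect i \<otimes>\<^sub>k Ident [Black j]) \<otimes>\<^sub>k Ident C))))"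
    by (rule tensor_ident_comp4[OF tr[OF ob(1,2)] tc[OF obt(1) ob(2)] tr[OF ob(2) obt(1)] tc[OF obt(2,1)] ob(3)])
  also have "eqv oKLRW (?X @ C) (?W @ C) \<dots>
     (ctx [] (BCross (\<tau> j) (\<tau> i)) C \<circ>\<^sub>k ((Reflect j \<otimes>\<^sub>k Ident (Black (\<tau> i) # C)) \<circ>\<^sub>k
       (ctx [] (BCross (\<tau> i) j) C \<circ>\<^sub>k (Reflect i \<otimes>\<^sub>k Ident (Black j # C)))))"
    by (rule mor_eq.compose[OF mor_eq.compose[OF mor_eq.compose[OF cm[OF ob(1,2)] cc[OF obt(1) ob(2)]] cm[OF ob(2) obt(1)]] cc[OF obt(2,1)]])
  also have "eqv oKLRW (?X @ C) (?W @ C) \<dots> ?D'"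
    using mor_eq.sym[OF diagram_4[OF d' Z]] Zij Y by (simp add: sw pmc pmm del: diagram_mor.simps)
  finally have E1: "eqv oKLRW (?X @ C) (?W @ C) (?L1 \<otimes>\<^sub>k Ident C) ?D'" .
  have "eqv oKLRW (?X @ C) (?W @ C) (?L2 \<otimes>\<^sub>k Ident C)
     (((Reflect i \<otimes>\<^sub>k Ident [Black (\<tau> j)]) \<otimes>\<^sub>k Ident C) \<circ>\<^sub>k ((BCross (\<tau> j) i \<otimes>\<^sub>k Ident C) \<circ>\<^sub>k
       (((Reflect j \<otimes>\<^sub>k Ident [Black i]) \<otimes>\<^sub>k Ident C) \<circ>\<^sub>k (BCross i j \<otimes>\<^sub>k Ident C))))"
    by (rule tensor_ident_comp4[OF tc[OF ob(1,2)] tr[OF ob(2,1)] tc[OF obt(2) ob(1)] tr[OF ob(1) obt(2)] ob(3)])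
  also have "eqv oKLRW (?X @ C) (?W @ C) \<dots>
     ((Reflect i \<otimes>\<^sub>k Ident (Black (\<tau> j) # C)) \<circ>\<^sub>k (ctx [] (BCross (\<tau> j) i) C \<circ>\<^sub>k
       ((Reflect j \<otimes>\<^sub>k Ident (Black i # C)) \<circ>\<^sub>k ctx [] (BCross i j) C)))"
    by (rule mor_eq.compose[OF mor_eq.compose[OF mor_eq.compose[OF cc[OF ob(1,2)] cm[OF ob(2,1)]] cc[OF obt(2) ob(1)]] cm[OF ob(1) obt(2)]])
  also have "eqv oKLRW (?X @ C) (?W @ C) \<dots> ?D"
    using mor_eq.sym[OF diagram_4[OF d Z]] Zij Y by (simp add: sw pmc pmm del: diagram_mor.simps)
  finally have E2: "eqv oKLRW (?X @ C) (?W @ C) (?L2 \<otimes>\<^sub>k Ident C) ?D" .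
  have t1: "arrow oKLRW ?X ?W ?L1"
    by (rule is_mor.compose[OF is_mor.compose[OF is_mor.compose[OF tr[OF ob(1,2)] tc[OF obt(1) ob(2)]] tr[OF ob(2) obt(1)]] tc[OF obt(2,1)]])
  have t2: "arrow oKLRW ?X ?W ?L2"
    by (rule is_mor.compose[OF is_mor.compose[OF is_mor.compose[OF tc[OF ob(1,2)] tr[OF ob(2,1)]] tc[OF obt(2) ob(1)]] tr[OF ob(1) obt(2)]])
  note tm = is_mor.plus[OF t1 is_mor.scale[OF t2, of "- 1"]] and tI = is_mor.ident[OF ob(3)]
  have "\<exists>h. eqv oKLRW ?X ?W (?L1 -\<^sub>k ?L2) h \<and> lowering 3 (?X @ C) (?W @ C) (h \<otimes>\<^sub>k Ident C)"
  proof (cases "\<tau> i = j")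
    case False
    have "mirror_rel \<tau> \<mu> (?L1 -\<^sub>k ?L2) (Zero ?X ?W)"
      using mirror_rel.reflect_braid[of \<tau> i j undefined undefined \<mu>] False by (simp add: delta_mor_def)
    then have 1: "eqv oKLRW ?X ?W (?L1 -\<^sub>k ?L2) (Zero ?X ?W)" by (rule mor_eq.mirror[OF _ tm is_mor.zero[OF XW]])
    have z: "arrow oKLRW ?X ?W (Zero ?X ?W)" by (rule is_mor.zero[OF XW])
    have "eqv oKLRW (?X @ C) (?W @ C) (Zero ?X ?W \<otimes>\<^sub>k Ident C) ((0 *\<^sub>k Zero ?X ?W) \<otimes>\<^sub>k Ident C)"
      by (rule mor_eq.tensor[OF zero_scale[OF XW] mor_eq.refl[OF tI]])
    also have "eqv oKLRW (?X @ C) (?W @ C) \<dots> (0 *\<^sub>k (Zero ?X ?W \<otimes>\<^sub>k Ident C))"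
      by (rule lm(1)[OF linear_monoidal_rel.tensor_scale_left is_mor.tensor[OF is_mor.scale[OF z] tI] is_mor.scale[OF is_mor.tensor[OF z tI]]])
    also have "eqv oKLRW (?X @ C) (?W @ C) \<dots> (Zero (?X @ C) (?W @ C))"
      by (rule scale_0[OF is_mor.tensor[OF z tI]])
    finally have zI: "eqv oKLRW (?X @ C) (?W @ C) (Zero ?X ?W \<otimes>\<^sub>k Ident C) (Zero (?X @ C) (?W @ C))" .
    have "lowering 3 (?X @ C) (?W @ C) (Zero ?X ?W \<otimes>\<^sub>k Ident C)"
      by (rule lowering_eqv[OF lowering_Zero zI]) (use XW ob in simp_all)
    then show ?thesis using 1 by blast
  next
    case True
    have "\<tau> (\<tau> i) = i" by (rule tau_invol[OF ob(1)])
    then have tj: "\<tau> j = i" using True by simp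
    obtain q where q: "dot_expressible (TYPE('k)) [Black j, Black i] q"
       "q * (Var 1 + Var 2) = fmu_poly \<tau> \<mu> i (Var 1) - fmu_poly \<tau> \<mu> j (Var 2)"
      using fmu_poly_quotient[of i "[Black j, Black i]"] tau_invol[OF ob(1)] True by (auto simp: length_black_positions)
    then obtain t :: "('v, 'k) mor" where t: "dot_poly [Black j, Black i] q t" by (auto simp: dot_expressible_def)
    have rel: "mirror_rel \<tau> \<mu> (?L1 -\<^sub>k ?L2) (t \<circ>\<^sub>k BCross i j)"
      using mirror_rel.reflect_braid[of \<tau> i j q t \<mu>] True t q(2) by (simp add: delta_mor_def)
    \<comment> \<open>Reflecting both strands now has the same effect on the word as one crossing,
      which is why the correction is well typed.\<close>
    have W: "?W = [Black j, Black i]" using True tj by simp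
    have tt: "arrow KLRW ?W ?W t" unfolding W by (rule arrow_dot_poly[OF t]) (use XW W in simp)
    have tcij: "arrow KLRW ?X ?W (BCross i j)" unfolding W by (rule tc[OF ob(1,2)])
    have 1: "eqv oKLRW ?X ?W (?L1 -\<^sub>k ?L2) (t \<circ>\<^sub>k BCross i j)"
      by (rule mor_eq.mirror[OF rel tm arrow_mono[OF is_mor.compose[OF tcij tt]]])
    have "eqv oKLRW (?X @ C) (?W @ C) ((t \<circ>\<^sub>k BCross i j) \<otimes>\<^sub>k Ident C) ((t \<otimes>\<^sub>k Ident C) \<circ>\<^sub>k (BCross i j \<otimes>\<^sub>k Ident C))"
      by (rule tensor_ident_comp[OF arrow_mono[OF tcij] arrow_mono[OF tt] ob(3)])
    also have "eqv oKLRW (?X @ C) (?W @ C) \<dots> (ctx [] t C \<circ>\<^sub>k ctx [] (BCross i j) C)"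
      by (rule mor_eq.compose[OF mor_eq.sym[OF ctx_Nil[OF tcij ob(3)]] mor_eq.sym[OF ctx_Nil[OF tt ob(3)]]])
    finally have e: "eqv oKLRW (?X @ C) (?W @ C) ((t \<circ>\<^sub>k BCross i j) \<otimes>\<^sub>k Ident C) (ctx [] t C \<circ>\<^sub>k ctx [] (BCross i j) C)" .
    have l1: "lowering 1 (?X @ C) (?W @ C) (ctx [] (BCross i j) C)"
      using lowering_piece[of Z "Crossing 0"] Z Zij True tj by (simp add: sw pmc)
    have l2: "lowering 0 (?W @ C) (?W @ C) (ctx [] t C)"
      using lowering_dot_poly[OF t, of "[]" C] XW W ob by simp
    have "lowering 3 (?X @ C) (?W @ C) (ctx [] t C \<circ>\<^sub>k ctx [] (BCross i j) C)"
      by (rule lowering_mono[OF lowering_compose[OF l1 l2]]) simp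
    then show ?thesis using 1 lowering_eqv[OF _ e] by blast
  qed
  then obtain h where h: "eqv oKLRW ?X ?W (?L1 -\<^sub>k ?L2) h" "lowering 3 (?X @ C) (?W @ C) (h \<otimes>\<^sub>k Ident C)" by blast
  note th = eqv_arrow(2)[OF h(1)]
  note tsh = is_mor.scale[OF th, of "- 1"]
  let ?k = "((- 1) *\<^sub>k h) \<otimes>\<^sub>k Ident C"
  have "eqv oKLRW ?X ?W ?L2 (?L1 +\<^sub>k (- 1) *\<^sub>k h)"
    by (rule eqv_move[OF mor_eq.trans[OF eqv_of_diff[OF h(1) t1 t2] plus_commute_eqv[OF th t2]] t2 th])
  then have "eqv oKLRW (?X @ C) (?W @ C) (?L2 \<otimes>\<^sub>k Ident C) ((?L1 +\<^sub>k (- 1) *\<^sub>k h) \<otimes>\<^sub>k Ident C)"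
    by (rule mor_eq.tensor[OF _ mor_eq.refl[OF tI]])
  also have "eqv oKLRW (?X @ C) (?W @ C) \<dots> (?L1 \<otimes>\<^sub>k Ident C +\<^sub>k ?k)"
    by (rule lm(1)[OF linear_monoidal_rel.tensor_plus_left is_mor.tensor[OF is_mor.plus[OF t1 tsh] tI]
          is_mor.plus[OF is_mor.tensor[OF t1 tI] is_mor.tensor[OF tsh tI]]])
  finally have "eqv oKLRW (?X @ C) (?W @ C) ?D (?D' +\<^sub>k ?k)"
    by (rule mor_eq.trans[OF mor_eq.trans[OF mor_eq.sym[OF E2]] mor_eq.plus[OF E1 mor_eq.refl[OF is_mor.tensor[OF tsh tI]]]])
  moreover have "lowering 3 (?X @ C) (?W @ C) ?k"
    by (rule lowering_eqv[OF lowering_scale[OF h(2), of "- 1"]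
         lm(1)[OF linear_monoidal_rel.tensor_scale_left is_mor.tensor[OF tsh tI] is_mor.scale[OF is_mor.tensor[OF th tI]]]])
  ultimately show ?thesis using Zij Y by auto
qed

text \<open>The two moves of distant pieces hold exactly; a zero correction puts them into the
  common form.\<close>

lemma exact_braid:
  assumes e: "eqv oKLRW Z Y f g" and Z: "Z \<in> objects Q"
  shows "\<exists>k. eqv oKLRW Z Y f (g +\<^sub>k k) \<and> lowering l Z Y k"
proof (intro exI conjI)
  have Y: "Y \<in> objects Q" using arrow_objects[OF eqv_arrow(1)[OF e]] by simp
  show "eqv oKLRW Z Y f (g +\<^sub>k Zero Z Y)" by (rule mor_eq.trans[OF e mor_eq.sym[OF plus_Zero[OF eqv_arrow(2)[OF e]]]])
  show "lowering l Z Y (Zero Z Y)" by (rule lowering_Zero[OF Z Y])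
qed

lemma braid_move_filt:
  assumes "braid_move b b'" and Z: "Z \<in> objects Q" and d: "is_diagram \<tau> Z Y b" "is_diagram \<tau> Z Y b'"
  shows "\<exists>k. eqv oKLRW Z Y (diagram_mor \<tau> Z b) (diagram_mor \<tau> Z b' +\<^sub>k k) \<and> lowering (length b - 1) Z Y k"
  using assms(1)
proof cases
  case (far p q)
  have "q + 1 < length Z" using far d by simp
  then obtain A' c e C where A': "Z = A' @ c # e # C" "length A' = q" by (rule split_at_crossing)
  have "p + 1 < length A'" using far A' by simp
  then obtain A x y B where A: "A' = A @ x # y # B" "length A = p" by (rule split_at_crossing)
  have Zx: "Z = A @ x # y # B @ c # e # C" using A A' by simp
  have q: "q = length (A @ u # v # B)" for u v using A A' by simp
  have sq: "swap_at q (A @ u # v # B @ c # e # C) = A @ u # v # B @ e # c # C" for u v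
    using swap_at_append'[OF q, of u v c e C] by simp
  have sp: "swap_at p (A @ u # v # W) = A @ v # u # W" for u v W using A by (simp add: swap_at_append')
  have pq: "piece_mor (A @ u # v # B @ c # e # C) (Crossing q) = (ctx (A @ [u, v] @ B) (Cross c e) C :: ('v, 'k) mor)" for u v
    using piece_mor_append'[OF q, of u v c e C] by simp
  have pp: "piece_mor (A @ u # v # W) (Crossing p) = (ctx A (Cross u v) W :: ('v, 'k) mor)" for u v W
    using A by (simp add: piece_mor_append')
  have nq: "(A @ u # v # B @ c # e # C) ! q = c" "(A @ u # v # B @ c # e # C) ! Suc q = e" for u v
    unfolding q[of u v] by (simp_all add: nth_append)
  have np: "(A @ u # v # W) ! p = u" "(A @ u # v # W) ! Suc p = v" for u v W using A by (simp_all add: nth_append)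
  have bl: "is_black x \<or> is_black y" "is_black c \<or> is_black e" using d far Zx by (simp_all add: sp sq np nq)
  have ob: "A \<in> objects Q" "B \<in> objects Q" "C \<in> objects Q" "x \<in> letters Q" "y \<in> letters Q" "c \<in> letters Q" "e \<in> letters Q"
    using Z Zx by auto
  have Y: "Y = A @ [y, x] @ B @ [e, c] @ C" using d far Zx by (simp add: sp sq)
  have "eqv oKLRW Z Y (diagram_mor \<tau> Z b) (ctx (A @ [y, x] @ B) (Cross c e) C \<circ>\<^sub>k ctx A (Cross x y) (B @ [c, e] @ C))"
    using diagram_2[OF d(1)[unfolded far(1)] Z] Zx unfolding far(1) by (simp add: sp pq pp del: diagram_mor.simps)
  also have "eqv oKLRW Z Y \<dots> (ctx A (Cross x y) (B @ [e, c] @ C) \<circ>\<^sub>k ctx (A @ [x, y] @ B) (Cross c e) C)"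
    using ctx_far[OF is_mor.cross[OF ob(4,5) bl(1)] is_mor.cross[OF ob(6,7) bl(2)] ob(1-3)] Zx Y by simp
  also have "eqv oKLRW Z Y \<dots> (diagram_mor \<tau> Z b')"
    using mor_eq.sym[OF diagram_2[OF d(2)[unfolded far(2)] Z]] Zx unfolding far(2) by (simp add: sq pq pp del: diagram_mor.simps)
  finally show ?thesis by (rule exact_braid[OF _ Z])
next
  case (far_mirror p)
  obtain a W where "Z = a # W" using d far_mirror by (cases Z) auto
  then obtain i where Zi: "Z = Black i # W" using d far_mirror by (cases a) auto
  obtain p' where p': "p = Suc p'" using far_mirror by (cases p) auto
  have "p' + 1 < length W" using d far_mirror p' Zi by simp
  then obtain B c e C where W: "W = B @ c # e # C" "length B = p'" by (rule split_at_crossing)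
  have p: "p = length (u # B)" for u :: "'v letter" using W p' by simp
  have sp: "swap_at p (u # B @ c # e # C) = u # B @ e # c # C" for u using swap_at_append'[OF p, of u c e C] by simp
  have pp: "piece_mor (u # B @ c # e # C) (Crossing p) = (ctx ([u] @ B) (Cross c e) C :: ('v, 'k) mor)" for u
    using piece_mor_append'[OF p, of u c e C] by simp
  have pmm: "piece_mor (Black u # W) Mirror = (Reflect u \<otimes>\<^sub>k Ident W :: ('v, 'k) mor)" for u W
    by (simp add: piece_mor.simps)
  have np: "(u # B @ c # e # C) ! p = c" "(u # B @ c # e # C) ! Suc p = e" for u
    unfolding p[of u] by (simp_all add: nth_append)
  have "(B @ c # e # C) ! p = e" using W p' by (simp add: nth_append)
  then have bl: "is_black c \<or> is_black e" using d far_mirror Zi W by (simp add: np)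
  have ob: "i \<in> verts Q" "B \<in> objects Q" "C \<in> objects Q" "c \<in> letters Q" "e \<in> letters Q"
    using Z Zi W by (auto simp: letters_def)
  have Y: "Y = [Black (\<tau> i)] @ B @ [e, c] @ C" using d far_mirror Zi W by (simp add: sp)
  have "eqv oKLRW Z Y (diagram_mor \<tau> Z b) (ctx ([Black (\<tau> i)] @ B) (Cross c e) C \<circ>\<^sub>k (Reflect i \<otimes>\<^sub>k Ident (B @ [c, e] @ C)))"
    using diagram_2[OF d(1)[unfolded far_mirror(1)] Z] Zi W unfolding far_mirror(1) by (simp add: pp pmm del: diagram_mor.simps)
  also have "eqv oKLRW Z Y \<dots> ((Reflect i \<otimes>\<^sub>k Ident (B @ [e, c] @ C)) \<circ>\<^sub>k ctx ([Black i] @ B) (Cross c e) C)"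
    using far_exchange[OF is_mor.reflect[OF ob(1), of \<tau>] is_mor.cross[OF ob(4,5) bl] ob(2,3)] Zi W Y by simp
  also have "eqv oKLRW Z Y \<dots> (diagram_mor \<tau> Z b')"
    using mor_eq.sym[OF diagram_2[OF d(2)[unfolded far_mirror(2)] Z]] Zi W unfolding far_mirror(2) by (simp add: sp pp pmm del: diagram_mor.simps)
  finally show ?thesis by (rule exact_braid[OF _ Z])
next
  case (braid p)
  have "Suc p + 1 < length Z" using d braid by simp
  then obtain A' y z B where A': "Z = A' @ y # z # B" "length A' = Suc p" by (rule split_at_crossing)
  then obtain A x where "A' = A @ [x]" by (cases A' rule: rev_cases) auto
  then have "Z = A @ x # y # z # B" "p = length A" using A' by simp_all
  from braid_filt[OF Z this d(1)[unfolded braid(1)] d(2)[unfolded braid(2)]] show ?thesis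
    unfolding braid by (simp add: numeral_2_eq_2 del: diagram_mor.simps)
next
  case mirror_braid
  from mirror_braid_filt[OF Z d(1)[unfolded mirror_braid(1)] d(2)[unfolded mirror_braid(2)]] show ?thesis
    unfolding mirror_braid by (simp add: numeral_3_eq_3 del: diagram_mor.simps)
qed

subsection \<open>Diagrams modulo fewer crossings\<close>

text \<open>Equality modulo diagrams with fewer pieces than \<open>ds\<close>; the equal lengths
  make this symmetric.\<close>

definition diagram_equiv :: "'v wrd \<Rightarrow> diagram \<Rightarrow> diagram \<Rightarrow> bool" where
  "diagram_equiv X ds es \<longleftrightarrow> (\<exists>Y h. is_diagram \<tau> X Y ds \<and> is_diagram \<tau> X Y es \<and> length es = length ds \<and>
     filt (length ds) X Y h \<and> eqv oKLRW X Y (diagram_mor \<tau> X ds) (diagram_mor \<tau> X es +\<^sub>k h))"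

text \<open>\<open>matsumoto\<close> with \<open>compatible X\<close> as the invariant: a braid move
  costs a correction with fewer pieces, and a further piece on top raises the length and the bound
  on the correction alike.\<close>

lemma reduced_equiv:
  assumes X: "X \<in> objects Q"
  shows "\<lbrakk>reduced (length X) ds; reduced (length X) es; state (length X) ds = state (length X) es;
    compatible X (state (length X) ds)\<rbrakk> \<Longrightarrow> diagram_equiv X ds es"
proof (rule matsumoto[where C = "compatible X" and R = "diagram_equiv X" and N = "length X"])
  note inv = involutive_on_objects[OF X]
  show "diagram_equiv X es ds" if "diagram_equiv X ds es" for ds es
  proof -
    obtain Y h where Y: "is_diagram \<tau> X Y ds" "is_diagram \<tau> X Y es" "length es = length ds"
      "filt (length ds) X Y h" "eqv oKLRW X Y (diagram_mor \<tau> X ds) (diagram_mor \<tau> X es +\<^sub>k h)"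
      using \<open>diagram_equiv X ds es\<close> unfolding diagram_equiv_def by blast
    have "eqv oKLRW X Y (diagram_mor \<tau> X es) (diagram_mor \<tau> X ds +\<^sub>k (- 1) *\<^sub>k h)"
      by (rule eqv_move[OF Y(5) arrow_diagram[OF Y(2) X] lin_span_arrow[OF Y(4)]])
    then show ?thesis unfolding diagram_equiv_def using Y lin_span.scale[OF Y(4), of "- 1"]
      by (intro exI[of _ Y] exI[of _ "(- 1) *\<^sub>k h"]) simp
  qed
  show "diagram_equiv X ds fs" if "diagram_equiv X ds es" "diagram_equiv X es fs" for ds es fs
  proof -
    note eqs = that
    obtain Y h where Y: "is_diagram \<tau> X Y ds" "is_diagram \<tau> X Y es" "length es = length ds"
      "filt (length ds) X Y h" "eqv oKLRW X Y (diagram_mor \<tau> X ds) (diagram_mor \<tau> X es +\<^sub>k h)"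
      using eqs(1) unfolding diagram_equiv_def by blast
    obtain Y' h' where Y': "is_diagram \<tau> X Y' es" "is_diagram \<tau> X Y' fs" "length fs = length es"
      "filt (length es) X Y' h'" "eqv oKLRW X Y' (diagram_mor \<tau> X es) (diagram_mor \<tau> X fs +\<^sub>k h')"
      using eqs(2) unfolding diagram_equiv_def by blast
    have YY: "Y' = Y" using is_diagram_unique Y Y' by blast
    note h = lin_span_arrow[OF Y(4)] lin_span_arrow[OF Y'(4)[unfolded YY]] arrow_diagram[OF Y'(2)[unfolded YY] X]
    have "eqv oKLRW X Y (diagram_mor \<tau> X ds) ((diagram_mor \<tau> X fs +\<^sub>k h') +\<^sub>k h)"
      by (rule mor_eq.trans[OF Y(5) mor_eq.plus[OF Y'(5)[unfolded YY] mor_eq.refl[OF h(1)]]])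
    also have "eqv oKLRW X Y \<dots> (diagram_mor \<tau> X fs +\<^sub>k (h' +\<^sub>k h))"
      by (rule lm(1)[OF linear_monoidal_rel.plus_assoc is_mor.plus[OF is_mor.plus[OF h(3,2)] h(1)] is_mor.plus[OF h(3) is_mor.plus[OF h(2,1)]]])
    finally show ?thesis unfolding diagram_equiv_def using Y Y' YY lin_span.plus[of _ X Y h' h]
      by (intro exI[of _ Y] exI[of _ "h' +\<^sub>k h"]) simp
  qed
  show "diagram_equiv X [] []"
    unfolding diagram_equiv_def
    by (intro exI[of _ X] exI[of _ "Zero X X"])
      (auto intro: lin_span.zero[OF X X] mor_eq.sym[OF plus_Zero[OF is_mor.ident[OF X]]])
  show "compatible X (piece_act xs d)"
    if "compatible X xs" "signed_list (length X) xs" "in_range (length X) d" "descends xs d" for xs d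
    by (rule compatible_descent(1)[OF that])
  show "diagram_equiv X (ds @ [d]) (es @ [d])"
    if "diagram_equiv X ds es" "reduced (length X) (ds @ [d])" "reduced (length X) (es @ [d])"
      "state (length X) es = state (length X) ds" "compatible X (state (length X) (ds @ [d]))" for ds es d
  proof -
    note asm = that
    obtain Y h where Y: "is_diagram \<tau> X Y ds" "is_diagram \<tau> X Y es" "length es = length ds"
      "filt (length ds) X Y h" "eqv oKLRW X Y (diagram_mor \<tau> X ds) (diagram_mor \<tau> X es +\<^sub>k h)"
      using asm(1) unfolding diagram_equiv_def by blast
    have "\<exists>Z. is_diagram \<tau> X Z ds \<and> piece_ok Z d"
      using reduced_is_diagram[OF inv asm(2,5)] unfolding is_diagram_snoc by blast
    then have ok: "piece_ok Y d" using is_diagram_unique Y(1) by blast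
    let ?T = "piece_target \<tau> Y d"
    note tes = arrow_diagram[OF Y(2) X] and th = lin_span_arrow[OF Y(4)]
    have tP: "arrow oKLRW Y ?T (piece_mor Y d)" using arrow_piece[OF ok] arrow_objects[OF tes] by simp
    have "eqv oKLRW X ?T (diagram_mor \<tau> X (ds @ [d])) (piece_mor Y d \<circ>\<^sub>k (diagram_mor \<tau> X es +\<^sub>k h))"
      by (rule mor_eq.trans[OF diagram_snoc[OF Y(1) ok X] comp_cong_right[OF Y(5) tP]])
    also have "eqv oKLRW X ?T \<dots> (piece_mor Y d \<circ>\<^sub>k diagram_mor \<tau> X es +\<^sub>k piece_mor Y d \<circ>\<^sub>k h)"
      by (rule comp_plus_right_eqv[OF tP tes th])
    also have "eqv oKLRW X ?T \<dots> (diagram_mor \<tau> X (es @ [d]) +\<^sub>k piece_mor Y d \<circ>\<^sub>k h)"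
      by (rule mor_eq.plus[OF mor_eq.sym[OF diagram_snoc[OF Y(2) ok X]] mor_eq.refl[OF is_mor.compose[OF th tP]]])
    finally show ?thesis unfolding diagram_equiv_def using Y ok filt_piece[OF Y(4) ok X]
      by (intro exI[of _ ?T] exI[of _ "piece_mor Y d \<circ>\<^sub>k h"]) (auto simp: is_diagram_snoc)
  qed
  show "diagram_equiv X (e @ b) (e @ b')"
    if "braid_move b b'" "reduced (length X) (e @ b)" "reduced (length X) (e @ b')"
      "state (length X) (e @ b) = state (length X) (e @ b')" "compatible X (state (length X) (e @ b))" for e b b'
  proof -
    note asm = that
    let ?Y = "map (strand_letter \<tau> X) (state (length X) (e @ b))"
    have d: "is_diagram \<tau> X ?Y (e @ b)" by (rule reduced_is_diagram[OF inv asm(2,5)])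
    have d': "is_diagram \<tau> X ?Y (e @ b')" using reduced_is_diagram[OF inv asm(3)] asm(4,5) by simp
    obtain Z where Z: "is_diagram \<tau> X Z e" "is_diagram \<tau> Z ?Y b" using d unfolding is_diagram_append by blast
    have Z': "is_diagram \<tau> Z ?Y b'" using d' Z(1) is_diagram_unique unfolding is_diagram_append by blast
    have te: "arrow oKLRW X Z (diagram_mor \<tau> X e)" by (rule arrow_diagram[OF Z(1) X])
    have ZQ: "Z \<in> objects Q" using arrow_objects[OF te] by simp
    obtain k where k: "eqv oKLRW Z ?Y (diagram_mor \<tau> Z b) (diagram_mor \<tau> Z b' +\<^sub>k k)" "lowering (length b - 1) Z ?Y k"
      using braid_move_filt[OF asm(1) ZQ Z(2) Z'] by blast
    have len: "length b' = length b" "0 < length b" using asm(1) by (auto elim: braid_move.cases)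
    have tk: "arrow oKLRW Z ?Y k" using k(2) by (simp add: lowering_def)
    \<comment> \<open>The strict bound \<open>Suc (length e)\<close> for the prefix and
      \<open>length b - 1\<close> for the correction add up to
      \<open>length (e @ b)\<close>.\<close>
    have fk: "filt (length (e @ b)) X ?Y (k \<circ>\<^sub>k diagram_mor \<tau> X e)"
    proof -
      have "filt (Suc (length e) + (length b - 1)) X ?Y (k \<circ>\<^sub>k diagram_mor \<tau> X e)"
        using k(2) X filt_diagram[OF Z(1) X, of "Suc (length e)"] unfolding lowering_def by blast
      then show ?thesis using len(2) by simp
    qed
    note tb' = arrow_diagram[OF Z' ZQ]
    have "eqv oKLRW X ?Y (diagram_mor \<tau> X (e @ b)) ((diagram_mor \<tau> Z b' +\<^sub>k k) \<circ>\<^sub>k diagram_mor \<tau> X e)"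
      by (rule mor_eq.trans[OF diagram_append[OF Z X] comp_cong_left[OF k(1) te]])
    also have "eqv oKLRW X ?Y \<dots> (diagram_mor \<tau> Z b' \<circ>\<^sub>k diagram_mor \<tau> X e +\<^sub>k k \<circ>\<^sub>k diagram_mor \<tau> X e)"
      by (rule comp_plus_left_eqv[OF te tb' tk])
    also have "eqv oKLRW X ?Y \<dots> (diagram_mor \<tau> X (e @ b') +\<^sub>k k \<circ>\<^sub>k diagram_mor \<tau> X e)"
      by (rule mor_eq.plus[OF mor_eq.sym[OF diagram_append[OF Z(1) Z' X]] mor_eq.refl[OF is_mor.compose[OF te tk]]])
    finally show ?thesis unfolding diagram_equiv_def using d d' fk len(1)
      by (intro exI[of _ ?Y] exI[of _ "k \<circ>\<^sub>k diagram_mor \<tau> X e"]) simp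
  qed
qed

end

context oklrw
begin

text \<open>Where the word first fails to be reduced, the new piece \<open>d\<close> is a descent of
  the state of \<open>ds\<close>. Modulo lower terms \<open>ds\<close> can be rewritten to end in
  \<open>d\<close>, and the repeated \<open>d\<close> collapses into dots.\<close>

lemma filt_nonreduced:
  assumes X: "X \<in> objects Q"
  shows "is_diagram \<tau> X Y ds \<Longrightarrow> \<not> reduced (length X) ds \<Longrightarrow> filt (length ds) X Y (diagram_mor \<tau> X ds)"
proof (induction ds arbitrary: Y rule: rev_induct)
  case Nil
  then show ?case by (simp add: reduced_Nil)
next
  case (snoc d ds)
  note inv = involutive_on_objects[OF X]
  obtain Z where Z: "is_diagram \<tau> X Z ds" "piece_ok Z d" "Y = piece_target \<tau> Z d"
    using snoc.prems by (auto simp: is_diagram_snoc)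
  note E = diagram_snoc[OF Z(1,2) X, folded Z(3)]
  have td: "arrow oKLRW X Z (diagram_mor \<tau> X ds)" by (rule arrow_diagram[OF Z(1) X])
  have ZQ: "Z \<in> objects Q" using arrow_objects[OF td] by simp
  have tP: "arrow oKLRW Z Y (piece_mor Z d)" using arrow_piece[OF Z(2) ZQ] Z(3) by simp
  show ?case
  proof (cases "reduced (length X) ds")
    case False
    have "filt (Suc (length ds)) X Y (piece_mor Z d \<circ>\<^sub>k diagram_mor \<tau> X ds)"
      using filt_piece[OF snoc.IH[OF Z(1) False] Z(2) X] Z(3) by simp
    then show ?thesis using lin_span_equiv'[OF _ E] by simp
  next
    case True
    let ?xs = "state (length X) ds"
    note st = is_diagram_state[OF inv Z(1)]
    have sl: "signed_list (length X) ?xs" using st by (simp add: signed_list_state)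
    have lenZ: "length Z = length X" using st sl by (simp add: signed_list_def)
    have rng: "in_range (length X) d" using Z(2) lenZ by (cases d) auto
    have "descends ?xs d" using snoc.prems(2) True rng by (simp add: reduced_snoc)
    then obtain e where e: "reduced (length X) (e @ [d])" "state (length X) (e @ [d]) = ?xs"
      using exists_reduced_snoc[OF sl rng] by metis
    have "diagram_equiv X ds (e @ [d])"
      using reduced_equiv[OF X True e(1)] e(2) st by simp
    then obtain Z' h where h: "is_diagram \<tau> X Z' ds" "is_diagram \<tau> X Z' (e @ [d])" "length (e @ [d]) = length ds"
      "filt (length ds) X Z' h" "eqv oKLRW X Z' (diagram_mor \<tau> X ds) (diagram_mor \<tau> X (e @ [d]) +\<^sub>k h)"
      unfolding diagram_equiv_def by blast
    have [simp]: "Z' = Z" using is_diagram_unique[OF h(1) Z(1)] .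
    obtain W where W: "is_diagram \<tau> X W e" "piece_ok W d" "Z = piece_target \<tau> W d"
      using h(2) by (auto simp: is_diagram_snoc)
    note te = arrow_diagram[OF W(1) X]
    have WQ: "W \<in> objects Q" using arrow_objects[OF te] by simp
    have ZW: "Y = W" using Z(3) W(3) piece_target_invol[OF W(2) WQ] by simp
    have th: "arrow oKLRW X Z h" using lin_span_arrow[OF h(4)] by simp
    have tW: "arrow oKLRW W Z (piece_mor W d)" using arrow_piece[OF W(2) WQ] W(3) by simp
    have Ee: "eqv oKLRW X Z (diagram_mor \<tau> X (e @ [d])) (piece_mor W d \<circ>\<^sub>k diagram_mor \<tau> X e)"
      using diagram_snoc[OF W(1,2) X] W(3) by simp
    have h5: "eqv oKLRW X Z (diagram_mor \<tau> X ds) (diagram_mor \<tau> X (e @ [d]) +\<^sub>k h)" using h(5) by simp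
    have "eqv oKLRW X Y (diagram_mor \<tau> X (ds @ [d])) (piece_mor Z d \<circ>\<^sub>k (diagram_mor \<tau> X (e @ [d]) +\<^sub>k h))"
      by (rule mor_eq.trans[OF E comp_cong_right[OF h5 tP]])
    also have "eqv oKLRW X Y \<dots> (piece_mor Z d \<circ>\<^sub>k diagram_mor \<tau> X (e @ [d]) +\<^sub>k piece_mor Z d \<circ>\<^sub>k h)"
      by (rule comp_plus_right_eqv[OF tP eqv_arrow(1)[OF Ee] th])
    also have "eqv oKLRW X Y \<dots> (piece_mor Z d \<circ>\<^sub>k (piece_mor W d \<circ>\<^sub>k diagram_mor \<tau> X e) +\<^sub>k piece_mor Z d \<circ>\<^sub>k h)"
      by (rule mor_eq.plus[OF comp_cong_right[OF Ee tP] mor_eq.refl[OF is_mor.compose[OF th tP]]])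
    finally have EE: "eqv oKLRW X Y (diagram_mor \<tau> X (ds @ [d]))
        (piece_mor Z d \<circ>\<^sub>k (piece_mor W d \<circ>\<^sub>k diagram_mor \<tau> X e) +\<^sub>k piece_mor Z d \<circ>\<^sub>k h)" .
    \<comment> \<open>\<open>e\<close> is one piece shorter than \<open>ds\<close>, and the double
      piece above it adds nothing.\<close>
    have "filt (length ds) X W (piece_mor Z d \<circ>\<^sub>k (piece_mor W d \<circ>\<^sub>k diagram_mor \<tau> X e))"
      using filt_piece_twice[OF filt_diagram[OF W(1) X, of "length ds"] W(2) X] h(3) W(3) by simp
    then have 1: "filt (Suc (length ds)) X Y (piece_mor Z d \<circ>\<^sub>k (piece_mor W d \<circ>\<^sub>k diagram_mor \<tau> X e))"
      using filt_mono[of "length ds" X W _ "Suc (length ds)"] ZW by simp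
    have 2: "filt (Suc (length ds)) X Y (piece_mor Z d \<circ>\<^sub>k h)"
      using filt_piece[OF h(4) _ X, of d] Z(2,3) by simp
    show ?thesis using lin_span_equiv'[OF lin_span.plus[OF 1 2] EE] by simp
  qed
qed

subsection \<open>Multiplication by monomials in the dots\<close>

lemma power_monomial:
  assumes X: "X \<in> objects Q" and r: "1 \<le> r" "r \<le> length (black_positions X)" and bs: "length bs = length (black_positions X)"
  shows "\<exists>cs. length cs = length (black_positions X) \<and>
    eqv c X X (mor_power X (black_dot X r) n \<circ>\<^sub>k dot_monomial X bs) (dot_monomial X cs)"
proof (induction n)
  case 0
  then show ?case using ident_left[OF arrow_dot_monomial[OF X bs]] bs by auto
next
  case (Suc n)
  then obtain cs where cs: "length cs = length (black_positions X)"
    "eqv c X X (mor_power X (black_dot X r) n \<circ>\<^sub>k dot_monomial X bs) (dot_monomial X cs)" by blast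
  note tb = arrow_black_dot[OF r X, of c]
  have "eqv c X X ((black_dot X r \<circ>\<^sub>k mor_power X (black_dot X r) n) \<circ>\<^sub>k dot_monomial X bs)
      (black_dot X r \<circ>\<^sub>k dot_monomial X cs)"
    by (rule mor_eq.trans[OF comp_assoc_eqv[OF arrow_dot_monomial[OF X bs] arrow_mor_power[OF tb] tb] comp_cong_right[OF cs(2) tb]])
  from mor_eq.trans[OF this black_dot_monomial[OF X cs(1) r]] show ?case using cs(1)
    by (intro exI[of _ "cs[r - 1 := Suc (cs ! (r - 1))]"]) simp
qed

lemma monomial_monomial:
  assumes X: "X \<in> objects Q" and as: "length as = length (black_positions X)" and bs: "length bs = length (black_positions X)"
  shows "\<exists>cs. length cs = length (black_positions X) \<and>
    eqv c X X (dot_monomial X as \<circ>\<^sub>k dot_monomial X bs) (dot_monomial X cs)"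
proof -
  have "\<exists>cs. length cs = length (black_positions X) \<and>
    eqv c X X (foldr (\<lambda>r g. mor_power X (black_dot X r) (as ! (r - 1)) \<circ>\<^sub>k g) rs (Ident X) \<circ>\<^sub>k dot_monomial X bs) (dot_monomial X cs)"
    if "set rs \<subseteq> {1..length as}" for rs
    using that
  proof (induction rs)
    case Nil
    then show ?case using ident_left[OF arrow_dot_monomial[OF X bs]] bs by auto
  next
    case (Cons r rs)
    let ?F = "foldr (\<lambda>r g. mor_power X (black_dot X r) (as ! (r - 1)) \<circ>\<^sub>k g) rs (Ident X)"
    obtain cs where cs: "length cs = length (black_positions X)" "eqv c X X (?F \<circ>\<^sub>k dot_monomial X bs) (dot_monomial X cs)"
      using Cons by auto
    have r: "1 \<le> r" "r \<le> length (black_positions X)" using Cons.prems as by auto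
    have tF: "arrow c X X ?F"
      using Cons.prems as by (intro arrow_dot_foldr[OF X] arrow_mor_power arrow_black_dot X) auto
    note tp = arrow_mor_power[OF arrow_black_dot[OF r X, of c], of "as ! (r - 1)"]
    obtain es where es: "length es = length (black_positions X)"
      "eqv c X X (mor_power X (black_dot X r) (as ! (r - 1)) \<circ>\<^sub>k dot_monomial X cs) (dot_monomial X es)"
      using power_monomial[OF X r cs(1)] by blast
    have "eqv c X X ((mor_power X (black_dot X r) (as ! (r - 1)) \<circ>\<^sub>k ?F) \<circ>\<^sub>k dot_monomial X bs) (dot_monomial X es)"
      by (rule mor_eq.trans[OF mor_eq.trans[OF comp_assoc_eqv[OF arrow_dot_monomial[OF X bs] tF tp] comp_cong_right[OF cs(2) tp]] es(2)])
    then show ?case using es(1) by auto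
  qed
  from this[of "[1..<Suc (length as)]"] show ?thesis
    unfolding dot_monomial_def[of X as] by (simp only: set_upt atLeastLessThanSuc_atLeastAtMost subset_refl)
qed

lemma filt_monomial:
  assumes f: "filt m X Y f" and X: "X \<in> objects Q" and bs: "length bs = length (black_positions X)"
  shows "filt m X Y (f \<circ>\<^sub>k dot_monomial X bs)"
proof (rule lin_span_right[OF _ arrow_dot_monomial[OF X bs] f])
  fix g assume "g \<in> diagram_gens m X Y" "arrow oKLRW X Y g"
  then obtain ds as where g: "g = diagram_mor \<tau> X ds \<circ>\<^sub>k dot_monomial X as" "is_diagram \<tau> X Y ds"
     "length as = length (black_positions X)" "length ds < m" by (auto simp: diagram_gens_def)
  obtain cs where cs: "length cs = length (black_positions X)"
    "eqv oKLRW X X (dot_monomial X as \<circ>\<^sub>k dot_monomial X bs) (dot_monomial X cs)"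
    using monomial_monomial[OF X g(3) bs] by blast
  note td = arrow_diagram[OF g(2) X]
  have "eqv oKLRW X Y (g \<circ>\<^sub>k dot_monomial X bs) (diagram_mor \<tau> X ds \<circ>\<^sub>k dot_monomial X cs)"
    unfolding g(1) by (rule mor_eq.trans[OF comp_assoc_eqv[OF arrow_dot_monomial[OF X bs] arrow_dot_monomial[OF X g(3)] td] comp_cong_right[OF cs(2) td]])
  then show "filt m X Y (g \<circ>\<^sub>k dot_monomial X bs)"
    by (rule lin_span_equiv'[OF filt_gen[OF g(2) X cs(1) g(4)]])
qed

subsection \<open>Spanning\<close>

text \<open>Induction on the typing of \<open>f\<close>. The bound \<open>m'\<close> is left open:
  exhaustion by the filtration only needs that some bound exists.\<close>

lemma filt_ctx:
  assumes "arrow KLRW Y Z f"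
  shows "A \<in> objects Q \<Longrightarrow> B \<in> objects Q \<Longrightarrow> X \<in> objects Q \<Longrightarrow> filt m X (A @ Y @ B) g \<Longrightarrow>
    \<exists>m'. filt m' X (A @ Z @ B) (ctx A f B \<circ>\<^sub>k g)"
  using assms
proof (induction KLRW Y Z f arbitrary: A B X m g rule: is_mor.induct)
  case (ident Y)
  show ?case
    using lin_span_equiv'[OF ident(5) mor_eq.trans[OF comp_cong_left[OF ctx_Ident[OF ident(1,2,3)] lin_span_arrow[OF ident(5)]]
          ident_left[OF lin_span_arrow[OF ident(5)]]]] by blast
next
  case (zero Y Z)
  have ob: "A @ Z @ B \<in> objects Q" using zero by simp
  show ?case
    using lin_span_equiv'[OF lin_span.zero[OF zero(5) ob] mor_eq.trans[OF comp_cong_left[OF ctx_Zero[OF zero(1-4)] lin_span_arrow[OF zero(6)]]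
          comp_Zero_left[OF lin_span_arrow[OF zero(6)] ob]]] by blast
next
  case (dot i)
  have "dot_at (A @ [Black i] @ B) (length A) = (ctx A (Dot i) B :: ('v, 'k) mor)" by (simp add: dot_at_append')
  then show ?case using filt_dot[OF dot(5) _ dot(4), of "length A"] by (intro exI[of _ m]) simp
next
  case (cross a b)
  have "piece_mor (A @ [a, b] @ B) (Crossing (length A)) = (ctx A (Cross a b) B :: ('v, 'k) mor)" by (simp add: piece_mor_append)
  moreover have "piece_target \<tau> (A @ [a, b] @ B) (Crossing (length A)) = A @ [b, a] @ B" by (simp add: swap_at_append)
  moreover have "piece_ok (A @ [a, b] @ B) (Crossing (length A))" using cross(3) by (simp add: nth_append)
  ultimately show ?case using filt_piece[OF cross(7) _ cross(6), of "Crossing (length A)"] by (intro exI[of _ "Suc m"]) simp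
next
  case (compose Y Z f W f')
  obtain m1 where m1: "filt m1 X (A @ Z @ B) (ctx A f B \<circ>\<^sub>k g)" using compose(2)[OF compose(5-8)] by metis
  obtain m2 where m2: "filt m2 X (A @ W @ B) (ctx A f' B \<circ>\<^sub>k (ctx A f B \<circ>\<^sub>k g))" using compose(4)[OF compose(5-7) m1] by metis
  note tg = lin_span_arrow[OF compose(8)] and ob = compose(5,6)
  note t = arrow_ctx[OF compose(1) ob] arrow_ctx[OF compose(3) ob]
  show ?case
    using lin_span_equiv'[OF m2 mor_eq.trans[OF comp_cong_left[OF ctx_comp[OF compose(1,3) ob] tg] comp_assoc_eqv[OF tg t]]] by blast
next
  case (tensor Y Z f Y' Z' f')
  note ob = tensor(5,6) and tg = lin_span_arrow[OF tensor(8)]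
  have obs: "Y \<in> objects Q" "Z \<in> objects Q" "Y' \<in> objects Q" "Z' \<in> objects Q"
    using arrow_objects[OF tensor(1)] arrow_objects[OF tensor(3)] by auto
  have obs': "Y' @ B \<in> objects Q" "A @ Z \<in> objects Q" using ob obs by auto
  have g': "filt m X (A @ Y @ (Y' @ B)) g" using tensor(8) by simp
  obtain m1 where m1: "filt m1 X (A @ Z @ (Y' @ B)) (ctx A f (Y' @ B) \<circ>\<^sub>k g)"
    using tensor(2)[OF ob(1) obs'(1) tensor(7) g'] by metis
  then have m1': "filt m1 X ((A @ Z) @ Y' @ B) (ctx A f (Y' @ B) \<circ>\<^sub>k g)" by simp
  obtain m2 where m2: "filt m2 X ((A @ Z) @ Z' @ B) (ctx (A @ Z) f' B \<circ>\<^sub>k (ctx A f (Y' @ B) \<circ>\<^sub>k g))"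
    using tensor(4)[OF obs'(2) ob(2) tensor(7) m1'] by metis
  note I = is_mor.ident[OF obs(2)] is_mor.ident[OF obs(3)]
  note t1 = is_mor.tensor[OF tensor(1) I(2)] and t2 = is_mor.tensor[OF I(1) tensor(3)]
  let ?W = "A @ (Y @ Y') @ B" and ?V = "A @ (Z @ Z') @ B"
  have "eqv oKLRW ?W ?V (ctx A (f \<otimes>\<^sub>k f') B) (ctx A ((Ident Z \<otimes>\<^sub>k f') \<circ>\<^sub>k (f \<otimes>\<^sub>k Ident Y')) B)"
    by (rule ctx_cong[OF tensor_exchange(1)[OF tensor(1,3)] ob])
  also have "eqv oKLRW ?W ?V \<dots> (ctx A (Ident Z \<otimes>\<^sub>k f') B \<circ>\<^sub>k ctx A (f \<otimes>\<^sub>k Ident Y') B)"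
    by (rule ctx_comp[OF t1 t2 ob])
  also have "eqv oKLRW ?W ?V \<dots> (ctx (A @ Z) f' B \<circ>\<^sub>k ctx A f (Y' @ B))"
    using mor_eq.compose[OF ctx_tensor_right[OF tensor(1) ob(1) obs(3) ob(2)] ctx_tensor_left[OF tensor(3) ob(1) obs(2) ob(2)]] by simp
  finally have e: "eqv oKLRW ?W ?V (ctx A (f \<otimes>\<^sub>k f') B) (ctx (A @ Z) f' B \<circ>\<^sub>k ctx A f (Y' @ B))" .
  have t: "arrow oKLRW ?W (A @ Z @ Y' @ B) (ctx A f (Y' @ B))" "arrow oKLRW (A @ Z @ Y' @ B) ?V (ctx (A @ Z) f' B)"
    using arrow_ctx[OF tensor(1) ob(1), of "Y' @ B"] arrow_ctx[OF tensor(3) _ ob(2), of "A @ Z"] ob obs by auto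
  have "filt m2 X ?V (ctx A (f \<otimes>\<^sub>k f') B \<circ>\<^sub>k g)"
    by (rule lin_span_equiv'[OF _ mor_eq.trans[OF comp_cong_left[OF e tg] comp_assoc_eqv[OF tg t]]]) (use m2 in simp)
  then show ?case by blast
next
  case (plus Y Z f f')
  note ob = plus(5,6) and tg = lin_span_arrow[OF plus(8)]
  obtain m1 m2 where m: "filt m1 X (A @ Z @ B) (ctx A f B \<circ>\<^sub>k g)" "filt m2 X (A @ Z @ B) (ctx A f' B \<circ>\<^sub>k g)"
    using plus(2)[OF plus(5-8)] plus(4)[OF plus(5-8)] by metis
  have "filt (max m1 m2) X (A @ Z @ B) (ctx A (f +\<^sub>k f') B \<circ>\<^sub>k g)"
    by (rule lin_span_equiv'[OF lin_span.plus[OF filt_mono[OF m(1)] filt_mono[OF m(2)]]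
          mor_eq.trans[OF comp_cong_left[OF ctx_plus[OF plus(1,3) ob] tg] comp_plus_left_eqv[OF tg arrow_ctx[OF plus(1) ob] arrow_ctx[OF plus(3) ob]]]]) simp_all
  then show ?case by blast
next
  case (scale Y Z f a)
  note ob = scale(3,4) and tg = lin_span_arrow[OF scale(6)]
  obtain m1 where m: "filt m1 X (A @ Z @ B) (ctx A f B \<circ>\<^sub>k g)" using scale(2)[OF scale(3-6)] by metis
  show ?case
    using lin_span_equiv'[OF lin_span.scale[OF m] mor_eq.trans[OF comp_cong_left[OF ctx_scale[OF scale(1) ob] tg]
          comp_scale_left_eqv[OF tg arrow_ctx[OF scale(1) ob]]]] by blast
qed

text \<open>Reflections occur at the left edge, so \<open>f\<close> needs room on its right only;
  the parts from the KLRW category are left to \<open>filt_ctx\<close>.\<close>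

lemma filt_tensor_ident:
  assumes "arrow oKLRW Y Z f"
  shows "B \<in> objects Q \<Longrightarrow> X \<in> objects Q \<Longrightarrow> filt m X (Y @ B) g \<Longrightarrow> \<exists>m'. filt m' X (Z @ B) ((f \<otimes>\<^sub>k Ident B) \<circ>\<^sub>k g)"
  using assms
proof (induction oKLRW Y Z f arbitrary: B X m g rule: is_mor.induct)
  have klrw: "\<exists>m'. filt m' X (Z @ B) ((f \<otimes>\<^sub>k Ident B) \<circ>\<^sub>k g)"
    if "arrow KLRW Y Z f" "B \<in> objects Q" "X \<in> objects Q" "filt m X (Y @ B) g" for Y Z f B X m g
  proof -
    note asm = that
    obtain m' where m': "filt m' X ([] @ Z @ B) (ctx [] f B \<circ>\<^sub>k g)"
      using filt_ctx[OF asm(1) _ asm(2,3), of "[]" m g] asm(4) by auto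
    have "filt m' X (Z @ B) ((f \<otimes>\<^sub>k Ident B) \<circ>\<^sub>k g)"
      by (rule lin_span_equiv'[OF _ comp_cong_left[OF mor_eq.sym[OF ctx_Nil[OF asm(1,2)]] lin_span_arrow[OF asm(4)]]]) (use m' in simp)
    then show ?thesis by blast
  qed
  {
    case (ident Y)
    show ?case by (rule klrw[OF is_mor.ident[OF ident(1)] ident(2-4)])
  next
    case (zero Y Z)
    show ?case by (rule klrw[OF is_mor.zero[OF zero(1,2)] zero(3-5)])
  next
    case (dot i)
    show ?case by (rule klrw[OF is_mor.dot[OF dot(1)] dot(2-4)])
  next
    case (cross a b)
    show ?case by (rule klrw[OF is_mor.cross[OF cross(1-3)] cross(4-6)])
  next
    case (reflect i)
    have "piece_mor ([Black i] @ B) Mirror = (Reflect i \<otimes>\<^sub>k Ident B :: ('v, 'k) mor)" by (simp add: piece_mor.simps)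
    then show ?case using filt_piece[OF reflect(4) _ reflect(3), of Mirror] by (intro exI[of _ "Suc m"]) simp
  next
    case (compose Y Z f W f')
    obtain m1 where m1: "filt m1 X (Z @ B) ((f \<otimes>\<^sub>k Ident B) \<circ>\<^sub>k g)" using compose(2)[OF compose(5-7)] by metis
    obtain m2 where m2: "filt m2 X (W @ B) ((f' \<otimes>\<^sub>k Ident B) \<circ>\<^sub>k ((f \<otimes>\<^sub>k Ident B) \<circ>\<^sub>k g))" using compose(4)[OF compose(5,6) m1] by metis
    note tg = lin_span_arrow[OF compose(7)] and I = is_mor.ident[OF compose(5)]
    show ?case
      using lin_span_equiv'[OF m2 mor_eq.trans[OF comp_cong_left[OF tensor_ident_comp[OF compose(1,3,5)] tg]
            comp_assoc_eqv[OF tg is_mor.tensor[OF compose(1) I] is_mor.tensor[OF compose(3) I]]]] by blast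
  next
    case (tensor Y Z f Y' Z' f')
    note tg = lin_span_arrow[OF tensor(6)]
    have obs: "Y \<in> objects Q" "Z \<in> objects Q" "Y' \<in> objects Q" "Z' \<in> objects Q"
      using arrow_objects[OF tensor(1)] arrow_objects[OF tensor(3)] by auto
    have obs': "Y' @ B \<in> objects Q" using tensor(4) obs by auto
    have g': "filt m X (Y @ (Y' @ B)) g" using tensor(6) by simp
    obtain m1 where m1: "filt m1 X (Z @ (Y' @ B)) ((f \<otimes>\<^sub>k Ident (Y' @ B)) \<circ>\<^sub>k g)"
      using tensor(2)[OF obs' tensor(5) g'] by metis
    obtain m2 where m2: "filt m2 X (Z @ Z' @ B) (ctx Z f' B \<circ>\<^sub>k ((f \<otimes>\<^sub>k Ident (Y' @ B)) \<circ>\<^sub>k g))"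
      using filt_ctx[OF tensor(3) obs(2) tensor(4,5) m1] by blast
    note t1 = is_mor.tensor[OF tensor(1) is_mor.ident[OF obs(3)]] and t2 = is_mor.tensor[OF is_mor.ident[OF obs(2)] tensor(3)]
    let ?W = "(Y @ Y') @ B" and ?V = "(Z @ Z') @ B"
    have "eqv oKLRW ?W ?V ((f \<otimes>\<^sub>k f') \<otimes>\<^sub>k Ident B) (((Ident Z \<otimes>\<^sub>k f') \<circ>\<^sub>k (f \<otimes>\<^sub>k Ident Y')) \<otimes>\<^sub>k Ident B)"
      by (rule mor_eq.tensor[OF tensor_exchange(1)[OF tensor(1,3)] mor_eq.refl[OF is_mor.ident[OF tensor(4)]]])
    also have "eqv oKLRW ?W ?V \<dots> (((Ident Z \<otimes>\<^sub>k f') \<otimes>\<^sub>k Ident B) \<circ>\<^sub>k ((f \<otimes>\<^sub>k Ident Y') \<otimes>\<^sub>k Ident B))"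
      by (rule tensor_ident_comp[OF t1 t2 tensor(4)])
    also have "eqv oKLRW ?W ?V \<dots> (ctx Z f' B \<circ>\<^sub>k (f \<otimes>\<^sub>k Ident (Y' @ B)))"
      using mor_eq.compose[OF tensor_ident_append[OF tensor(1) obs(3) tensor(4)] ident_tensor_tensor_ident[OF tensor(3) obs(2) tensor(4)]] by simp
    finally have e: "eqv oKLRW ?W ?V ((f \<otimes>\<^sub>k f') \<otimes>\<^sub>k Ident B) (ctx Z f' B \<circ>\<^sub>k (f \<otimes>\<^sub>k Ident (Y' @ B)))" .
    have t: "arrow oKLRW ?W (Z @ Y' @ B) (f \<otimes>\<^sub>k Ident (Y' @ B))" "arrow oKLRW (Z @ Y' @ B) ?V (ctx Z f' B)"
      using is_mor.tensor[OF tensor(1) is_mor.ident, of "Y' @ B"] arrow_ctx[OF tensor(3) obs(2) tensor(4)] tensor(4) obs by auto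
    have "filt m2 X ?V (((f \<otimes>\<^sub>k f') \<otimes>\<^sub>k Ident B) \<circ>\<^sub>k g)"
      by (rule lin_span_equiv'[OF _ mor_eq.trans[OF comp_cong_left[OF e tg] comp_assoc_eqv[OF tg t]]]) (use m2 in simp)
    then show ?case by blast
  next
    case (plus Y Z f f')
    note tg = lin_span_arrow[OF plus(7)] and I = is_mor.ident[OF plus(5)]
    obtain m1 m2 where m: "filt m1 X (Z @ B) ((f \<otimes>\<^sub>k Ident B) \<circ>\<^sub>k g)" "filt m2 X (Z @ B) ((f' \<otimes>\<^sub>k Ident B) \<circ>\<^sub>k g)"
      using plus(2)[OF plus(5-7)] plus(4)[OF plus(5-7)] by metis
    note t = is_mor.tensor[OF plus(1) I] is_mor.tensor[OF plus(3) I]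
    have e: "eqv oKLRW (Y @ B) (Z @ B) ((f +\<^sub>k f') \<otimes>\<^sub>k Ident B) (f \<otimes>\<^sub>k Ident B +\<^sub>k f' \<otimes>\<^sub>k Ident B)"
      by (rule lm(1)[OF linear_monoidal_rel.tensor_plus_left is_mor.tensor[OF is_mor.plus[OF plus(1,3)] I] is_mor.plus[OF t]])
    have "filt (max m1 m2) X (Z @ B) (((f +\<^sub>k f') \<otimes>\<^sub>k Ident B) \<circ>\<^sub>k g)"
      by (rule lin_span_equiv'[OF lin_span.plus[OF filt_mono[OF m(1)] filt_mono[OF m(2)]]
            mor_eq.trans[OF comp_cong_left[OF e tg] comp_plus_left_eqv[OF tg t]]]) simp_all
    then show ?case by blast
  next
    case (scale Y Z f a)
    note tg = lin_span_arrow[OF scale(5)] and I = is_mor.ident[OF scale(3)]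
    note t = is_mor.tensor[OF scale(1) I]
    obtain m1 where m: "filt m1 X (Z @ B) ((f \<otimes>\<^sub>k Ident B) \<circ>\<^sub>k g)" using scale(2)[OF scale(3-5)] by metis
    have e: "eqv oKLRW (Y @ B) (Z @ B) ((a *\<^sub>k f) \<otimes>\<^sub>k Ident B) (a *\<^sub>k (f \<otimes>\<^sub>k Ident B))"
      by (rule lm(1)[OF linear_monoidal_rel.tensor_scale_left is_mor.tensor[OF is_mor.scale[OF scale(1)] I] is_mor.scale[OF t]])
    show ?case
      using lin_span_equiv'[OF lin_span.scale[OF m] mor_eq.trans[OF comp_cong_left[OF e tg] comp_scale_left_eqv[OF tg t]]] by blast
  }
qed

text \<open>Every morphism acts on the identity, which is the diagram without pieces.\<close>

lemma filt_exhaustive: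
  assumes f: "arrow oKLRW X Y f"
  shows "\<exists>m. filt m X Y f"
proof -
  have X: "X \<in> objects Q" using arrow_objects[OF f] by simp
  have n: "[] \<in> objects Q" by simp
  have "filt 1 X (X @ []) (Ident X)" using filt_diagram[of X X "[]" 1] X by simp
  then obtain m where m: "filt m X (Y @ []) ((f \<otimes>\<^sub>k Ident []) \<circ>\<^sub>k Ident X)"
    using filt_tensor_ident[OF f n X] by blast
  have tf: "arrow oKLRW X Y (f \<otimes>\<^sub>k Ident [])" using is_mor.tensor[OF f is_mor.ident[OF n]] by simp
  have "eqv oKLRW X Y ((f \<otimes>\<^sub>k Ident []) \<circ>\<^sub>k Ident X) f"
    by (rule mor_eq.trans[OF ident_right[OF tf] lm(1)[OF linear_monoidal_rel.tensor_unit_right tf f]])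
  then show ?thesis using lin_span.equiv m by force
qed

text \<open>Induction on the filtration: a nonreduced diagram drops by
  \<open>filt_nonreduced\<close>, and a reduced one is exchanged for a member of \<open>C\<close>
  with the same state at the cost of lower terms.\<close>

theorem reduced_diagrams_span:
  fixes C :: "diagram set"
  assumes X: "X \<in> objects Q"
    and C: "\<And>ds. reduced (length X) ds \<Longrightarrow> is_diagram \<tau> X Y ds \<Longrightarrow>
      \<exists>es\<in>C. reduced (length X) es \<and> state (length X) es = state (length X) ds"
    and f: "arrow oKLRW X Y f"
  shows "lin_span {diagram_mor \<tau> X es \<circ>\<^sub>k dot_monomial X as | es as.
      es \<in> C \<and> is_diagram \<tau> X Y es \<and> length as = length (black_positions X)} X Y f" (is "lin_span ?S X Y f")
proof -
  have "filt m X Y g \<Longrightarrow> lin_span ?S X Y g" for m g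
  proof (induction m arbitrary: g)
    case 0
    then show ?case by (rule lin_span_trans[rotated]) (simp add: diagram_gens_def)
  next
    case (Suc m)
    show ?case
    proof (rule lin_span_trans[OF _ Suc.prems])
      fix g assume "g \<in> diagram_gens (Suc m) X Y" "arrow oKLRW X Y g"
      then obtain ds as where g: "g = diagram_mor \<tau> X ds \<circ>\<^sub>k dot_monomial X as" "is_diagram \<tau> X Y ds"
         "length as = length (black_positions X)" "length ds \<le> m" by (auto simp: diagram_gens_def)
      show "lin_span ?S X Y g"
      proof (cases "reduced (length X) ds")
        case False
        have "filt m X Y g" unfolding g(1)
          by (rule filt_mono[OF filt_monomial[OF filt_nonreduced[OF X g(2) False] X g(3)] g(4)])
        then show ?thesis by (rule Suc.IH)
      next
        case True
        obtain es where es: "es \<in> C" "reduced (length X) es" "state (length X) es = state (length X) ds"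
          using C[OF True g(2)] by blast
        have "compatible X (state (length X) ds)"
          using is_diagram_state[OF involutive_on_objects[OF X] g(2)] by simp
        then have "diagram_equiv X ds es" using reduced_equiv[OF X True es(2)] es(3) by simp
        then obtain Y' h where h: "is_diagram \<tau> X Y' ds" "is_diagram \<tau> X Y' es"
          "filt (length ds) X Y' h" "eqv oKLRW X Y' (diagram_mor \<tau> X ds) (diagram_mor \<tau> X es +\<^sub>k h)"
          unfolding diagram_equiv_def by blast
        have "Y' = Y" using is_diagram_unique[OF h(1) g(2)] .
        note h = h[unfolded this]
        note tm = arrow_dot_monomial[OF X g(3)]
        have e: "eqv oKLRW X Y g (diagram_mor \<tau> X es \<circ>\<^sub>k dot_monomial X as +\<^sub>k h \<circ>\<^sub>k dot_monomial X as)"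
          unfolding g(1) by (rule mor_eq.trans[OF comp_cong_left[OF h(4) tm] comp_plus_left_eqv[OF tm arrow_diagram[OF h(2) X] lin_span_arrow[OF h(3)]]])
        have 1: "lin_span ?S X Y (diagram_mor \<tau> X es \<circ>\<^sub>k dot_monomial X as)"
          by (rule lin_span.gen[OF _ is_mor.compose[OF tm arrow_diagram[OF h(2) X]]]) (use es(1) h(2) g(3) in blast)
        have 2: "lin_span ?S X Y (h \<circ>\<^sub>k dot_monomial X as)"
          by (rule Suc.IH[OF filt_mono[OF filt_monomial[OF h(3) X g(3)] g(4)]])
        show ?thesis by (rule lin_span_equiv'[OF lin_span.plus[OF 1 2] e])
      qed
    qed
  qed
  then show ?thesis using filt_exhaustive[OF f] by blast
qed

end

section \<open>A representation on functions\<close>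

subsection \<open>Evaluation of polynomials\<close>

definition mono_eval :: "(nat \<Rightarrow> 'k :: comm_ring_1) \<Rightarrow> (nat \<Rightarrow>\<^sub>0 nat) \<Rightarrow> 'k" where
  "mono_eval \<rho> m = (\<Prod>r\<in>Poly_Mapping.keys m. \<rho> r ^ Poly_Mapping.lookup m r)"

definition poly_eval :: "(nat \<Rightarrow> 'k :: field) \<Rightarrow> 'k mpolynomial \<Rightarrow> 'k" where
  "poly_eval \<rho> P = (\<Sum>m\<in>Poly_Mapping.keys P. Poly_Mapping.lookup P m * mono_eval \<rho> m)"

lemma mono_eval_superset: "finite S \<Longrightarrow> Poly_Mapping.keys m \<subseteq> S \<Longrightarrow> mono_eval \<rho> m = (\<Prod>r\<in>S. \<rho> r ^ Poly_Mapping.lookup m r)"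
  unfolding mono_eval_def by (rule prod.mono_neutral_left) (auto simp: in_keys_iff)

lemma mono_eval_plus: "mono_eval \<rho> (m + m') = mono_eval \<rho> m * mono_eval \<rho> m'"
proof -
  let ?S = "Poly_Mapping.keys m \<union> Poly_Mapping.keys m'"
  have "mono_eval \<rho> (m + m') = (\<Prod>r\<in>?S. \<rho> r ^ Poly_Mapping.lookup (m + m') r)"
    by (rule mono_eval_superset) (use Poly_Mapping.keys_add[of m m'] in auto)
  also have "\<dots> = (\<Prod>r\<in>?S. \<rho> r ^ Poly_Mapping.lookup m r) * (\<Prod>r\<in>?S. \<rho> r ^ Poly_Mapping.lookup m' r)"
    by (simp add: lookup_add power_add prod.distrib)
  finally show ?thesis using mono_eval_superset[of ?S m \<rho>] mono_eval_superset[of ?S m' \<rho>] by simp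
qed

lemma poly_eval_superset: "finite S \<Longrightarrow> Poly_Mapping.keys P \<subseteq> S \<Longrightarrow> poly_eval \<rho> P = (\<Sum>m\<in>S. Poly_Mapping.lookup P m * mono_eval \<rho> m)"
  unfolding poly_eval_def by (rule sum.mono_neutral_left) (auto simp: in_keys_iff)

lemma poly_eval_plus: "poly_eval \<rho> (P + R) = poly_eval \<rho> P + poly_eval \<rho> R"
proof -
  let ?S = "Poly_Mapping.keys P \<union> Poly_Mapping.keys R"
  have "poly_eval \<rho> (P + R) = (\<Sum>m\<in>?S. Poly_Mapping.lookup (P + R) m * mono_eval \<rho> m)"
    by (rule poly_eval_superset) (use Poly_Mapping.keys_add[of P R] in auto)
  also have "\<dots> = (\<Sum>m\<in>?S. Poly_Mapping.lookup P m * mono_eval \<rho> m) + (\<Sum>m\<in>?S. Poly_Mapping.lookup R m * mono_eval \<rho> m)"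
    by (simp add: lookup_add algebra_simps sum.distrib)
  finally show ?thesis using poly_eval_superset[of ?S P \<rho>] poly_eval_superset[of ?S R \<rho>] by simp
qed

lemma poly_eval_0 [simp]: "poly_eval \<rho> 0 = 0"
  by (simp add: poly_eval_def)

lemma poly_eval_sum: "poly_eval \<rho> (sum h S) = (\<Sum>a\<in>S. poly_eval \<rho> (h a))"
  by (induction S rule: infinite_finite_induct) (simp_all add: poly_eval_plus)

lemma poly_eval_single: "poly_eval \<rho> (Poly_Mapping.single m a) = a * mono_eval \<rho> m"
  by (simp add: poly_eval_def)

lemma poly_as_sum: "P = (\<Sum>m\<in>Poly_Mapping.keys P. Poly_Mapping.single m (Poly_Mapping.lookup P m))"
proof (rule poly_mapping_eqI)
  fix m
  have "Poly_Mapping.lookup (\<Sum>n\<in>Poly_Mapping.keys P. Poly_Mapping.single n (Poly_Mapping.lookup P n)) m = (\<Sum>n\<in>Poly_Mapping.keys P. if n = m then Poly_Mapping.lookup P n else 0)"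
    by (simp add: lookup_sum lookup_single when_def)
  also have "\<dots> = Poly_Mapping.lookup P m" by (simp add: in_keys_iff)
  finally show "Poly_Mapping.lookup P m = Poly_Mapping.lookup (\<Sum>n\<in>Poly_Mapping.keys P. Poly_Mapping.single n (Poly_Mapping.lookup P n)) m" by simp
qed

lemma poly_eval_times: "poly_eval \<rho> (P * R) = poly_eval \<rho> P * poly_eval \<rho> R"
proof -
  have "P * R = (\<Sum>m\<in>Poly_Mapping.keys P. \<Sum>n\<in>Poly_Mapping.keys R. Poly_Mapping.single (m + n) (Poly_Mapping.lookup P m * Poly_Mapping.lookup R n))"
    by (subst poly_as_sum[of P], subst poly_as_sum[of R]) (simp add: sum_product mult_single)
  then have "poly_eval \<rho> (P * R) = (\<Sum>m\<in>Poly_Mapping.keys P. \<Sum>n\<in>Poly_Mapping.keys R. Poly_Mapping.lookup P m * Poly_Mapping.lookup R n * (mono_eval \<rho> m * mono_eval \<rho> n))"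
    by (simp add: poly_eval_sum poly_eval_single mono_eval_plus)
  also have "\<dots> = poly_eval \<rho> P * poly_eval \<rho> R"
    by (simp add: poly_eval_def sum_product algebra_simps)
  finally show ?thesis .
qed

lemma poly_eval_Cst [simp]: "poly_eval \<rho> (Cst a) = a"
  by (simp add: Cst_def poly_eval_single mono_eval_def)

lemma poly_eval_Var [simp]: "poly_eval \<rho> (Var r) = \<rho> r"
  by (simp add: Var_def poly_eval_single mono_eval_def)

lemma poly_eval_1 [simp]: "poly_eval \<rho> 1 = 1"
  using poly_eval_Cst[of \<rho> 1] by (simp add: Cst_1)

lemma poly_eval_uminus [simp]: "poly_eval \<rho> (- P) = - poly_eval \<rho> P"
  using poly_eval_plus[of \<rho> P "- P"] by (simp add: eq_neg_iff_add_eq_0 add.commute)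

lemma poly_eval_minus: "poly_eval \<rho> (P - R) = poly_eval \<rho> P - poly_eval \<rho> R"
  using poly_eval_plus[of \<rho> P "- R"] by simp

lemma poly_eval_power: "poly_eval \<rho> (P ^ n) = poly_eval \<rho> P ^ n"
  by (induction n) (simp_all add: poly_eval_times)

lemmas poly_eval_simps = poly_eval_plus poly_eval_minus poly_eval_times poly_eval_power poly_eval_sum

lemma poly_eval_f_poly: "poly_eval \<rho> (f_poly Q i j P R) = f_poly Q i j (poly_eval \<rho> P) (poly_eval \<rho> R)"
  by (simp add: f_poly_def X_poly_def poly_eval_simps)

lemma poly_eval_fmu_poly: "poly_eval \<rho> (fmu_poly \<tau> \<mu> i P) = fmu_poly \<tau> \<mu> i (poly_eval \<rho> P)"
  by (simp add: fmu_poly_def poly_eval_simps)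

subsection \<open>Finitely supported functionals\<close>

text \<open>Functionals that are finite combinations of evaluations at points of \<open>S\<close>.
  As a functional of \<open>F\<close>, \<open>rep f F y\<close> is of this kind, which gives
  linearity, locality and the exchange of two such functionals for arbitrary functions.\<close>

definition finsup :: "'x set \<Rightarrow> (('x \<Rightarrow> 'k :: field) \<Rightarrow> 'k) \<Rightarrow> bool" where
  "finsup S \<phi> \<longleftrightarrow> (\<exists>L. snd ` set L \<subseteq> S \<and> (\<forall>F. \<phi> F = (\<Sum>(c, z)\<leftarrow>L. c * F z)))"

lemma finsup_point: "z \<in> S \<Longrightarrow> finsup S (\<lambda>F. F z)"
  unfolding finsup_def by (rule exI[of _ "[(1, z)]"]) simp

lemma finsup_zero: "finsup S (\<lambda>F. 0)"
  unfolding finsup_def by (rule exI[of _ "[]"]) simp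

lemma finsup_plus:
  assumes "finsup S \<phi>" "finsup S \<psi>"
  shows "finsup S (\<lambda>F. \<phi> F + \<psi> F)"
proof -
  obtain L M where "snd ` set L \<subseteq> S" "\<forall>F. \<phi> F = (\<Sum>(c, z)\<leftarrow>L. c * F z)" "snd ` set M \<subseteq> S" "\<forall>F. \<psi> F = (\<Sum>(c, z)\<leftarrow>M. c * F z)"
    using assms unfolding finsup_def by blast
  then show ?thesis unfolding finsup_def by (intro exI[of _ "L @ M"]) auto
qed

lemma finsup_scale:
  assumes "finsup S \<phi>"
  shows "finsup S (\<lambda>F. a * \<phi> F)"
proof -
  obtain L where L: "snd ` set L \<subseteq> S" "\<forall>F. \<phi> F = (\<Sum>(c, z)\<leftarrow>L. c * F z)"
    using assms unfolding finsup_def by blast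
  have "a * (\<Sum>(c, z)\<leftarrow>M. c * F z) = (\<Sum>(c, z)\<leftarrow>map (\<lambda>(c, z). (a * c, z)) M. c * F z)" for F M
    by (induction M) (auto simp: algebra_simps)
  then show ?thesis using L unfolding finsup_def
    by (intro exI[of _ "map (\<lambda>(c, z). (a * c, z)) L"]) (force simp: image_image)
qed

lemma finsup_minus: "finsup S \<phi> \<Longrightarrow> finsup S \<psi> \<Longrightarrow> finsup S (\<lambda>F. \<phi> F - \<psi> F)"
  using finsup_plus[OF _ finsup_scale[of S \<psi> "- 1"]] by simp

lemma finsup_bind:
  assumes "finsup S \<phi>" and \<psi>: "\<And>z. z \<in> S \<Longrightarrow> finsup T (\<psi> z)"
  shows "finsup T (\<lambda>F. \<phi> (\<lambda>z. \<psi> z F))"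
proof -
  obtain L where L: "snd ` set L \<subseteq> S" "\<forall>F. \<phi> F = (\<Sum>(c, z)\<leftarrow>L. c * F z)"
    using assms unfolding finsup_def by blast
  have "finsup T (\<lambda>F. \<Sum>(c, z)\<leftarrow>L. c * \<psi> z F)"
    using L(1) by (induction L) (auto intro!: finsup_zero finsup_plus finsup_scale \<psi>)
  then show ?thesis using L(2) by simp
qed

lemma finsup_linear:
  assumes "finsup S \<phi>"
  shows "\<phi> (\<lambda>z. F z + G z) = \<phi> F + \<phi> G" "\<phi> (\<lambda>z. a * F z) = a * \<phi> F" "\<phi> (\<lambda>z. 0) = 0"
proof -
  obtain L where L: "\<And>F. \<phi> F = (\<Sum>(c, z)\<leftarrow>L. c * F z)"
    using assms unfolding finsup_def by blast
  show "\<phi> (\<lambda>z. F z + G z) = \<phi> F + \<phi> G" unfolding L by (induction L) (auto simp: algebra_simps)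
  show "\<phi> (\<lambda>z. a * F z) = a * \<phi> F" unfolding L by (induction L) (auto simp: algebra_simps)
  show "\<phi> (\<lambda>z. 0) = 0" unfolding L by (induction L) auto
qed

lemma finsup_cong:
  assumes "finsup S \<phi>" "\<And>z. z \<in> S \<Longrightarrow> F z = G z"
  shows "\<phi> F = \<phi> G"
proof -
  obtain L where L: "snd ` set L \<subseteq> S" "\<And>F. \<phi> F = (\<Sum>(c, z)\<leftarrow>L. c * F z)"
    using assms unfolding finsup_def by blast
  show ?thesis unfolding L(2) using L(1) assms(2)
    by (intro arg_cong[of _ _ sum_list] map_cong) auto
qed

text \<open>This makes the interchange law hold in the representation.\<close>

lemma finsup_fubini:
  assumes "finsup S \<phi>" and \<psi>: "finsup T \<psi>"
  shows "\<phi> (\<lambda>a. \<psi> (\<lambda>b. G a b)) = \<psi> (\<lambda>b. \<phi> (\<lambda>a. G a b))"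
proof -
  obtain L where L: "\<And>F. \<phi> F = (\<Sum>(c, z)\<leftarrow>L. c * F z)"
    using assms unfolding finsup_def by blast
  show ?thesis unfolding L
    by (induction L) (auto simp: finsup_linear[OF \<psi>])
qed

subsection \<open>The representation\<close>

text \<open>The coordinates of a point belong to the black strands. A point is generic if no difference or
  sum of two coordinates and no coordinate vanishes, so that the divided differences below make
  sense for arbitrary functions.\<close>

definition orbit :: "'k :: field list \<Rightarrow> 'k list set" where
  "orbit y = {z. mset (map (\<lambda>u. u\<^sup>2) z) = mset (map (\<lambda>u. u\<^sup>2) y)}"

definition generic :: "'k :: field list \<Rightarrow> bool" where
  "generic y \<longleftrightarrow> distinct (map (\<lambda>u. u\<^sup>2) y) \<and> 0 \<notin> set y"

lemma orbit_refl: "y \<in> orbit y"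
  by (simp add: orbit_def)

lemma orbit_length: "z \<in> orbit y \<Longrightarrow> length z = length y"
  unfolding orbit_def by (metis (mono_tags) length_map mem_Collect_eq size_mset)

lemma orbit_trans: "z \<in> orbit y \<Longrightarrow> w \<in> orbit z \<Longrightarrow> w \<in> orbit y"
  by (simp add: orbit_def)

lemma orbit_append: "z \<in> orbit y \<Longrightarrow> z' \<in> orbit y' \<Longrightarrow> z @ z' \<in> orbit (y @ y')"
  by (simp add: orbit_def)

lemma generic_orbit: "generic y \<Longrightarrow> z \<in> orbit y \<Longrightarrow> generic z"
proof -
  assume y: "generic y" and "z \<in> orbit y"
  then have m: "mset (map (\<lambda>u. u\<^sup>2) z) = mset (map (\<lambda>u. u\<^sup>2) y)" by (simp add: orbit_def)
  have "(0 :: 'a) \<in> set z \<longleftrightarrow> 0 \<in> set (map (\<lambda>u. u\<^sup>2) z)" for z by force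
  then show ?thesis using y mset_eq_imp_distinct_iff[OF m] mset_eq_setD[OF m] by (auto simp: generic_def)
qed

lemma generic_append: "generic (y @ y') \<Longrightarrow> generic y \<and> generic y'"
  by (simp add: generic_def)

text \<open>\<open>strand_count\<close> counts the black strands at the top: a zero morphism may join words with
  different numbers of black letters.\<close>

fun strand_count :: "('v, 'k) mor \<Rightarrow> nat" where
  "strand_count (Ident X) = length (filter is_black X)"
| "strand_count (Zero X Y) = length (filter is_black Y)"
| "strand_count (Dot i) = 1"
| "strand_count (Cross a b) = length (filter is_black [a, b])"
| "strand_count (Reflect i) = 1"
| "strand_count (g \<circ>\<^sub>k f) = strand_count g"
| "strand_count (f \<otimes>\<^sub>k g) = strand_count f + strand_count g"
| "strand_count (f +\<^sub>k g) = strand_count f"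
| "strand_count (a *\<^sub>k f) = strand_count f"

text \<open>\<open>rep f\<close> turns functions of the coordinates at the bottom of
  \<open>f\<close> into functions of those at its top. The polynomial of each double-crossing or
  double-reflection relation is split between the two directions: \<open>f_poly\<close> into two
  factors \<open>X_poly\<close>, the power for a red strand into itself and 1, and
  \<open>fmu_poly\<close> at the negated coordinate into one power for each reflection.\<close>

fun rep :: "('v, 'a) pre_digraph \<Rightarrow> ('v \<Rightarrow> 'v) \<Rightarrow> 'v weight \<Rightarrow> ('v, 'k :: field) mor \<Rightarrow>
    ('k list \<Rightarrow> 'k) \<Rightarrow> 'k list \<Rightarrow> 'k" where
  "rep Q \<tau> \<mu> (Ident X) F y = F y"
| "rep Q \<tau> \<mu> (Zero X Y) F y = 0"
| "rep Q \<tau> \<mu> (Dot i) F y = hd y * F y"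
| "rep Q \<tau> \<mu> (Cross (Black i) (Black j)) F y =
     (if i = j then (F y - F [y ! 1, y ! 0]) / (y ! 0 - y ! 1)
      else X_poly Q j i (y ! 0) (y ! 1) * F [y ! 1, y ! 0])"
| "rep Q \<tau> \<mu> (Cross (Red \<theta>) (Black i)) F y = hd y ^ \<theta> i * F y"
| "rep Q \<tau> \<mu> (Cross a (Red \<theta>)) F y = F y"
| "rep Q \<tau> \<mu> (Reflect i) F y = hd y ^ \<mu> (\<tau> i) * F [- hd y]"
| "rep Q \<tau> \<mu> (g \<circ>\<^sub>k f) F y = rep Q \<tau> \<mu> g (rep Q \<tau> \<mu> f F) y"
| "rep Q \<tau> \<mu> (f \<otimes>\<^sub>k g) F y = rep Q \<tau> \<mu> f
     (\<lambda>a. rep Q \<tau> \<mu> g (\<lambda>b. F (a @ b)) (drop (strand_count f) y)) (take (strand_count f) y)"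
| "rep Q \<tau> \<mu> (f +\<^sub>k g) F y = rep Q \<tau> \<mu> f F y + rep Q \<tau> \<mu> g F y"
| "rep Q \<tau> \<mu> (a *\<^sub>k f) F y = a * rep Q \<tau> \<mu> f F y"

lemma strand_count_arrow:
  "is_mor Q \<tau> c X Y f \<Longrightarrow> strand_count f = length (filter is_black Y)"
  by (induction rule: is_mor.induct) auto

lemma length_1_cases: "length y = 1 \<Longrightarrow> (\<And>u. y = [u] \<Longrightarrow> P) \<Longrightarrow> P"
  by (auto simp: length_Suc_conv)

lemma length_2_cases: "length y = 2 \<Longrightarrow> (\<And>u v. y = [u, v] \<Longrightarrow> P) \<Longrightarrow> P"
  by (auto simp: length_Suc_conv numeral_2_eq_2)

lemma length_3_cases: "length y = 3 \<Longrightarrow> (\<And>u v w. y = [u, v, w] \<Longrightarrow> P) \<Longrightarrow> P"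
  by (auto simp: length_Suc_conv numeral_3_eq_3)

lemma finsup_difference_quotient:
  "y \<in> S \<Longrightarrow> z \<in> S \<Longrightarrow> finsup S (\<lambda>F. (F y - F z) / c)"
  using finsup_scale[OF finsup_minus[OF finsup_point finsup_point], of y S z "inverse c"] by (simp add: field_simps)

text \<open>Holds for ill-typed expressions too, so that \<open>rep_linear\<close> carries no typing
  conditions.\<close>

lemma rep_finsup_UNIV: "finsup UNIV (\<lambda>F. rep Q \<tau> \<mu> f F y)"
proof (induction f arbitrary: y)
  case (Cross a b)
  show ?case
  proof (cases a)
    case a: (Black i)
    show ?thesis
    proof (cases b)
      case (Black j)
      then show ?thesis using a
        by (cases "i = j") (simp_all add: finsup_difference_quotient finsup_scale finsup_point)
    next
      case (Red \<theta>)
      then show ?thesis using a by (simp add: finsup_point)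
    qed
  next
    case (Red \<theta>)
    then show ?thesis by (cases b) (simp_all add: finsup_scale finsup_point)
  qed
next
  case (Compose g f)
  from finsup_bind[OF Compose.IH(1) Compose.IH(2)] show ?case by simp
next
  case (Tensor f g)
  have "finsup UNIV (\<lambda>F. rep Q \<tau> \<mu> g (\<lambda>b. F (a @ b)) z)" for a z
    by (rule finsup_bind[OF Tensor.IH(2)]) (simp add: finsup_point)
  from finsup_bind[OF Tensor.IH(1) this] show ?case by simp
qed (simp_all add: finsup_point finsup_zero finsup_scale finsup_plus)

lemmas rep_linear = finsup_linear[OF rep_finsup_UNIV]

text \<open>The number of black strands can change only through \<open>Zero\<close>, which acts by
  0.\<close>

lemma rep_unbalanced:
  "is_mor Q \<tau> c X Y f \<Longrightarrow> length (filter is_black X) \<noteq> length (filter is_black Y) \<Longrightarrow> rep Q \<tau> \<mu> f F y = 0"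
proof (induction arbitrary: F y rule: is_mor.induct)
  case (compose c X Y f Z g)
  show ?case
  proof (cases "length (filter is_black X) = length (filter is_black Y)")
    case False
    then have "rep Q \<tau> \<mu> f F = (\<lambda>y. 0)" using compose.IH(1) by blast
    then show ?thesis by (simp add: rep_linear(3))
  qed (use compose in simp)
next
  case (tensor c X Y f X' Y' g)
  show ?case
  proof (cases "length (filter is_black X) = length (filter is_black Y)")
    case True
    then show ?thesis using tensor by (simp add: rep_linear(3))
  qed (use tensor in simp)
qed (auto split: if_splits)

text \<open>Well-typed morphisms evaluate \<open>F\<close> only after permutations and sign changes
  of coordinates, that is, within one orbit. If \<open>y\<close> is generic, all these points
  are.\<close>

lemma rep_finsup:
  assumes "is_mor Q \<tau> c X Y f"
  shows "length y = length (filter is_black Y) \<Longrightarrow> finsup (orbit y) (\<lambda>F. rep Q \<tau> \<mu> f F y)"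
  using assms
proof (induction arbitrary: y rule: is_mor.induct)
  case (ident X c)
  then show ?case by (simp add: finsup_point orbit_refl)
next
  case (zero X Y c)
  then show ?case by (simp add: finsup_zero)
next
  case (dot i c)
  then show ?case by (simp add: finsup_scale finsup_point orbit_refl)
next
  case (cross a b c)
  show ?case
  proof (cases a)
    case a: (Black i)
    show ?thesis
    proof (cases b)
      case b: (Black j)
      then obtain u v where y: "y = [u, v]" using cross a length_2_cases[of y] by (auto simp: numeral_2_eq_2)
      have o: "[v, u] \<in> orbit [u, v]" by (simp add: orbit_def add_mset_commute)
      show ?thesis unfolding a b y using o
        by (cases "i = j") (simp_all add: finsup_difference_quotient finsup_scale finsup_point orbit_refl)
    next
      case (Red \<theta>)
      then show ?thesis using a by (simp add: finsup_point orbit_refl)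
    qed
  next
    case (Red \<theta>)
    then show ?thesis using cross(3) by (cases b) (simp_all add: finsup_scale finsup_point orbit_refl)
  qed
next
  case (reflect i)
  then obtain u where y: "y = [u]" using length_1_cases[of y] by auto
  have "[- u] \<in> orbit y" by (simp add: orbit_def y)
  then show ?case using y by (simp add: finsup_scale finsup_point)
next
  case (compose c X Y f Z g)
  show ?case
  proof (cases "length (filter is_black Y) = length (filter is_black Z)")
    case True
    have 1: "finsup (orbit y) (\<lambda>F. rep Q \<tau> \<mu> g F y)" using compose by simp
    have "finsup (orbit y) (\<lambda>F. rep Q \<tau> \<mu> f F z)" if "z \<in> orbit y" for z
    proof -
      have sub: "orbit z \<subseteq> orbit y" using that orbit_trans by blast
      have "finsup (orbit z) (\<lambda>F. rep Q \<tau> \<mu> f F z)" using compose orbit_length[OF that] True by simp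
      then show ?thesis unfolding finsup_def using sub by (meson order_trans)
    qed
    from finsup_bind[OF 1 this] show ?thesis by simp
  next
    case False
    then show ?thesis using rep_unbalanced[OF compose(2)] by (simp add: finsup_zero)
  qed
next
  case (tensor c X Y f X' Y' g)
  let ?n = "strand_count f"
  have n: "?n = length (filter is_black Y)" by (rule strand_count_arrow[OF tensor(1)])
  have 1: "finsup (orbit (take ?n y)) (\<lambda>F. rep Q \<tau> \<mu> f F (take ?n y))" using tensor n by simp
  have 2: "finsup (orbit (drop ?n y)) (\<lambda>F. rep Q \<tau> \<mu> g F (drop ?n y))" using tensor n by simp
  have "finsup (orbit y) (\<lambda>F. rep Q \<tau> \<mu> g (\<lambda>b. F (a @ b)) (drop ?n y))" if "a \<in> orbit (take ?n y)" for a
    by (rule finsup_bind[OF 2]) (use orbit_append[OF that, of _ "drop ?n y"] in \<open>auto intro: finsup_point\<close>)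
  from finsup_bind[OF 1 this] show ?case by simp
next
  case (plus c X Y f g)
  then show ?case by (simp add: finsup_plus)
next
  case (scale c X Y f a)
  then show ?case by (simp add: finsup_scale)
qed

inductive_cases is_mor_ComposeE: "is_mor Q \<tau> c X Z (g \<circ>\<^sub>k f)"
inductive_cases is_mor_TensorE: "is_mor Q \<tau> c X Y (f \<otimes>\<^sub>k g)"
inductive_cases is_mor_PlusE: "is_mor Q \<tau> c X Y (f +\<^sub>k g)"
inductive_cases is_mor_ScaleE: "is_mor Q \<tau> c X Y (a *\<^sub>k f)"

lemma rep_Compose: "rep Q \<tau> \<mu> (g \<circ>\<^sub>k f) F = rep Q \<tau> \<mu> g (rep Q \<tau> \<mu> f F)"
  and rep_Ident: "rep Q \<tau> \<mu> (Ident X) F = F"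
  by (simp_all add: fun_eq_iff)

text \<open>Most axioms are immediate from linearity. In the interchange law both sides must cut
  \<open>y\<close> at the same place, and the functionals of two independent factors must be
  exchanged.\<close>

lemma rep_linear_monoidal:
  assumes "linear_monoidal_rel f g" "is_mor Q \<tau> c X Y f" "is_mor Q \<tau> c X Y g" "length y = length (filter is_black Y)"
  shows "rep Q \<tau> \<mu> f F y = rep Q \<tau> \<mu> g F y"
proof -
  note cnt = strand_count_arrow
  note fin = rep_finsup[where Q = Q and \<tau> = \<tau> and \<mu> = \<mu>]
  show ?thesis using assms
  proof (cases rule: linear_monoidal_rel.cases)
    case (comp_plus_right g' f1 f2)
    have "rep Q \<tau> \<mu> (f1 +\<^sub>k f2) F = (\<lambda>z. rep Q \<tau> \<mu> f1 F z + rep Q \<tau> \<mu> f2 F z)" by (rule ext) simp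
    then show ?thesis unfolding comp_plus_right by (simp add: rep_linear)
  next
    case (comp_scale_right g' a f1)
    have "rep Q \<tau> \<mu> (a *\<^sub>k f1) F = (\<lambda>z. a * rep Q \<tau> \<mu> f1 F z)" by (rule ext) simp
    then show ?thesis unfolding comp_scale_right by (simp add: rep_linear)
  next
    case (tensor_unit_right)
    then show ?thesis using cnt[OF assms(3)] assms(4) by simp
  next
    case (tensor_assoc f1 f2 f3)
    show ?thesis unfolding tensor_assoc
      by (simp add: take_drop min_def drop_drop add.commute)
  next
    case (tensor_plus_left f1 f2 f3)
    from assms(2) have "strand_count f1 = strand_count f2"
      unfolding tensor_plus_left by (elim is_mor_TensorE is_mor_PlusE) (metis cnt)
    then show ?thesis unfolding tensor_plus_left by simp
  next
    case (interchange g1 g2 f1 f2)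
    from assms(3) obtain X1 X2 Y1 Y2 Z1 Z2 where t: "is_mor Q \<tau> c X1 Y1 f1" "is_mor Q \<tau> c Y1 Z1 g1"
        "is_mor Q \<tau> KLRW X2 Y2 f2" "is_mor Q \<tau> KLRW Y2 Z2 g2" and Y: "Y = Z1 @ Z2"
      unfolding interchange by (elim is_mor_TensorE is_mor_ComposeE) auto
    \<comment> \<open>An unbalanced factor makes both sides 0; in the balanced case the cuts of
      \<open>y\<close> agree.\<close>
    consider (g1) "length (filter is_black Y1) \<noteq> length (filter is_black Z1)"
      | (g2) "length (filter is_black Y2) \<noteq> length (filter is_black Z2)"
      | (bal) "length (filter is_black Y1) = length (filter is_black Z1)" "length (filter is_black Y2) = length (filter is_black Z2)"
      by blast
    then show ?thesis
    proof cases
      case g1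
      then show ?thesis unfolding interchange using rep_unbalanced[OF t(2)] by simp
    next
      case g2
      then show ?thesis unfolding interchange using rep_unbalanced[OF t(4)] by (simp add: rep_linear)
    next
      case bal
      have n: "strand_count g1 = strand_count f1" "strand_count g2 = strand_count f2"
        using cnt[OF t(1)] cnt[OF t(2)] cnt[OF t(3)] cnt[OF t(4)] bal by simp_all
      let ?n = "strand_count f1"
      have l: "length (take ?n y) = length (filter is_black Z1)" "length (drop ?n y) = length (filter is_black Z2)"
        using assms(4) Y n cnt[OF t(2)] by simp_all
      have "rep Q \<tau> \<mu> g1 (\<lambda>a. rep Q \<tau> \<mu> g2 (\<lambda>b. rep Q \<tau> \<mu> f1 (\<lambda>a'. rep Q \<tau> \<mu> f2 (\<lambda>b'. F (a' @ b'))
           (drop ?n (a @ b))) (take ?n (a @ b))) (drop ?n y)) (take ?n y)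
         = rep Q \<tau> \<mu> g1 (\<lambda>a. rep Q \<tau> \<mu> g2 (\<lambda>b. rep Q \<tau> \<mu> f1 (\<lambda>a'. rep Q \<tau> \<mu> f2 (\<lambda>b'. F (a' @ b')) b) a) (drop ?n y)) (take ?n y)"
      proof (rule finsup_cong[OF fin[OF t(2) l(1)]])
        fix a assume "a \<in> orbit (take ?n y)"
        then have "length a = ?n" using orbit_length l(1) n cnt[OF t(2)] by metis
        then show "rep Q \<tau> \<mu> g2 (\<lambda>b. rep Q \<tau> \<mu> f1 (\<lambda>a'. rep Q \<tau> \<mu> f2 (\<lambda>b'. F (a' @ b'))
           (drop ?n (a @ b))) (take ?n (a @ b))) (drop ?n y) =
           rep Q \<tau> \<mu> g2 (\<lambda>b. rep Q \<tau> \<mu> f1 (\<lambda>a'. rep Q \<tau> \<mu> f2 (\<lambda>b'. F (a' @ b')) b) a) (drop ?n y)"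
          by simp
      qed
      \<comment> \<open>The outer functional of the right factor passes the inner functional of the
        left one.\<close>
      also have "\<dots> = rep Q \<tau> \<mu> g1 (\<lambda>a. rep Q \<tau> \<mu> f1 (\<lambda>a'. rep Q \<tau> \<mu> g2 (\<lambda>b. rep Q \<tau> \<mu> f2 (\<lambda>b'. F (a' @ b')) b) (drop ?n y)) a) (take ?n y)"
      proof -
        have "rep Q \<tau> \<mu> g2 (\<lambda>b. rep Q \<tau> \<mu> f1 (\<lambda>a'. rep Q \<tau> \<mu> f2 (\<lambda>b'. F (a' @ b')) b) a) (drop ?n y) =
            rep Q \<tau> \<mu> f1 (\<lambda>a'. rep Q \<tau> \<mu> g2 (\<lambda>b. rep Q \<tau> \<mu> f2 (\<lambda>b'. F (a' @ b')) b) (drop ?n y)) a" for a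
          by (rule finsup_fubini[where \<phi> = "\<lambda>F. rep Q \<tau> \<mu> g2 F (drop ?n y)" and \<psi> = "\<lambda>F. rep Q \<tau> \<mu> f1 F a"
                and G = "\<lambda>b a'. rep Q \<tau> \<mu> f2 (\<lambda>b'. F (a' @ b')) b", OF rep_finsup_UNIV rep_finsup_UNIV])
        then show ?thesis by (simp only:)
      qed
      finally show ?thesis unfolding interchange using n by simp
    qed
  qed (auto simp: algebra_simps rep_linear rep_Compose rep_Ident)
qed

text \<open>Matches coordinate \<open>r - 1\<close> of a point with the place at which
  \<open>black_dot X r\<close> cuts it.\<close>

lemma is_black_nb_take:
  assumes "1 \<le> r" "r \<le> length (black_positions X)"
  shows "length (filter is_black (take (black_positions X ! (r - 1)) X)) = r - 1"
proof -
  let ?p = "black_positions X ! (r - 1)"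
  have "?p \<in> set (black_positions X)" using assms by (intro nth_mem) simp
  then have p: "?p < length X" "is_black (X ! ?p)" by (auto simp: black_positions_def)
  then obtain A a B where X: "X = A @ a # B" "length A = ?p" using split_at[of ?p X] by metis
  have a: "is_black a" using p(2) X by (metis nth_append_length)
  have "black_positions X = filter (\<lambda>q. is_black (X ! q)) [0..<length A] @ length A #
      filter (\<lambda>q. is_black (X ! q)) [Suc (length A)..<length X]"
  proof -
    have lt: "length A < length X" using X(1) by simp
    have "[0..<length X] = [0..<length A] @ [length A..<length X]"
      using upt_add_eq_append[of 0 "length A" "length X - length A"] lt by simp
    also have "[length A..<length X] = length A # [Suc (length A)..<length X]" using lt by (rule upt_conv_Cons)
    finally show ?thesis unfolding black_positions_def using a X(1) by simp
  qed
  moreover have "length (filter (\<lambda>q. is_black (X ! q)) [0..<length A]) = length (filter is_black A)"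
  proof -
    have "filter (\<lambda>q. is_black (X ! q)) [0..<length A] = filter (\<lambda>q. is_black (A ! q)) [0..<length A]"
      by (rule filter_cong) (auto simp: X(1) nth_append)
    then show ?thesis using length_black_positions[of A] by (simp add: black_positions_def)
  qed
  ultimately have nb: "length (filter is_black A) < length (black_positions X)"
    "black_positions X ! length (filter is_black A) = length A"
    by (simp_all add: nth_append)
  have "distinct (black_positions X)" by (simp add: black_positions_def)
  moreover have "r - 1 < length (black_positions X)" using assms by simp
  ultimately have "length (filter is_black A) = r - 1"
    using nb X(2) nth_eq_iff_index_eq by metis
  then show ?thesis using X by (metis append_eq_conv_conj)
qed

lemma rep_black_dot:
  assumes r: "1 \<le> r" "r \<le> length (black_positions X)" and y: "length y = length (filter is_black X)"
  shows "rep Q \<tau> \<mu> (black_dot X r) F y = y ! (r - 1) * F y"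
proof -
  let ?p = "black_positions X ! (r - 1)"
  have "?p \<in> set (black_positions X)" using r by (intro nth_mem) simp
  then have p: "?p < length X" "is_black (X ! ?p)" by (auto simp: black_positions_def)
  then obtain i where i: "X ! ?p = Black i" by (cases "X ! ?p") auto
  have n: "r - 1 < length y" using r y by (simp add: length_black_positions)
  then have d: "drop (r - 1) y = y ! (r - 1) # drop r y" using r(1) by (metis Cons_nth_drop_Suc Suc_pred' Suc_le_eq One_nat_def)
  have "rep Q \<tau> \<mu> (black_dot X r) F y =
      y ! (r - 1) * F (take (r - 1) y @ take 1 (drop (r - 1) y) @ drop 1 (drop (r - 1) y))"
    unfolding black_dot_def Let_def using is_black_nb_take[OF r] by (simp add: i[simplified] d[simplified])
  then show ?thesis by (simp only: append_take_drop_id)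
qed

lemma rep_dot_poly:
  "dot_poly X P t \<Longrightarrow> length y = length (filter is_black X) \<Longrightarrow>
    rep Q \<tau> \<mu> t F y = poly_eval (\<lambda>r. y ! (r - 1)) P * F y"
proof (induction arbitrary: F rule: dot_poly.induct)
  case (2 r)
  then show ?case by (simp add: rep_black_dot)
qed (simp_all add: poly_eval_simps algebra_simps)

section \<open>The defining relations hold at generic points\<close>

lemma generic_pair: "generic [u, v] \<Longrightarrow> u - v \<noteq> 0 \<and> v - u \<noteq> 0 \<and> u + v \<noteq> 0 \<and> v + u \<noteq> 0"
  by (auto simp: generic_def add_eq_0_iff)

lemma generic_triple: "generic [u, v, w] \<Longrightarrow> generic [u, v] \<and> generic [u, w] \<and> generic [v, w]"
  by (auto simp: generic_def)

text \<open>At a generic point the denominators of all divided differences are nonzero; after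
  clearing them each relation is an identity between finitely many values of
  \<open>F\<close>.\<close>

lemma rep_klrw:
  assumes iq: "involutive_quiver Q \<tau> \<tau>\<^sub>1" and rel: "klrw_rel Q f g" and f: "is_mor Q \<tau> c X Y f"
    and y: "generic y" "length y = length (filter is_black Y)"
  shows "rep Q \<tau> \<mu> f F y = rep Q \<tau> \<mu> g F y"
proof -
  have len: "length y = strand_count f" using strand_count_arrow[OF f] y(2) by simp
  show ?thesis using rel
  proof cases
    case (dot_cross_left j i)
    then have "length y = 2" using len by simp
    then obtain u v where [simp]: "y = [u, v]" by (rule length_2_cases)
    show ?thesis unfolding dot_cross_left using generic_pair[of u v] y(1)
      by (cases "i = j") (simp_all add: delta_mor_def field_simps)
  next
    case (dot_cross_right i j)
    then have "length y = 2" using len by simp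
    then obtain u v where [simp]: "y = [u, v]" by (rule length_2_cases)
    show ?thesis unfolding dot_cross_right using generic_pair[of u v] y(1)
      by (cases "i = j") (simp_all add: delta_mor_def field_simps)
  next
    case (cross_cross_same i)
    then have "length y = 2" using len by simp
    then obtain u v where [simp]: "y = [u, v]" by (rule length_2_cases)
    show ?thesis unfolding cross_cross_same using generic_pair[of u v] y(1)
      by (simp add: divide_simps) (simp add: algebra_simps)
  next
    case (cross_cross i j)
    then have "length y = 2" using len by simp
    then obtain u v where yu: "y = [u, v]" by (rule length_2_cases)
    have "rep Q \<tau> \<mu> g F y = f_poly Q i j u v * F y"
      using rep_dot_poly[OF cross_cross(3), of y Q \<tau> \<mu> F] yu by (simp add: poly_eval_f_poly)
    then show ?thesis unfolding cross_cross(1) using cross_cross(2) by (simp add: yu f_poly_def)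
  next
    case (braid i k j q t)
    then have "length y = 3" using len by simp
    then obtain u v w where yu: "y = [u, v, w]" by (rule length_3_cases)
    have ne: "u - v \<noteq> 0" "v - u \<noteq> 0" "u - w \<noteq> 0" "w - u \<noteq> 0" "v - w \<noteq> 0" "w - v \<noteq> 0"
      using y(1) generic_triple[of u v w] generic_pair[of u v] generic_pair[of u w] generic_pair[of v w] yu by auto
    show ?thesis
    proof (cases "i = k \<and> k \<noteq> j")
      case True
      then have q: "dot_poly [Black i, Black j, Black k] q t"
        "q * (Var 3 - Var 1) = f_poly Q i j (Var 3) (Var 2) - f_poly Q i j (Var 1) (Var 2)" using braid(3) by auto
      let ?q = "poly_eval (\<lambda>r. y ! (r - 1)) q"
      have "?q * (w - u) = f_poly Q i j w v - f_poly Q i j u v"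
        using arg_cong[OF q(2), of "poly_eval (\<lambda>r. y ! (r - 1))"]
        by (simp add: yu poly_eval_simps poly_eval_f_poly numeral_3_eq_3 numeral_2_eq_2)
      then have qq: "?q = (f_poly Q i j w v - f_poly Q i j u v) / (w - u)" using ne by (simp add: eq_divide_eq)
      have "rep Q \<tau> \<mu> g F y = ?q * F y"
        unfolding braid(2) using rep_dot_poly[OF q(1), of y Q \<tau> \<mu> F] True by (simp add: yu delta_mor_def)
      also have "\<dots> = (f_poly Q i j w v - f_poly Q i j u v) / (w - u) * F y" unfolding qq ..
      finally have g: "rep Q \<tau> \<mu> g F y = (f_poly Q i j w v - f_poly Q i j u v) / (w - u) * F y" .
      have ik: "i = k" "k \<noteq> j" "j \<noteq> k" using True by auto
      show ?thesis unfolding g unfolding braid(1) ik(1) using ik(2,3) ne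
        by (simp add: yu f_poly_def, simp add: divide_simps, simp add: algebra_simps)
    next
      case False
      then consider "i = k" "k = j" | "i \<noteq> k" "i = j" | "i \<noteq> k" "j = k" | "i \<noteq> k" "i \<noteq> j" "j \<noteq> k" by blast
      then show ?thesis
      proof cases
        case 1
        then show ?thesis unfolding braid using ne
          by (simp add: yu delta_mor_def numeral_2_eq_2 divide_simps) (simp add: algebra_simps)
      next
        case 2
        then show ?thesis unfolding braid using ne
          by (simp add: yu delta_mor_def numeral_2_eq_2 divide_simps) (simp add: algebra_simps)
      next
        case 3
        then show ?thesis unfolding braid using ne
          by (simp add: yu delta_mor_def numeral_2_eq_2 divide_simps) (simp add: algebra_simps)
      next
        case 4
        then show ?thesis unfolding braid using ne
          by (simp add: yu delta_mor_def numeral_2_eq_2)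
      qed
    qed
  next
    case (braid_red_middle i j \<theta> t)
    then have "length y = 2" using len by simp
    then obtain u v where yu: "y = [u, v]" by (rule length_2_cases)
    have ne: "u - v \<noteq> 0" "v - u \<noteq> 0" using y(1) generic_pair[of u v] yu by auto
    show ?thesis
    proof (cases "i = j")
      case True
      let ?S = "\<Sum>(a, b) | a + b + 1 = \<theta> i. u ^ a * v ^ b"
      have "rep Q \<tau> \<mu> g F y = poly_eval (\<lambda>r. y ! (r - 1)) (\<Sum>(a, b) | a + b + 1 = \<theta> i. Var 1 ^ a * Var 2 ^ b) * F y"
        unfolding braid_red_middle(2) using rep_dot_poly[OF braid_red_middle(3)[OF True], of y Q \<tau> \<mu> F] True by (simp add: yu delta_mor_def)
      also have "poly_eval (\<lambda>r. y ! (r - 1)) (\<Sum>(a, b) | a + b + 1 = \<theta> i. Var 1 ^ a * Var 2 ^ b) = ?S"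
        by (simp add: poly_eval_simps case_prod_unfold yu)
      \<comment> \<open>The sum is the divided difference of the \<open>\<theta> i\<close>-th power.
        It arises because only one direction of crossing the red strand carries that power.\<close>
      also have "?S = (u ^ \<theta> i - v ^ \<theta> i) / (u - v)"
      proof -
        have "?S = (\<Sum>a<\<theta> i. u ^ a * v ^ (\<theta> i - Suc a))"
        proof (rule sum.reindex_bij_witness[of _ "\<lambda>a. (a, \<theta> i - Suc a)" fst])
          fix p assume "p \<in> {(a, b). a + b + 1 = \<theta> i}"
          then have "\<theta> i - Suc (fst p) = snd p" by auto
          then show "u ^ fst p * v ^ (\<theta> i - Suc (fst p)) = (case p of (a, b) \<Rightarrow> u ^ a * v ^ b)" by (simp add: case_prod_unfold)
        qed auto
        also have "\<dots> * (u - v) = u ^ \<theta> i - v ^ \<theta> i"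
          using power_diff_sumr2[of u "\<theta> i" v] by (simp add: mult.commute)
        then have "(\<Sum>a<\<theta> i. u ^ a * v ^ (\<theta> i - Suc a)) = (u ^ \<theta> i - v ^ \<theta> i) / (u - v)"
          using ne by (simp add: eq_divide_eq)
        finally show ?thesis .
      qed
      finally have "rep Q \<tau> \<mu> g F y = (u ^ \<theta> i - v ^ \<theta> i) / (u - v) * F y" .
      then show ?thesis unfolding braid_red_middle(1) using True ne
        by (simp add: yu divide_simps) (simp add: algebra_simps)
    next
      case False
      then show ?thesis unfolding braid_red_middle by (simp add: yu delta_mor_def)
    qed
  next
    case (braid_red_right j \<theta> i)
    then have "length y = 2" using len by simp
    then obtain u v where [simp]: "y = [u, v]" by (rule length_2_cases)
    show ?thesis unfolding braid_red_right by simp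
  next
    case (braid_red_left j i \<theta>)
    then have "length y = 2" using len by simp
    then obtain u v where [simp]: "y = [u, v]" by (rule length_2_cases)
    show ?thesis unfolding braid_red_left
      by (cases "i = j") (simp_all add: algebra_simps diff_divide_distrib)
  next
    case (dot_cross_red_left i \<theta>)
    then have "length y = 1" using len by simp
    then obtain u where [simp]: "y = [u]" by (rule length_1_cases)
    show ?thesis unfolding dot_cross_red_left by simp
  next
    case (dot_cross_red_right i \<theta>)
    then have "length y = 1" using len by simp
    then obtain u where [simp]: "y = [u]" by (rule length_1_cases)
    show ?thesis unfolding dot_cross_red_right by simp
  next
    case (cross_cross_red_left \<theta> i)
    then have "length y = 1" using len by simp
    then obtain u where yu: "y = [u]" by (rule length_1_cases)
    show ?thesis unfolding cross_cross_red_left(1)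
      using rep_dot_poly[OF cross_cross_red_left(2), of y Q \<tau> \<mu> F] by (simp add: yu poly_eval_simps)
  next
    case (cross_cross_red_right i \<theta>)
    then have "length y = 1" using len by simp
    then obtain u where yu: "y = [u]" by (rule length_1_cases)
    show ?thesis unfolding cross_cross_red_right(1)
      using rep_dot_poly[OF cross_cross_red_right(2), of y Q \<tau> \<mu> F] by (simp add: yu poly_eval_simps)
  qed
qed


inductive_cases is_mor_ReflectE: "is_mor Q \<tau> c X Y (Reflect i)"
inductive_cases is_mor_CrossE: "is_mor Q \<tau> c X Y (Cross a b)"

text \<open>The involution on arrows reverses them and applies \<open>\<tau>\<close> to both ends.
  It relates the polynomials of a crossing before and after its strands are reflected.\<close>

lemma (in involutive_quiver) arc_tau:
  assumes "i \<in> verts Q" "j \<in> verts Q"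
  shows "\<tau> j \<rightarrow>\<^bsub>Q\<^esub> \<tau> i \<longleftrightarrow> i \<rightarrow>\<^bsub>Q\<^esub> j"
proof -
  have imp: "\<tau> j \<rightarrow>\<^bsub>Q\<^esub> \<tau> i" if "i \<rightarrow>\<^bsub>Q\<^esub> j" for i j
  proof -
    obtain h where "h \<in> arcs Q" "tail Q h = i" "head Q h = j"
      using \<open>i \<rightarrow>\<^bsub>Q\<^esub> j\<close> by (auto simp: arcs_ends_def arc_to_ends_def)
    then have "\<tau>\<^sub>1 h \<in> arcs Q" "tail Q (\<tau>\<^sub>1 h) = \<tau> j" "head Q (\<tau>\<^sub>1 h) = \<tau> i"
      using tau1_closed tail_tau1 head_tau1 by auto
    then show ?thesis by (force simp: arcs_ends_def arc_to_ends_def image_iff)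
  qed
  show ?thesis using imp[of i j] imp[of "\<tau> j" "\<tau> i"] tau_invol assms by auto
qed

text \<open>In the braid relation with the mirror, \<open>\<tau> i = j\<close> makes the inner
  crossing of each side one of equal labels; their divided differences give the correction. For
  \<open>i = j\<close> the outer crossings act by divided differences, and otherwise there are only
  substitutions times polynomials.\<close>

lemma rep_mirror:
  fixes f g :: "('v, 'k :: field) mor"
  assumes iq: "involutive_quiver Q \<tau> \<tau>\<^sub>1" and rel: "mirror_rel \<tau> \<mu> f g" and f: "is_mor Q \<tau> c X Y f"
    and y: "generic y" "length y = length (filter is_black Y)"
  shows "rep Q \<tau> \<mu> f F y = rep Q \<tau> \<mu> g F y"
proof -
  interpret involutive_quiver Q \<tau> \<tau>\<^sub>1 by (rule iq)
  have len: "length y = strand_count f" using strand_count_arrow[OF f] y(2) by simp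
  show ?thesis using rel
  proof cases
    case (reflect_reflect i)
    have "i \<in> verts Q" using f unfolding reflect_reflect(1) by (elim is_mor_ComposeE is_mor_ReflectE) auto
    then have [simp]: "\<tau> (\<tau> i) = i" by (rule tau_invol)
    have "length y = 1" using len reflect_reflect by simp
    then obtain u where yu: "y = [u]" by (rule length_1_cases)
    have "rep Q \<tau> \<mu> g F y = fmu_poly \<tau> \<mu> i (- u) * F y"
      using rep_dot_poly[OF reflect_reflect(2), of y Q \<tau> \<mu> F] by (simp add: yu poly_eval_fmu_poly)
    then show ?thesis unfolding reflect_reflect(1) by (simp add: yu fmu_poly_def)
  next
    case (reflect_dot i)
    then have "length y = 1" using len by simp
    then obtain u where [simp]: "y = [u]" by (rule length_1_cases)
    show ?thesis unfolding reflect_dot by simp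
  next
    case (reflect_braid i j q t)
    have ij: "i \<in> verts Q" "j \<in> verts Q"
      using f unfolding reflect_braid(1) by (elim is_mor_ComposeE is_mor_PlusE is_mor_TensorE is_mor_ReflectE; simp)+
    have [simp]: "\<tau> (\<tau> i) = i" "\<tau> (\<tau> j) = j" using ij by (auto simp: tau_invol)
    have fx: "\<tau> i \<noteq> i" "i \<noteq> \<tau> i" "\<tau> j \<noteq> j" "j \<noteq> \<tau> j" using ij tau_no_fixed by metis+
    have "length y = 2" using len reflect_braid by simp
    then obtain u v where yu: "y = [u, v]" by (rule length_2_cases)
    have ne: "u - v \<noteq> 0" "v - u \<noteq> 0" "u + v \<noteq> 0" "v + u \<noteq> 0" "- u - v \<noteq> 0" "- v - u \<noteq> 0"
      using y(1) generic_pair[of u v] yu by (auto simp: diff_eq_eq add_eq_0_iff minus_equation_iff)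
    have X1: "X_poly Q (\<tau> i) (\<tau> j) x z = X_poly Q j i x z" for x z :: 'k
      using arc_tau[OF ij] by (simp add: X_poly_def)
    have X2: "X_poly Q i (\<tau> j) x z = X_poly Q j (\<tau> i) x z" for x z :: 'k
      using arc_tau[OF tau_closed[OF ij(1)] ij(2)] by (simp add: X_poly_def)
    show ?thesis
    proof (cases "\<tau> i = j")
      case True
      then have tj: "\<tau> j = i" by auto
      have q: "dot_poly [Black j, Black i] q t"
        "q * (Var 1 + Var 2) = fmu_poly \<tau> \<mu> i (Var 1) - fmu_poly \<tau> \<mu> j (Var 2)" using reflect_braid(3) True by auto
      let ?q = "poly_eval (\<lambda>r. y ! (r - 1)) q"
      have "?q * (u + v) = fmu_poly \<tau> \<mu> i u - fmu_poly \<tau> \<mu> j v"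
        using arg_cong[OF q(2), of "poly_eval (\<lambda>r. y ! (r - 1))"]
        by (simp add: yu poly_eval_simps poly_eval_fmu_poly)
      then have qq: "?q = (fmu_poly \<tau> \<mu> i u - fmu_poly \<tau> \<mu> j v) / (u + v)" using ne by (simp add: eq_divide_eq)
      have nij: "i \<noteq> j" using True fx by auto
      have "rep Q \<tau> \<mu> g F y = ?q * (X_poly Q j i u v * F [v, u])"
        unfolding reflect_braid(2) using rep_dot_poly[OF q(1), of y Q \<tau> \<mu> "rep Q \<tau> \<mu> (BCross i j) F"] True nij
        by (simp add: yu delta_mor_def)
      also have "\<dots> = (fmu_poly \<tau> \<mu> i u - fmu_poly \<tau> \<mu> j v) / (u + v) * (X_poly Q j i u v * F [v, u])" unfolding qq ..
      finally have g: "rep Q \<tau> \<mu> g F y = (fmu_poly \<tau> \<mu> i u - fmu_poly \<tau> \<mu> j v) / (u + v) * (X_poly Q j i u v * F [v, u])" .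
      \<comment> \<open>\<open>X_poly\<close> depends only on the difference of its arguments, which
        is unchanged when they are exchanged and both negated.\<close>
      have XX: "X_poly Q j i (- v) (- u) = X_poly Q j i u v" by (simp add: X_poly_def)
      show ?thesis unfolding g unfolding reflect_braid(1) True tj using nij nij[symmetric] ne
        by (simp add: yu True tj fmu_poly_def XX, simp add: divide_simps, simp add: algebra_simps)
    next
      case False
      then have tj: "\<tau> j \<noteq> i" "i \<noteq> \<tau> j" "j \<noteq> \<tau> i" by auto
      have g: "rep Q \<tau> \<mu> g F y = 0" unfolding reflect_braid(2) using False by (simp add: delta_mor_def)
      show ?thesis
      proof (cases "i = j")
        case True
        have X3: "X_poly Q a b (- u) v = X_poly Q a b (- v) u" for a b by (simp add: X_poly_def)
        show ?thesis unfolding g unfolding reflect_braid(1) True[symmetric] using fx ne(1-4) False tj True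
          by (simp add: yu X3, simp add: divide_simps, simp add: algebra_simps)
      next
        case nij: False
        have tij: "\<tau> i \<noteq> \<tau> j" "\<tau> j \<noteq> \<tau> i" using nij \<open>\<tau> (\<tau> i) = i\<close> \<open>\<tau> (\<tau> j) = j\<close> by metis+
        have X3: "X_poly Q j i (- v) (- u) = X_poly Q j i u v" by (simp add: X_poly_def)
        have X4: "X_poly Q j (\<tau> i) (- u) v = X_poly Q j (\<tau> i) (- v) u" by (simp add: X_poly_def)
        show ?thesis unfolding g unfolding reflect_braid(1) using nij tij tj False
          by (simp add: yu X1 X2 X3 X4)
      qed
    qed
  qed
qed

text \<open>Genericity passes to the whole orbit, so in a composition the hypothesis for the inner
  factor is available at every point that the outer factor sees.\<close>

theorem rep_eqv:
  assumes iq: "involutive_quiver Q \<tau> \<tau>\<^sub>1"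
  shows "mor_eq Q \<tau> \<mu> c X Y f g \<Longrightarrow> generic y \<Longrightarrow> length y = length (filter is_black Y) \<Longrightarrow>
    rep Q \<tau> \<mu> f F y = rep Q \<tau> \<mu> g F y"
proof (induction arbitrary: F y rule: mor_eq.induct)
  case (compose c X Y f f' Z g g')
  note ty = mor_eq_is_mor[OF compose(1)] mor_eq_is_mor[OF compose(2)]
  show ?case
  proof (cases "length (filter is_black Y) = length (filter is_black Z)")
    case True
    have "rep Q \<tau> \<mu> g (rep Q \<tau> \<mu> f F) y = rep Q \<tau> \<mu> g (rep Q \<tau> \<mu> f' F) y"
    proof (rule finsup_cong[OF rep_finsup[OF ty(3) compose.prems(2)]])
      fix z assume z: "z \<in> orbit y"
      show "rep Q \<tau> \<mu> f F z = rep Q \<tau> \<mu> f' F z"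
        by (rule compose.IH(1)[OF generic_orbit[OF compose.prems(1) z]]) (simp add: orbit_length[OF z] compose.prems True)
    qed
    then show ?thesis using compose.IH(2)[OF compose.prems] by simp
  next
    case False
    then show ?thesis using rep_unbalanced[OF ty(3)] rep_unbalanced[OF ty(4)] by simp
  qed
next
  case (tensor c X Y f f' X' Y' g g')
  note ty = mor_eq_is_mor[OF tensor(1)] mor_eq_is_mor[OF tensor(2)]
  have n: "strand_count f = length (filter is_black Y)" "strand_count f' = length (filter is_black Y)"
    using strand_count_arrow ty by metis+
  let ?n = "length (filter is_black Y)"
  have gen: "generic (take ?n y)" "generic (drop ?n y)" using tensor.prems(1) generic_append[of "take ?n y" "drop ?n y"] by simp_all
  show ?case using tensor.IH(1)[OF gen(1)] tensor.IH(2)[OF gen(2)] tensor.prems(2) by (simp add: n)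
next
  case (linear_monoidal f g c X Y)
  then show ?case using rep_linear_monoidal by blast
next
  case (klrw f g c X Y)
  then show ?case using rep_klrw[OF iq] by blast
next
  case (mirror f g X Y)
  then show ?case using rep_mirror[OF iq] by blast
qed auto

section \<open>Signed permutations and the leading term of a diagram\<close>

text \<open>Generator 0 is the mirror and generator c exchanges places c and c + 1 counted from 1,
  while crossings count places from 0: hence the shift.\<close>

fun gen_piece :: "nat \<Rightarrow> piece" where
  "gen_piece 0 = Mirror"
| "gen_piece (Suc c) = Crossing c"

text \<open>One operation for three kinds of lists: \<open>\<nu>\<close> is negation for strands and
  for points, and \<open>\<tau>\<close> for labels.\<close>

fun gen_act :: "('x \<Rightarrow> 'x) \<Rightarrow> nat \<Rightarrow> 'x list \<Rightarrow> 'x list" where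
  "gen_act \<nu> 0 xs = \<nu> (hd xs) # tl xs"
| "gen_act \<nu> (Suc c) xs = swap_at c xs"

text \<open>The inverse appears because the entry at a position names the strand that ends
  there.\<close>

definition one_line :: "nat \<Rightarrow> (int \<Rightarrow> int) \<Rightarrow> int list" where
  "one_line n w = map (\<lambda>b. inv_into UNIV w (int b)) [1..<Suc n]"

definition signed_entry :: "('x \<Rightarrow> 'x) \<Rightarrow> 'x list \<Rightarrow> int \<Rightarrow> 'x" where
  "signed_entry \<nu> xs b = (if b > 0 then xs ! (nat b - 1) else \<nu> (xs ! (nat (- b) - 1)))"

text \<open>The substitution by which a diagram of \<open>w\<close> acts: entry a of the result is
  the coordinate at the upper end of strand a, with a sign if that end is negative. It reverses the
  order of products (\<open>pull_snoc\<close>).\<close>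

definition pull :: "(int \<Rightarrow> int) \<Rightarrow> 'k :: field list \<Rightarrow> 'k list" where
  "pull w y = map (\<lambda>a. signed_entry uminus y (w (int a))) [1..<Suc (length y)]"

lemma nth_map_upt_1: "1 \<le> b \<Longrightarrow> b \<le> n \<Longrightarrow> map f [1..<Suc n] ! (b - 1) = f b"
  by (simp del: upt_Suc add: nth_upt)

lemma gens_perm_Nil: "gens_perm [] = id"
  unfolding gens_perm_def by simp

lemma gens_perm_snoc: "gens_perm (cs @ [c]) = signed_gen c \<circ> gens_perm cs"
  unfolding gens_perm_def by simp

lemma signed_gen_0: "signed_gen 0 b = (if b = 1 then - 1 else if b = - 1 then 1 else b)"
  by (simp add: signed_gen_def transpose_def)

lemma signed_gen_Suc: "signed_gen (Suc c) b =
    (if b = int c + 1 then int c + 2 else if b = int c + 2 then int c + 1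
     else if b = - int c - 1 then - int c - 2 else if b = - int c - 2 then - int c - 1 else b)"
  by (auto simp: signed_gen_def transpose_def)

lemma signed_gen_invol: "signed_gen c (signed_gen c b) = b"
  by (cases c) (auto simp: signed_gen_0 signed_gen_Suc)

lemma signed_gen_neg: "signed_gen c (- b) = - signed_gen c b"
  by (cases c) (auto simp: signed_gen_0 signed_gen_Suc)

lemma signed_gen_range: "c < n \<Longrightarrow> b \<in> {- int n..int n} - {0} \<Longrightarrow> signed_gen c b \<in> {- int n..int n} - {0}"
  by (cases c) (auto simp: signed_gen_0 signed_gen_Suc)

lemma signed_gen_outside: "c < n \<Longrightarrow> b \<notin> {- int n..int n} - {0} \<Longrightarrow> signed_gen c b = b"
  by (cases c) (auto simp: signed_gen_0 signed_gen_Suc)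

lemma signed_gen_perm: "c < n \<Longrightarrow> signed_gen c \<in> signed_perms n"
proof -
  assume c: "c < n"
  have "bij (signed_gen c)" by (rule involuntory_imp_bij) (rule signed_gen_invol)
  then have "signed_gen c permutes ({- int n..int n} - {0})"
    using signed_gen_outside[OF c] unfolding permutes_def bij_iff by blast
  then show ?thesis by (simp add: signed_perms_def signed_gen_neg)
qed

lemma gens_perm_perm: "set cs \<subseteq> {..<n} \<Longrightarrow> gens_perm cs \<in> signed_perms n"
proof (induction cs rule: rev_induct)
  case Nil
  show ?case unfolding gens_perm_Nil signed_perms_def by (rule CollectI, rule conjI, rule permutes_id) simp
next
  case (snoc c cs)
  have "signed_gen c \<circ> gens_perm cs permutes ({- int n..int n} - {0})"
    using snoc signed_gen_perm[of c n] by (intro permutes_compose) (auto simp: signed_perms_def)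
  moreover have "\<forall>a. (signed_gen c \<circ> gens_perm cs) (- a) = - (signed_gen c \<circ> gens_perm cs) a"
    using snoc signed_gen_neg by (auto simp: signed_perms_def)
  ultimately show ?case unfolding gens_perm_snoc signed_perms_def by blast
qed

lemma signed_perm_range:
  "w \<in> signed_perms n \<Longrightarrow> b \<in> {- int n..int n} - {0} \<Longrightarrow> w b \<in> {- int n..int n} - {0}"
  using permutes_in_image[of w "{- int n..int n} - {0}" b] by (simp add: signed_perms_def)

lemma signed_perm_inv: "w \<in> signed_perms n \<Longrightarrow> inv_into UNIV w \<in> signed_perms n"
proof -
  assume "w \<in> signed_perms n"
  then have p: "w permutes ({- int n..int n} - {0})" and odd: "\<And>a. w (- a) = - w a" by (auto simp: signed_perms_def)
  have "inv_into UNIV w (- a) = - inv_into UNIV w a" for a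
    using odd[of "inv_into UNIV w a"] permutes_inverses[OF p] by metis
  then show ?thesis using permutes_inv[OF p] by (simp add: signed_perms_def)
qed

lemma signed_perms_eqI:
  assumes "w \<in> signed_perms n" "w' \<in> signed_perms n" "\<And>a. 1 \<le> a \<Longrightarrow> a \<le> n \<Longrightarrow> w (int a) = w' (int a)"
  shows "w = w'"
proof
  fix b
  have odd: "w (- a) = - w a" "w' (- a) = - w' a" for a using assms by (auto simp: signed_perms_def)
  have p: "w permutes ({- int n..int n} - {0})" "w' permutes ({- int n..int n} - {0})"
    using assms by (auto simp: signed_perms_def)
  consider "b \<notin> {- int n..int n} - {0}" | "1 \<le> b" "b \<le> int n" | "1 \<le> - b" "- b \<le> int n" by fastforce
  then show "w b = w' b"
  proof cases
    case 1
    then show ?thesis using permutes_not_in[OF p(1)] permutes_not_in[OF p(2)] by metis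
  next
    case 2
    then show ?thesis using assms(3)[of "nat b"] by simp
  next
    case 3
    then show ?thesis using assms(3)[of "nat (- b)"] odd[of "- b"] by simp
  qed
qed

lemma one_line_inj:
  assumes "w \<in> signed_perms n" "w' \<in> signed_perms n" "one_line n w = one_line n w'"
  shows "w = w'"
proof -
  have "inv_into UNIV w (int a) = inv_into UNIV w' (int a)" if "1 \<le> a" "a \<le> n" for a
    using arg_cong[OF assms(3), of "\<lambda>xs. xs ! (a - 1)"] unfolding one_line_def nth_map_upt_1[OF that] .
  then have "inv_into UNIV w = inv_into UNIV w'"
    by (rule signed_perms_eqI[OF signed_perm_inv[OF assms(1)] signed_perm_inv[OF assms(2)]])
  moreover have "bij w" "bij w'" using assms permutes_bij by (auto simp: signed_perms_def)
  ultimately show ?thesis by (metis inv_inv_eq)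
qed

lemma in_range_gen_piece: "c < n \<Longrightarrow> in_range n (gen_piece c)"
  by (cases c) auto

lemma nth_swap_at:
  "p + 1 < length xs \<Longrightarrow> i < length xs \<Longrightarrow> swap_at p xs ! i = (if i = p then xs ! (p + 1) else if i = p + 1 then xs ! p else xs ! i)"
  by (auto simp: swap_at_def nth_list_update)

lemma piece_act_gen_piece: "piece_act xs (gen_piece c) = gen_act uminus c xs"
  by (cases c) auto

lemma nth_gen_act:
  assumes "c < length xs" "1 \<le> b" "b \<le> length xs"
  shows "gen_act \<nu> c xs ! (b - 1) = signed_entry \<nu> xs (signed_gen c (int b))"
proof (cases c)
  case 0
  then obtain x ys where "xs = x # ys" using assms by (cases xs) auto
  then show ?thesis using 0 assms by (auto simp: signed_entry_def signed_gen_0 nth_Cons')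
next
  case (Suc c')
  then show ?thesis using assms
    by (auto simp: signed_entry_def signed_gen_Suc nth_swap_at nat_add_distrib nat_diff_distrib)
qed

text \<open>A new generator acts on positions, that is, on the argument of the inverse permutation.
  This links words of pieces with signed permutations.\<close>

lemma state_one_line:
  "set cs \<subseteq> {..<n} \<Longrightarrow> state n (map gen_piece cs) = one_line n (gens_perm cs)"
proof (induction cs rule: rev_induct)
  case Nil
  show ?case unfolding gens_perm_Nil by (simp add: one_line_def ident_list_def del: upt_Suc)
next
  case (snoc c cs)
  let ?w = "gens_perm cs"
  have w: "?w \<in> signed_perms n" and c: "c < n" using snoc.prems by (auto intro: gens_perm_perm)
  have iw: "inv_into UNIV ?w \<in> signed_perms n" by (rule signed_perm_inv[OF w])
  have "bij ?w" "bij (signed_gen c)"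
    using w signed_gen_perm[OF c] permutes_bij by (auto simp: signed_perms_def)
  then have inv: "inv_into UNIV (signed_gen c \<circ> ?w) = inv_into UNIV ?w \<circ> signed_gen c"
    using o_inv_distrib[of "signed_gen c" ?w] inv_unique_comp[of "signed_gen c" "signed_gen c"]
    by (simp add: signed_gen_invol fun_eq_iff)
  have len: "length (one_line n ?w) = n" by (simp add: one_line_def)
  have "gen_act uminus c (one_line n ?w) = one_line n (signed_gen c \<circ> ?w)"
  proof (rule nth_equalityI)
    have "length (gen_act uminus c xs) = length xs" if "c < length xs" for xs :: "int list"
      using that by (cases c) auto
    then show l: "length (gen_act uminus c (one_line n ?w)) = length (one_line n (signed_gen c \<circ> ?w))"
      using c len by (simp add: one_line_def)
    fix i assume "i < length (gen_act uminus c (one_line n ?w))"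
    then have i: "i < n" using l by (simp add: one_line_def del: upt_Suc)
    have e: "one_line n v ! (b - 1) = inv_into UNIV v (int b)" if "1 \<le> b" "b \<le> n" for v b
      unfolding one_line_def nth_map_upt_1[OF that] ..
    have "gen_act uminus c (one_line n ?w) ! i = signed_entry uminus (one_line n ?w) (signed_gen c (int (Suc i)))"
      using nth_gen_act[of c "one_line n ?w" "Suc i" uminus] c i len by simp
    also have "\<dots> = inv_into UNIV ?w (signed_gen c (int (Suc i)))"
    proof -
      let ?b = "signed_gen c (int (Suc i))"
      have b: "?b \<in> {- int n..int n} - {0}" by (rule signed_gen_range[OF c]) (use i in simp)
      have odd: "inv_into UNIV ?w (- a) = - inv_into UNIV ?w a" for a using iw by (simp add: signed_perms_def)
      show ?thesis
      proof (cases "?b > 0")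
        case True
        then show ?thesis using e[of "nat ?b" ?w] b by (simp add: signed_entry_def)
      next
        case False
        then show ?thesis using e[of "nat (- ?b)" ?w] b odd[of "?b"] by (auto simp: signed_entry_def)
      qed
    qed
    also have "\<dots> = one_line n (signed_gen c \<circ> ?w) ! i" using e[of "Suc i" "signed_gen c \<circ> ?w"] i inv by simp
    finally show "gen_act uminus c (one_line n ?w) ! i = one_line n (signed_gen c \<circ> ?w) ! i" .
  qed
  moreover have "state n (map gen_piece (cs @ [c])) = gen_act uminus c (one_line n ?w)"
    using snoc by (simp add: piece_act_gen_piece)
  ultimately show ?case by (simp only: gens_perm_snoc comp_def)
qed

lemma signed_act_one_line:
  "signed_act \<tau> w is = map (signed_entry \<tau> is) (one_line (length is) w)"
  by (simp add: signed_act_def one_line_def signed_entry_def Let_def del: upt_Suc)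

lemma map_signed_entry_gen_act:
  assumes inv: "\<And>i. i \<in> set is \<Longrightarrow> \<nu> (\<nu> i) = i" and c: "c < length xs"
    and xs: "\<And>x. x \<in> set xs \<Longrightarrow> x \<noteq> 0 \<and> \<bar>x\<bar> \<le> int (length is)"
  shows "map (signed_entry \<nu> is) (gen_act uminus c xs) = gen_act \<nu> c (map (signed_entry \<nu> is) xs)"
proof (cases c)
  case 0
  then obtain x ys where x: "xs = x # ys" using c by (cases xs) auto
  have x0: "x \<noteq> 0" "\<bar>x\<bar> \<le> int (length is)" using xs[of x] x by auto
  have "nat (- x) - 1 < length is" if "x < 0" using that x0 by linarith
  then have "signed_entry \<nu> is (- x) = \<nu> (signed_entry \<nu> is x)"
    using x0 inv by (auto simp: signed_entry_def)
  then show ?thesis using 0 x by simp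
next
  case (Suc c')
  then show ?thesis using c by (simp add: map_swap_at)
qed

lemma signed_act_snoc:
  assumes inv: "\<And>i. i \<in> set is \<Longrightarrow> \<tau> (\<tau> i) = i" and cs: "set (cs @ [c]) \<subseteq> {..<length is}"
  shows "signed_act \<tau> (gens_perm (cs @ [c])) is = gen_act \<tau> c (signed_act \<tau> (gens_perm cs) is)"
proof -
  let ?n = "length is"
  have r: "list_all (in_range ?n) (map gen_piece cs)" using cs by (auto simp: list_all_iff in_range_gen_piece)
  have sl: "signed_list ?n (state ?n (map gen_piece cs))" by (rule signed_list_state[OF r])
  have *: "one_line ?n (gens_perm (cs @ [c])) = gen_act uminus c (one_line ?n (gens_perm cs))"
    using state_one_line[OF cs] state_one_line[of cs ?n] cs by (simp add: piece_act_gen_piece)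
  show ?thesis unfolding signed_act_one_line *
  proof (rule map_signed_entry_gen_act)
    show "c < length (one_line ?n (gens_perm cs))" using cs by (simp add: one_line_def del: upt_Suc)
    fix x assume "x \<in> set (one_line ?n (gens_perm cs))"
    then have "\<bar>x\<bar> \<in> {1..int ?n}" using sl state_one_line[of cs ?n] cs by (auto simp: signed_list_def)
    then show "x \<noteq> 0 \<and> \<bar>x\<bar> \<le> int ?n" by auto
  qed (rule inv)
qed

lemma length_gen_act: "c < length xs \<Longrightarrow> length (gen_act \<nu> c xs) = length xs"
  by (cases c) auto

lemma gen_act_invol:
  assumes "c < length y"
  shows "gen_act uminus c (gen_act uminus c y) = (y :: 'k :: field list)"
proof (cases c)
  case 0
  then show ?thesis using assms by (cases y) auto
next
  case (Suc c')
  then have "c' + 1 < length y" using assms by simp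
  then obtain A u v B where "y = A @ u # v # B" "length A = c'" by (rule split_at_crossing)
  then show ?thesis using Suc by (simp add: swap_at_append')
qed

lemma gen_act_orbit: "c < length y \<Longrightarrow> gen_act uminus c y \<in> orbit y"
proof (cases c)
  case 0
  then show "c < length y \<Longrightarrow> ?thesis" by (cases y) (auto simp: orbit_def)
next
  case (Suc c')
  then show "c < length y \<Longrightarrow> ?thesis" using mset_swap_at[of c' y] by (simp add: orbit_def)
qed

lemma pull_snoc:
  assumes cs: "set (cs @ [c]) \<subseteq> {..<length y}"
  shows "pull (gens_perm (cs @ [c])) y = pull (gens_perm cs) (gen_act uminus c y)"
proof -
  let ?n = "length y" and ?y = "gen_act uminus c y"
  have c: "c < ?n" using cs by simp
  have w: "gens_perm cs \<in> signed_perms ?n" using cs by (auto intro: gens_perm_perm)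
  have "signed_entry uminus y (signed_gen c b) = signed_entry uminus ?y b" if b: "b \<in> {- int ?n..int ?n} - {0}" for b
  proof (cases "b > 0")
    case True
    then show ?thesis using nth_gen_act[OF c, of "nat b" uminus] b by (simp add: signed_entry_def[of uminus ?y])
  next
    case False
    have neg: "signed_entry uminus y (- d) = - signed_entry uminus y d" if "d \<noteq> 0" for d
      using that by (auto simp: signed_entry_def)
    have "signed_gen c (- b) \<noteq> 0" using signed_gen_range[OF c, of "- b"] b by auto
    then have "signed_entry uminus y (signed_gen c b) = - signed_entry uminus y (signed_gen c (- b))"
      using neg[of "signed_gen c (- b)"] by (simp add: signed_gen_neg)
    also have "\<dots> = - (?y ! (nat (- b) - 1))"
    proof -
      have nb: "1 \<le> nat (- b)" "nat (- b) \<le> length y" "int (nat (- b)) = - b" using b False by auto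
      show ?thesis using nth_gen_act[OF c nb(1,2), of uminus] unfolding nb(3) by simp
    qed
    finally show ?thesis using False by (simp add: signed_entry_def[of uminus ?y])
  qed
  then show ?thesis using signed_perm_range[OF w] c unfolding gens_perm_snoc
    by (auto simp: pull_def length_gen_act simp del: upt_Suc)
qed

lemma pull_id: "pull id y = y"
  by (rule nth_equalityI) (simp_all add: pull_def signed_entry_def nat_add_distrib del: upt_Suc)

lemma pull_orbit: "set cs \<subseteq> {..<length y} \<Longrightarrow> pull (gens_perm cs) y \<in> orbit y"
proof (induction cs arbitrary: y rule: rev_induct)
  case Nil
  show ?case unfolding gens_perm_Nil pull_id by (rule orbit_refl)
next
  case (snoc c cs)
  then have c: "c < length y" by simp
  have "pull (gens_perm cs) (gen_act uminus c y) \<in> orbit (gen_act uminus c y)"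
    using snoc c by (intro snoc.IH) (simp add: length_gen_act)
  then show ?case using orbit_trans[OF gen_act_orbit[OF c]] pull_snoc[OF snoc.prems] by simp
qed

text \<open>Provides the point at which the leading term of a reduced word sees a prescribed
  \<open>z\<close>.\<close>

lemma pull_surj: "set cs \<subseteq> {..<length z} \<Longrightarrow> \<exists>y\<in>orbit z. pull (gens_perm cs) y = z"
proof (induction cs rule: rev_induct)
  case Nil
  show ?case unfolding gens_perm_Nil pull_id using orbit_refl by blast
next
  case (snoc c cs)
  then obtain y where y: "y \<in> orbit z" "pull (gens_perm cs) y = z" by auto
  have len: "length y = length z" by (rule orbit_length[OF y(1)])
  have c: "c < length y" using snoc.prems len by simp
  have "set (cs @ [c]) \<subseteq> {..<length (gen_act uminus c y)}" using snoc.prems len c by (simp add: length_gen_act)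
  then have "pull (gens_perm (cs @ [c])) (gen_act uminus c y) = z"
    using pull_snoc[of cs c "gen_act uminus c y"] gen_act_invol[OF c] y by simp
  then show ?case using orbit_trans[OF y(1) gen_act_orbit[OF c]] by blast
qed

text \<open>Distinct squares show that \<open>w a\<close> and \<open>w' a\<close> agree up to sign.
  In characteristic 2 the point does not show the sign, but the labels do: opposite signs would put
  a label and its image under \<open>\<tau>\<close> at the same place.\<close>

lemma pull_inj:
  assumes w: "w \<in> signed_perms (length is)" "w' \<in> signed_perms (length is)"
    and act: "signed_act \<tau> w is = signed_act \<tau> w' is" and nofix: "\<And>i. i \<in> set is \<Longrightarrow> \<tau> i \<noteq> i"
    and y: "generic y" "length y = length is" and eq: "pull w y = pull w' y"
  shows "w = w'"
proof (rule signed_perms_eqI[OF w])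
  fix a assume a: "1 \<le> a" "a \<le> length is"
  let ?n = "length is"
  have r: "w (int a) \<in> {- int ?n..int ?n} - {0}" "w' (int a) \<in> {- int ?n..int ?n} - {0}"
    using signed_perm_range w a by auto
  have "signed_entry uminus y (w (int a)) = signed_entry uminus y (w' (int a))"
    using arg_cong[OF eq, of "\<lambda>xs. xs ! (a - 1)"] unfolding pull_def y(2) nth_map_upt_1[OF a] .
  moreover have "(signed_entry uminus y b)\<^sup>2 = map (\<lambda>u. u\<^sup>2) y ! (nat \<bar>b\<bar> - 1)" if "b \<in> {- int ?n..int ?n} - {0}" for b
  proof -
    have "nat \<bar>b\<bar> - 1 < length y" using that y(2) by auto
    then show ?thesis by (auto simp: signed_entry_def)
  qed
  ultimately have "map (\<lambda>u. u\<^sup>2) y ! (nat \<bar>w (int a)\<bar> - 1) = map (\<lambda>u. u\<^sup>2) y ! (nat \<bar>w' (int a)\<bar> - 1)"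
    using r by metis
  moreover have "nat \<bar>w (int a)\<bar> - 1 < length (map (\<lambda>u. u\<^sup>2) y)" "nat \<bar>w' (int a)\<bar> - 1 < length (map (\<lambda>u. u\<^sup>2) y)"
    using r y(2) by auto
  ultimately have "nat \<bar>w (int a)\<bar> - 1 = nat \<bar>w' (int a)\<bar> - 1"
    using y(1) unfolding generic_def by (metis nth_eq_iff_index_eq)
  then have abs: "\<bar>w (int a)\<bar> = \<bar>w' (int a)\<bar>" using r by auto
  have nf: "\<tau> (is ! (a - 1)) \<noteq> is ! (a - 1)" using nofix a by simp
  consider "w (int a) = w' (int a)" | "w (int a) > 0" "w' (int a) = - w (int a)" | "w (int a) < 0" "w' (int a) = - w (int a)"
    using abs r by fastforce
  then show "w (int a) = w' (int a)"
  proof cases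
    case 2
    then show ?thesis using signed_act_nth(1)[OF w(1) a, of \<tau>] signed_act_nth(2)[OF w(2) a, of \<tau>] act nf by simp
  next
    case 3
    then show ?thesis using signed_act_nth(2)[OF w(1) a, of \<tau>] signed_act_nth(1)[OF w(2) a, of \<tau>] act nf by simp
  qed
qed

subsection \<open>The black strands of a diagram\<close>

fun letter_vertex :: "'v letter \<Rightarrow> 'v" where
  "letter_vertex (Black i) = i"
| "letter_vertex (Red \<theta>) = undefined"

definition black_word :: "'v wrd \<Rightarrow> 'v list" where
  "black_word X = map letter_vertex (filter is_black X)"

lemma length_black_word: "length (black_word X) = length (filter is_black X)"
  by (simp add: black_word_def)

lemma black_word_append: "black_word (X @ Y) = black_word X @ black_word Y"
  by (simp add: black_word_def)

lemma black_word_Cons: "black_word (a # Y) = (if is_black a then letter_vertex a # black_word Y else black_word Y)"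
  by (simp add: black_word_def)

lemma black_expression_snoc:
  "is_diagram \<tau> X Z ds \<Longrightarrow> black_expression \<tau> X (ds @ [d]) = black_expression \<tau> X ds @ black_gens Z d"
  by (induction ds arbitrary: X) auto

lemma black_word_piece_target:
  assumes "piece_ok Z d"
  shows "(black_gens Z d = [] \<and> black_word (piece_target \<tau> Z d) = black_word Z) \<or>
    (\<exists>c < length (black_word Z). black_gens Z d = [c] \<and> black_word (piece_target \<tau> Z d) = gen_act \<tau> c (black_word Z))"
proof (cases d)
  case (Crossing p)
  then have "p + 1 < length Z" using assms by simp
  then obtain A a b B where Z: "Z = A @ a # b # B" "length A = p" by (rule split_at_crossing)
  have bl: "is_black a \<or> is_black b" using assms Crossing Z by (auto simp: nth_append)
  have sw: "swap_at (length (filter is_black A)) (black_word A @ u # v # W) = black_word A @ v # u # W" for u v W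
    by (simp add: swap_at_append' length_black_word)
  show ?thesis
  proof (cases "is_black a \<and> is_black b")
    case True
    then show ?thesis using Crossing Z
      by (intro disjI2 exI[of _ "Suc (length (filter is_black A))"])
        (auto simp: nth_append swap_at_append' black_word_append black_word_Cons length_black_word sw)
  next
    case False
    then show ?thesis using Crossing Z bl
      by (auto simp: nth_append swap_at_append' black_word_append black_word_Cons)
  qed
next
  case Mirror
  then obtain a B where "Z = a # B" "is_black a" using assms by (cases Z) auto
  then show ?thesis using Mirror by (cases a) (auto simp: black_word_Cons)
qed

lemma in_set_black_word: "i \<in> set (black_word X) \<longleftrightarrow> Black i \<in> set X"
proof
  assume "i \<in> set (black_word X)"
  then obtain a where a: "a \<in> set X" "is_black a" "i = letter_vertex a" by (auto simp: black_word_def)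
  have "Black i = a" using a(2,3) by (cases a) auto
  then show "Black i \<in> set X" using a(1) by simp
qed (force simp: black_word_def)

lemma involutive_black_word: "involutive_on \<tau> X \<Longrightarrow> i \<in> set (black_word X) \<Longrightarrow> \<tau> (\<tau> i) = i"
  by (simp add: in_set_black_word involutive_on_def)

lemma black_word_diagram:
  assumes inv: "involutive_on \<tau> X"
  shows "is_diagram \<tau> X Y ds \<Longrightarrow> set (black_expression \<tau> X ds) \<subseteq> {..<length (black_word X)} \<and>
    black_word Y = signed_act \<tau> (gens_perm (black_expression \<tau> X ds)) (black_word X)"
proof (induction ds arbitrary: Y rule: rev_induct)
  case Nil
  have "signed_act \<tau> id xs = xs" for xs
    by (rule nth_equalityI) (auto simp: signed_act_def Let_def nat_add_distrib simp del: upt_Suc)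
  then have "black_word Y = signed_act \<tau> id (black_word X)" using Nil by simp
  then show ?case by (simp add: gens_perm_Nil id_def)
next
  case (snoc d ds)
  then obtain Z where Z: "is_diagram \<tau> X Z ds" "piece_ok Z d" "Y = piece_target \<tau> Z d" by (auto simp: is_diagram_snoc)
  let ?cs = "black_expression \<tau> X ds"
  have IH: "set ?cs \<subseteq> {..<length (black_word X)}" "black_word Z = signed_act \<tau> (gens_perm ?cs) (black_word X)"
    using snoc.IH[OF Z(1)] by auto
  note inv' = involutive_black_word[OF inv]
  have len: "length (black_word Z) = length (black_word X)" using IH(2) by (simp add: signed_act_def del: upt_Suc)
  from black_word_piece_target[OF Z(2), of \<tau>] show ?case
  proof (elim disjE exE conjE)
    assume "black_gens Z d = []" "black_word (piece_target \<tau> Z d) = black_word Z"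
    then show ?thesis using IH Z(3) black_expression_snoc[OF Z(1), of d] by simp
  next
    fix c assume c: "c < length (black_word Z)" "black_gens Z d = [c]" "black_word (piece_target \<tau> Z d) = gen_act \<tau> c (black_word Z)"
    have cs: "set (?cs @ [c]) \<subseteq> {..<length (black_word X)}" using IH(1) c(1) len by simp
    show ?thesis using signed_act_snoc[OF inv' cs] cs IH(2) c Z(3) black_expression_snoc[OF Z(1), of d] by simp
  qed
qed

lemma sum_list_map_zero: "(\<And>x. x \<in> set xs \<Longrightarrow> f x = (0 :: 'k :: field)) \<Longrightarrow> (\<Sum>x\<leftarrow>xs. f x) = 0"
  by (induction xs) auto

lemma generic_adjacent:
  assumes "generic (y @ u # v # y')"
  shows "u - v \<noteq> 0" "u \<noteq> 0" "v \<noteq> 0"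
  using assms by (auto simp: generic_def)

section \<open>Leading terms and independence of reduced diagrams\<close>

context oklrw
begin

lemma rep_ctx:
  "rep Q \<tau> \<mu> (ctx A f B) G y = rep Q \<tau> \<mu> f
     (\<lambda>a. G (take (length (filter is_black A)) y @ a @ drop (strand_count f) (drop (length (filter is_black A)) y)))
     (take (strand_count f) (drop (length (filter is_black A)) y))"
  by (simp add: ctx_def)

definition moved_point :: "nat list \<Rightarrow> 'k list \<Rightarrow> 'k list" where
  "moved_point gs y = (case gs of [] \<Rightarrow> y | g # _ \<Rightarrow> gen_act uminus g y)"

text \<open>The factor \<open>c\<close> is a power of a coordinate, \<open>X_poly\<close>, 1 or the
  coefficient of a divided difference, all nonzero at generic points. The term with
  \<open>c'\<close> occurs only at equal black labels, where omitting the piece does not change the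
  word at the top.\<close>

lemma rep_piece:
  fixes y :: "'k list"
  assumes ok: "piece_ok Z d" and y: "generic y" "length y = length (filter is_black Z)"
  shows "\<exists>c c'. c \<noteq> 0 \<and> (\<forall>G. rep Q \<tau> \<mu> (piece_mor Z d) G y = c * G (moved_point (black_gens Z d) y) + c' * G y) \<and>
    (c' = 0 \<or> black_gens Z d \<noteq> [] \<and> piece_target \<tau> Z d = Z)"
proof (cases d)
  case (Crossing p)
  then obtain A a b B where Z: "Z = A @ a # b # B" "length A = p" and bl: "is_black a \<or> is_black b"
    using ok crossing_okE by metis
  let ?n = "length (filter is_black A)"
  have pm: "piece_mor Z d = (ctx A (Cross a b) B :: ('v, 'k) mor)" using Z Crossing by (simp add: piece_mor_append')
  have gens: "black_gens Z d = (if is_black a \<and> is_black b then [Suc ?n] else [])"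
    using Z Crossing by (auto simp: nth_append)
  have tgt: "piece_target \<tau> Z d = A @ b # a # B" using Z Crossing by (simp add: swap_at_append')
  show ?thesis
  proof (cases "is_black a \<and> is_black b")
    case True
    then obtain i j where ab: "a = Black i" "b = Black j" by (cases a; cases b) auto
    have "?n + 1 < length y" using y(2) Z ab by simp
    then obtain y1 u v y2 where yy: "y = y1 @ u # v # y2" "length y1 = ?n" by (rule split_at_crossing)
    note ne = generic_adjacent[OF y(1)[unfolded yy(1)]]
    have mp: "moved_point (black_gens Z d) y = y1 @ v # u # y2"
      unfolding gens moved_point_def using True yy by (simp add: swap_at_append')
    show ?thesis
    proof (cases "i = j")
      case True
      show ?thesis unfolding mp
      proof (rule exI[of _ "- 1 / (u - v)"], rule exI[of _ "1 / (u - v)"], intro conjI allI)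
        show "rep Q \<tau> \<mu> (piece_mor Z d) G y = - 1 / (u - v) * G (y1 @ v # u # y2) + 1 / (u - v) * G y" for G
          unfolding pm rep_ctx using ab yy True by (simp add: diff_divide_distrib)
        show "1 / (u - v) = 0 \<or> black_gens Z d \<noteq> [] \<and> piece_target \<tau> Z d = Z"
          using gens ab tgt Z True by simp
      qed (use ne in simp)
    next
      case False
      show ?thesis unfolding mp
      proof (rule exI[of _ "X_poly Q j i u v"], rule exI[of _ 0], intro conjI allI)
        show "rep Q \<tau> \<mu> (piece_mor Z d) G y = X_poly Q j i u v * G (y1 @ v # u # y2) + 0 * G y" for G
          unfolding pm rep_ctx using ab yy False by simp
      qed (use ne in \<open>simp_all add: X_poly_def\<close>)
    qed
  next
    case False
    have mp: "moved_point (black_gens Z d) y = y" unfolding gens moved_point_def using False by auto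
    from False bl consider (l) \<theta> i where "a = Red \<theta>" "b = Black i" | (r) \<theta> i where "a = Black i" "b = Red \<theta>"
      by (cases a; cases b) auto
    then show ?thesis
    proof cases
      case l
      then have "?n < length y" using y(2) Z by simp
      then obtain y1 u y2 where yy: "y = y1 @ u # y2" "length y1 = ?n" by (rule split_at)
      have u: "u \<noteq> 0" using y(1) yy by (auto simp: generic_def)
      show ?thesis unfolding mp
      proof (rule exI[of _ "u ^ \<theta> i"], rule exI[of _ 0], intro conjI allI)
        show "rep Q \<tau> \<mu> (piece_mor Z d) G y = u ^ \<theta> i * G y + 0 * G y" for G
          unfolding pm rep_ctx using l yy by simp
      qed (use u in simp_all)
    next
      case r
      then have "?n < length y" using y(2) Z by simp
      then obtain y1 u y2 where yy: "y = y1 @ u # y2" "length y1 = ?n" by (rule split_at)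
      show ?thesis unfolding mp
      proof (rule exI[of _ 1], rule exI[of _ 0], intro conjI allI)
        show "rep Q \<tau> \<mu> (piece_mor Z d) G y = 1 * G y + 0 * G y" for G
          unfolding pm rep_ctx using r yy by simp
      qed simp_all
    qed
  qed
next
  case Mirror
  then obtain i B where Z: "Z = Black i # B" using ok mirror_okE by metis
  then obtain u y2 where yy: "y = u # y2" using y(2) by (cases y) auto
  have u: "u \<noteq> 0" using y(1) yy by (auto simp: generic_def)
  have mp: "moved_point (black_gens Z d) y = (- u) # y2" unfolding moved_point_def using Mirror yy by simp
  show ?thesis unfolding mp
  proof (rule exI[of _ "u ^ \<mu> (\<tau> i)"], rule exI[of _ 0], intro conjI allI)
    show "rep Q \<tau> \<mu> (piece_mor Z d) G y = u ^ \<mu> (\<tau> i) * G (- u # y2) + 0 * G y" for G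
      using Z Mirror yy by (simp add: piece_mor.simps)
  qed (use u in simp_all)
qed

text \<open>The remaining terms come from the identity part of divided differences; they belong to
  shorter words with the same labels at the top.\<close>

lemma rep_diagram_leading:
  fixes y :: "'k list"
  assumes X: "X \<in> objects Q"
  shows "is_diagram \<tau> X Y ds \<Longrightarrow> generic y \<Longrightarrow> length y = length (black_word X) \<Longrightarrow>
    \<exists>c L. c \<noteq> 0 \<and> (\<forall>F. rep Q \<tau> \<mu> (diagram_mor \<tau> X ds) F y =
        c * F (pull (gens_perm (black_expression \<tau> X ds)) y) + (\<Sum>(d, cs)\<leftarrow>L. d * F (pull (gens_perm cs) y))) \<and>
      (\<forall>(d, cs)\<in>set L. length cs < length (black_expression \<tau> X ds) \<and> set cs \<subseteq> {..<length (black_word X)} \<and>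
         signed_act \<tau> (gens_perm cs) (black_word X) = black_word Y)"
proof (induction ds arbitrary: Y y rule: rev_induct)
  case Nil
  show ?case
  proof (rule exI[of _ 1], rule exI[of _ "[]"], intro conjI allI)
    show "rep Q \<tau> \<mu> (diagram_mor \<tau> X []) F y = 1 * F (pull (gens_perm (black_expression \<tau> X [])) y) +
        (\<Sum>(d, cs)\<leftarrow>[]. d * F (pull (gens_perm cs) y))" for F
      unfolding black_expression.simps gens_perm_Nil pull_id by simp
  qed simp_all
next
  case (snoc d ds)
  note inv = involutive_on_objects[OF X]
  obtain Z where Z: "is_diagram \<tau> X Z ds" "piece_ok Z d" "Y = piece_target \<tau> Z d"
    using snoc.prems by (auto simp: is_diagram_snoc)
  let ?be = "black_expression \<tau> X ds" and ?n = "length (black_word X)"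
  note bw = black_word_diagram[OF inv Z(1)]
  have lenZ: "length (black_word Z) = ?n" using bw by (simp add: signed_act_def del: upt_Suc)
  note bY = black_word_diagram[OF inv snoc.prems(1)]
  have lenY: "length (black_word Y) = ?n" using bY by (simp add: signed_act_def del: upt_Suc)
  have be: "black_expression \<tau> X (ds @ [d]) = ?be @ black_gens Z d" by (rule black_expression_snoc[OF Z(1)])
  note inv' = involutive_black_word[OF inv]
  have step: "rep Q \<tau> \<mu> (diagram_mor \<tau> X (ds @ [d])) F y = rep Q \<tau> \<mu> (piece_mor Z d) (rep Q \<tau> \<mu> (diagram_mor \<tau> X ds) F) y" for F
    using rep_eqv[OF involutive_quiver_axioms diagram_snoc[OF Z(1,2) X] snoc.prems(2)] snoc.prems(3) lenY Z(3)
    by (simp add: length_black_word)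
  obtain c c' where c: "c \<noteq> 0"
    "\<And>G. rep Q \<tau> \<mu> (piece_mor Z d) G y = c * G (moved_point (black_gens Z d) y) + c' * G y"
    "c' = 0 \<or> black_gens Z d \<noteq> [] \<and> piece_target \<tau> Z d = Z"
    using rep_piece[OF Z(2) snoc.prems(2)] snoc.prems(3) lenZ by (auto simp: length_black_word)
  obtain c2 L2 where L2: "c2 \<noteq> 0" "\<And>F. rep Q \<tau> \<mu> (diagram_mor \<tau> X ds) F y =
        c2 * F (pull (gens_perm ?be) y) + (\<Sum>(d, cs)\<leftarrow>L2. d * F (pull (gens_perm cs) y))"
      "\<And>d cs. (d, cs) \<in> set L2 \<Longrightarrow> length cs < length ?be \<and> set cs \<subseteq> {..<?n} \<and>
         signed_act \<tau> (gens_perm cs) (black_word X) = black_word Z"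
    using snoc.IH[OF Z(1) snoc.prems(2,3)] by blast
  have scaleL: "a * (\<Sum>(d, cs)\<leftarrow>L. d * H cs) = (\<Sum>(d, cs)\<leftarrow>map (\<lambda>(d, cs). (a * d, cs)) L. d * H cs)"
    for a :: 'k and L and H :: "nat list \<Rightarrow> 'k" by (induction L) (auto simp: algebra_simps)
  show ?case
  proof (cases "black_gens Z d = []")
    case True
    have "c' = 0" using c(3) True by simp
    then have e: "rep Q \<tau> \<mu> (diagram_mor \<tau> X (ds @ [d])) F y = (c * c2) * F (pull (gens_perm ?be) y) +
        (\<Sum>(d, cs)\<leftarrow>map (\<lambda>(d, cs). (c * d, cs)) L2. d * F (pull (gens_perm cs) y))" for F
      unfolding step c(2) L2(2) scaleL[symmetric] by (simp add: True moved_point_def L2(2) algebra_simps)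
    have "black_word Y = black_word Z" using black_word_piece_target[OF Z(2), of \<tau>] True Z(3) by auto
    then show ?thesis unfolding be True append_Nil2 using e c(1) L2(1,3)
      by - (rule exI[of _ "c * c2"], rule exI[of _ "map (\<lambda>(d, cs). (c * d, cs)) L2"], auto)
  next
    case False
    then obtain g where g: "g < length (black_word Z)" "black_gens Z d = [g]" "black_word Y = gen_act \<tau> g (black_word Z)"
      using black_word_piece_target[OF Z(2), of \<tau>] Z(3) by auto
    have gn: "g < length y" using g(1) lenZ snoc.prems(3) by simp
    let ?y = "gen_act uminus g y"
    have y': "generic ?y" "length ?y = ?n"
      using generic_orbit[OF snoc.prems(2) gen_act_orbit[OF gn]] length_gen_act[OF gn] snoc.prems(3) by auto
    obtain c1 L1 where L1: "c1 \<noteq> 0" "\<And>F. rep Q \<tau> \<mu> (diagram_mor \<tau> X ds) F ?y =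
          c1 * F (pull (gens_perm ?be) ?y) + (\<Sum>(d, cs)\<leftarrow>L1. d * F (pull (gens_perm cs) ?y))"
        "\<And>d cs. (d, cs) \<in> set L1 \<Longrightarrow> length cs < length ?be \<and> set cs \<subseteq> {..<?n} \<and>
           signed_act \<tau> (gens_perm cs) (black_word X) = black_word Z"
      using snoc.IH[OF Z(1) y'] by blast
    have pl: "pull (gens_perm cs) ?y = pull (gens_perm (cs @ [g])) y" if "set cs \<subseteq> {..<?n}" for cs
      using pull_snoc[of cs g y] that gn snoc.prems(3) by simp
    \<comment> \<open>The substitution part of the piece appends \<open>g\<close> to every word. Its
      identity part keeps the words of \<open>ds\<close>, so even the leading word of
      \<open>ds\<close> becomes one of the shorter words.\<close>
    let ?L1 = "map (\<lambda>(d, cs). (c * d, cs @ [g])) L1"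
    \<comment> \<open>For \<open>c' = 0\<close> the list must be empty: only
      \<open>c' \<noteq> 0\<close> guarantees that these words have the right labels at the
      top.\<close>
    let ?L2 = "if c' = 0 then [] else (c' * c2, ?be) # map (\<lambda>(d, cs). (c' * d, cs)) L2"
    have s1: "c * (\<Sum>(d, cs)\<leftarrow>L1. d * F (pull (gens_perm cs) ?y)) = (\<Sum>(d, cs)\<leftarrow>?L1. d * F (pull (gens_perm cs) y))" for F :: "'k list \<Rightarrow> 'k"
    proof -
      have "(\<Sum>(d, cs)\<leftarrow>L1. d * F (pull (gens_perm cs) ?y)) = (\<Sum>(d, cs)\<leftarrow>L1. d * F (pull (gens_perm (cs @ [g])) y))"
        using L1(3) pl by (intro arg_cong[of _ _ sum_list] map_cong) auto
      moreover have "c * (\<Sum>(d, cs)\<leftarrow>L. d * F (pull (gens_perm (cs @ [g])) y)) =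
          (\<Sum>(d, cs)\<leftarrow>map (\<lambda>(d, cs). (c * d, cs @ [g])) L. d * F (pull (gens_perm cs) y))" for L
        by (induction L) (auto simp: algebra_simps)
      ultimately show ?thesis by simp
    qed
    have s2: "c' * rep Q \<tau> \<mu> (diagram_mor \<tau> X ds) F y = (\<Sum>(d, cs)\<leftarrow>?L2. d * F (pull (gens_perm cs) y))" for F
      unfolding L2(2) distrib_left scaleL by (simp add: sum_list_map_zero split_beta)
    have "rep Q \<tau> \<mu> (diagram_mor \<tau> X (ds @ [d])) F y = (c * c1) * F (pull (gens_perm (?be @ [g])) y) +
        (\<Sum>(d, cs)\<leftarrow>?L1 @ ?L2. d * F (pull (gens_perm cs) y))" for F
    proof -
      have "rep Q \<tau> \<mu> (diagram_mor \<tau> X (ds @ [d])) F y =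
          c * rep Q \<tau> \<mu> (diagram_mor \<tau> X ds) F ?y + c' * rep Q \<tau> \<mu> (diagram_mor \<tau> X ds) F y"
        unfolding step c(2) g(2) by (simp add: moved_point_def)
      also have "c * rep Q \<tau> \<mu> (diagram_mor \<tau> X ds) F ?y =
          (c * c1) * F (pull (gens_perm (?be @ [g])) y) + (\<Sum>(d, cs)\<leftarrow>?L1. d * F (pull (gens_perm cs) y))"
        unfolding L1(2) distrib_left s1 using pl[of ?be] bw by simp
      finally show ?thesis unfolding s2 by simp
    qed
    moreover have "length cs < length (?be @ [g]) \<and> set cs \<subseteq> {..<?n} \<and> signed_act \<tau> (gens_perm cs) (black_word X) = black_word Y"
      if "(d', cs) \<in> set (?L1 @ ?L2)" for d' cs
    proof -
      from that consider d1 cs1 where "(d1, cs1) \<in> set L1" "cs = cs1 @ [g]" | "(d', cs) \<in> set ?L2" by auto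
      then show ?thesis
      proof cases
        case 1
        have "set (cs1 @ [g]) \<subseteq> {..<?n}" using L1(3)[OF 1(1)] gn snoc.prems(3) by simp
        then show ?thesis using signed_act_snoc[OF inv', where cs = cs1 and c = g] L1(3)[OF 1(1)] 1(2) g(3) by simp
      next
        case 2
        then have "c' \<noteq> 0" by (auto split: if_splits)
        then have "Y = Z" using c(3) Z(3) by simp
        from 2 \<open>c' \<noteq> 0\<close> consider "cs = ?be" | d2 where "(d2, cs) \<in> set L2" by auto
        then show ?thesis
        proof cases
          case 1
          then show ?thesis using bw \<open>Y = Z\<close> by simp
        next
          case 2
          then show ?thesis using L2(3)[OF 2] \<open>Y = Z\<close> by simp
        qed
      qed
    qed
    moreover obtain L where "?L1 @ ?L2 = L" by simp
    ultimately have e: "\<And>F. rep Q \<tau> \<mu> (diagram_mor \<tau> X (ds @ [d])) F y = (c * c1) * F (pull (gens_perm (?be @ [g])) y) +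
        (\<Sum>(d, cs)\<leftarrow>L. d * F (pull (gens_perm cs) y))"
      "\<And>d' cs. (d', cs) \<in> set L \<Longrightarrow> length cs < length (?be @ [g]) \<and> set cs \<subseteq> {..<?n} \<and>
        signed_act \<tau> (gens_perm cs) (black_word X) = black_word Y"
      by (simp_all only:)
    show ?thesis unfolding be g(2)
    proof (rule exI[of _ "c * c1"], rule exI[of _ L], intro conjI allI ballI)
      show "c * c1 \<noteq> 0" using c(1) L1(1) by simp
    qed (use e in auto)
  qed
qed

text \<open>Induction on the length of the black word, longest first. The relation is tested on the
  function supported at \<open>z\<close>, at a point \<open>y\<close> with
  \<open>pull w y = z\<close>. Longer words have vanishing coefficients already. In all others no
  word but those of \<open>w\<close> can carry \<open>y\<close> to \<open>z\<close> with the given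
  labels, and a word shorter than a reduced expression of \<open>w\<close> does not represent
  \<open>w\<close>.\<close>

lemma reduced_diagrams_independent:
  fixes p :: "(int \<Rightarrow> int) \<Rightarrow> 'k list \<Rightarrow> 'k"
  assumes X: "X \<in> objects Q" and W: "finite W" "W \<subseteq> signed_perms (length (black_word X))"
    and D: "\<And>w. w \<in> W \<Longrightarrow> is_diagram \<tau> X Y (D w)"
    and red: "\<And>w. w \<in> W \<Longrightarrow> reduced_expression (length (black_word X)) (black_expression \<tau> X (D w)) w"
    and zero: "\<And>y F. generic y \<Longrightarrow> length y = length (black_word X) \<Longrightarrow>
      (\<Sum>w\<in>W. rep Q \<tau> \<mu> (diagram_mor \<tau> X (D w)) (\<lambda>z. p w z * F z) y) = 0"
  shows "w \<in> W \<Longrightarrow> generic z \<Longrightarrow> length z = length (black_word X) \<Longrightarrow> p w z = 0"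
proof (induction "Max ((\<lambda>w. length (black_expression \<tau> X (D w))) ` W) - length (black_expression \<tau> X (D w))"
    arbitrary: w z rule: less_induct)
  case less
  let ?n = "length (black_word X)" and ?be = "\<lambda>w. black_expression \<tau> X (D w)"
  note inv = involutive_on_objects[OF X]
  have gp: "gens_perm (?be w) = w" "set (?be w) \<subseteq> {..<?n}" if "w \<in> W" for w
    using red[OF that] by (auto simp: reduced_expression_def)
  have act: "signed_act \<tau> w (black_word X) = black_word Y" if "w \<in> W" for w
    using black_word_diagram[OF inv D[OF that]] gp[OF that] by simp
  have nofix: "\<tau> i \<noteq> i" if "i \<in> set (black_word X)" for i
    using that X tau_no_fixed by (auto simp: in_set_black_word letters_def)
  have larger: "p w' z' = 0" if "w' \<in> W" "length (?be w) < length (?be w')" "generic z'" "length z' = ?n" for w' z'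
  proof (rule less.hyps[OF _ that(1,3,4)])
    have "length (?be w') \<le> Max ((\<lambda>w. length (?be w)) ` W)" using that(1) W(1) by simp
    then show "Max ((\<lambda>w. length (?be w)) ` W) - length (?be w') < Max ((\<lambda>w. length (?be w)) ` W) - length (?be w)"
      using that(2) by linarith
  qed
  obtain y where y: "y \<in> orbit z" "pull w y = z" using pull_surj[of "?be w" z] gp[OF less.prems(1)] less.prems(3) by auto
  have gy: "generic y" "length y = ?n" using generic_orbit[OF less.prems(2) y(1)] orbit_length[OF y(1)] less.prems(3) by auto
  define F where "F = (\<lambda>z'. if z' = z then 1 else 0 :: 'k)"
  have low: "F (pull (gens_perm cs) y) = 0"
    if "set cs \<subseteq> {..<?n}" "signed_act \<tau> (gens_perm cs) (black_word X) = black_word Y" "gens_perm cs \<noteq> w" for cs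
  proof -
    have "pull (gens_perm cs) y \<noteq> pull w y"
      using pull_inj[OF gens_perm_perm[OF that(1)] _ _ nofix gy(1,2)] W(2) less.prems(1) that(2,3) act by auto
    then show ?thesis using y(2) by (simp add: F_def)
  qed
  have shorter: "gens_perm cs \<noteq> w" if "set cs \<subseteq> {..<?n}" "length cs < length (?be w)" for cs
    using red[OF less.prems(1)] that unfolding reduced_expression_def using leD by blast
  have summand: "\<exists>c. (w' = w \<longrightarrow> c \<noteq> 0) \<and> rep Q \<tau> \<mu> (diagram_mor \<tau> X (D w')) (\<lambda>z. p w' z * F z) y = (if w' = w then c * p w z else 0)"
    if w': "w' \<in> W" for w'
  proof -
    obtain c L where L: "c \<noteq> 0" "\<And>F. rep Q \<tau> \<mu> (diagram_mor \<tau> X (D w')) F y =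
        c * F (pull (gens_perm (?be w')) y) + (\<Sum>(d, cs)\<leftarrow>L. d * F (pull (gens_perm cs) y))"
      "\<And>d cs. (d, cs) \<in> set L \<Longrightarrow> length cs < length (?be w') \<and> set cs \<subseteq> {..<?n} \<and>
         signed_act \<tau> (gens_perm cs) (black_word X) = black_word Y"
      using rep_diagram_leading[OF X D[OF w'] gy] by blast
    have pw: "pull (gens_perm (?be w')) y = pull w' y" using gp[OF w'] by simp
    show ?thesis
    proof (cases "length (?be w) < length (?be w')")
      case True
      \<comment> \<open>All points reached by the longer diagram are generic, and there
        \<open>p w'\<close> is already known to vanish.\<close>
      have "p w' (pull (gens_perm cs) y) = 0" if "set cs \<subseteq> {..<?n}" for cs
      proof (rule larger[OF w' True])
        have o: "pull (gens_perm cs) y \<in> orbit y" using that gy(2) by (intro pull_orbit) simp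
        show "generic (pull (gens_perm cs) y)" "length (pull (gens_perm cs) y) = ?n"
          using generic_orbit[OF gy(1) o] orbit_length[OF o] gy(2) by auto
      qed
      then have "rep Q \<tau> \<mu> (diagram_mor \<tau> X (D w')) (\<lambda>z. p w' z * F z) y = 0"
        unfolding L(2) using gp(2)[OF w'] L(3) by (subst sum_list_map_zero) auto
      moreover have "w' \<noteq> w" using True by auto
      ultimately show ?thesis by simp
    next
      case False
      have "d * (p w' (pull (gens_perm cs) y) * F (pull (gens_perm cs) y)) = 0" if "(d, cs) \<in> set L" for d cs
        using L(3)[OF that] low[of cs] shorter[of cs] False by simp
      then have "(\<Sum>(d, cs)\<leftarrow>L. d * (p w' (pull (gens_perm cs) y) * F (pull (gens_perm cs) y))) = 0"
        by (intro sum_list_map_zero) auto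
      then have e: "rep Q \<tau> \<mu> (diagram_mor \<tau> X (D w')) (\<lambda>z. p w' z * F z) y = c * (p w' (pull w' y) * F (pull w' y))"
        unfolding L(2) pw by simp
      show ?thesis
      proof (cases "w' = w")
        case True
        then show ?thesis using e y(2) L(1) by (intro exI[of _ c]) (simp add: F_def)
      next
        case False
        then have "F (pull w' y) = 0" using low[OF gp(2)[OF w']] gp(1)[OF w'] act[OF w'] by simp
        then show ?thesis using e False by simp
      qed
    qed
  qed
  obtain c where c: "c \<noteq> 0" "rep Q \<tau> \<mu> (diagram_mor \<tau> X (D w)) (\<lambda>z. p w z * F z) y = c * p w z"
    using summand[OF less.prems(1)] by metis
  have "(\<Sum>w'\<in>W. rep Q \<tau> \<mu> (diagram_mor \<tau> X (D w')) (\<lambda>z. p w' z * F z) y) = (\<Sum>w'\<in>W. if w' = w then c * p w z else 0)"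
  proof (rule sum.cong[OF HOL.refl])
    fix w' assume "w' \<in> W"
    from summand[OF this] c(2) show "rep Q \<tau> \<mu> (diagram_mor \<tau> X (D w')) (\<lambda>z. p w' z * F z) y = (if w' = w then c * p w z else 0)"
      by auto
  qed
  also have "\<dots> = c * p w z" using W(1) less.prems(1) by simp
  finally show ?case using zero[OF gy] c(1) by simp
qed

subsection \<open>Monomials in the dots\<close>

definition monomial_value :: "nat list \<Rightarrow> 'k list \<Rightarrow> 'k" where
  "monomial_value as z = (\<Prod>r\<in>{1..length as}. (z ! (r - 1)) ^ (as ! (r - 1)))"

lemma rep_power_dot:
  assumes "1 \<le> r" "r \<le> length (black_positions X)" "length y = length (filter is_black X)"
  shows "rep Q \<tau> \<mu> (mor_power X (black_dot X r) n) F y = (y ! (r - 1)) ^ n * F y"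
  by (induction n arbitrary: F) (simp_all add: rep_black_dot[OF assms])

lemma rep_dot_monomial:
  assumes as: "length as = length (black_positions X)" and y: "length y = length (filter is_black X)"
  shows "rep Q \<tau> \<mu> (dot_monomial X as) F y = monomial_value as y * F y"
proof -
  have "rep Q \<tau> \<mu> (foldr (\<lambda>r g. mor_power X (black_dot X r) (as ! (r - 1)) \<circ>\<^sub>k g) rs (Ident X)) F y =
      (\<Prod>r\<in>set rs. (y ! (r - 1)) ^ (as ! (r - 1))) * F y" if "set rs \<subseteq> {1..length as}" "distinct rs" for rs F
    using that
  proof (induction rs arbitrary: F)
    case (Cons r rs)
    then have r: "1 \<le> r" "r \<le> length (black_positions X)" using as by auto
    show ?case using Cons rep_power_dot[OF r y] by (simp add: algebra_simps)
  qed simp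
  from this[of "[1..<Suc (length as)]"] show ?thesis
    unfolding dot_monomial_def monomial_value_def by (simp add: atLeastLessThanSuc_atLeastAtMost del: upt_Suc)
qed

lemma monomial_value_Cons: "monomial_value (e # as) (u # z) = u ^ e * monomial_value as z"
proof -
  have "{1..length (e # as)} = insert 1 (Suc ` {1..length as})" by (auto simp: image_Suc_atLeastAtMost)
  moreover have "(1::nat) \<notin> Suc ` {1..length as}" by auto
  ultimately have "monomial_value (e # as) (u # z) =
      u ^ e * (\<Prod>r\<in>Suc ` {1..length as}. ((u # z) ! (r - 1)) ^ ((e # as) ! (r - 1)))"
    unfolding monomial_value_def by simp
  also have "(\<Prod>r\<in>Suc ` {1..length as}. ((u # z) ! (r - 1)) ^ ((e # as) ! (r - 1))) =
      (\<Prod>r\<in>{1..length as}. ((u # z) ! r) ^ ((e # as) ! r))"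
    by (subst prod.reindex) auto
  also have "\<dots> = monomial_value as z"
    unfolding monomial_value_def by (rule prod.cong) (auto simp: nth_Cons')
  finally show ?thesis .
qed

text \<open>Induction on the number of coordinates. For fixed generic \<open>z\<close> the sum is a
  polynomial in the first coordinate with infinitely many zeros, so its coefficient at the exponent
  \<open>e0\<close> vanishes, and this coefficient is a sum of the same kind in
  \<open>z\<close>.\<close>

lemma polynomial_vanishing_on_generic:
  assumes inf: "infinite (UNIV :: 'k set)"
  shows "finite S \<Longrightarrow> (\<And>as. as \<in> S \<Longrightarrow> length as = n) \<Longrightarrow>
    (\<And>z. generic z \<Longrightarrow> length z = n \<Longrightarrow> (\<Sum>as\<in>S. a as * monomial_value as z) = 0) \<Longrightarrow> as \<in> S \<Longrightarrow> a as = (0 :: 'k)"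
proof (induction n arbitrary: S a as)
  case 0
  then have "S = {[]}" using 0 by fastforce
  then show ?case using 0(3)[of "[]"] 0(4) by (simp add: generic_def monomial_value_def)
next
  case (Suc n)
  obtain e0 as0 where as: "as = e0 # as0" using Suc.prems(2)[OF Suc.prems(4)] by (cases as) auto
  define T where "T = tl ` {bs \<in> S. hd bs = e0}"
  have Cons_S: "bs = hd bs # tl bs" if "bs \<in> S" for bs using Suc.prems(2)[OF that] by (cases bs) auto
  have "a (e0 # as0) = 0"
  proof (rule Suc.IH[of T "\<lambda>bs. a (e0 # bs)" as0])
    show "finite T" using Suc.prems(1) by (simp add: T_def)
    show "length bs = n" if "bs \<in> T" for bs using that Suc.prems(2) by (force simp: T_def)
    show "as0 \<in> T" using Suc.prems(4) as by (force simp: T_def)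
    fix z :: "'k list" assume z: "generic z" "length z = n"
    define P where "P = (\<Sum>bs\<in>S. monom (a bs * monomial_value (tl bs) z) (hd bs))"
    \<comment> \<open>For fixed \<open>z\<close>, all but finitely many \<open>u\<close> make
      \<open>u # z\<close> generic.\<close>
    have "poly P u = 0" if "u \<notin> insert 0 (set z \<union> uminus ` set z)" for u
    proof -
      have "u\<^sup>2 \<noteq> v\<^sup>2" if "v \<in> set z" for v
        using that \<open>u \<notin> _\<close> by (auto simp: power2_eq_iff)
      then have "generic (u # z)" using z(1) \<open>u \<notin> _\<close> by (auto simp: generic_def)
      then have "(\<Sum>bs\<in>S. a bs * monomial_value bs (u # z)) = 0" using Suc.prems(3)[of "u # z"] z(2) by simp
      moreover have "poly P u = (\<Sum>bs\<in>S. a bs * monomial_value bs (u # z))"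
        unfolding P_def poly_sum
      proof (rule sum.cong[OF HOL.refl])
        fix bs assume "bs \<in> S"
        then show "poly (monom (a bs * monomial_value (tl bs) z) (hd bs)) u = a bs * monomial_value bs (u # z)"
          by (subst (4) Cons_S) (simp_all add: monomial_value_Cons poly_monom algebra_simps)
      qed
      ultimately show ?thesis by simp
    qed
    then have "- insert 0 (set z \<union> uminus ` set z) \<subseteq> {u. poly P u = 0}" by blast
    moreover have "infinite (- insert 0 (set z \<union> uminus ` set z))"
      using inf finite_compl[of "insert 0 (set z \<union> uminus ` set z)"] by simp
    ultimately have "infinite {u. poly P u = 0}" using finite_subset by blast
    then have "P = 0" using poly_roots_finite by blast
    then have "coeff P e0 = 0" by simp
    then have "(\<Sum>bs\<in>S. if hd bs = e0 then a bs * monomial_value (tl bs) z else 0) = 0"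
      by (simp add: P_def coeff_sum)
    then have "(\<Sum>bs\<in>{bs \<in> S. hd bs = e0}. a bs * monomial_value (tl bs) z) = 0"
      using Suc.prems(1) by (simp add: sum.If_cases Int_def)
    moreover have "(\<Sum>bs\<in>T. a (e0 # bs) * monomial_value bs z) = (\<Sum>bs\<in>{bs \<in> S. hd bs = e0}. a bs * monomial_value (tl bs) z)"
    proof -
      have i: "inj_on tl {bs \<in> S. hd bs = e0}"
        by (rule inj_onI) (metis (mono_tags, lifting) Cons_S mem_Collect_eq)
      show ?thesis unfolding T_def
      proof (subst sum.reindex[OF i], rule sum.cong[OF HOL.refl])
        fix bs assume "bs \<in> {bs \<in> S. hd bs = e0}"
        then have "e0 # tl bs = bs" using Cons_S[of bs] by auto
        then show "((\<lambda>bs. a (e0 # bs) * monomial_value bs z) \<circ> tl) bs = a bs * monomial_value (tl bs) z" by simp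
      qed
    qed
    ultimately show "(\<Sum>bs\<in>T. a (e0 # bs) * monomial_value bs z) = 0" by simp
  qed
  then show ?case using as by simp
qed

end

text \<open>Over a finite field the product of all factors x - a vanishes everywhere, so adding 1
  gives a nonconstant polynomial without roots.\<close>

lemma infinite_alg_closed: "infinite (UNIV :: 'k :: alg_closed_field set)"
proof
  assume fin: "finite (UNIV :: 'k set)"
  define P :: "'k poly" where "P = (\<Prod>a\<in>UNIV. [:- a, 1:]) + 1"
  have deg: "degree (\<Prod>a\<in>(UNIV :: 'k set). [:- a, 1:]) = card (UNIV :: 'k set)"
    by (subst degree_prod_eq_sum_degree) auto
  have "card (UNIV :: 'k set) > 0" using fin by (simp add: card_gt_0_iff)
  then have "degree P > 0" unfolding P_def using deg
    by (subst degree_add_eq_left) auto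
  then obtain x where "poly P x = 0" using alg_closed_imp_poly_has_root by blast
  moreover have "poly (\<Prod>a\<in>(UNIV :: 'k set). [:- a, 1:]) x = 0"
    using fin by (simp add: poly_prod prod_zero_iff)
  ultimately show False by (simp add: P_def)
qed

section \<open>Reduced Stendhal diagrams are reduced words\<close>

text \<open>From strands counted among the black ones to strands counted among all.\<close>

definition black_entry :: "'v wrd \<Rightarrow> int \<Rightarrow> int" where
  "black_entry X x = sgn x * (int (black_positions X ! (nat \<bar>x\<bar> - 1)) + 1)"

lemma black_entry_neg: "black_entry X (- x) = - black_entry X x"
  by (simp add: black_entry_def sgn_minus)

lemma sgn_black_entry: "x \<noteq> 0 \<Longrightarrow> (black_entry X x < 0) = (x < 0)"
  by (auto simp: black_entry_def sgn_if)

lemma black_entry_mono: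
  assumes "x \<le> y" "x \<noteq> 0" "y \<noteq> 0" "\<bar>x\<bar> \<le> int (length (black_positions X))" "\<bar>y\<bar> \<le> int (length (black_positions X))"
  shows "black_entry X x \<le> black_entry X y"
proof -
  have "sorted (black_positions X)" by (simp add: black_positions_def sorted_wrt_filter)
  then have m: "black_positions X ! i \<le> black_positions X ! j" if "i \<le> j" "j < length (black_positions X)" for i j
    using that by (simp add: sorted_nth_mono)
  consider "0 < x" "0 < y" | "x < 0" "y < 0" | "x < 0" "0 < y" using assms by linarith
  then show ?thesis
  proof cases
    case 1
    have "nat \<bar>x\<bar> - 1 \<le> nat \<bar>y\<bar> - 1" "nat \<bar>y\<bar> - 1 < length (black_positions X)" using assms 1 by linarith+
    then show ?thesis using m[of "nat \<bar>x\<bar> - 1" "nat \<bar>y\<bar> - 1"] 1 by (simp add: black_entry_def)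
  next
    case 2
    have "nat \<bar>y\<bar> - 1 \<le> nat \<bar>x\<bar> - 1" "nat \<bar>x\<bar> - 1 < length (black_positions X)" using assms 2 by linarith+
    then have "int (black_positions X ! (nat \<bar>y\<bar> - 1)) \<le> int (black_positions X ! (nat \<bar>x\<bar> - 1))" using m by simp
    then show ?thesis using 2 by (simp add: black_entry_def)
  next
    case 3
    then show ?thesis by (simp add: black_entry_def)
  qed
qed

lemma filter_black_piece_act:
  assumes Z: "Z = map (strand_letter \<tau> X) xs" and ok: "piece_ok Z d"
  shows "(black_gens Z d = [] \<and> filter (strand_black X) (piece_act xs d) = filter (strand_black X) xs) \<or>
    (\<exists>c < length (filter (strand_black X) xs). black_gens Z d = [c] \<and>
      filter (strand_black X) (piece_act xs d) = gen_act uminus c (filter (strand_black X) xs))"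
proof (cases d)
  case (Crossing p)
  then have "p + 1 < length xs" using ok Z by simp
  then obtain A x y B where xs: "xs = A @ x # y # B" "length A = p" by (rule split_at_crossing)
  have bl: "strand_black X x \<or> strand_black X y" using ok Crossing Z xs by (auto simp: nth_append)
  have fl: "length (filter (is_black \<circ> strand_letter \<tau> X) A) = length (filter (strand_black X) A)"
    by (simp add: comp_def)
  have sw: "swap_at (length (filter (strand_black X) A)) (filter (strand_black X) A @ u # v # W) = filter (strand_black X) A @ v # u # W"
    for u v W by (simp add: swap_at_append)
  show ?thesis
  proof (cases "strand_black X x \<and> strand_black X y")
    case True
    then show ?thesis using Crossing xs Z
      by (intro disjI2 exI[of _ "Suc (length (filter (strand_black X) A))"])
        (auto simp: nth_append swap_at_append' filter_map fl sw)
  next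
    case False
    then show ?thesis using Crossing xs Z bl
      by (auto simp: nth_append swap_at_append')
  qed
next
  case Mirror
  then obtain x B where "xs = x # B" "strand_black X x" using ok Z by (cases xs) auto
  then show ?thesis using Mirror by simp
qed

lemma filter_ident_list:
  "filter (strand_black X) (ident_list (length X)) = map (black_entry X) (ident_list (length (black_positions X)))"
proof -
  have up: "ident_list n = map (\<lambda>p. int p + 1) [0..<n]" for n
    unfolding ident_list_def by (rule nth_equalityI) (simp_all del: upt_Suc)
  have "filter (strand_black X) (ident_list (length X)) = map (\<lambda>p. int p + 1) (black_positions X)"
    unfolding up filter_map by (auto simp: comp_def black_positions_def strand_black_def nat_add_distrib)
  also have "\<dots> = map (black_entry X) (ident_list (length (black_positions X)))"
    unfolding up by (rule nth_equalityI) (simp_all add: black_entry_def nat_add_distrib)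
  finally show ?thesis .
qed

text \<open>Transfers descents between the hyperoctahedral group on the black letters and the one on
  all letters, as \<open>black_entry\<close> is odd and increasing.\<close>

lemma black_state:
  assumes inv: "involutive_on \<tau> X"
  shows "is_diagram \<tau> X Y ds \<Longrightarrow> filter (strand_black X) (state (length X) ds) =
    map (black_entry X) (state (length (black_word X)) (map gen_piece (black_expression \<tau> X ds)))"
proof (induction ds arbitrary: Y rule: rev_induct)
  case Nil
  then show ?case by (simp add: filter_ident_list length_black_word length_black_positions)
next
  case (snoc d ds)
  then obtain Z where Z: "is_diagram \<tau> X Z ds" "piece_ok Z d" by (auto simp: is_diagram_snoc)
  let ?xs = "state (length X) ds"
    and ?bs = "state (length (black_word X)) (map gen_piece (black_expression \<tau> X ds))"
  have Zx: "Z = map (strand_letter \<tau> X) ?xs" using is_diagram_state[OF inv Z(1)] by simp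
  note IH = snoc.IH[OF Z(1)]
  note be = black_expression_snoc[OF Z(1), of d]
  from filter_black_piece_act[OF Zx Z(2)] show ?case
  proof (elim disjE exE conjE)
    assume "black_gens Z d = []" "filter (strand_black X) (piece_act ?xs d) = filter (strand_black X) ?xs"
    then show ?thesis using IH be by simp
  next
    fix c assume c: "c < length (filter (strand_black X) ?xs)" "black_gens Z d = [c]"
      "filter (strand_black X) (piece_act ?xs d) = gen_act uminus c (filter (strand_black X) ?xs)"
    have l: "c < length ?bs" using c(1) unfolding IH by simp
    have "gen_act uminus c (map (black_entry X) ?bs) = map (black_entry X) (gen_act uminus c ?bs)"
    proof (cases c)
      case 0
      then show ?thesis using l by (cases ?bs) (auto simp: black_entry_neg)
    next
      case (Suc c')
      then show ?thesis using l by (simp add: map_swap_at)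
    qed
    then show ?thesis using c IH be by (simp add: piece_act_gen_piece)
  qed
qed

lemma gen_piece_surj: "\<exists>c. d = gen_piece c \<and> (in_range n d \<longrightarrow> c < n)"
proof (cases d)
  case (Crossing p)
  then show ?thesis by (intro exI[of _ "Suc p"]) simp
next
  case Mirror
  then show ?thesis by (intro exI[of _ 0]) simp
qed

lemma gen_pieces_surj: "list_all (in_range n) ds \<Longrightarrow> \<exists>cs. ds = map gen_piece cs \<and> set cs \<subseteq> {..<n}"
proof (induction ds)
  case (Cons d ds)
  then obtain c cs where "d = gen_piece c" "c < n" "ds = map gen_piece cs" "set cs \<subseteq> {..<n}"
    using gen_piece_surj[of d n] by auto
  then show ?case by (intro exI[of _ "c # cs"]) auto
qed simp

text \<open>The state of \<open>cs\<close> also has a word of Coxeter length, which represents the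
  same permutation; minimality of \<open>cs\<close> compares the two lengths.\<close>

lemma reduced_expression_reduced:
  assumes "reduced_expression n cs w"
  shows "reduced n (map gen_piece cs)"
proof -
  have cs: "set cs \<subseteq> {..<n}" "gens_perm cs = w"
    and min: "\<And>cs'. set cs' \<subseteq> {..<n} \<Longrightarrow> gens_perm cs' = w \<Longrightarrow> length cs \<le> length cs'"
    using assms by (auto simp: reduced_expression_def)
  have r: "list_all (in_range n) (map gen_piece cs)" using cs(1) by (auto simp: list_all_iff in_range_gen_piece)
  obtain es where es: "reduced n es" "state n es = state n (map gen_piece cs)"
    using exists_reduced[OF signed_list_state[OF r]] by blast
  obtain cs' where cs': "es = map gen_piece cs'" "set cs' \<subseteq> {..<n}"
    using gen_pieces_surj es(1) unfolding reduced_def by blast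
  have "one_line n (gens_perm cs') = one_line n (gens_perm cs)"
    using es(2) state_one_line[OF cs(1)] state_one_line[OF cs'(2)] cs'(1) by simp
  then have "gens_perm cs' = w" using one_line_inj gens_perm_perm cs(1) cs'(2) cs(2) by metis
  then have "length cs \<le> length es" using min[OF cs'(2)] cs'(1) by simp
  then show ?thesis using es signed_inv_state_le[OF r] r by (simp add: reduced_def)
qed

section \<open>Red-black crossings in reduced words\<close>

lemma strands_state: "strands N ds = map (\<lambda>x. nat \<bar>x\<bar> - 1) (state N ds)" if "list_all (in_range N) ds"
  using that
proof (induction ds rule: rev_induct)
  case Nil
  show ?case unfolding strands_def by (rule nth_equalityI) (simp_all add: ident_list_def del: upt_Suc)
next
  case (snoc d ds)
  then have sl: "signed_list N (state N ds)" by (auto intro: signed_list_state)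
  show ?case
  proof (cases d)
    case (Crossing p)
    then show ?thesis using snoc sl by (simp add: strands_def map_swap_at signed_list_def)
  next
    case Mirror
    then show ?thesis using snoc sl by (cases "state N ds") (auto simp: strands_def signed_list_def)
  qed
qed

lemma crossing_times_snoc:
  "crossing_times m (ds @ [d]) a b = crossing_times m ds a b \<union>
    (if \<exists>p. d = Crossing p \<and> {strands m ds ! p, strands m ds ! (p + 1)} = {a, b} then {length ds} else {})"
  by (auto simp: crossing_times_def nth_append less_Suc_eq)

lemma mirror_times_snoc:
  "mirror_times m (ds @ [d]) b = mirror_times m ds b \<union> (if d = Mirror \<and> strands m ds ! 0 = b then {length ds} else {})"
  by (auto simp: mirror_times_def nth_append less_Suc_eq)

lemma crossing_times_append: "crossing_times m ds a b \<subseteq> crossing_times m (ds @ es) a b"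
  by (auto simp: crossing_times_def nth_append)

lemma mirror_times_append: "t < length ds \<Longrightarrow> t \<in> mirror_times m (ds @ es) b \<longleftrightarrow> t \<in> mirror_times m ds b"
  by (auto simp: mirror_times_def nth_append)

lemma mirror_times_append': "mirror_times m ds b \<subseteq> mirror_times m (ds @ es) b"
  by (auto simp: mirror_times_def nth_append)

lemma crossing_times_commute: "crossing_times m ds a b = crossing_times m ds b a"
  by (simp add: crossing_times_def insert_commute)

lemma times_less: "t \<in> crossing_times m ds a b \<Longrightarrow> t < length ds" "t \<in> mirror_times m ds b \<Longrightarrow> t < length ds"
  by (auto simp: crossing_times_def mirror_times_def)

text \<open>In a reduced word every step ascends, so that the mirror turns positive entries into negative
  ones, for good.\<close>

lemma mirror_times_sign:
  assumes "reduced N ds" "x \<in> set (state N ds)"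
  shows "0 < x \<longleftrightarrow> mirror_times N ds (nat \<bar>x\<bar> - 1) = {}"
  using assms
proof (induction ds arbitrary: x rule: rev_induct)
  case Nil
  then show ?case by (auto simp: ident_list_def mirror_times_def simp del: upt_Suc)
next
  case (snoc d ds)
  have r: "reduced N ds" "in_range N d" "\<not> descends (state N ds) d" using snoc.prems(1) by (auto simp: reduced_snoc)
  have la: "list_all (in_range N) ds" using r(1) by (simp add: reduced_def)
  have sl: "signed_list N (state N ds)" using la by (rule signed_list_state)
  show ?case
  proof (cases d)
    case (Crossing p)
    have "mset (state N (ds @ [d])) = mset (state N ds)" using r(2) sl Crossing mset_swap_at[of p "state N ds"] by (simp add: signed_list_def)
    then have "x \<in> set (state N ds)" using snoc.prems(2) mset_eq_setD by blast
    then show ?thesis using snoc.IH[OF r(1)] Crossing by (simp add: mirror_times_snoc)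
  next
    case Mirror
    then obtain u B where u: "state N ds = u # B" using sl r(2) by (cases "state N ds") (auto simp: signed_list_def)
    have dist: "\<bar>u\<bar> \<notin> abs ` set B" and im: "abs ` set (u # B) = {1..int N}"
      using sl u by (simp_all add: signed_list_def)
    have "\<bar>u\<bar> \<in> {1..int N}" unfolding im[symmetric] by simp
    moreover have "\<not> u < 0" using r(3) u Mirror by simp
    ultimately have u0: "0 < u" by auto
    have B0: "\<bar>y\<bar> \<noteq> \<bar>u\<bar> \<and> y \<noteq> 0" if "y \<in> set B" for y
    proof -
      have "\<bar>y\<bar> \<in> {1..int N}" unfolding im[symmetric] using that by simp
      moreover have "\<bar>y\<bar> \<in> abs ` set B" using that by (rule imageI)
      then have "\<bar>y\<bar> \<noteq> \<bar>u\<bar>" using dist by metis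
      ultimately show ?thesis by auto
    qed
    have str: "strands N ds ! 0 = nat \<bar>u\<bar> - 1" using strands_state[OF la] u by simp
    from snoc.prems(2) Mirror u consider "x = - u" | "x \<in> set B" by auto
    then show ?thesis
    proof cases
      case 1
      then show ?thesis using u0 Mirror str by (simp add: mirror_times_snoc)
    next
      case 2
      then have "nat \<bar>x\<bar> - 1 \<noteq> nat \<bar>u\<bar> - 1" using B0[OF 2] u0 by linarith
      then show ?thesis using snoc.IH[OF r(1), of x] 2 u Mirror str by (simp add: mirror_times_snoc)
    qed
  qed
qed

text \<open>The crossing found in the second case is on the way back from the mirror.\<close>

lemma inversion_crossing:
  assumes inv: "involutive_on \<tau> X"
  shows "is_diagram \<tau> X Y ds \<Longrightarrow> reduced (length X) ds \<Longrightarrow> i < j \<Longrightarrow> j < length X \<Longrightarrow>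
    x = state (length X) ds ! i \<Longrightarrow> y = state (length X) ds ! j \<Longrightarrow> strand_black X x \<noteq> strand_black X y \<Longrightarrow> y < x \<Longrightarrow>
    \<exists>s \<in> crossing_times (length X) ds (nat \<bar>x\<bar> - 1) (nat \<bar>y\<bar> - 1).
      y < 0 \<longrightarrow> (\<exists>t \<in> mirror_times (length X) ds (nat \<bar>y\<bar> - 1). t < s)"
proof (induction ds arbitrary: Y i j x y rule: rev_induct)
  case Nil
  then show ?case by (simp add: ident_list_def del: upt_Suc)
next
  case (snoc d ds)
  let ?N = "length X"
  let ?xs = "state ?N ds"
  obtain Z where Z: "is_diagram \<tau> X Z ds" "piece_ok Z d" using snoc.prems(1) by (auto simp: is_diagram_snoc)
  have r: "reduced ?N ds" "in_range ?N d" "\<not> descends ?xs d" using snoc.prems(2) by (auto simp: reduced_snoc)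
  have la: "list_all (in_range ?N) ds" using r(1) by (simp add: reduced_def)
  have sl: "signed_list ?N ?xs" using la by (rule signed_list_state)
  have len: "length ?xs = ?N" using sl by (simp add: signed_list_def)
  have Zx: "Z = map (strand_letter \<tau> X) ?xs" and comp: "compatible X ?xs" using is_diagram_state[OF inv Z(1)] by auto
  have comp': "compatible X (state ?N (ds @ [d]))" using is_diagram_state[OF inv snoc.prems(1)] by auto
  \<comment> \<open>A pair that was already inverted below \<open>d\<close> keeps the crossing and
    the mirror time found there.\<close>
  have earlier: ?case if e: "i' < j'" "j' < ?N" "x = ?xs ! i'" "y = ?xs ! j'" for i' j'
  proof -
    obtain s where s: "s \<in> crossing_times ?N ds (nat \<bar>x\<bar> - 1) (nat \<bar>y\<bar> - 1)"
      "y < 0 \<longrightarrow> (\<exists>t \<in> mirror_times ?N ds (nat \<bar>y\<bar> - 1). t < s)"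
      using snoc.IH[OF Z(1) r(1) e snoc.prems(7,8)] by blast
    show ?thesis
      using subsetD[OF crossing_times_append s(1), of "[d]"] s(2) mirror_times_append'[of ?N ds "nat \<bar>y\<bar> - 1" "[d]"] by blast
  qed
  show ?case
  proof (cases d)
    case (Crossing p)
    have p: "p + 1 < length ?xs" using r(2) Crossing len by simp
    have st: "state ?N (ds @ [d]) ! k = (if k = p then ?xs ! (p + 1) else if k = p + 1 then ?xs ! p else ?xs ! k)" if "k < ?N" for k
      using nth_swap_at[OF p, of k] that len Crossing by simp
    show ?thesis
    proof (cases "i = p \<and> j = p + 1")
      case True
      then have xy: "x = ?xs ! (p + 1)" "y = ?xs ! p" using snoc.prems(3-6) st[of i] st[of j] by auto
      have "strands ?N ds ! p = nat \<bar>y\<bar> - 1" "strands ?N ds ! (p + 1) = nat \<bar>x\<bar> - 1"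
        using strands_state[OF la] p xy by simp_all
      then have "length ds \<in> crossing_times ?N (ds @ [d]) (nat \<bar>x\<bar> - 1) (nat \<bar>y\<bar> - 1)"
        using Crossing by (auto simp: crossing_times_snoc)
      \<comment> \<open>A negative entry records a meeting with the mirror, which lies below
        \<open>d\<close>.\<close>
      moreover have "\<exists>t \<in> mirror_times ?N (ds @ [d]) (nat \<bar>y\<bar> - 1). t < length ds" if neg: "y < 0"
      proof -
        have "y \<in> set ?xs" using xy(2) p by simp
        then obtain t where t: "t \<in> mirror_times ?N ds (nat \<bar>y\<bar> - 1)"
          using mirror_times_sign[OF r(1), of y] neg by auto
        show ?thesis by (rule bexI[of _ t]) (rule times_less(2)[OF t], rule subsetD[OF mirror_times_append' t])
      qed
      ultimately show ?thesis by blast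
    next
      case False
      let ?f = "\<lambda>k. if k = p then p + 1 else if k = p + 1 then p else k"
      have "?f i < ?f j" "?f j < ?N" using False snoc.prems(3,4) p len by auto
      moreover have "x = ?xs ! ?f i" "y = ?xs ! ?f j" using st[of i] st[of j] snoc.prems(3-6) by auto
      ultimately show ?thesis by (rule earlier)
    qed
  next
    case Mirror
    then obtain u B where u: "?xs = u # B" using len r(2) by (cases ?xs) auto
    have ub: "strand_black X u" "0 \<le> u" using Z(2) Zx u Mirror r(3) by auto
    have y: "y = ?xs ! j" using snoc.prems(3,6) u Mirror by (cases j) auto
    show ?thesis
    proof (cases i)
      case 0
      \<comment> \<open>The reflected entry is now negative and the other one, being red, is
        positive; so the mirror creates no red-black inversion.\<close>
      then have x: "x = - u" using snoc.prems(5) u Mirror by simp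
      then have "\<not> strand_black X y" using snoc.prems(7) ub by simp
      moreover have "y \<in> set ?xs" using y snoc.prems(4) len by simp
      ultimately have "0 < y" using comp by (simp add: compatible_def)
      then show ?thesis using snoc.prems(8) x ub by simp
    next
      case (Suc i')
      then have "x = ?xs ! i" using snoc.prems(5) u Mirror by simp
      then show ?thesis using earlier[of i j] y snoc.prems(3,4) by blast
    qed
  qed
qed

lemma two_le_card: "finite S \<Longrightarrow> s \<in> S \<Longrightarrow> t \<in> S \<Longrightarrow> s \<noteq> t \<Longrightarrow> card S \<le> 1 \<Longrightarrow> False"
  by (metis card_le_Suc0_iff_eq One_nat_def)

text \<open>A descent at the mirror or between two black entries would be a descent of the black
  word, which is reduced. A red-black descent means that the two strands have crossed below, so
  \<open>d\<close> crosses them again. If \<open>y < 0\<close>, both crossings follow a meeting of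
  the black strand with the mirror; otherwise both entries are positive and both crossings precede
  any such meeting.\<close>

lemma reduced_diagram_ascends:
  assumes X: "X = stendhal_word is \<kappa> \<Lambda>" and inv: "involutive_on \<tau> X" and n: "length is = length (black_word X)"
    and red: "reduced_diagram \<tau> \<Lambda> w is \<kappa> \<kappa>' (ds @ d # es)" and r: "reduced (length X) ds"
  shows "\<not> descends (state (length X) ds) d"
proof
  assume desc: "descends (state (length X) ds) d"
  let ?N = "length X" and ?ds = "ds @ d # es"
  let ?xs = "state ?N ds"
  obtain Y where dg: "is_diagram \<tau> X Y ?ds"
    and be: "reduced_expression (length is) (black_expression \<tau> X ?ds) w"
    and cr: "\<And>r b. r < ?N \<Longrightarrow> b < ?N \<Longrightarrow> \<not> is_black (X ! r) \<Longrightarrow> is_black (X ! b) \<Longrightarrow>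
          (mirror_times ?N ?ds b = {} \<longrightarrow> card (crossing_times ?N ?ds r b) \<le> 1) \<and>
          (\<forall>t\<in>mirror_times ?N ?ds b.
             card {s \<in> crossing_times ?N ?ds r b. s < t} \<le> 1 \<and>
             card {s \<in> crossing_times ?N ?ds r b. t < s} \<le> 1)"
    using red unfolding reduced_diagram_def Let_def X[symmetric] by blast
  obtain Z where Z: "is_diagram \<tau> X Z (ds @ [d])"
  proof -
    have "is_diagram \<tau> X Y (us @ vs) \<Longrightarrow> \<exists>Z. is_diagram \<tau> X Z us" for us vs
      by (induction us arbitrary: X) auto
    from this[of "ds @ [d]" es] dg that show ?thesis by auto
  qed
  then obtain W where W: "is_diagram \<tau> X W ds" "piece_ok W d" by (auto simp: is_diagram_snoc)
  have la: "list_all (in_range ?N) ds" using r by (simp add: reduced_def)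
  have sl: "signed_list ?N ?xs" using la by (rule signed_list_state)
  have len: "length ?xs = ?N" using sl by (simp add: signed_list_def)
  have Wx: "W = map (strand_letter \<tau> X) ?xs" and comp: "compatible X ?xs" using is_diagram_state[OF inv W(1)] by auto
  define cs where "cs = black_expression \<tau> X ds"
  let ?n = "length (black_word X)"
  have "black_expression \<tau> X ?ds = black_expression \<tau> X (ds @ [d]) @ black_expression \<tau> Z es"
  proof -
    have "is_diagram \<tau> X Z us \<Longrightarrow> black_expression \<tau> X (us @ vs) = black_expression \<tau> X us @ black_expression \<tau> Z vs" for us vs
      by (induction us arbitrary: X) auto
    from this[OF Z, of es] show ?thesis by simp
  qed
  then have rb: "reduced ?n (map gen_piece cs @ map gen_piece (black_gens W d))"
    using reduced_append[of ?n "map gen_piece (black_expression \<tau> X (ds @ [d]))"] reduced_expression_reduced[OF be] n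
      black_expression_snoc[OF W(1), of d] by (simp add: cs_def)
  let ?bs = "state ?n (map gen_piece cs)"
  have bst: "filter (strand_black X) ?xs = map (black_entry X) ?bs" using black_state[OF inv W(1)] by (simp add: cs_def)
  have slb: "signed_list ?n ?bs" using reduced_append[OF rb] by (auto simp: reduced_def intro: signed_list_state)
  have bs: "x \<noteq> 0" "\<bar>x\<bar> \<le> int (length (black_positions X))" if "x \<in> set ?bs" for x
  proof -
    have "\<bar>x\<bar> \<in> {1..int ?n}" using slb that by (auto simp: signed_list_def)
    then show "x \<noteq> 0" "\<bar>x\<bar> \<le> int (length (black_positions X))" by (auto simp: length_black_word length_black_positions)
  qed
  show False
  proof (cases d)
    case (Crossing p)
    have "p + 1 < length ?xs" using Crossing W(2) Wx by simp
    then obtain A x y B where xs: "?xs = A @ x # y # B" "length A = p" by (rule split_at_crossing)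
    have yx: "y < x" using desc xs Crossing by (simp add: nth_append)
    have bl: "strand_black X x \<or> strand_black X y" using W(2) Wx Crossing xs by (auto simp: nth_append)
    show False
    proof (cases "strand_black X x \<and> strand_black X y")
      case True
      \<comment> \<open>The place of \<open>x\<close> among the black entries, so that
        \<open>d\<close> acts on the black word as \<open>Crossing a\<close>.\<close>
      define a where "a = length (filter (strand_black X) A)"
      have "black_gens W d = [Suc a]"
        using Crossing xs Wx True by (auto simp: nth_append filter_map comp_def a_def)
      then have nd: "\<not> descends ?bs (Crossing a)" using rb by (simp add: reduced_snoc)
      have m: "map (black_entry X) ?bs = filter (strand_black X) A @ x # y # filter (strand_black X) B"
        using bst xs True by simp
      have la: "Suc a < length ?bs" using arg_cong[OF m, of length] by (simp add: a_def)
      have "black_entry X (?bs ! a) = x" "black_entry X (?bs ! Suc a) = y"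
        using arg_cong[OF m, of "\<lambda>l. l ! a"] arg_cong[OF m, of "\<lambda>l. l ! Suc a"] la by (auto simp: nth_append a_def)
      moreover have "?bs ! a \<le> ?bs ! Suc a" using nd by simp
      ultimately show False using black_entry_mono[of "?bs ! a" "?bs ! Suc a" X] bs[of "?bs ! a"] bs[of "?bs ! Suc a"] la yx by simp
    next
      case False
      then have ne: "strand_black X x \<noteq> strand_black X y" using bl by blast
      let ?x = "nat \<bar>x\<bar> - 1" and ?y = "nat \<bar>y\<bar> - 1"
      have xy: "x = ?xs ! p" "y = ?xs ! (p + 1)" using xs by (auto simp: nth_append)
      obtain s where s: "s \<in> crossing_times ?N ds ?x ?y" "y < 0 \<longrightarrow> (\<exists>t \<in> mirror_times ?N ds ?y. t < s)"
        using inversion_crossing[OF inv W(1) r _ _ xy ne yx] \<open>p + 1 < length ?xs\<close> len by auto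
      let ?t = "length ds" and ?C = "crossing_times ?N ?ds ?x ?y"
      have st: "s \<in> ?C" "s < ?t" by (rule subsetD[OF crossing_times_append s(1)], rule times_less(1)[OF s(1)])
      have "strands ?N ds ! p = ?x" "strands ?N ds ! (p + 1) = ?y"
        using strands_state[OF la] xy \<open>p + 1 < length ?xs\<close> by simp_all
      then have t: "?t \<in> ?C" using Crossing by (auto simp: crossing_times_def)
      have fin: "finite ?C" by (rule finite_subset[of _ "{..<length ?ds}"]) (auto dest: times_less)
      have rng: "\<bar>x\<bar> \<in> {1..int ?N}" "\<bar>y\<bar> \<in> {1..int ?N}" using sl xs by (auto simp: signed_list_def)
      then have lt: "?x < ?N" "?y < ?N" by auto
      have ins: "x \<in> set ?xs" "y \<in> set ?xs" using xs by auto
      \<comment> \<open>The black one of the two strands, whose mirror times enter the reducedness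
        conditions.\<close>
      define b where "b = (if strand_black X x then ?x else ?y)"
      have c: "(mirror_times ?N ?ds b = {} \<longrightarrow> card ?C \<le> 1) \<and>
          (\<forall>t\<in>mirror_times ?N ?ds b. card {s \<in> ?C. s < t} \<le> 1 \<and> card {s \<in> ?C. t < s} \<le> 1)"
      proof (cases "strand_black X x")
        case True
        then have b: "\<not> is_black (X ! ?y)" "is_black (X ! ?x)" "b = ?x" using ne by (simp_all add: strand_black_def b_def)
        show ?thesis unfolding crossing_times_commute[of ?N ?ds ?x ?y] b(3) by (rule cr[OF lt(2,1) b(1,2)])
      next
        case False
        then have b: "\<not> is_black (X ! ?x)" "is_black (X ! ?y)" "b = ?y" using ne by (simp_all add: strand_black_def b_def)
        show ?thesis unfolding b(3) by (rule cr[OF lt b(1,2)])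
      qed
      show False
      proof (cases "y < 0")
        case True
        then have "strand_black X y" using comp ins by (auto simp: compatible_def)
        then have b: "b = ?y" using ne by (simp add: b_def)
        \<comment> \<open>The crossing \<open>s\<close> comes after this meeting with the mirror,
          hence so does the later crossing \<open>d\<close>.\<close>
        obtain t' where t': "t' \<in> mirror_times ?N ds ?y" "t' < s" using s(2) True by blast
        have "t' \<in> mirror_times ?N ?ds b" unfolding b by (rule subsetD[OF mirror_times_append' t'(1)])
        from bspec[OF conjunct2[OF c] this] have one: "card {s \<in> ?C. t' < s} \<le> 1" by (rule conjunct2)
        show False
          by (rule two_le_card[OF _ _ _ _ one, of s ?t]) (use fin st t t'(2) in auto)
      next
        case False
        then have pos: "0 < x" "0 < y" using yx rng by auto
        have no: "mirror_times ?N ds b = {}"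
          using mirror_times_sign[OF r ins(1)] mirror_times_sign[OF r ins(2)] pos by (auto simp: b_def)
        show False
        proof (cases "mirror_times ?N ?ds b = {}")
          case True
          show False by (rule two_le_card[OF fin st(1) t _ mp[OF conjunct1[OF c] True]]) (use st(2) in simp)
        next
          case False
          then obtain t' where t': "t' \<in> mirror_times ?N ?ds b" by blast
          \<comment> \<open>The black strand is still positive, so it meets the mirror only after
            \<open>d\<close>, and both crossings are on the way there.\<close>
          have "\<not> t' < ?t" using mirror_times_append[of t' ds ?N "d # es" b] t' no by blast
          moreover have "t' \<noteq> ?t" using t' Crossing by (auto simp: mirror_times_def)
          ultimately have lt': "?t < t'" by simp
          from bspec[OF conjunct2[OF c] t'] have one: "card {s \<in> ?C. s < t'} \<le> 1" by (rule conjunct1)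
          show False
            by (rule two_le_card[OF _ _ _ _ one, of s ?t]) (use fin st t lt' in auto)
        qed
      qed
    qed
  next
    case Mirror
    then obtain x B where xs: "?xs = x # B" "strand_black X x" using W(2) Wx by (cases ?xs) auto
    have "black_gens W d = [0]" using Mirror by simp
    then have nd: "\<not> hd ?bs < 0" using rb by (simp add: reduced_snoc)
    obtain b bs' where b: "?bs = b # bs'" "black_entry X b = x" using bst xs by (cases ?bs) auto
    then show False using nd bs[of b] sgn_black_entry[of b X] desc Mirror xs by simp
  qed
qed

lemma reduced_diagram_reduced:
  assumes X: "X = stendhal_word is \<kappa> \<Lambda>" and inv: "involutive_on \<tau> X" and n: "length is = length (black_word X)"
    and red: "reduced_diagram \<tau> \<Lambda> w is \<kappa> \<kappa>' ds"
  shows "reduced (length X) ds"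
proof -
  have dg: "is_diagram \<tau> X (stendhal_word (signed_act \<tau> w is) \<kappa>' \<Lambda>) ds"
    using red unfolding reduced_diagram_def Let_def X[symmetric] by blast
  have la: "list_all (in_range (length X)) ds" using is_diagram_state[OF inv dg] by simp
  have "ds = es @ fs \<Longrightarrow> reduced (length X) es" for es fs
  proof (induction es arbitrary: fs rule: rev_induct)
    case Nil
    show ?case by (rule reduced_Nil)
  next
    case (snoc d es)
    have "reduced (length X) es" using snoc.IH[of "d # fs"] snoc.prems by simp
    then show ?case using reduced_diagram_ascends[OF X inv n, of w \<kappa>' es d fs] red snoc.prems la by (simp add: reduced_snoc)
  qed
  then show ?thesis by simp
qed

lemma filter_merge_eqI:
  "map P xs = map P ys \<Longrightarrow> filter P xs = filter P ys \<Longrightarrow> filter (\<lambda>x. \<not> P x) xs = filter (\<lambda>x. \<not> P x) ys \<Longrightarrow> xs = ys"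
proof (induction xs arbitrary: ys)
  case (Cons x xs)
  then show ?case by (cases ys) (auto split: if_splits)
qed simp

lemma red_state:
  assumes "compatible X xs" "signed_list N xs"
  shows "set (filter (\<lambda>x. \<not> strand_black X x) xs) = {v \<in> {1..int N}. \<not> strand_black X v}"
proof (intro equalityI subsetI)
  fix x assume "x \<in> set (filter (\<lambda>x. \<not> strand_black X x) xs)"
  then have x: "x \<in> set xs" "\<not> strand_black X x" "0 < x" using assms(1) by (auto simp: compatible_def)
  have "\<bar>x\<bar> \<in> abs ` set xs" using x(1) by (rule imageI)
  then have "\<bar>x\<bar> \<in> {1..int N}" using assms(2) by (simp add: signed_list_def)
  then show "x \<in> {v \<in> {1..int N}. \<not> strand_black X v}" using x by simp
next
  fix v assume v: "v \<in> {v \<in> {1..int N}. \<not> strand_black X v}"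
  then have "v \<in> abs ` set xs" using assms(2) by (auto simp: signed_list_def)
  then obtain x where x: "x \<in> set xs" "v = \<bar>x\<bar>" by blast
  then have "\<not> strand_black X x" using v by (simp add: strand_black_def)
  then show "v \<in> set (filter (\<lambda>x. \<not> strand_black X x) xs)" using x assms(1) by (auto simp: compatible_def)
qed

text \<open>The common target fixes the colour pattern, the signed permutation fixes the black
  entries, and compatibility fixes the red ones, as they are positive and increasing.\<close>

lemma diagram_state_unique:
  assumes inv: "involutive_on \<tau> X" and ds: "is_diagram \<tau> X Y ds" and es: "is_diagram \<tau> X Y es"
    and w: "gens_perm (black_expression \<tau> X ds) = gens_perm (black_expression \<tau> X es)"
  shows "state (length X) ds = state (length X) es"
proof (rule filter_merge_eqI[of "strand_black X"])
  let ?N = "length X"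
  note D = is_diagram_state[OF inv ds] is_diagram_state[OF inv es]
  have pat: "map (strand_black X) xs = map is_black (map (strand_letter \<tau> X) xs)" for xs by simp
  show "map (strand_black X) (state ?N ds) = map (strand_black X) (state ?N es)"
    unfolding pat using D by metis
  show "filter (strand_black X) (state ?N ds) = filter (strand_black X) (state ?N es)"
    using black_state[OF inv ds] black_state[OF inv es] w
      state_one_line[of "black_expression \<tau> X ds" "length (black_word X)"] black_word_diagram[OF inv ds]
      state_one_line[of "black_expression \<tau> X es" "length (black_word X)"] black_word_diagram[OF inv es] by simp
  have c: "compatible X (state ?N ds)" "compatible X (state ?N es)"
    "signed_list ?N (state ?N ds)" "signed_list ?N (state ?N es)"
    using D signed_list_state by auto
  show "filter (\<lambda>x. \<not> strand_black X x) (state ?N ds) = filter (\<lambda>x. \<not> strand_black X x) (state ?N es)"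
    by (rule strict_sorted_equal)
      (use c in \<open>simp_all only: red_state[OF c(1,3)] red_state[OF c(2,4)]\<close>, simp_all add: compatible_def)
qed

section \<open>Stendhal words\<close>

fun blacks_before :: "'v wrd \<Rightarrow> nat list" where
  "blacks_before [] = []"
| "blacks_before (Black i # X) = map Suc (blacks_before X)"
| "blacks_before (Red \<theta> # X) = 0 # blacks_before X"

text \<open>Recovers \<kappa> from a word; the restriction makes it one of the extensional functions
  in \<open>red_placements\<close>.\<close>

definition placement :: "'v wrd \<Rightarrow> nat \<Rightarrow> nat" where
  "placement X = (\<lambda>r\<in>{1..length (red_letters X)}. blacks_before X ! (r - 1))"

lemma length_blacks_before: "length (blacks_before X) = length (red_letters X)"
  by (induction X rule: blacks_before.induct) auto

lemma blacks_before_append: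
  "blacks_before (X @ Y) = blacks_before X @ map ((+) (length (black_word X))) (blacks_before Y)"
  by (induction X rule: blacks_before.induct) (auto simp: black_word_def)

lemma red_letters_append: "red_letters (X @ Y) = red_letters X @ red_letters Y"
  by (induction X rule: red_letters.induct) auto

lemma blacks_before_sorted: "sorted (blacks_before X) \<and> (\<forall>k\<in>set (blacks_before X). k \<le> length (black_word X))"
  by (induction X rule: blacks_before.induct) (auto simp: black_word_def sorted_map sorted_wrt_map)

lemma word_eqI:
  "black_word X = black_word Y \<Longrightarrow> blacks_before X = blacks_before Y \<Longrightarrow> red_letters X = red_letters Y \<Longrightarrow> X = Y"
proof (induction X arbitrary: Y rule: blacks_before.induct)
  case 1
  then show ?case by (cases Y rule: blacks_before.cases) (auto simp: black_word_def)
next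
  case (2 i X)
  then show ?case by (cases Y rule: blacks_before.cases) (auto simp: black_word_def inj_map_eq_map Cons_eq_map_conv)
next
  case (3 \<theta> X)
  then show ?case by (cases Y rule: blacks_before.cases) (auto simp: black_word_def Cons_eq_map_conv)
qed

lemma objects_iff: "X \<in> objects Q \<longleftrightarrow> set (black_word X) \<subseteq> verts Q \<and> set (red_letters X) \<subseteq> dominant_weights Q"
  by (induction X rule: blacks_before.induct) (auto simp: black_word_def letters_def)

lemma filter_sorted_split:
  "sorted (map \<kappa> rs) \<Longrightarrow> filter (\<lambda>r. \<kappa> r < (m :: nat)) rs @ filter (\<lambda>r. \<kappa> r = m) rs = filter (\<lambda>r. \<kappa> r < Suc m) rs"
proof (induction rs)
  case (Cons r rs)
  have none: "filter (\<lambda>r. \<kappa> r < m) rs = []" if "m \<le> \<kappa> r"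
    using Cons.prems that by (fastforce simp: filter_empty_conv)
  have "\<kappa> r < m \<or> \<kappa> r = m \<or> m < \<kappa> r" by linarith
  then show ?case using Cons none by (auto simp: less_Suc_eq)
qed simp

text \<open>Stated for the first \<open>m\<close> blocks to allow induction; as \<kappa> is sorted,
  the red letters of the next block follow those counted so far.\<close>

lemma stendhal_word_blocks:
  fixes "is" \<Lambda>
  defines "block \<equiv> \<lambda>\<kappa> p. map (\<lambda>r. Red (\<Lambda> ! (r - 1))) (filter (\<lambda>r. \<kappa> r = p) [1..<Suc (length \<Lambda>)])
      @ (if p < length is then [Black (is ! p)] else [])"
  assumes srt: "sorted (map \<kappa> [1..<Suc (length \<Lambda>)])"
  shows "m \<le> Suc (length is) \<Longrightarrow>
    black_word (concat (map (block \<kappa>) [0..<m])) = take m is \<and>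
    red_letters (concat (map (block \<kappa>) [0..<m])) = map (\<lambda>r. \<Lambda> ! (r - 1)) (filter (\<lambda>r. \<kappa> r < m) [1..<Suc (length \<Lambda>)]) \<and>
    blacks_before (concat (map (block \<kappa>) [0..<m])) = map \<kappa> (filter (\<lambda>r. \<kappa> r < m) [1..<Suc (length \<Lambda>)])"
proof (induction m)
  case 0
  then show ?case by (simp add: black_word_def)
next
  case (Suc m)
  let ?rs = "[1..<Suc (length \<Lambda>)]"
  have reds: "black_word (map (\<lambda>r. Red (\<Lambda> ! (r - 1))) rs) = []"
    "red_letters (map (\<lambda>r. Red (\<Lambda> ! (r - 1))) rs) = map (\<lambda>r. \<Lambda> ! (r - 1)) rs"
    "blacks_before (map (\<lambda>r. Red (\<Lambda> ! (r - 1))) rs) = map (\<lambda>r. 0) rs" for rs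
    by (induction rs) (auto simp: black_word_def)
  have bl: "black_word (block \<kappa> m) = (if m < length is then [is ! m] else [])"
    "red_letters (block \<kappa> m) = map (\<lambda>r. \<Lambda> ! (r - 1)) (filter (\<lambda>r. \<kappa> r = m) ?rs)"
    "blacks_before (block \<kappa> m) = map (\<lambda>r. 0) (filter (\<lambda>r. \<kappa> r = m) ?rs)"
    unfolding block_def black_word_append red_letters_append blacks_before_append reds
    by (simp_all add: black_word_def del: upt_Suc One_nat_def)
  have len: "length (take m is) = m" using Suc.prems by simp
  have eq: "map (\<lambda>r. m) (filter (\<lambda>r. \<kappa> r = m) ?rs) = map \<kappa> (filter (\<lambda>r. \<kappa> r = m) ?rs)"
    by (rule map_cong[OF HOL.refl]) auto
  have IH: "black_word (concat (map (block \<kappa>) [0..<m])) = take m is"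
    "red_letters (concat (map (block \<kappa>) [0..<m])) = map (\<lambda>r. \<Lambda> ! (r - 1)) (filter (\<lambda>r. \<kappa> r < m) ?rs)"
    "blacks_before (concat (map (block \<kappa>) [0..<m])) = map \<kappa> (filter (\<lambda>r. \<kappa> r < m) ?rs)"
    using Suc.IH Suc.prems by auto
  have split: "concat (map (block \<kappa>) [0..<Suc m]) = concat (map (block \<kappa>) [0..<m]) @ block \<kappa> m" by simp
  show ?case unfolding split black_word_append red_letters_append blacks_before_append IH bl
      filter_sorted_split[OF srt, symmetric] map_append
    using len eq by (auto simp: take_Suc_conv_app_nth comp_def simp del: upt_Suc)
qed

lemma stendhal_word_invariants:
  assumes k: "\<kappa> \<in> red_placements (length \<Lambda>) (length is)"
  shows "black_word (stendhal_word is \<kappa> \<Lambda>) = is" "red_letters (stendhal_word is \<kappa> \<Lambda>) = \<Lambda>"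
    "blacks_before (stendhal_word is \<kappa> \<Lambda>) = map \<kappa> [1..<Suc (length \<Lambda>)]"
proof -
  have "sorted (map \<kappa> [1..<Suc (length \<Lambda>)])"
    using k by (auto simp: red_placements_def sorted_map mono_on_def sorted_wrt_iff_nth_less simp del: upt_Suc)
  note b = stendhal_word_blocks[OF this le_refl, of "is"]
  have "filter (\<lambda>r. \<kappa> r < Suc (length is)) [1..<Suc (length \<Lambda>)] = [1..<Suc (length \<Lambda>)]"
    unfolding filter_id_conv using k by (auto simp: red_placements_def less_Suc_eq_le simp del: upt_Suc)
  note b = b[unfolded this]
  have "map (\<lambda>r. \<Lambda> ! (r - 1)) [1..<Suc (length \<Lambda>)] = \<Lambda>"
    by (rule nth_equalityI) (simp_all del: upt_Suc)
  note b = b[unfolded this]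
  show "black_word (stendhal_word is \<kappa> \<Lambda>) = is" "red_letters (stendhal_word is \<kappa> \<Lambda>) = \<Lambda>"
    "blacks_before (stendhal_word is \<kappa> \<Lambda>) = map \<kappa> [1..<Suc (length \<Lambda>)]"
    unfolding stendhal_word_def using b by simp_all
qed

lemma placement_stendhal_word:
  assumes k: "\<kappa> \<in> red_placements (length \<Lambda>) (length is)"
  shows "placement (stendhal_word is \<kappa> \<Lambda>) = \<kappa>"
proof
  fix r
  show "placement (stendhal_word is \<kappa> \<Lambda>) r = \<kappa> r"
    unfolding placement_def stendhal_word_invariants[OF k]
    using k by (auto simp: red_placements_def PiE_def extensional_def restrict_def simp del: upt_Suc)
qed

lemma placement_in: "placement X \<in> red_placements (length (red_letters X)) (length (black_word X))"
proof -
  note s = blacks_before_sorted[of X]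
  have "mono_on {1..length (red_letters X)} (placement X)"
    using s by (auto simp: mono_on_def placement_def length_blacks_before intro!: sorted_nth_mono)
  moreover have "blacks_before X ! (r - 1) \<le> length (black_word X)" if "1 \<le> r" "r \<le> length (red_letters X)" for r
    using s that nth_mem[of "r - 1" "blacks_before X"] by (simp add: length_blacks_before)
  ultimately show ?thesis by (auto simp: red_placements_def placement_def)
qed

lemma stendhal_word_placement: "stendhal_word (black_word X) (placement X) (red_letters X) = X"
proof (rule word_eqI)
  note i = stendhal_word_invariants[OF placement_in[of X]]
  show "black_word (stendhal_word (black_word X) (placement X) (red_letters X)) = black_word X"
    "red_letters (stendhal_word (black_word X) (placement X) (red_letters X)) = red_letters X" using i by auto
  show "blacks_before (stendhal_word (black_word X) (placement X) (red_letters X)) = blacks_before X"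
    unfolding i(3) by (rule nth_equalityI) (simp_all add: placement_def length_blacks_before del: upt_Suc)
qed

lemma length_signed_act [simp]: "length (signed_act \<tau> w is) = length is"
  by (simp add: signed_act_def del: upt_Suc)

section \<open>The basis of the oKLRW algebra\<close>

lemma carrier_algebra:
  "v \<in> carrier (oKLRW_algebra Q \<tau> \<mu> \<Lambda> :: ('k :: field, 'v wrd \<times> 'v wrd \<Rightarrow> ('v, 'k) mor set) module) \<longleftrightarrow>
    v \<in> (\<Pi>\<^sub>E (X, Y)\<in>objects_over Q \<Lambda> \<times> objects_over Q \<Lambda>. carrier (Hom Q \<tau> \<mu> X Y)) \<and>
    finite {(X, Y). X \<in> objects_over Q \<Lambda> \<and> Y \<in> objects_over Q \<Lambda> \<and> v (X, Y) \<noteq> \<zero>\<^bsub>(Hom Q \<tau> \<mu> X Y :: ('k, ('v, 'k) mor set) module)\<^esub>}"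
proof -
  have "{i \<in> I \<times> I. v i \<noteq> \<zero>\<^bsub>(case i of (X, Y) \<Rightarrow> (Hom Q \<tau> \<mu> X Y :: ('k, ('v, 'k) mor set) module))\<^esub>} =
      {(X, Y). X \<in> I \<and> Y \<in> I \<and> v (X, Y) \<noteq> \<zero>\<^bsub>(Hom Q \<tau> \<mu> X Y :: ('k, ('v, 'k) mor set) module)\<^esub>}" for I
    by auto
  moreover have "(\<Pi>\<^sub>E i\<in>I. carrier (case i of (X, Y) \<Rightarrow> (Hom Q \<tau> \<mu> X Y :: ('k, ('v, 'k) mor set) module))) =
      (\<Pi>\<^sub>E (X, Y)\<in>I. carrier (Hom Q \<tau> \<mu> X Y))" for I
    by (rule PiE_cong) auto
  ultimately show ?thesis by (simp add: oKLRW_algebra_def module_direct_sum_def)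
qed

context oklrw
begin

abbreviation algebra :: "'v weight list \<Rightarrow> ('k, 'v wrd \<times> 'v wrd \<Rightarrow> ('v, 'k) mor set) module" where
  "algebra \<equiv> oKLRW_algebra Q \<tau> \<mu>"

abbreviation arrow_class :: "'v wrd \<Rightarrow> 'v wrd \<Rightarrow> ('v, 'k) mor \<Rightarrow> ('v, 'k) mor set" where
  "arrow_class \<equiv> mor_class Q \<tau> \<mu>"

abbreviation element :: "'v weight list \<Rightarrow> 'v wrd \<Rightarrow> 'v wrd \<Rightarrow> ('v, 'k) mor \<Rightarrow> 'v wrd \<times> 'v wrd \<Rightarrow> ('v, 'k) mor set" where
  "element \<equiv> algebra_element Q \<tau> \<mu>"

lemma carrier_component:
  assumes "v \<in> carrier (algebra \<Lambda>)" "X \<in> objects_over Q \<Lambda>" "Y \<in> objects_over Q \<Lambda>"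
  obtains f where "arrow oKLRW X Y f" "v (X, Y) = arrow_class X Y f"
proof -
  have "v (X, Y) \<in> carrier (Hom Q \<tau> \<mu> X Y)" using assms PiE_mem[of v _ _ "(X, Y)"] unfolding carrier_algebra by blast
  then show ?thesis using that by (elim Hom_carrierE)
qed

lemma algebra_component:
  assumes "X \<in> objects_over Q \<Lambda>" "Y \<in> objects_over Q \<Lambda>"
  shows "(v \<oplus>\<^bsub>algebra \<Lambda>\<^esub> u) (X, Y) = v (X, Y) \<oplus>\<^bsub>Hom Q \<tau> \<mu> X Y\<^esub> u (X, Y)"
    "(a \<odot>\<^bsub>algebra \<Lambda>\<^esub> v) (X, Y) = a \<odot>\<^bsub>Hom Q \<tau> \<mu> X Y\<^esub> v (X, Y)"
    "\<zero>\<^bsub>algebra \<Lambda>\<^esub> (X, Y) = arrow_class X Y (Zero X Y)"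
  using assms by (simp_all add: oKLRW_algebra_def module_direct_sum_def zero_Hom)

lemma algebra_eqI:
  assumes "v \<in> carrier (algebra \<Lambda>)" "u \<in> carrier (algebra \<Lambda>)"
    "\<And>X Y. X \<in> objects_over Q \<Lambda> \<Longrightarrow> Y \<in> objects_over Q \<Lambda> \<Longrightarrow> v (X, Y) = u (X, Y)"
  shows "v = u"
  using assms(1,2) unfolding carrier_algebra by (elim conjE) (rule PiE_ext, assumption+, use assms(3) in auto)

lemma element_component:
  assumes "X' \<in> objects_over Q \<Lambda>" "Y' \<in> objects_over Q \<Lambda>"
  shows "element \<Lambda> X Y f (X', Y') = (if X' = X \<and> Y' = Y then arrow_class X Y f else arrow_class X' Y' (Zero X' Y'))"
  using assms by (auto simp: algebra_element_def direct_sum_incl_def zero_Hom)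

lemma objects_overD: "X \<in> objects_over Q \<Lambda> \<Longrightarrow> X \<in> objects Q"
  by (simp add: objects_over_def)

lemma element_carrier:
  assumes f: "arrow oKLRW X Y f" and XY: "X \<in> objects_over Q \<Lambda>" "Y \<in> objects_over Q \<Lambda>"
  shows "element \<Lambda> X Y f \<in> carrier (algebra \<Lambda>)"
  unfolding carrier_algebra
proof
  have c: "element \<Lambda> X Y f (X', Y') \<in> carrier (Hom Q \<tau> \<mu> X' Y')"
    if "X' \<in> objects_over Q \<Lambda>" "Y' \<in> objects_over Q \<Lambda>" for X' Y'
    unfolding element_component[OF that] using f that
    by (auto intro!: mor_class_carrier is_mor.zero dest: objects_overD)
  show "element \<Lambda> X Y f \<in> (\<Pi>\<^sub>E (X, Y)\<in>objects_over Q \<Lambda> \<times> objects_over Q \<Lambda>. carrier (Hom Q \<tau> \<mu> X Y))"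
  proof (rule PiE_I)
    fix i assume "i \<in> objects_over Q \<Lambda> \<times> objects_over Q \<Lambda>"
    then show "element \<Lambda> X Y f i \<in> (case i of (X, Y) \<Rightarrow> carrier (Hom Q \<tau> \<mu> X Y))" using c by (cases i) simp
  qed (simp add: algebra_element_def direct_sum_incl_def)
  have "{(X', Y'). X' \<in> objects_over Q \<Lambda> \<and> Y' \<in> objects_over Q \<Lambda> \<and> element \<Lambda> X Y f (X', Y') \<noteq> \<zero>\<^bsub>Hom Q \<tau> \<mu> X' Y'\<^esub>} \<subseteq> {(X, Y)}"
    by (auto simp: element_component zero_Hom split: if_splits)
  then show "finite {(X', Y'). X' \<in> objects_over Q \<Lambda> \<and> Y' \<in> objects_over Q \<Lambda> \<and> element \<Lambda> X Y f (X', Y') \<noteq> \<zero>\<^bsub>Hom Q \<tau> \<mu> X' Y'\<^esub>}"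
    by (rule finite_subset) simp
qed

lemma algebra_space: "vectorspace class_ring (algebra \<Lambda>)"
  by (rule vectorspace_oKLRW_algebra)

lemma algebra_module: "module class_ring (algebra \<Lambda>)"
  using algebra_space by (simp add: vectorspace_def)

lemma algebra_closed:
  "v \<in> carrier (algebra \<Lambda>) \<Longrightarrow> u \<in> carrier (algebra \<Lambda>) \<Longrightarrow> v \<oplus>\<^bsub>algebra \<Lambda>\<^esub> u \<in> carrier (algebra \<Lambda>)"
  "v \<in> carrier (algebra \<Lambda>) \<Longrightarrow> a \<odot>\<^bsub>algebra \<Lambda>\<^esub> v \<in> carrier (algebra \<Lambda>)"
  "\<zero>\<^bsub>algebra \<Lambda>\<^esub> \<in> carrier (algebra \<Lambda>)"
proof -
  interpret M: module class_ring "algebra \<Lambda>" by (rule algebra_module)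
  show "v \<in> carrier (algebra \<Lambda>) \<Longrightarrow> u \<in> carrier (algebra \<Lambda>) \<Longrightarrow> v \<oplus>\<^bsub>algebra \<Lambda>\<^esub> u \<in> carrier (algebra \<Lambda>)"
    "v \<in> carrier (algebra \<Lambda>) \<Longrightarrow> a \<odot>\<^bsub>algebra \<Lambda>\<^esub> v \<in> carrier (algebra \<Lambda>)"
    "\<zero>\<^bsub>algebra \<Lambda>\<^esub> \<in> carrier (algebra \<Lambda>)"
    using M.smult_closed[of a v] by auto
qed

lemma zero_plus_zero: "X \<in> objects Q \<Longrightarrow> Y \<in> objects Q \<Longrightarrow>
    arrow_class X Y (Zero X Y +\<^sub>k Zero X Y) = arrow_class X Y (Zero X Y)"
  by (rule mor_class_eqI[OF plus_Zero[OF is_mor.zero]])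

lemma scale_zero: "X \<in> objects Q \<Longrightarrow> Y \<in> objects Q \<Longrightarrow>
    arrow_class X Y (a *\<^sub>k Zero X Y) = arrow_class X Y (Zero X Y)"
  by (rule mor_class_eqI[OF scale_Zero])

lemma element_plus:
  assumes f: "arrow oKLRW X Y f" "arrow oKLRW X Y g" and XY: "X \<in> objects_over Q \<Lambda>" "Y \<in> objects_over Q \<Lambda>"
  shows "element \<Lambda> X Y (f +\<^sub>k g) = element \<Lambda> X Y f \<oplus>\<^bsub>algebra \<Lambda>\<^esub> element \<Lambda> X Y g"
proof (rule algebra_eqI[OF element_carrier[OF is_mor.plus[OF f] XY] algebra_closed(1)[OF element_carrier[OF f(1) XY] element_carrier[OF f(2) XY]]])
  fix X' Y' assume i: "X' \<in> objects_over Q \<Lambda>" "Y' \<in> objects_over Q \<Lambda>"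
  then have o: "X' \<in> objects Q" "Y' \<in> objects Q" by (auto dest: objects_overD)
  show "element \<Lambda> X Y (f +\<^sub>k g) (X', Y') = (element \<Lambda> X Y f \<oplus>\<^bsub>algebra \<Lambda>\<^esub> element \<Lambda> X Y g) (X', Y')"
    unfolding algebra_component[OF i] element_component[OF i]
    by (auto simp: add_mor_class[OF f] add_mor_class[OF is_mor.zero[OF o] is_mor.zero[OF o]] zero_plus_zero[OF o])
qed

lemma element_scale:
  assumes f: "arrow oKLRW X Y f" and XY: "X \<in> objects_over Q \<Lambda>" "Y \<in> objects_over Q \<Lambda>"
  shows "element \<Lambda> X Y (a *\<^sub>k f) = a \<odot>\<^bsub>algebra \<Lambda>\<^esub> element \<Lambda> X Y f"
proof (rule algebra_eqI[OF element_carrier[OF is_mor.scale[OF f] XY] algebra_closed(2)[OF element_carrier[OF f XY]]])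
  fix X' Y' assume i: "X' \<in> objects_over Q \<Lambda>" "Y' \<in> objects_over Q \<Lambda>"
  then have o: "X' \<in> objects Q" "Y' \<in> objects Q" by (auto dest: objects_overD)
  show "element \<Lambda> X Y (a *\<^sub>k f) (X', Y') = (a \<odot>\<^bsub>algebra \<Lambda>\<^esub> element \<Lambda> X Y f) (X', Y')"
    unfolding algebra_component[OF i] element_component[OF i]
    by (auto simp: smult_mor_class[OF f] smult_mor_class[OF is_mor.zero[OF o]] scale_zero[OF o])
qed

lemma element_zero:
  assumes XY: "X \<in> objects_over Q \<Lambda>" "Y \<in> objects_over Q \<Lambda>"
  shows "element \<Lambda> X Y (Zero X Y) = \<zero>\<^bsub>algebra \<Lambda>\<^esub>"
proof (rule algebra_eqI[OF element_carrier[OF is_mor.zero XY] algebra_closed(3)])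
  show "X \<in> objects Q" "Y \<in> objects Q" using XY by (auto dest: objects_overD)
  fix X' Y' assume i: "X' \<in> objects_over Q \<Lambda>" "Y' \<in> objects_over Q \<Lambda>"
  show "element \<Lambda> X Y (Zero X Y) (X', Y') = \<zero>\<^bsub>algebra \<Lambda>\<^esub> (X', Y')"
    unfolding algebra_component[OF i] element_component[OF i] by auto
qed

lemma lin_span_element:
  assumes N: "submodule class_ring N (algebra \<Lambda>)" and XY: "X \<in> objects_over Q \<Lambda>" "Y \<in> objects_over Q \<Lambda>"
    and S: "\<And>f. f \<in> S \<Longrightarrow> arrow oKLRW X Y f \<Longrightarrow> element \<Lambda> X Y f \<in> N"
  shows "lin_span S X Y f \<Longrightarrow> element \<Lambda> X Y f \<in> N"
proof (induction rule: lin_span.induct)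
  case (gen f)
  then show ?case by (rule S)
next
  case zero
  show ?case unfolding element_zero[OF XY] by (rule submodule.zero_closed[OF N])
next
  case (plus f g)
  show ?case unfolding element_plus[OF lin_span_arrow[OF plus.hyps(1)] lin_span_arrow[OF plus.hyps(2)] XY]
    by (rule submodule.m_closed[OF N plus.IH])
next
  case (scale f a)
  show ?case unfolding element_scale[OF lin_span_arrow[OF scale.hyps] XY]
    by (rule submodule.smult_closed[OF N _ scale.IH]) simp
next
  case (equiv f g)
  then show ?case using mor_class_eqI[OF equiv.hyps(2)] by (simp add: algebra_element_def)
qed

text \<open>Induction over a finite set containing the support; one component is split off at each
  step.\<close>

lemma elements_generate:
  assumes N: "submodule class_ring N (algebra \<Lambda>)"
    and S: "\<And>X Y f. X \<in> objects_over Q \<Lambda> \<Longrightarrow> Y \<in> objects_over Q \<Lambda> \<Longrightarrow> arrow oKLRW X Y f \<Longrightarrow> element \<Lambda> X Y f \<in> N"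
  shows "carrier (algebra \<Lambda>) \<subseteq> N"
proof
  let ?supp = "\<lambda>v. {(X, Y). X \<in> objects_over Q \<Lambda> \<and> Y \<in> objects_over Q \<Lambda> \<and> v (X, Y) \<noteq> \<zero>\<^bsub>(Hom Q \<tau> \<mu> X Y :: ('k, ('v, 'k) mor set) module)\<^esub>}"
  fix v assume v: "v \<in> carrier (algebra \<Lambda>)"
  have "finite J \<Longrightarrow> v \<in> carrier (algebra \<Lambda>) \<Longrightarrow> ?supp v \<subseteq> J \<Longrightarrow> v \<in> N" for J v
  proof (induction J arbitrary: v rule: finite_induct)
    case empty
    have "v = \<zero>\<^bsub>algebra \<Lambda>\<^esub>"
      by (rule algebra_eqI[OF empty.prems(1) algebra_closed(3)]) (use empty.prems(2) in \<open>auto simp: algebra_component zero_Hom\<close>)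
    then show ?case using submodule.zero_closed[OF N] by simp
  next
    case (insert j J)
    obtain X Y where j: "j = (X, Y)" by (cases j)
    show ?case
    proof (cases "X \<in> objects_over Q \<Lambda> \<and> Y \<in> objects_over Q \<Lambda>")
      case False
      then have "?supp v \<subseteq> J" using insert.prems(2) j by auto
      then show ?thesis using insert by blast
    next
      case True
      then have XY: "X \<in> objects_over Q \<Lambda>" "Y \<in> objects_over Q \<Lambda>" by auto
      then have o: "X \<in> objects Q" "Y \<in> objects Q" by (auto dest: objects_overD)
      obtain f where f: "arrow oKLRW X Y f" "v (X, Y) = arrow_class X Y f"
        by (rule carrier_component[OF insert.prems(1) XY])
      define v' where "v' = v(j := arrow_class X Y (Zero X Y))"
      have supp: "?supp v' \<subseteq> ?supp v - {j}" by (auto simp: v'_def j zero_Hom split: if_splits)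
      have v': "v' \<in> carrier (algebra \<Lambda>)"
        unfolding carrier_algebra
      proof
        have "v \<in> (\<Pi>\<^sub>E (X, Y)\<in>objects_over Q \<Lambda> \<times> objects_over Q \<Lambda>. carrier (Hom Q \<tau> \<mu> X Y))"
          using insert.prems(1) unfolding carrier_algebra by blast
        from PiE_fun_upd[OF _ this, of "arrow_class X Y (Zero X Y)" "(X, Y)"]
        show "v' \<in> (\<Pi>\<^sub>E (X, Y)\<in>objects_over Q \<Lambda> \<times> objects_over Q \<Lambda>. carrier (Hom Q \<tau> \<mu> X Y))"
          using XY o by (simp add: v'_def j mor_class_carrier is_mor.zero insert_absorb)
        show "finite (?supp v')" using insert.prems(1) finite_subset[OF supp] unfolding carrier_algebra by blast
      qed
      have "v' \<in> N" by (rule insert.IH[OF v']) (use supp insert.prems(2) in blast)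
      moreover have "v = v' \<oplus>\<^bsub>algebra \<Lambda>\<^esub> element \<Lambda> X Y f"
      proof (rule algebra_eqI[OF insert.prems(1) algebra_closed(1)[OF v' element_carrier[OF f(1) XY]]])
        fix X' Y' assume i: "X' \<in> objects_over Q \<Lambda>" "Y' \<in> objects_over Q \<Lambda>"
        then have o': "X' \<in> objects Q" "Y' \<in> objects Q" by (auto dest: objects_overD)
        show "v (X', Y') = (v' \<oplus>\<^bsub>algebra \<Lambda>\<^esub> element \<Lambda> X Y f) (X', Y')"
        proof (cases "X' = X \<and> Y' = Y")
          case True
          have "arrow_class X Y (Zero X Y +\<^sub>k f) = arrow_class X Y f"
            by (rule mor_class_eqI[OF mor_eq.trans[OF mor_eq.linear_monoidal[OF linear_monoidal_rel.plus_comm] plus_Zero]])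
              (use f(1) o in \<open>auto intro: is_mor.zero is_mor.plus\<close>)
          then show ?thesis using True XY f(2) add_mor_class[OF is_mor.zero[OF o] f(1)]
            by (simp add: algebra_component element_component v'_def j)
        next
          case False
          obtain g where g: "arrow oKLRW X' Y' g" "v (X', Y') = arrow_class X' Y' g"
            by (rule carrier_component[OF insert.prems(1) i])
          have "v' (X', Y') = arrow_class X' Y' g" using False g(2) by (auto simp: v'_def j)
          moreover have "arrow_class X' Y' (g +\<^sub>k Zero X' Y') = arrow_class X' Y' g"
            by (rule mor_class_eqI[OF plus_Zero[OF g(1)]])
          ultimately show ?thesis using False g i add_mor_class[OF g(1) is_mor.zero[OF o']]
            by (auto simp: algebra_component element_component)
        qed
      qed
      ultimately show ?thesis using submodule.m_closed[OF N] S[OF XY f(1)] by simp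
    qed
  qed
  then show "v \<in> N" using v unfolding carrier_algebra by blast
qed

text \<open>The representative chosen by \<open>SOME\<close> does not matter at generic points of
  the right length, by \<open>rep_eqv\<close>.\<close>

definition component_value :: "'v wrd \<Rightarrow> 'v wrd \<Rightarrow> ('k list \<Rightarrow> 'k) \<Rightarrow> 'k list \<Rightarrow>
    ('v wrd \<times> 'v wrd \<Rightarrow> ('v, 'k) mor set) \<Rightarrow> 'k" where
  "component_value X Y F y v = rep Q \<tau> \<mu> (SOME f. f \<in> v (X, Y)) F y"

lemma component_value_class:
  assumes "arrow oKLRW X Y f" "v (X, Y) = arrow_class X Y f" "generic y" "length y = length (black_word Y)"
  shows "component_value X Y F y v = rep Q \<tau> \<mu> f F y"
proof -
  have "f \<in> v (X, Y)" using assms by (simp add: mor_class_def mor_rel_def mor_eq.refl)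
  then have "(SOME g. g \<in> v (X, Y)) \<in> v (X, Y)" by (rule someI)
  then have "eqv oKLRW X Y f (SOME g. g \<in> v (X, Y))" using assms(2) by (simp add: mor_class_def mor_rel_def)
  from rep_eqv[OF involutive_quiver_axioms this assms(3)] assms(4) show ?thesis
    by (simp add: component_value_def length_black_word)
qed

lemma component_value_sum:
  assumes XY: "X \<in> objects_over Q \<Lambda>" "Y \<in> objects_over Q \<Lambda>"
    and y: "generic y" "length y = length (black_word Y)"
  shows "finite A \<Longrightarrow> A \<subseteq> carrier (algebra \<Lambda>) \<Longrightarrow>
    component_value X Y F y (module.lincomb (algebra \<Lambda>) a A) = (\<Sum>v\<in>A. a v * component_value X Y F y v)"
proof (induction A rule: finite_induct)
  interpret M: module class_ring "algebra \<Lambda>" by (rule algebra_module)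
  have o: "X \<in> objects Q" "Y \<in> objects Q" using XY by (auto dest: objects_overD)
  {
    case empty
    have "component_value X Y F y \<zero>\<^bsub>algebra \<Lambda>\<^esub> = rep Q \<tau> \<mu> (Zero X Y) F y"
      by (rule component_value_class[where v = "\<zero>\<^bsub>algebra \<Lambda>\<^esub>", OF is_mor.zero[OF o] algebra_component(3)[OF XY] y])
    then show ?case by (simp add: M.lincomb_def)
  next
    case (insert v A)
    have v: "v \<in> carrier (algebra \<Lambda>)" and A: "A \<subseteq> carrier (algebra \<Lambda>)" using insert.prems by auto
    have l: "M.lincomb a A \<in> carrier (algebra \<Lambda>)" by (rule M.lincomb_closed[OF A]) simp
    have e: "M.lincomb a (insert v A) = a v \<odot>\<^bsub>algebra \<Lambda>\<^esub> v \<oplus>\<^bsub>algebra \<Lambda>\<^esub> M.lincomb a A"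
      unfolding M.lincomb_def using insert.hyps v A by (subst M.finsum_insert) auto
    obtain f where f: "arrow oKLRW X Y f" "v (X, Y) = arrow_class X Y f" by (rule carrier_component[OF v XY])
    obtain g where g: "arrow oKLRW X Y g" "M.lincomb a A (X, Y) = arrow_class X Y g" by (rule carrier_component[OF l XY])
    have sf: "arrow oKLRW X Y (a v *\<^sub>k f)" by (rule is_mor.scale[OF f(1)])
    have "component_value X Y F y (M.lincomb a (insert v A)) = rep Q \<tau> \<mu> (a v *\<^sub>k f +\<^sub>k g) F y"
      by (rule component_value_class[where v = "M.lincomb a (insert v A)", OF is_mor.plus[OF sf g(1)] _ y])
        (simp only: e algebra_component[OF XY] f(2) g(2) smult_mor_class[OF f(1)] add_mor_class[OF sf g(1)])
    also have "\<dots> = a v * component_value X Y F y v + component_value X Y F y (M.lincomb a A)"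
      using component_value_class[where v = v, OF f y] component_value_class[where v = "M.lincomb a A", OF g y] by simp
    finally show ?case using insert A by simp
  }
qed

end

section \<open>The chosen diagrams span and are independent\<close>

locale diagram_choice = oklrw Q \<tau> \<tau>\<^sub>1 \<mu> scalars
  for Q :: "('v, 'a) pre_digraph" and \<tau> :: "'v \<Rightarrow> 'v" and \<tau>\<^sub>1 :: "'a \<Rightarrow> 'a"
    and \<mu> :: "'v weight" and scalars :: "'k :: field itself" +
  fixes \<Lambda> :: "'v weight list" and D :: "(int \<Rightarrow> int) \<Rightarrow> 'v list \<Rightarrow> (nat \<Rightarrow> nat) \<Rightarrow> (nat \<Rightarrow> nat) \<Rightarrow> diagram"
  assumes weights: "set \<Lambda> \<subseteq> dominant_weights Q"
    and chosen_reduced: "\<lbrakk>w \<in> signed_perms (length is); set is \<subseteq> verts Q;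
           \<kappa> \<in> red_placements (length \<Lambda>) (length is); \<kappa>' \<in> red_placements (length \<Lambda>) (length is)\<rbrakk>
         \<Longrightarrow> reduced_diagram \<tau> \<Lambda> w is \<kappa> \<kappa>' (D w is \<kappa> \<kappa>')"
begin

definition member :: "(int \<Rightarrow> int) \<times> 'v list \<times> (nat \<Rightarrow> nat) \<times> (nat \<Rightarrow> nat) \<times> nat list \<Rightarrow>
    'v wrd \<times> 'v wrd \<Rightarrow> ('v, 'k) mor set" where
  "member = (\<lambda>(w, is, \<kappa>, \<kappa>', as). basis_element Q \<tau> \<mu> \<Lambda> (D w is \<kappa> \<kappa>') w is \<kappa> \<kappa>' as)"

lemma stendhal_word_objects:
  assumes "set is \<subseteq> verts Q" "\<kappa> \<in> red_placements (length \<Lambda>) (length is)"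
  shows "stendhal_word is \<kappa> \<Lambda> \<in> objects_over Q \<Lambda>"
  using assms weights by (simp add: objects_over_def objects_iff[unfolded in_lists_conv_set] objects_iff stendhal_word_invariants del: in_listsI)

lemma chosen_diagram:
  assumes i: "(w, is, \<kappa>, \<kappa>', as) \<in> basis_index Q (length \<Lambda>)"
    and X: "X = stendhal_word is \<kappa> \<Lambda>" and Y: "Y = stendhal_word (signed_act \<tau> w is) \<kappa>' \<Lambda>"
  shows "X \<in> objects_over Q \<Lambda>" "Y \<in> objects_over Q \<Lambda>" "black_word X = is" "black_word Y = signed_act \<tau> w is"
    "is_diagram \<tau> X Y (D w is \<kappa> \<kappa>')" "reduced_expression (length is) (black_expression \<tau> X (D w is \<kappa> \<kappa>')) w"
    "reduced (length X) (D w is \<kappa> \<kappa>')" "length as = length (black_positions X)"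
    "arrow oKLRW X Y (diagram_mor \<tau> X (D w is \<kappa> \<kappa>') \<circ>\<^sub>k dot_monomial X as)"
    "placement X = \<kappa>" "placement Y = \<kappa>'"
proof -
  have idx: "set is \<subseteq> verts Q" "w \<in> signed_perms (length is)" "\<kappa> \<in> red_placements (length \<Lambda>) (length is)"
      "\<kappa>' \<in> red_placements (length \<Lambda>) (length is)" "length as = length is" using i by (auto simp: basis_index_def)
  have k': "\<kappa>' \<in> red_placements (length \<Lambda>) (length (signed_act \<tau> w is))" using idx by simp
  show X': "X \<in> objects_over Q \<Lambda>" unfolding X by (rule stendhal_word_objects[OF idx(1,3)])
  show bX: "black_word X = is" and bY: "black_word Y = signed_act \<tau> w is"
    unfolding X Y by (rule stendhal_word_invariants(1)[OF idx(3)], rule stendhal_word_invariants(1)[OF k'])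
  show "placement X = \<kappa>" "placement Y = \<kappa>'"
    unfolding X Y by (rule placement_stendhal_word[OF idx(3)], rule placement_stendhal_word[OF k'])
  note red = chosen_reduced[OF idx(2,1,3,4)]
  show dg: "is_diagram \<tau> X Y (D w is \<kappa> \<kappa>')" and "reduced_expression (length is) (black_expression \<tau> X (D w is \<kappa> \<kappa>')) w"
    using red unfolding reduced_diagram_def Let_def X Y by blast+
  have o: "X \<in> objects Q" using X' by (rule objects_overD)
  show l: "length as = length (black_positions X)"
    using idx(5) bX by (simp add: length_black_positions length_black_word[symmetric])
  show ar: "arrow oKLRW X Y (diagram_mor \<tau> X (D w is \<kappa> \<kappa>') \<circ>\<^sub>k dot_monomial X as)"
    by (rule is_mor.compose[OF arrow_dot_monomial[OF o l] arrow_diagram[OF dg o]])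
  have "Y \<in> objects Q" using arrow_objects[OF ar] by blast
  moreover have "red_letters Y = \<Lambda>" unfolding Y by (rule stendhal_word_invariants(2)[OF k'])
  ultimately show "Y \<in> objects_over Q \<Lambda>" by (simp add: objects_over_def)
  show "reduced (length X) (D w is \<kappa> \<kappa>')"
    by (rule reduced_diagram_reduced[OF X involutive_on_objects[OF o] _ red]) (simp add: bX)
qed

lemma member_element:
  "member (w, is, \<kappa>, \<kappa>', as) = element \<Lambda> (stendhal_word is \<kappa> \<Lambda>) (stendhal_word (signed_act \<tau> w is) \<kappa>' \<Lambda>)
    (diagram_mor \<tau> (stendhal_word is \<kappa> \<Lambda>) (D w is \<kappa> \<kappa>') \<circ>\<^sub>k dot_monomial (stendhal_word is \<kappa> \<Lambda>) as)"
  by (simp add: member_def basis_element_def Let_def)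

lemma members_carrier: "member ` basis_index Q (length \<Lambda>) \<subseteq> carrier (algebra \<Lambda>)"
proof (clarify)
  fix w "is" \<kappa> \<kappa>' as assume i: "(w, is, \<kappa>, \<kappa>', as) \<in> basis_index Q (length \<Lambda>)"
  note c = chosen_diagram[OF i HOL.refl HOL.refl]
  show "member (w, is, \<kappa>, \<kappa>', as) \<in> carrier (algebra \<Lambda>)"
    unfolding member_element by (rule element_carrier[OF c(9,1,2)])
qed

text \<open>Source, target and permutation determine the state
  (\<open>diagram_state_unique\<close>). The diagram chosen for the permutation of any given diagram
  can therefore serve as its representative in \<open>reduced_diagrams_span\<close>.\<close>

lemma members_span: "carrier (algebra \<Lambda>) \<subseteq> module.span class_ring (algebra \<Lambda>) (member ` basis_index Q (length \<Lambda>))"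
proof (rule elements_generate)
  interpret M: module class_ring "algebra \<Lambda>" by (rule algebra_module)
  let ?B = "member ` basis_index Q (length \<Lambda>)"
  show sub: "submodule class_ring (M.span ?B) (algebra \<Lambda>)" by (rule M.span_is_submodule[OF members_carrier])
  fix X Y f assume XY: "X \<in> objects_over Q \<Lambda>" "Y \<in> objects_over Q \<Lambda>" and f: "arrow oKLRW X Y f"
  have o: "X \<in> objects Q" "Y \<in> objects Q" using XY by (auto dest: objects_overD)
  have rl: "red_letters X = \<Lambda>" "red_letters Y = \<Lambda>" using XY by (auto simp: objects_over_def)
  have vs: "set (black_word X) \<subseteq> verts Q" using o(1) unfolding objects_iff by blast
  note inv = involutive_on_objects[OF o(1)]
  let ?is = "black_word X"
  let ?D = "\<lambda>w. D w ?is (placement X) (placement Y)"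
  have idx: "(w, ?is, placement X, placement Y, as) \<in> basis_index Q (length \<Lambda>)"
    if "w \<in> signed_perms (length ?is)" "black_word Y = signed_act \<tau> w ?is" "length as = length ?is" for w as
    using that vs placement_in[of X] placement_in[of Y] rl by (simp add: basis_index_def)
  have tgt: "Y = stendhal_word (signed_act \<tau> w ?is) (placement Y) \<Lambda>" if "black_word Y = signed_act \<tau> w ?is" for w
    using stendhal_word_placement[of Y] rl that by simp
  have src: "X = stendhal_word ?is (placement X) \<Lambda>" using stendhal_word_placement[of X] rl by simp
  let ?C = "{?D w | w. w \<in> signed_perms (length ?is) \<and> black_word Y = signed_act \<tau> w ?is}"
  have "lin_span {diagram_mor \<tau> X es \<circ>\<^sub>k dot_monomial X as | es as.
      es \<in> ?C \<and> is_diagram \<tau> X Y es \<and> length as = length (black_positions X)} X Y f"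
  proof (rule reduced_diagrams_span[OF o(1) _ f])
    fix ds assume ds: "reduced (length X) ds" "is_diagram \<tau> X Y ds"
    let ?w = "gens_perm (black_expression \<tau> X ds)"
    note bw = black_word_diagram[OF inv ds(2)]
    have w: "?w \<in> signed_perms (length ?is)" "black_word Y = signed_act \<tau> ?w ?is"
      using bw gens_perm_perm by auto
    \<comment> \<open>The zero exponents are arbitrary: only facts about the diagram itself are
      taken from here.\<close>
    note c = chosen_diagram[OF idx[OF w, of "replicate (length ?is) 0", simplified] src tgt[OF w(2)]]
    have "gens_perm (black_expression \<tau> X (?D ?w)) = ?w" using c(6) by (simp add: reduced_expression_def)
    then have "state (length X) (?D ?w) = state (length X) ds" by (rule diagram_state_unique[OF inv c(5) ds(2)])
    then show "\<exists>es\<in>?C. reduced (length X) es \<and> state (length X) es = state (length X) ds"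
      using w c(7) by blast
  qed
  then show "element \<Lambda> X Y f \<in> M.span ?B"
  proof (rule lin_span_element[OF sub XY, rotated])
    fix g :: "('v, 'k) mor" assume "g \<in> {diagram_mor \<tau> X es \<circ>\<^sub>k dot_monomial X as | es as.
      es \<in> ?C \<and> is_diagram \<tau> X Y es \<and> length as = length (black_positions X)}"
    then obtain w as where w: "w \<in> signed_perms (length ?is)" "black_word Y = signed_act \<tau> w ?is"
      "length as = length ?is" "g = diagram_mor \<tau> X (?D w) \<circ>\<^sub>k dot_monomial X as"
      by (auto simp: length_black_positions length_black_word)
    have "element \<Lambda> X Y g = member (w, ?is, placement X, placement Y, as)"
      unfolding member_element src[symmetric] tgt[OF w(2), symmetric] w(4) ..
    then show "element \<Lambda> X Y g \<in> M.span ?B" using M.in_own_span[OF members_carrier] idx[OF w(1-3)] by blast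
  qed
qed

lemma member_value:
  assumes i: "(w, is, \<kappa>, \<kappa>', as) \<in> basis_index Q (length \<Lambda>)"
    and XY: "X \<in> objects_over Q \<Lambda>" "Y \<in> objects_over Q \<Lambda>" and y: "generic y" "length y = length (black_word Y)"
  shows "component_value X Y F y (member (w, is, \<kappa>, \<kappa>', as)) =
    (if X = stendhal_word is \<kappa> \<Lambda> \<and> Y = stendhal_word (signed_act \<tau> w is) \<kappa>' \<Lambda>
     then rep Q \<tau> \<mu> (diagram_mor \<tau> X (D w is \<kappa> \<kappa>')) (\<lambda>z. monomial_value as z * F z) y else 0)"
proof -
  note c = chosen_diagram[OF i HOL.refl HOL.refl]
  show ?thesis
  proof (cases "X = stendhal_word is \<kappa> \<Lambda> \<and> Y = stendhal_word (signed_act \<tau> w is) \<kappa>' \<Lambda>")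
    case True
    let ?f = "diagram_mor \<tau> X (D w is \<kappa> \<kappa>') \<circ>\<^sub>k dot_monomial X as :: ('v, 'k) mor"
    have o: "X \<in> objects Q" using XY(1) by (rule objects_overD)
    note c' = chosen_diagram[OF i conjunct1[OF True] conjunct2[OF True]]
    have "member (w, is, \<kappa>, \<kappa>', as) (X, Y) = arrow_class X Y ?f"
      unfolding member_element element_component[OF XY] using True by auto
    then have "component_value X Y F y (member (w, is, \<kappa>, \<kappa>', as)) = rep Q \<tau> \<mu> ?f F y"
      by (rule component_value_class[OF c'(9) _ y])
    also have "\<dots> = rep Q \<tau> \<mu> (diagram_mor \<tau> X (D w is \<kappa> \<kappa>')) (rep Q \<tau> \<mu> (dot_monomial X as) F) y" by simp
    also have "\<dots> = rep Q \<tau> \<mu> (diagram_mor \<tau> X (D w is \<kappa> \<kappa>')) (\<lambda>z. monomial_value as z * F z) y"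
    proof (rule finsup_cong[OF rep_finsup[OF arrow_diagram[OF c'(5) o]]])
      show "length y = length (filter is_black Y)" using y by (simp add: length_black_word)
      fix z assume "z \<in> orbit y"
      then have "length z = length (black_word X)" using orbit_length y c'(3,4) by fastforce
      then show "rep Q \<tau> \<mu> (dot_monomial X as) F z = monomial_value as z * F z"
        by (intro rep_dot_monomial c'(8)) (simp add: length_black_word)
    qed
    finally show ?thesis using True by simp
  next
    case False
    have o: "X \<in> objects Q" "Y \<in> objects Q" using XY by (auto dest: objects_overD)
    have "member (w, is, \<kappa>, \<kappa>', as) (X, Y) = arrow_class X Y (Zero X Y)"
      unfolding member_element element_component[OF XY] using False by auto
    then have "component_value X Y F y (member (w, is, \<kappa>, \<kappa>', as)) = rep Q \<tau> \<mu> (Zero X Y) F y"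
      by (rule component_value_class[OF is_mor.zero[OF o] _ y])
    then show ?thesis unfolding if_not_P[OF False] by simp
  qed
qed

lemma rep_sum: "finite S \<Longrightarrow> (\<Sum>s\<in>S. c s * rep Q \<tau> \<mu> f (\<lambda>z. m s z * F z) y) = rep Q \<tau> \<mu> f (\<lambda>z. (\<Sum>s\<in>S. c s * m s z) * F z) y"
proof (induction S rule: finite_induct)
  case empty
  then show ?case by (simp add: rep_linear(3))
next
  case (insert s S)
  have "rep Q \<tau> \<mu> f (\<lambda>z. c s * (m s z * F z) + (\<Sum>s\<in>S. c s * m s z) * F z) y =
      c s * rep Q \<tau> \<mu> f (\<lambda>z. m s z * F z) y + rep Q \<tau> \<mu> f (\<lambda>z. (\<Sum>s\<in>S. c s * m s z) * F z) y"
    by (simp only: rep_linear)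
  then show ?case using insert by (simp add: algebra_simps)
qed

text \<open>Coefficients are indexed by \<open>T\<close> and not by vectors, so that injectivity of
  \<open>member\<close> follows as well. The component from \<open>X\<close> to \<open>Y\<close>
  fixes the labels and both placements; there \<open>reduced_diagrams_independent\<close> separates
  the permutations, and the dot monomials are separated on generic points.\<close>

lemma members_independent:
  assumes inf: "infinite (UNIV :: 'k set)" and T: "finite T" "T \<subseteq> basis_index Q (length \<Lambda>)"
    and zero: "\<And>X Y F y. X \<in> objects_over Q \<Lambda> \<Longrightarrow> Y \<in> objects_over Q \<Lambda> \<Longrightarrow> generic y \<Longrightarrow>
      length y = length (black_word Y) \<Longrightarrow> (\<Sum>t\<in>T. a t * component_value X Y F y (member t)) = 0"
    and t: "t \<in> T"
  shows "a t = 0"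
proof -
  obtain w0 "is" \<kappa> \<kappa>' as0 where t0: "t = (w0, is, \<kappa>, \<kappa>', as0)" by (cases t)
  define X where "X = stendhal_word is \<kappa> \<Lambda>"
  define Y where "Y = stendhal_word (signed_act \<tau> w0 is) \<kappa>' \<Lambda>"
  have i0: "(w0, is, \<kappa>, \<kappa>', as0) \<in> basis_index Q (length \<Lambda>)" using t t0 T by auto
  note c0 = chosen_diagram[OF i0 X_def Y_def]
  have o: "X \<in> objects Q" using c0(1) by (rule objects_overD)
  let ?D = "\<lambda>w. D w is \<kappa> \<kappa>'" and ?h = "\<lambda>(w, as). (w, is, \<kappa>, \<kappa>', as)"
  \<comment> \<open>The indices whose source and target are \<open>X\<close> and \<open>Y\<close>;
    they differ only in the permutation and the exponents.\<close>
  define T' where "T' = {(w, as). (w, is, \<kappa>, \<kappa>', as) \<in> T \<and> signed_act \<tau> w is = signed_act \<tau> w0 is}"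
  have inj: "inj_on ?h A" for A by (auto simp: inj_on_def)
  have sub: "?h ` T' \<subseteq> T" by (auto simp: T'_def)
  have fin': "finite T'" by (rule finite_imageD[OF finite_subset[OF sub T(1)] inj])
  define W where "W = fst ` T'"
  define S where "S w = {as. (w, as) \<in> T'}" for w
  have T'S: "T' = Sigma W S" by (force simp: W_def S_def)
  have finW: "finite W" unfolding W_def using fin' by simp
  have finS: "finite (S w)" for w
    by (rule finite_subset[of _ "snd ` T'"]) (use fin' in \<open>force simp: S_def\<close>)+
  have W: "\<exists>as. (w, is, \<kappa>, \<kappa>', as) \<in> basis_index Q (length \<Lambda>) \<and> Y = stendhal_word (signed_act \<tau> w is) \<kappa>' \<Lambda>" if "w \<in> W" for w
    using that T(2) by (force simp: W_def T'_def Y_def)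
  define p where "p w z = (\<Sum>as\<in>S w. a (w, is, \<kappa>, \<kappa>', as) * monomial_value as z)" for w z
  have "p w z = 0" if w: "w \<in> W" and z: "generic z" "length z = length (black_word X)" for w z
  proof (rule reduced_diagrams_independent[OF o finW, where D = ?D and Y = Y and p = p])
    show "W \<subseteq> signed_perms (length (black_word X))" using W c0(3) by (force simp: basis_index_def)
    show "is_diagram \<tau> X Y (?D v)" "reduced_expression (length (black_word X)) (black_expression \<tau> X (?D v)) v" if "v \<in> W" for v
      using W[OF that] chosen_diagram(5,6)[OF _ X_def] c0(3) by blast+
    show "w \<in> W" "generic z" "length z = length (black_word X)" by fact+
    fix y :: "'k list" and F assume y: "generic y" "length y = length (black_word X)"
    have y': "length y = length (black_word Y)" using y(2) c0(3,4) by simp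
    have val: "component_value X Y F y (member (w, is, \<kappa>, \<kappa>', as)) =
        rep Q \<tau> \<mu> (diagram_mor \<tau> X (?D w)) (\<lambda>z. monomial_value as z * F z) y" if "(w, as) \<in> T'" for w as
    proof -
      have "(w, is, \<kappa>, \<kappa>', as) \<in> basis_index Q (length \<Lambda>)" "signed_act \<tau> w is = signed_act \<tau> w0 is"
        using that T(2) by (auto simp: T'_def)
      from member_value[OF this(1) c0(1,2) y(1) y', of F] this(2) show ?thesis by (simp add: X_def[symmetric] Y_def[symmetric])
    qed
    have other: "component_value X Y F y (member t) = 0" if t: "t \<in> T - ?h ` T'" for t
    proof -
      obtain w "is'" k k' as where tt: "t = (w, is', k, k', as)" by (cases t)
      have i: "(w, is', k, k', as) \<in> basis_index Q (length \<Lambda>)" using t T(2) tt by auto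
      note c = chosen_diagram[OF i]
      have "\<not> (X = stendhal_word is' k \<Lambda> \<and> Y = stendhal_word (signed_act \<tau> w is') k' \<Lambda>)"
      proof
        assume e: "X = stendhal_word is' k \<Lambda> \<and> Y = stendhal_word (signed_act \<tau> w is') k' \<Lambda>"
        note c = c[OF conjunct1[OF e] conjunct2[OF e]]
        \<comment> \<open>Labels and placements can be recovered from the words \<open>X\<close> and
          \<open>Y\<close>.\<close>
        have "is' = is" "k = \<kappa>" "k' = \<kappa>'" "signed_act \<tau> w is' = signed_act \<tau> w0 is"
          using c(3,4,10,11) c0(3,4,10,11) by simp_all
        then have "t \<in> ?h ` T'" using t tt by (auto simp: T'_def)
        then show False using t by blast
      qed
      then show ?thesis unfolding tt member_value[OF i c0(1,2) y(1) y'] by (rule if_not_P)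
    qed
    have "(\<Sum>w\<in>W. rep Q \<tau> \<mu> (diagram_mor \<tau> X (?D w)) (\<lambda>z. p w z * F z) y) =
        (\<Sum>w\<in>W. \<Sum>as\<in>S w. a (w, is, \<kappa>, \<kappa>', as) * rep Q \<tau> \<mu> (diagram_mor \<tau> X (?D w)) (\<lambda>z. monomial_value as z * F z) y)"
      unfolding p_def rep_sum[OF finS] ..
    also have "\<dots> = (\<Sum>(w, as)\<in>T'. a (w, is, \<kappa>, \<kappa>', as) * rep Q \<tau> \<mu> (diagram_mor \<tau> X (?D w)) (\<lambda>z. monomial_value as z * F z) y)"
      unfolding T'S by (rule sum.Sigma) (use finW finS in auto)
    also have "\<dots> = (\<Sum>s\<in>T'. a (?h s) * component_value X Y F y (member (?h s)))"
      by (rule sum.cong[OF HOL.refl]) (use val in auto)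
    also have "\<dots> = (\<Sum>t\<in>?h ` T'. a t * component_value X Y F y (member t))"
      by (simp add: sum.reindex[OF inj])
    also have "\<dots> = (\<Sum>t\<in>T. a t * component_value X Y F y (member t))"
      by (rule sum.mono_neutral_left[OF T(1) sub]) (use other in auto)
    also have "\<dots> = 0" by (rule zero[OF c0(1,2) y(1) y'])
    finally show "(\<Sum>w\<in>W. rep Q \<tau> \<mu> (diagram_mor \<tau> X (?D w)) (\<lambda>z. p w z * F z) y) = 0" .
  qed
  note pz = this
  have "a (w0, is, \<kappa>, \<kappa>', as0) = 0"
  proof (rule polynomial_vanishing_on_generic[OF inf finS[of w0], where n = "length is" and a = "\<lambda>as. a (w0, is, \<kappa>, \<kappa>', as)"])
    show "as0 \<in> S w0" using t t0 by (simp add: S_def T'_def)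
    then have "w0 \<in> W" by (force simp: S_def W_def)
    then show "(\<Sum>as\<in>S w0. a (w0, is, \<kappa>, \<kappa>', as) * monomial_value as z) = 0" if "generic z" "length z = length is" for z
      using pz[of w0 z] that c0(3) by (simp add: p_def)
    show "length as = length is" if "as \<in> S w0" for as
      using that T(2) by (auto simp: S_def T'_def basis_index_def)
  qed
  then show ?thesis using t0 by simp
qed

lemma members_inj:
  assumes inf: "infinite (UNIV :: 'k set)"
  shows "inj_on member (basis_index Q (length \<Lambda>))"
proof (rule inj_onI, rule ccontr)
  fix s t assume st: "s \<in> basis_index Q (length \<Lambda>)" "t \<in> basis_index Q (length \<Lambda>)" "member s = member t" "s \<noteq> t"
  \<comment> \<open>Two indices with the same vector would satisfy a relation with coefficients 1
    and -1.\<close>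
  have "(\<lambda>u. if u = s then 1 else - 1 :: 'k) s = 0"
    by (rule members_independent[OF inf, of "{s, t}"]) (use st in auto)
  then show False by simp
qed

lemma members_basis:
  assumes inf: "infinite (UNIV :: 'k set)"
  shows "vectorspace.basis class_ring (algebra \<Lambda>) (member ` basis_index Q (length \<Lambda>))"
proof -
  interpret V: vectorspace class_ring "algebra \<Lambda>" by (rule algebra_space)
  let ?I = "basis_index Q (length \<Lambda>)"
  let ?B = "member ` ?I"
  have "V.lin_indpt ?B"
  proof
    assume "V.lin_dep ?B"
    then obtain A a v where A: "finite A" "A \<subseteq> ?B" "V.lincomb a A = \<zero>\<^bsub>algebra \<Lambda>\<^esub>" "v \<in> A" "a v \<noteq> 0"
      unfolding V.lin_dep_def by auto
    \<comment> \<open>The relation between vectors is pulled back along \<open>member\<close>, which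
      is injective, to a relation between indices.\<close>
    define T where "T = {t \<in> ?I. member t \<in> A}"
    have inj: "inj_on member T" using members_inj[OF inf] by (rule inj_on_subset) (auto simp: T_def)
    have img: "member ` T = A" using A(2) by (auto simp: T_def)
    have finT: "finite T" by (rule finite_imageD[OF _ inj]) (simp add: img A(1))
    obtain t where t: "t \<in> T" "v = member t" using A(4) img by blast
    have "(a \<circ> member) t = 0"
    proof (rule members_independent[OF inf finT _ _ t(1)])
      show "T \<subseteq> ?I" by (auto simp: T_def)
      fix X Y F and y :: "'k list" assume XY: "X \<in> objects_over Q \<Lambda>" "Y \<in> objects_over Q \<Lambda>" and y: "generic y" "length y = length (black_word Y)"
      have o: "X \<in> objects Q" "Y \<in> objects Q" using XY by (auto dest: objects_overD)
      have "(\<Sum>t\<in>T. (a \<circ> member) t * component_value X Y F y (member t)) = (\<Sum>v\<in>A. a v * component_value X Y F y v)"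
        unfolding img[symmetric] by (simp add: sum.reindex[OF inj])
      also have "\<dots> = component_value X Y F y (V.lincomb a A)"
        using component_value_sum[OF XY y A(1), of F a] A(2) members_carrier by auto
      also have "\<dots> = rep Q \<tau> \<mu> (Zero X Y) F y"
        unfolding A(3) by (rule component_value_class[where v = "\<zero>\<^bsub>algebra \<Lambda>\<^esub>", OF is_mor.zero[OF o] algebra_component(3)[OF XY] y])
      finally show "(\<Sum>t\<in>T. (a \<circ> member) t * component_value X Y F y (member t)) = 0" by simp
    qed
    then show False using A(5) t(2) by simp
  qed
  moreover have "V.span ?B = carrier (algebra \<Lambda>)"
    using members_span V.span_is_submodule[OF members_carrier] submodule.subset by blast
  ultimately show ?thesis using members_carrier by (simp add: V.basis_def)
qed

end

theorem theorem2p15: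
  fixes Q :: "('v, 'a) pre_digraph" and \<tau> :: "'v \<Rightarrow> 'v" and \<tau>\<^sub>1 :: "'a \<Rightarrow> 'a"
    and \<mu> :: "'v weight" and \<Lambda> :: "'v weight list"
    and D :: "(int \<Rightarrow> int) \<Rightarrow> 'v list \<Rightarrow> (nat \<Rightarrow> nat) \<Rightarrow> (nat \<Rightarrow> nat) \<Rightarrow> diagram"
  assumes "involutive_quiver Q \<tau> \<tau>\<^sub>1"
    and "\<mu> \<in> dominant_weights Q"
    and "set \<Lambda> \<subseteq> dominant_weights Q"
    and "\<And>n w is \<kappa> \<kappa>'. \<lbrakk>w \<in> signed_perms n; length is = n; set is \<subseteq> verts Q;
           \<kappa> \<in> red_placements (length \<Lambda>) n; \<kappa>' \<in> red_placements (length \<Lambda>) n\<rbrakk>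
         \<Longrightarrow> reduced_diagram \<tau> \<Lambda> w is \<kappa> \<kappa>' (D w is \<kappa> \<kappa>')"
  shows "let b = \<lambda>(w, is, \<kappa>, \<kappa>', as).
               (basis_element Q \<tau> \<mu> \<Lambda> (D w is \<kappa> \<kappa>') w is \<kappa> \<kappa>' as
                  :: 'v wrd \<times> 'v wrd \<Rightarrow> ('v, 'k :: alg_closed_field) mor set);
             B = b ` basis_index Q (length \<Lambda>)
         in inj_on b (basis_index Q (length \<Lambda>)) \<and>
            vectorspace.basis (class_ring :: 'k ring) (oKLRW_algebra Q \<tau> \<mu> \<Lambda>) B"
proof -
  interpret diagram_choice Q \<tau> \<tau>\<^sub>1 \<mu> "TYPE('k)" \<Lambda> D
    using assms by (intro diagram_choice.intro oklrw.intro diagram_choice_axioms.intro) auto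
  show ?thesis
    unfolding Let_def member_def[symmetric]
    using members_inj[OF infinite_alg_closed] members_basis[OF infinite_alg_closed] by blast
qed

end
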